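(* Let $k$ be a number field and let $f,g\in k[x]$ be polynomials without repeated roots with $3\leqslant\deg f,\deg g\leqslant 4$. Let $E_1:y^2=g(x)$ and $E_2:s^2=f(t)$, and for $C\in k^*$ let $E_1^C:Cy^2=g(x)$, $E_2^C:Cs^2=f(t)$ be their quadratic twists (smooth projective genus one curves). Let $\operatorname{Kum}(E_1\times E_2)$ be the Kummer surface (the minimal desingularization of the quotient of $E_1\times E_2$ by the involution $((x,y),(t,s))\mapsto((x,-y),(t,-s))$), which is birational to the affine surface $f(T)Y^2=g(X)$. For $[C]\in k^*/k^{*2}$ say that condition SPR(C) holds if $E_1^C(k)\neq\varnothing$, $E_2^C(k)\neq\varnothing$, and, choosing rational points as origins, both $E_1^C(k)$ and $E_2^C(k)$ have positive Mordell–Weil rank. Then: (i) $\operatorname{Kum}(E_1\times E_2)(k)$ is Zariski dense in $\operatorname{Kum}(E_1\times E_2)$ if and only if there exists $[C]\in k^*/k^{*2}$ such that SPR(C) holds; (ii) if $\operatorname{Kum}(E_1\times E_2)$ satisfies the Hilbert property over $k$, then there exist infinitely many classes $[C]\in k^*/k^{*2}$ such that SPR(C) holds.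
   Context: For a variety $X$ over a number field $k$, the set $X(k)$ is thin if there exist finitely many dominant rational maps $\pi_i:Y_i\dashrightarrow X$ ($1\leqslant i\leqslant r$) over $k$ that are generically finite of degree $\geqslant 2$ (with $Y_i$ integral) such that $X(k)\setminus\bigcup_i\pi_i(Y_i(k))$ is contained in a proper Zariski closed subset of $X$. $X$ satisfies the Hilbert property over $k$ if $X(k)$ is not thin. *)

theory Defs
  imports
    "HOL-Algebra.Algebraic_Closure_Type"
    "HOL-Algebra.FiniteProduct"
    "HOL-Library.Function_Algebras"
    "HOL-Library.Poly_Mapping"
    "HOL-Library.Nat_Bijection"
    "HOL-Library.Extended_Nat"
    "HOL-Analysis.Analysis"
begin

(* HOL-Algebra uses the token X for the indeterminate of a polynomial ring. *)
no_notation var (\<open>X\<index>\<close>)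

(* Classical algebraic geometry over a field k of characteristic 0, given by the type 'k.
   A variety over k is a set of geometric points (points with coordinates in the algebraic
   closure of k) that is locally closed in a projective space for the Zariski topology over k,
   i.e. the one whose closed sets are cut out by homogeneous polynomials with coefficients
   in k.  Morphisms, rational functions and so on are likewise given by polynomials
   over k.  Since k is perfect, these sets correspond to the reduced quasi-projective
   k-schemes; k-irreducible sets correspond to integral ones. *)

definition number_field :: "'k::field_char_0 itself \<Rightarrow> bool" where
  "number_field _ \<longleftrightarrow>
     (\<exists>B. finite_dimensional_vector_space (\<lambda>(q::rat) (x::'k). of_rat q * x) B)"


section \<open>Polynomials and projective points\<close>

type_synonym 'k mpol = "(nat \<Rightarrow>\<^sub>0 nat) \<Rightarrow>\<^sub>0 'k"

definition mpol_eval :: "('k::zero \<Rightarrow> 'b::comm_semiring_1) \<Rightarrow> 'k mpol \<Rightarrow> (nat \<Rightarrow> 'b) \<Rightarrow> 'b" where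
  "mpol_eval h p v =
     (\<Sum>m\<in>Poly_Mapping.keys p. h (Poly_Mapping.lookup p m) *
        (\<Prod>i\<in>Poly_Mapping.keys m. v i ^ Poly_Mapping.lookup m i))"

abbreviation peval :: "'k::field mpol \<Rightarrow> (nat \<Rightarrow> 'k alg_closure) \<Rightarrow> 'k alg_closure" where
  "peval \<equiv> mpol_eval to_ac"

definition homogeneous :: "nat \<Rightarrow> 'k::zero mpol \<Rightarrow> bool" where
  "homogeneous d p \<longleftrightarrow>
     (\<forall>m\<in>Poly_Mapping.keys p. (\<Sum>i\<in>Poly_Mapping.keys m. Poly_Mapping.lookup m i) = d)"

(* A projective point is the set of all its homogeneous coordinate vectors.  Vectors are
   indexed by all of nat, so that the n-dimensional projective space is contained in the
   (n+1)-dimensional one; varieties are required below to lie in a finite-dimensional one. *)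
type_synonym 'a ppoint = "(nat \<Rightarrow> 'a) set"

definition hline :: "(nat \<Rightarrow> 'a::field) \<Rightarrow> 'a ppoint" where
  "hline v = {(\<lambda>i. c * v i) | c. c \<noteq> 0}"

definition proj_space :: "nat \<Rightarrow> 'a::field ppoint set" where
  "proj_space n = {hline v | v. v \<noteq> (\<lambda>_. 0) \<and> (\<forall>i>n. v i = 0)}"

definition basic_open :: "'k::field mpol \<Rightarrow> 'k alg_closure ppoint set" where
  "basic_open p = {hline v | v. v \<noteq> (\<lambda>_. 0) \<and> peval p v \<noteq> 0}"

definition zariski :: "'k::field alg_closure ppoint topology" where
  "zariski = topology_generated_by {basic_open p | p. \<exists>d. homogeneous d p}"

abbreviation zariski_on :: "'k::field alg_closure ppoint set \<Rightarrow> 'k alg_closure ppoint topology" where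
  "zariski_on X \<equiv> subtopology zariski X"

definition rational_points :: "'k::field alg_closure ppoint set \<Rightarrow> 'k alg_closure ppoint set" where
  "rational_points X = {x \<in> X. \<exists>v\<in>x. \<forall>i. v i \<in> range to_ac}"

definition zariski_dense_in ::
  "'k::field alg_closure ppoint set \<Rightarrow> 'k alg_closure ppoint set \<Rightarrow> bool" where
  "zariski_dense_in X S \<longleftrightarrow> Abstract_Topology.closure_of (zariski_on X) S = X"


section \<open>Varieties, regular functions, morphisms\<close>

definition zariski_irreducible :: "'k::field alg_closure ppoint set \<Rightarrow> bool" where
  "zariski_irreducible X \<longleftrightarrow> X \<noteq> {} \<and>
     (\<forall>Z W. closedin (zariski_on X) Z \<and> closedin (zariski_on X) W \<and> X = Z \<union> W \<longrightarrow> X = Z \<or> X = W)"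

definition integral_variety :: "'k::field alg_closure ppoint set \<Rightarrow> bool" where
  "integral_variety X \<longleftrightarrow> zariski_irreducible X \<and>
     (\<exists>n Z U. closedin zariski Z \<and> openin zariski U \<and> X = proj_space n \<inter> Z \<inter> U)"

definition projective_variety :: "'k::field alg_closure ppoint set \<Rightarrow> bool" where
  "projective_variety X \<longleftrightarrow>
     zariski_irreducible X \<and> closedin zariski X \<and> (\<exists>n. X \<subseteq> proj_space n)"

definition quotient_at ::
  "'k::field mpol \<Rightarrow> 'k mpol \<Rightarrow> ('k alg_closure ppoint \<Rightarrow> 'k alg_closure) \<Rightarrow> 'k alg_closure ppoint \<Rightarrow> bool"
  where
  "quotient_at F G f x \<longleftrightarrow> (\<forall>v\<in>x. peval G v \<noteq> 0 \<and> f x = peval F v / peval G v)"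

(* Functions are total; only their values near the point resp. on the open set matter. *)
definition regular_at ::
  "'k::field alg_closure ppoint set \<Rightarrow> 'k alg_closure ppoint \<Rightarrow>
     ('k alg_closure ppoint \<Rightarrow> 'k alg_closure) \<Rightarrow> bool" where
  "regular_at X x f \<longleftrightarrow>
     (\<exists>d F G. homogeneous d F \<and> homogeneous d G \<and>
        (\<forall>\<^sub>F y in nhdsin (zariski_on X) x. quotient_at F G f y))"

definition regular_on ::
  "'k::field alg_closure ppoint set \<Rightarrow> ('k alg_closure ppoint \<Rightarrow> 'k alg_closure) \<Rightarrow> bool" where
  "regular_on U f \<longleftrightarrow> (\<forall>x\<in>U. regular_at U x f)"

definition morphism ::
  "'k::field alg_closure ppoint set \<Rightarrow> 'k alg_closure ppoint set \<Rightarrow>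
     ('k alg_closure ppoint \<Rightarrow> 'k alg_closure ppoint) \<Rightarrow> bool" where
  "morphism X Y \<phi> \<longleftrightarrow> \<phi> ` X \<subseteq> Y \<and>
     (\<forall>x\<in>X. \<exists>d F. (\<forall>i. homogeneous d (F i)) \<and>
        (\<forall>\<^sub>F y in nhdsin (zariski_on X) x. \<forall>v\<in>y. (\<lambda>i. peval (F i) v) \<in> \<phi> y))"

definition isomorphism ::
  "'k::field alg_closure ppoint set \<Rightarrow> 'k alg_closure ppoint set \<Rightarrow>
     ('k alg_closure ppoint \<Rightarrow> 'k alg_closure ppoint) \<Rightarrow> bool" where
  "isomorphism X Y \<phi> \<longleftrightarrow> morphism X Y \<phi> \<and>
     (\<exists>\<psi>. morphism Y X \<psi> \<and> (\<forall>x\<in>X. \<psi> (\<phi> x) = x) \<and> (\<forall>y\<in>Y. \<phi> (\<psi> y) = y))"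

definition birational_morphism ::
  "'k::field alg_closure ppoint set \<Rightarrow> 'k alg_closure ppoint set \<Rightarrow>
     ('k alg_closure ppoint \<Rightarrow> 'k alg_closure ppoint) \<Rightarrow> bool" where
  "birational_morphism X Y \<phi> \<longleftrightarrow> morphism X Y \<phi> \<and>
     (\<exists>U V. openin (zariski_on X) U \<and> U \<noteq> {} \<and> openin (zariski_on Y) V \<and> V \<noteq> {} \<and>
        isomorphism U V \<phi>)"


section \<open>Function fields, rational maps, the Hilbert property\<close>

definition generically ::
  "'k::field alg_closure ppoint set \<Rightarrow> ('k alg_closure ppoint \<Rightarrow> bool) \<Rightarrow> bool" where
  "generically X P \<longleftrightarrow> (\<exists>U. openin (zariski_on X) U \<and> U \<noteq> {} \<and> (\<forall>x\<in>U. P x))"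

(* The function field k(X) of an integral X consists of these functions, two of them being
   identified if they agree generically. *)
definition rational_function ::
  "'k::field alg_closure ppoint set \<Rightarrow> ('k alg_closure ppoint \<Rightarrow> 'k alg_closure) \<Rightarrow> bool" where
  "rational_function X f \<longleftrightarrow>
     (\<exists>d F G. homogeneous d F \<and> homogeneous d G \<and> generically X (quotient_at F G f))"

(* [k(Y) : k(X)] = d for a dominant rational map \<pi> from Y to X: there is a basis
   b 0, ..., b (d - 1) of k(Y) as a vector space over k(X). *)
definition has_degree ::
  "'k::field alg_closure ppoint set \<Rightarrow> 'k alg_closure ppoint set \<Rightarrow>
     ('k alg_closure ppoint \<Rightarrow> 'k alg_closure ppoint) \<Rightarrow> nat \<Rightarrow> bool" where
  "has_degree Y X \<pi> d \<longleftrightarrow>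
     (\<exists>b :: nat \<Rightarrow> 'k alg_closure ppoint \<Rightarrow> 'k alg_closure.
        (\<forall>j<d. rational_function Y (b j)) \<and>
        (\<forall>h. rational_function Y h \<longrightarrow>
           (\<exists>c. (\<forall>j<d. rational_function X (c j)) \<and>
                generically Y (\<lambda>y. h y = (\<Sum>j<d. c j (\<pi> y) * b j y)))) \<and>
        (\<forall>c. (\<forall>j<d. rational_function X (c j)) \<and>
             generically Y (\<lambda>y. (\<Sum>j<d. c j (\<pi> y) * b j y) = 0) \<longrightarrow>
             (\<forall>j<d. generically X (\<lambda>x. c j x = 0))))"

(* A rational map from Y to X is given by a morphism \<pi> on a nonempty open subset U of Y. *)
definition dominant_rational_map ::
  "'k::field alg_closure ppoint set \<Rightarrow> 'k alg_closure ppoint set \<Rightarrow> 'k alg_closure ppoint set \<Rightarrow>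
     ('k alg_closure ppoint \<Rightarrow> 'k alg_closure ppoint) \<Rightarrow> bool" where
  "dominant_rational_map Y X U \<pi> \<longleftrightarrow>
     openin (zariski_on Y) U \<and> U \<noteq> {} \<and> morphism U X \<pi> \<and> zariski_dense_in X (\<pi> ` U)"

definition thin_rational_points :: "'k::field alg_closure ppoint set \<Rightarrow> bool" where
  "thin_rational_points X \<longleftrightarrow>
     (\<exists>(r::nat) Y U \<pi>.
        (\<forall>i<r. integral_variety (Y i) \<and> dominant_rational_map (Y i) X (U i) (\<pi> i) \<and>
               (\<exists>d\<ge>2. has_degree (Y i) X (\<pi> i) d)) \<and>
        (\<exists>Z. closedin (zariski_on X) Z \<and> Z \<noteq> X \<and>
             rational_points X - (\<Union>i<r. \<pi> i ` rational_points (U i)) \<subseteq> Z))"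

definition hilbert_property :: "'k::field alg_closure ppoint set \<Rightarrow> bool" where
  "hilbert_property X \<longleftrightarrow> \<not> thin_rational_points X"


section \<open>Smoothness and minimal desingularizations\<close>

definition variety_dim :: "'k::field alg_closure ppoint set \<Rightarrow> enat" where
  "variety_dim X = Sup {enat n | n. \<exists>Z :: nat \<Rightarrow> 'k alg_closure ppoint set.
     (\<forall>i\<le>n. closedin (zariski_on X) (Z i) \<and> zariski_irreducible (Z i)) \<and> (\<forall>i<n. Z i \<subset> Z (Suc i))}"

(* Tangent space at v of the affine cone over X: the directions w for which
   p (v + \<epsilon> w) vanishes modulo \<epsilon>^2 for all p in the homogeneous ideal of X.
   The coordinate functions that vanish on X are in this ideal, so the space is
   finite-dimensional. *)
definition cone_tangent_space ::
  "'k::field alg_closure ppoint set \<Rightarrow> (nat \<Rightarrow> 'k alg_closure) \<Rightarrow> (nat \<Rightarrow> 'k alg_closure) set" where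
  "cone_tangent_space X v =
     {w. \<forall>d p. homogeneous d p \<and> (\<forall>x\<in>X. \<forall>u\<in>x. peval p u = 0) \<longrightarrow>
        Polynomial.coeff (mpol_eval (\<lambda>c. [:to_ac c:]) p (\<lambda>i. [:v i, w i:])) 1 = 0}"

definition smooth_variety :: "'k::field alg_closure ppoint set \<Rightarrow> bool" where
  "smooth_variety X \<longleftrightarrow>
     (\<forall>x\<in>X. \<forall>v\<in>x.
        enat (vector_space.dim (\<lambda>c w i. c * w i :: 'k alg_closure) (cone_tangent_space X v)) =
          variety_dim X + 1)"

(* Morphisms between projective varieties are automatically proper. *)
definition desingularization ::
  "'k::field alg_closure ppoint set \<Rightarrow> 'k alg_closure ppoint set \<Rightarrow>
     ('k alg_closure ppoint \<Rightarrow> 'k alg_closure ppoint) \<Rightarrow> bool" where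
  "desingularization X Q \<rho> \<longleftrightarrow>
     projective_variety X \<and> smooth_variety X \<and> birational_morphism X Q \<rho>"

definition minimal_desingularization ::
  "'k::field alg_closure ppoint set \<Rightarrow> 'k alg_closure ppoint set \<Rightarrow>
     ('k alg_closure ppoint \<Rightarrow> 'k alg_closure ppoint) \<Rightarrow> bool" where
  "minimal_desingularization X Q \<rho> \<longleftrightarrow> desingularization X Q \<rho> \<and>
     (\<forall>X' \<rho>'. desingularization X' Q \<rho>' \<longrightarrow>
        (\<exists>\<phi>. morphism X' X \<phi> \<and> (\<forall>x\<in>X'. \<rho> (\<phi> x) = \<rho>' x)))"

(* q : A \<rightarrow> Q is a geometric quotient by the involution \<sigma>: the fibres are the orbits, Q has
   the quotient topology, and the regular functions on Q are the \<sigma>-invariant regular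
   functions on A. *)
definition geometric_quotient ::
  "'k::field alg_closure ppoint set \<Rightarrow> ('k alg_closure ppoint \<Rightarrow> 'k alg_closure ppoint) \<Rightarrow>
     'k alg_closure ppoint set \<Rightarrow> ('k alg_closure ppoint \<Rightarrow> 'k alg_closure ppoint) \<Rightarrow> bool" where
  "geometric_quotient A \<sigma> Q q \<longleftrightarrow>
     morphism A Q q \<and> q ` A = Q \<and>
     (\<forall>a\<in>A. \<forall>b\<in>A. q a = q b \<longleftrightarrow> b = a \<or> b = \<sigma> a) \<and>
     (\<forall>V\<subseteq>Q. openin (zariski_on Q) V \<longleftrightarrow> openin (zariski_on A) {a \<in> A. q a \<in> V}) \<and>
     (\<forall>V f. openin (zariski_on Q) V \<longrightarrow>
        (regular_on V f \<longleftrightarrow> regular_on {a \<in> A. q a \<in> V} (f \<circ> q)))"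


section \<open>The genus one curves and the Kummer surface\<close>

(* The smooth projective model of C y^2 = g(x), deg g \<le> 4, as an intersection of two
   quadrics in 3-space: the closure of the image of (x, y) \<mapsto> (1 : x : x^2 : y).
   The points at infinity, v 0 = v 1 = 0, are (0 : 0 : 1 : w) with C w^2 = coeff g 4. *)
definition twisted_curve :: "'k::field poly \<Rightarrow> 'k \<Rightarrow> 'k alg_closure ppoint set" where
  "twisted_curve g C = {x \<in> proj_space 3. \<forall>v\<in>x.
     v 0 * v 2 = v 1 ^ 2 \<and>
     to_ac C * v 3 ^ 2 =
       to_ac (Polynomial.coeff g 4) * v 2 ^ 2 + to_ac (Polynomial.coeff g 3) * v 1 * v 2 +
       to_ac (Polynomial.coeff g 2) * v 0 * v 2 + to_ac (Polynomial.coeff g 1) * v 0 * v 1 +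
       to_ac (Polynomial.coeff g 0) * v 0 ^ 2}"

(* Segre embedding; the coordinate v i * w j has index prod_encode (i, j). *)
definition tensor :: "(nat \<Rightarrow> 'a::field) \<Rightarrow> (nat \<Rightarrow> 'a) \<Rightarrow> nat \<Rightarrow> 'a" where
  "tensor v w = (\<lambda>l. case prod_decode l of (i, j) \<Rightarrow> v i * w j)"

definition product_variety :: "'a::field ppoint set \<Rightarrow> 'a ppoint set \<Rightarrow> 'a ppoint set" where
  "product_variety X Y = {{tensor v w | v w. v \<in> x \<and> w \<in> y} | x y. x \<in> X \<and> y \<in> Y}"

(* On affine points: (x, y) \<mapsto> (x, -y). *)
definition flip :: "(nat \<Rightarrow> 'a::field) \<Rightarrow> nat \<Rightarrow> 'a" where
  "flip v = v(3 := - v 3)"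

definition kummer_involution :: "'a::field ppoint \<Rightarrow> 'a ppoint" where
  "kummer_involution p = {tensor (flip v) (flip w) | v w. tensor v w \<in> p}"

(* X is (a projective model of) Kum(E_1 \<times> E_2), where E_1 : y^2 = g(x), E_2 : s^2 = f(t). *)
definition is_kummer_surface ::
  "'k::field poly \<Rightarrow> 'k poly \<Rightarrow> 'k alg_closure ppoint set \<Rightarrow> bool" where
  "is_kummer_surface f g X \<longleftrightarrow>
     (\<exists>Q q \<rho>. projective_variety Q \<and>
        geometric_quotient (product_variety (twisted_curve g 1) (twisted_curve f 1))
          kummer_involution Q q \<and>
        minimal_desingularization X Q \<rho>)"


section \<open>Mordell--Weil groups and ranks\<close>

(* The local ring of X at x consists of the functions regular at x, and the maximal ideal of
   those vanishing at x; t generates this ideal. *)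
definition uniformizer ::
  "'k::field alg_closure ppoint set \<Rightarrow> 'k alg_closure ppoint \<Rightarrow>
     ('k alg_closure ppoint \<Rightarrow> 'k alg_closure) \<Rightarrow> bool" where
  "uniformizer X x t \<longleftrightarrow> regular_at X x t \<and> t x = 0 \<and>
     (\<forall>f. regular_at X x f \<and> f x = 0 \<longrightarrow>
        (\<exists>g. regular_at X x g \<and> (\<forall>\<^sub>F y in nhdsin (zariski_on X) x. f y = t y * g y)))"

definition has_order ::
  "'k::field alg_closure ppoint set \<Rightarrow> 'k alg_closure ppoint \<Rightarrow>
     ('k alg_closure ppoint \<Rightarrow> 'k alg_closure) \<Rightarrow> int \<Rightarrow> bool" where
  "has_order X x h n \<longleftrightarrow>
     (\<exists>t u. uniformizer X x t \<and> regular_at X x u \<and> u x \<noteq> 0 \<and>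
        generically X (\<lambda>y. h y = u y * t y powi n))"

definition principal_divisor ::
  "'k::field alg_closure ppoint set \<Rightarrow> ('k alg_closure ppoint \<Rightarrow> int) \<Rightarrow> bool" where
  "principal_divisor X D \<longleftrightarrow>
     (\<exists>h. rational_function X h \<and> (\<forall>x\<in>X. has_order X x h (D x)))"

(* The group E(k) of a smooth projective genus one curve E with origin z:
   p + q is the unique r for which (p) + (q) is linearly equivalent to (r) + (z). *)
definition mordell_weil_group ::
  "'k::field alg_closure ppoint set \<Rightarrow> 'k alg_closure ppoint \<Rightarrow> 'k alg_closure ppoint monoid" where
  "mordell_weil_group E z =
     \<lparr>carrier = rational_points E,
      monoid.mult = (\<lambda>p q. THE r. r \<in> rational_points E \<and>
        principal_divisor E
          (\<lambda>x. of_bool (x = p) + of_bool (x = q) - of_bool (x = r) - of_bool (x = z))),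
      one = z\<rparr>"

(* The maximal number of Z-independent elements, i.e. the dimension of G \<otimes> Q. *)
definition group_rank :: "('a, 'b) monoid_scheme \<Rightarrow> enat" where
  "group_rank G = Sup {enat (card S) | S. finite S \<and> S \<subseteq> carrier G \<and>
     (\<forall>c :: 'a \<Rightarrow> int. finprod G (\<lambda>s. s [^]\<^bsub>G\<^esub> c s) S = \<one>\<^bsub>G\<^esub> \<longrightarrow> (\<forall>s\<in>S. c s = 0))}"

definition SPR :: "'k::field poly \<Rightarrow> 'k poly \<Rightarrow> 'k \<Rightarrow> bool" where
  "SPR f g C \<longleftrightarrow>
     rational_points (twisted_curve g C) \<noteq> {} \<and> rational_points (twisted_curve f C) \<noteq> {} \<and>
     (\<forall>z\<in>rational_points (twisted_curve g C).
        group_rank (mordell_weil_group (twisted_curve g C) z) > 0) \<and>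
     (\<forall>z\<in>rational_points (twisted_curve f C).
        group_rank (mordell_weil_group (twisted_curve f C) z) > 0)"

(* The class [C] of C in k^* / k^{*2}, as a coset. *)
definition square_class :: "'k::field \<Rightarrow> 'k set" where
  "square_class C = {C * u ^ 2 | u. u \<noteq> 0}"

end

theory Submission
  imports Defs
begin

text \<open>
  The functions \<open>x\<close>, \<open>t\<close> and \<open>ys\<close> are invariant under the involution. Hence a rational point of a
  suitable open subset of the Kummer surface comes from rational points of the twists \<open>E\<^sub>1\<^sup>C\<close> and
  \<open>E\<^sub>2\<^sup>C\<close> with \<open>C = g(x)\<close>, while for every \<open>C\<close> the map from the product of the twists to the surface is
  dominant of degree 2. If both twists have positive rank, their product has dense rational points.
  If \<open>E\<^sub>1\<^sup>C\<close> has rank 0, then \<open>(x, y)\<close> and \<open>(x, -y)\<close> differ by a torsion point; moving a root of \<open>g\<close> to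
  infinity makes this a torsion point of a Weierstrass cubic that does not depend on \<open>C\<close>. For a 2-adic
  valuation ring of the algebraic closure, torsion points are not close to infinity, so distinct
  torsion abscissae are uniformly separated, and by pigeonhole only finitely many of them come from the
  number field. Thus finitely many \<open>x\<close> account for all \<open>C\<close> of rank 0, and they are removed by shrinking
  the open subset.
\<close>

section \<open>Forms\<close>

text \<open>The twists range over infinitely many C, so finiteness of each single torsion group does
  not suffice: the bound has to be uniform in C. This forces all points onto one cubic over the
  algebraic closure, since neither the root of g nor sqrt C need lie in k. The group law cannot be
  carried there by divisors, because \<open>principal_divisor\<close> refers to functions over its
  own ground field. Addition is therefore rewritten as a polynomial relation, four points of y^2 =
  h(x) on a conic y = q(x), which survives extension of scalars, rescaling of y and moving a root to
  infinity. The prime 2 is taken because the tangent formula alone then pushes points towards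
  infinity. The valuation is neither discrete nor complete by assumption; finiteness enters because
  k \<inter> V has finitely many residues modulo each power of 2. In (ii), finitely many classes
  would give finitely many double covers over k that hit every rational point of an open subset. The
  isomorphism of a twisted product with the original one needs sqrt C; parity under the involution
  is what brings the covers back to k.\<close>

definition form :: "nat => ((nat => 'k::field alg_closure) => 'k alg_closure) => bool" where
  "form d P \<longleftrightarrow> (\<exists>p. homogeneous d p \<and> P = peval p)"

lemma mpol_eval_superset:
  assumes "finite S" "Poly_Mapping.keys p \<subseteq> S" "h 0 = 0"
  shows "mpol_eval h p v =
     (\<Sum>m\<in>S. h (Poly_Mapping.lookup p m) * (\<Prod>i\<in>Poly_Mapping.keys m. v i ^ Poly_Mapping.lookup m i))"
  unfolding mpol_eval_def
  by (rule sum.mono_neutral_left) (use assms in \<open>auto simp: in_keys_iff\<close>)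

lemma peval_add: "peval (p + q) v = peval p v + peval q v"
proof -
  define S where "S = Poly_Mapping.keys p \<union> Poly_Mapping.keys q"
  have S: "finite S" "Poly_Mapping.keys p \<subseteq> S" "Poly_Mapping.keys q \<subseteq> S" "Poly_Mapping.keys (p + q) \<subseteq> S"
    using keys_add[of p q] by (auto simp: S_def)
  show ?thesis
    by (simp add: mpol_eval_superset[OF S(1) S(2)] mpol_eval_superset[OF S(1) S(3)]
        mpol_eval_superset[OF S(1) S(4)] lookup_add algebra_simps flip: sum.distrib)
qed

lemma monomial_eval_add:
  fixes v :: "nat => 'b::comm_semiring_1"
  shows "(\<Prod>i\<in>Poly_Mapping.keys (m + n). v i ^ Poly_Mapping.lookup (m + n) i) =
    (\<Prod>i\<in>Poly_Mapping.keys m. v i ^ Poly_Mapping.lookup m i) *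
    (\<Prod>i\<in>Poly_Mapping.keys n. v i ^ Poly_Mapping.lookup n i)"
proof -
  define S where "S = Poly_Mapping.keys m \<union> Poly_Mapping.keys n"
  have *: "(\<Prod>i\<in>Poly_Mapping.keys k. v i ^ Poly_Mapping.lookup k i) = (\<Prod>i\<in>S. v i ^ Poly_Mapping.lookup k i)"
    if "Poly_Mapping.keys k \<subseteq> S" for k
    by (rule prod.mono_neutral_left) (use that in \<open>auto simp: S_def in_keys_iff\<close>)
  have "Poly_Mapping.keys (m + n) \<subseteq> S" "Poly_Mapping.keys m \<subseteq> S" "Poly_Mapping.keys n \<subseteq> S"
    using keys_add[of m n] by (auto simp: S_def)
  then show ?thesis
    using *[of m] *[of n] *[of "m + n"] by (simp add: lookup_add power_add prod.distrib)
qed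

lemma peval_single:
  "peval (Poly_Mapping.single m c) v = to_ac c * (\<Prod>i\<in>Poly_Mapping.keys m. v i ^ Poly_Mapping.lookup m i)"
  by (simp add: mpol_eval_def)

lemma peval_zero: "peval 0 v = 0"
  by (simp add: mpol_eval_def)

lemma mpol_sum_singles: "p = (\<Sum>m\<in>Poly_Mapping.keys p. Poly_Mapping.single m (Poly_Mapping.lookup p m))"
  for p :: "'k::field mpol"
proof (rule poly_mapping_eqI)
  fix n
  show "Poly_Mapping.lookup p n =
    Poly_Mapping.lookup (\<Sum>m\<in>Poly_Mapping.keys p. Poly_Mapping.single m (Poly_Mapping.lookup p m)) n"
    by (auto simp: lookup_sum lookup_single when_def in_keys_iff sum.delta)
qed

lemma peval_sum: "peval (sum f S) v = (\<Sum>i\<in>S. peval (f i) v)"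
  by (induction S rule: infinite_finite_induct) (auto simp: peval_zero peval_add)

lemma peval_mult: "peval (p * q) v = peval p v * peval q v"
proof -
  have 1: "peval (Poly_Mapping.single m c * Poly_Mapping.single n d) v =
    peval (Poly_Mapping.single m c) v * peval (Poly_Mapping.single n d) v" for m n c d
    by (simp add: mult_single peval_single monomial_eval_add)
  have "peval ((\<Sum>m\<in>Poly_Mapping.keys p. Poly_Mapping.single m (Poly_Mapping.lookup p m)) *
       (\<Sum>m\<in>Poly_Mapping.keys q. Poly_Mapping.single m (Poly_Mapping.lookup q m))) v =
     peval (\<Sum>m\<in>Poly_Mapping.keys p. Poly_Mapping.single m (Poly_Mapping.lookup p m)) v *
       peval (\<Sum>m\<in>Poly_Mapping.keys q. Poly_Mapping.single m (Poly_Mapping.lookup q m)) v"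
    by (simp add: sum_product peval_sum 1)
  then show ?thesis
    by (simp flip: mpol_sum_singles)
qed

lemma degree_sum_add:
  "(\<Sum>i\<in>Poly_Mapping.keys (m + n). Poly_Mapping.lookup (m + n) i) =
    (\<Sum>i\<in>Poly_Mapping.keys m. Poly_Mapping.lookup m i) + (\<Sum>i\<in>Poly_Mapping.keys n. Poly_Mapping.lookup n i)"
  for m n :: "nat \<Rightarrow>\<^sub>0 nat"
proof -
  define S where "S = Poly_Mapping.keys m \<union> Poly_Mapping.keys n"
  have *: "(\<Sum>i\<in>Poly_Mapping.keys k. Poly_Mapping.lookup k i) = (\<Sum>i\<in>S. Poly_Mapping.lookup k i)"
    if "Poly_Mapping.keys k \<subseteq> S" for k
    by (rule sum.mono_neutral_left) (use that in \<open>auto simp: S_def in_keys_iff\<close>)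
  have "Poly_Mapping.keys (m + n) \<subseteq> S" "Poly_Mapping.keys m \<subseteq> S" "Poly_Mapping.keys n \<subseteq> S"
    using keys_add[of m n] by (auto simp: S_def)
  then show ?thesis
    using *[of m] *[of n] *[of "m + n"] by (simp add: lookup_add sum.distrib)
qed

lemma form_zero: "form d (\<lambda>_. 0)"
  unfolding form_def by (rule exI[of _ 0]) (auto simp: homogeneous_def peval_zero)

lemma form_const: "form 0 (\<lambda>_. to_ac c)"
  unfolding form_def
  by (rule exI[of _ "Poly_Mapping.single 0 c"]) (auto simp: homogeneous_def peval_single fun_eq_iff)

lemma form_coord: "form 1 (\<lambda>v. v i)"
  unfolding form_def
  by (rule exI[of _ "Poly_Mapping.single (Poly_Mapping.single i 1) 1"])
     (auto simp: homogeneous_def peval_single fun_eq_iff)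

lemma form_add: "form d P ==> form d R ==> form d (\<lambda>v. P v + R v)"
  unfolding form_def
proof (elim exE conjE)
  fix p q :: "'a mpol" assume *: "homogeneous d p" "P = peval p" "homogeneous d q" "R = peval q"
  then show "\<exists>p. homogeneous d p \<and> (\<lambda>v. P v + R v) = peval p"
    using keys_add[of p q]
    by (intro exI[of _ "p + q"]) (auto simp: homogeneous_def peval_add fun_eq_iff)
qed

lemma form_mult: "form d P ==> form e R ==> form (d + e) (\<lambda>v. P v * R v)"
  unfolding form_def
proof (elim exE conjE)
  fix p q :: "'a mpol" assume *: "homogeneous d p" "P = peval p" "homogeneous e q" "R = peval q"
  have "homogeneous (d + e) (p * q)"
    unfolding homogeneous_def
  proof
    fix m assume "m \<in> Poly_Mapping.keys (p * q)"
    then obtain a b where "m = a + b" "a \<in> Poly_Mapping.keys p" "b \<in> Poly_Mapping.keys q"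
      using keys_mult by blast
    with * show "(\<Sum>i\<in>Poly_Mapping.keys m. Poly_Mapping.lookup m i) = d + e"
      by (simp add: degree_sum_add homogeneous_def)
  qed
  with * show "\<exists>p. homogeneous (d + e) p \<and> (\<lambda>v. P v * R v) = peval p"
    by (intro exI[of _ "p * q"]) (auto simp: peval_mult fun_eq_iff)
qed

text \<open>Monomials are built from constants by multiplication with coordinates, so these four
  closure rules generate all forms; later inductions never touch monomials.\<close>

lemma form_induct [consumes 1, case_names zero const coord add]:
  assumes "form d P"
    and zero: "!!d. Q d (\<lambda>_. 0)" and const: "!!c. Q 0 (\<lambda>_. to_ac c)"
    and coord: "!!d P i. form d P ==> Q d P ==> Q (Suc d) (\<lambda>v. v i * P v)"
    and add: "!!d P R. form d P ==> form d R ==> Q d P ==> Q d R ==> Q d (\<lambda>v. P v + R v)"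
  shows "Q d P"
proof -
  \<comment> \<open>Carrying \<open>form d P\<close> along with \<open>Q d P\<close> makes the form
    hypotheses of the step cases available.\<close>
  define Q' where "Q' d P \<longleftrightarrow> form d P \<and> Q d P" for d P
  have zero': "Q' d (\<lambda>_. 0)" for d
    by (simp add: Q'_def zero form_zero)
  have const': "Q' 0 (\<lambda>_. to_ac c)" for c
    by (simp add: Q'_def const form_const)
  have coord': "Q' (Suc d) (\<lambda>v. v i * P v)" if "Q' d P" for d P i
    using that coord form_mult[OF form_coord] by (auto simp: Q'_def)
  have add': "Q' d (\<lambda>v. P v + R v)" if "Q' d P" "Q' d R" for d P R
    using that add form_add by (auto simp: Q'_def)
  have pow: "Q' (n + d) (\<lambda>v. v i ^ n * P v)" if "Q' d P" for n d P i
  proof (induction n)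
    case (Suc n)
    from coord'[OF this, of i] show ?case by (simp add: mult.assoc)
  qed (use that in simp)
  have mono: "Q' (\<Sum>i\<in>S. e i) (\<lambda>v. to_ac c * (\<Prod>i\<in>S. v i ^ e i))" if "finite S" for S e c
    using that
  proof induction
    case (insert j S)
    from pow[OF insert.IH, of "e j" j] insert.hyps show ?case
      by (simp add: mult.left_commute mult.assoc)
  qed (use const' in simp)
  obtain p where p: "homogeneous d p" "P = peval p"
    using assms(1) by (auto simp: form_def)
  have "Q' d (\<lambda>v. \<Sum>m\<in>T. to_ac (Poly_Mapping.lookup p m) *
      (\<Prod>i\<in>Poly_Mapping.keys m. v i ^ Poly_Mapping.lookup m i))"
    if "finite T" "T \<subseteq> Poly_Mapping.keys p" for T
    using that
  proof induction
    case (insert m T)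
    then have "(\<Sum>i\<in>Poly_Mapping.keys m. Poly_Mapping.lookup m i) = d"
      using p by (auto simp: homogeneous_def)
    then have "Q' d (\<lambda>v. to_ac (Poly_Mapping.lookup p m) *
      (\<Prod>i\<in>Poly_Mapping.keys m. v i ^ Poly_Mapping.lookup m i))"
      using mono[of "Poly_Mapping.keys m" "Poly_Mapping.lookup m" "Poly_Mapping.lookup p m"] by auto
    from add'[OF this insert.IH] insert show ?case
      by auto
  qed (use zero' in simp)
  from this[of "Poly_Mapping.keys p"] show ?thesis
    by (simp add: p(2) Q'_def mpol_eval_def[abs_def])
qed

lemma form_scale: "form d P ==> P (\<lambda>i. c * v i) = c ^ d * P v"
  by (induction rule: form_induct) (auto simp: algebra_simps)

lemma form_cmult: "form d P ==> form d (\<lambda>v. to_ac c * P v)"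
  using form_mult[OF form_const] by fastforce

lemma form_diff: "form d P ==> form d R ==> form d (\<lambda>v. P v - R v)"
  using form_add[OF _ form_cmult[of d R "-1"], of P] by simp

lemma form_comp:
  assumes "form d P" "!!i. form e (F i)"
  shows "form (d * e) (\<lambda>v. P (\<lambda>i. F i v))"
  using assms(1)
proof (induction rule: form_induct)
  case (coord d P i)
  from form_mult[OF assms(2)[of i] coord(2)] show ?case by simp
qed (auto intro: form_zero form_const form_add)

lemma range_to_ac_closed:
  assumes "a \<in> range to_ac" "b \<in> range to_ac"
  shows "a + b \<in> range to_ac" "a * b \<in> range to_ac" "a / b \<in> range to_ac" "a - b \<in> range to_ac"
  using assms by (auto simp flip: to_ac_add to_ac_mult to_ac_divide to_ac_diff)

lemma form_rational:
  assumes "form d P" "!!i. v i \<in> range to_ac"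
  shows "P v \<in> range to_ac"
  using assms(1)
proof (induction rule: form_induct)
  case (zero d)
  show ?case by (metis rangeI to_ac_0)
qed (use assms(2) in \<open>auto intro!: range_to_ac_closed(1,2)\<close>)

section \<open>The Zariski topology in terms of forms\<close>

definition pts :: "'a::field ppoint set" where
  "pts = {hline v | v. v ~= (\<lambda>_. 0)}"

definition nz :: "((nat => 'a::field) => 'a) => 'a ppoint set" where
  "nz P = {hline v | v. v ~= (\<lambda>_. 0) \<and> P v ~= 0}"

lemma hline_self [simp]: "v \<in> hline v"
  unfolding hline_def by (auto intro!: exI[of _ 1])

lemma hline_memD: "w \<in> hline v ==> \<exists>c. c ~= 0 \<and> w = (\<lambda>i. c * v i)"
  by (auto simp: hline_def)

lemma hline_scale:
  assumes c: "c ~= 0"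
  shows "hline (\<lambda>i. c * v i) = hline (v :: nat => 'a::field)"
proof (intro Set.set_eqI iffI)
  fix w assume "w \<in> hline (\<lambda>i. c * v i)"
  then obtain d where "d ~= 0" "w = (\<lambda>i. (d * c) * v i)"
    by (auto simp: hline_def mult.assoc)
  with c show "w \<in> hline v"
    unfolding hline_def by (auto intro!: exI[of _ "d * c"])
next
  fix w assume "w \<in> hline v"
  then obtain d where "d ~= 0" "w = (\<lambda>i. d * v i)"
    by (auto simp: hline_def)
  with c have "d ~= 0" "w = (\<lambda>i. d / c * (c * v i))"
    by auto
  with c show "w \<in> hline (\<lambda>i. c * v i)"
    unfolding hline_def by (auto intro!: exI[of _ "d / c"])
qed

lemma hline_eqI: "w \<in> hline v ==> hline w = hline (v :: nat => 'a::field)"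
proof -
  assume "w \<in> hline v"
  from hline_memD[OF this] obtain c where "c ~= 0" "w = (\<lambda>i. c * v i)" by blast
  then show ?thesis by (simp add: hline_scale)
qed

lemma hline_eq_iff: "hline v = hline w \<longleftrightarrow> (\<exists>c. c ~= 0 \<and> v = (\<lambda>i. c * w i))" for v w :: "nat => 'a::field"
proof
  assume "hline v = hline w"
  then have "v \<in> hline w" using hline_self[of v] by simp
  then show "\<exists>c. c ~= 0 \<and> v = (\<lambda>i. c * w i)" by (rule hline_memD)
next
  assume "\<exists>c. c ~= 0 \<and> v = (\<lambda>i. c * w i)"
  then obtain c where "c ~= 0" "v = (\<lambda>i. c * w i)" by blast
  then show "hline v = hline w" by (simp add: hline_scale)
qed

lemma pts_cases: "x \<in> pts ==> v \<in> x ==> x = hline v \<and> v ~= (\<lambda>_. 0)"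
proof -
  assume "x \<in> pts" and v: "v \<in> x"
  then obtain w where w: "x = hline w" "w ~= (\<lambda>_. 0)" by (auto simp: pts_def)
  with v obtain c where "c ~= 0" "v = (\<lambda>i. c * w i)" using hline_memD by blast
  moreover from this w(2) have "v ~= (\<lambda>_. 0)" by (auto simp: fun_eq_iff)
  ultimately show ?thesis using w v hline_eqI[of v w] by simp
qed

lemma pts_obtain: "x \<in> pts ==> (!!v. v \<in> x ==> x = hline v ==> v ~= (\<lambda>_. 0) ==> thesis) ==> thesis"
  unfolding pts_def using hline_self by blast

lemma hline_pts: "v ~= (\<lambda>_. 0) ==> hline v \<in> pts"
  by (auto simp: pts_def)

lemma nz_iff: "form d P ==> x \<in> pts ==> v \<in> x ==> x \<in> nz P \<longleftrightarrow> P v ~= 0"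
proof -
  assume P: "form d P" and x: "x \<in> pts" and v: "v \<in> x"
  have xv: "x = hline v" "v ~= (\<lambda>_. 0)" using pts_cases[OF x v] by auto
  show ?thesis
  proof
    assume "x \<in> nz P"
    then obtain w where w: "hline v = hline w" "P w ~= 0"
      by (auto simp: nz_def xv)
    then obtain c where "c ~= 0" "v = (\<lambda>i. c * w i)"
      by (auto simp: hline_eq_iff)
    then show "P v ~= 0" using form_scale[OF P, of c w] w by simp
  qed (use xv in \<open>auto simp: nz_def\<close>)
qed

lemma nz_subset: "nz P \<subseteq> pts"
  by (auto simp: nz_def pts_def)

lemma nz_mult:
  assumes P: "form d P" and R: "form e R"
  shows "nz (\<lambda>v. P v * R v) = nz P \<inter> nz R"
proof -
  have "x \<in> nz (\<lambda>v. P v * R v) \<longleftrightarrow> x \<in> nz P \<inter> nz R" if x: "x \<in> pts" for x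
  proof -
    obtain v where v: "v \<in> x" using x pts_obtain by blast
    show ?thesis
      using nz_iff[OF P x v] nz_iff[OF R x v] nz_iff[OF form_mult[OF P R] x v] by simp
  qed
  then show ?thesis using nz_subset by blast
qed

lemma nz_one: "nz (\<lambda>_. 1) = pts"
  by (auto simp: nz_def pts_def)

lemma basic_open_nz: "basic_open p = nz (peval p)"
  by (simp add: basic_open_def nz_def)

lemma zariski_nz: "zariski = topology_generated_by {nz P | P. \<exists>d. form d P}"
  unfolding zariski_def basic_open_nz form_def by (rule arg_cong[of _ _ topology_generated_by]) auto

text \<open>By \<open>nz_mult\<close> the loci \<open>nz P\<close> are closed under intersection, so
  the generating sets already form a basis.\<close>

lemma openin_zariski:
  "openin zariski U \<longleftrightarrow> (\<forall>x\<in>U. \<exists>d P. form d P \<and> x \<in> nz P \<and> nz P \<subseteq> U)"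
proof
  assume "openin zariski U"
  then have "generate_topology_on {nz P | P. \<exists>d. form d P} U"
    by (simp add: zariski_nz openin_topology_generated_by_iff)
  then show "\<forall>x\<in>U. \<exists>d P. form d P \<and> x \<in> nz P \<and> nz P \<subseteq> U"
  proof induction
    case (Int a b)
    show ?case
    proof
      fix x assume x: "x \<in> a \<inter> b"
      obtain d P e R where *: "form d P" "x \<in> nz P" "nz P \<subseteq> a" "form e R" "x \<in> nz R" "nz R \<subseteq> b"
        using Int.IH x by blast
      show "\<exists>d P. form d P \<and> x \<in> nz P \<and> nz P \<subseteq> a \<inter> b"
        by (rule exI[of _ "d + e"], rule exI[of _ "\<lambda>v. P v * R v"])
           (use * nz_mult[of d P e R] form_mult[of d P e R] in auto)
    qed
  next
    case (UN K) then show ?case by (meson Union_iff Union_upper order_trans)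
  qed auto
next
  assume *: "\<forall>x\<in>U. \<exists>d P. form d P \<and> x \<in> nz P \<and> nz P \<subseteq> U"
  define S where "S = {nz P | P d. form d P \<and> nz P \<subseteq> U}"
  have "openin zariski s" if "s \<in> S" for s
    using that unfolding zariski_nz S_def by (intro topology_generated_by_Basis) auto
  then have "openin zariski (\<Union>S)" by blast
  moreover have "\<Union>S = U" using * unfolding S_def by blast
  ultimately show "openin zariski U" by simp
qed

lemma topspace_zariski: "topspace zariski = pts"
proof
  show "topspace zariski \<subseteq> pts"
    using openin_topspace[of zariski] nz_subset unfolding openin_zariski by blast
  have "openin zariski (pts :: 'a alg_closure ppoint set)"
    unfolding openin_zariski
    using form_const[of 1] nz_one nz_subset by (metis to_ac_1)
  then show "pts \<subseteq> topspace (zariski :: 'a alg_closure ppoint topology)"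
    by (rule openin_subset)
qed

lemma openin_zariski_on:
  "openin (zariski_on X) U \<longleftrightarrow>
     U \<subseteq> X \<and> (\<forall>x\<in>U. \<exists>d P. form d P \<and> x \<in> nz P \<and> X \<inter> nz P \<subseteq> U)"
proof
  assume "openin (zariski_on X) U"
  then show "U \<subseteq> X \<and> (\<forall>x\<in>U. \<exists>d P. form d P \<and> x \<in> nz P \<and> X \<inter> nz P \<subseteq> U)"
    unfolding openin_subtopology openin_zariski by blast
next
  assume *: "U \<subseteq> X \<and> (\<forall>x\<in>U. \<exists>d P. form d P \<and> x \<in> nz P \<and> X \<inter> nz P \<subseteq> U)"
  define T where "T = \<Union>{nz P | P d. form d P \<and> X \<inter> nz P \<subseteq> U}"
  have "openin zariski T" unfolding openin_zariski T_def by blast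
  moreover have "U = T \<inter> X" using * unfolding T_def by blast
  ultimately show "openin (zariski_on X) U" by (auto simp: openin_subtopology)
qed

lemma openin_nz: "form d P ==> openin (zariski_on X) (X \<inter> nz P)"
  unfolding openin_zariski_on by blast

lemma topspace_zariski_on: "X \<subseteq> pts ==> topspace (zariski_on X) = X"
  by (auto simp: topspace_zariski)

lemma closedin_nz:
  assumes "X \<subseteq> pts" "form d P"
  shows "closedin (zariski_on X) (X - nz P)"
proof -
  have "X - (X - nz P) = X \<inter> nz P" by blast
  then show ?thesis
    unfolding closedin_def topspace_zariski_on[OF assms(1)] using openin_nz[OF assms(2), of X] by auto
qed

lemma eventually_zariski:
  assumes "X \<subseteq> pts" "x \<in> X"
  shows "eventually \<phi> (nhdsin (zariski_on X) x) \<longleftrightarrow>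
    (\<exists>d P. form d P \<and> x \<in> nz P \<and> (\<forall>y\<in>X \<inter> nz P. \<phi> y))"
  unfolding eventually_nhdsin topspace_zariski_on[OF assms(1)] openin_zariski_on
proof
  assume "x \<notin> X \<or> (\<exists>S. (S \<subseteq> X \<and> (\<forall>x\<in>S. \<exists>d P. form d P \<and> x \<in> nz P \<and> X \<inter> nz P \<subseteq> S)) \<and> x \<in> S \<and> (\<forall>x\<in>S. \<phi> x))"
  then show "\<exists>d P. form d P \<and> x \<in> nz P \<and> (\<forall>y\<in>X \<inter> nz P. \<phi> y)"
    using assms(2) by (meson subsetD)
next
  assume "\<exists>d P. form d P \<and> x \<in> nz P \<and> (\<forall>y\<in>X \<inter> nz P. \<phi> y)"
  then obtain d P where "form d P" "x \<in> nz P" "\<forall>y\<in>X \<inter> nz P. \<phi> y" by blast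
  then show "x \<notin> X \<or> (\<exists>S. (S \<subseteq> X \<and> (\<forall>x\<in>S. \<exists>d P. form d P \<and> x \<in> nz P \<and> X \<inter> nz P \<subseteq> S)) \<and> x \<in> S \<and> (\<forall>x\<in>S. \<phi> x))"
    using assms(2) by (intro disjI2 exI[of _ "X \<inter> nz P"]) blast
qed

lemma generically_iff:
  "generically X \<phi> \<longleftrightarrow> (\<exists>d P. form d P \<and> X \<inter> nz P ~= {} \<and> (\<forall>y\<in>X \<inter> nz P. \<phi> y))"
proof
  assume "generically X \<phi>"
  then show "\<exists>d P. form d P \<and> X \<inter> nz P ~= {} \<and> (\<forall>y\<in>X \<inter> nz P. \<phi> y)"
    unfolding generically_def openin_zariski_on by blast
next
  assume "\<exists>d P. form d P \<and> X \<inter> nz P ~= {} \<and> (\<forall>y\<in>X \<inter> nz P. \<phi> y)"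
  then show "generically X \<phi>"
    unfolding generically_def using openin_nz by blast
qed

lemma zariski_irreducible_iff:
  assumes "X \<subseteq> pts"
  shows "zariski_irreducible X \<longleftrightarrow> X ~= {} \<and>
    (\<forall>d P e R. form d P --> form e R --> X \<inter> nz P ~= {} --> X \<inter> nz R ~= {} --> X \<inter> nz P \<inter> nz R ~= {})"
proof (intro iffI conjI allI impI)
  assume i: "zariski_irreducible X"
  then show "X ~= {}" by (simp add: zariski_irreducible_def)
  fix d P e R assume *: "form d P" "form e R" "X \<inter> nz P ~= {}" "X \<inter> nz R ~= {}"
  show "X \<inter> nz P \<inter> nz R ~= {}"
  proof
    assume "X \<inter> nz P \<inter> nz R = {}"
    then have "X = (X - nz P) \<union> (X - nz R)" by blast
    moreover have "closedin (zariski_on X) (X - nz P)" "closedin (zariski_on X) (X - nz R)"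
      using * assms closedin_nz by blast+
    ultimately have "X = X - nz P \<or> X = X - nz R"
      using i unfolding zariski_irreducible_def by blast
    with * show False by blast
  qed
next
  assume i: "X ~= {} \<and> (\<forall>d P e R. form d P --> form e R --> X \<inter> nz P ~= {} --> X \<inter> nz R ~= {} --> X \<inter> nz P \<inter> nz R ~= {})"
  show "zariski_irreducible X"
    unfolding zariski_irreducible_def
  proof (intro conjI allI impI, use i in simp, elim conjE)
    fix Z W assume *: "closedin (zariski_on X) Z" "closedin (zariski_on X) W" "X = Z \<union> W"
    show "X = Z \<or> X = W"
    proof (rule ccontr)
      assume "\<not> (X = Z \<or> X = W)"
      then obtain x y where xy: "x \<in> X - Z" "y \<in> X - W" using * by blast
      have "openin (zariski_on X) (X - Z)" "openin (zariski_on X) (X - W)"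
        using * topspace_zariski_on[OF assms] by (metis closedin_def)+
      then obtain d P e R where "form d P" "x \<in> nz P" "X \<inter> nz P \<subseteq> X - Z" "form e R" "y \<in> nz R" "X \<inter> nz R \<subseteq> X - W"
        using xy unfolding openin_zariski_on by meson
      moreover from this have "X \<inter> nz P \<inter> nz R ~= {}"
        using i xy by (metis Diff_iff Int_iff empty_iff)
      ultimately show False using * by blast
    qed
  qed
qed

lemma zariski_dense_iff:
  assumes "X \<subseteq> pts" "S \<subseteq> X"
  shows "zariski_dense_in X S \<longleftrightarrow> (\<forall>d P. form d P --> X \<inter> nz P ~= {} --> S \<inter> nz P ~= {})"
proof -
  have "zariski_dense_in X S \<longleftrightarrow> (\<forall>T. openin (zariski_on X) T \<and> T ~= {} --> S \<inter> T ~= {})"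
    unfolding zariski_dense_in_def
    using dense_intersects_open[of "zariski_on X" S] topspace_zariski_on[OF assms(1)] by simp
  also have "\<dots> \<longleftrightarrow> (\<forall>d P. form d P --> X \<inter> nz P ~= {} --> S \<inter> nz P ~= {})"
  proof (intro iffI allI impI)
    fix d P assume "\<forall>T. openin (zariski_on X) T \<and> T ~= {} --> S \<inter> T ~= {}" "form d P" "X \<inter> nz P ~= {}"
    then show "S \<inter> nz P ~= {}" using openin_nz[of d P X] by blast
  next
    fix T assume *: "\<forall>d P. form d P --> X \<inter> nz P ~= {} --> S \<inter> nz P ~= {}"
      "openin (zariski_on X) T \<and> T ~= {}"
    then obtain x d P where "x \<in> T" "T \<subseteq> X" "form d P" "x \<in> nz P" "X \<inter> nz P \<subseteq> T"
      unfolding openin_zariski_on by blast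
    with *(1) assms(2) show "S \<inter> T ~= {}" by blast
  qed
  finally show ?thesis .
qed

lemma generically_mono: "generically X \<phi> ==> (!!x. x \<in> X ==> \<phi> x ==> \<psi> x) ==> generically X \<psi>"
  unfolding generically_iff by blast

lemma generically_conj:
  assumes "zariski_irreducible X" "X \<subseteq> pts" "generically X \<phi>" "generically X \<psi>"
  shows "generically X (\<lambda>x. \<phi> x \<and> \<psi> x)"
proof -
  obtain d P e R where *: "form d P" "X \<inter> nz P ~= {}" "\<forall>y\<in>X \<inter> nz P. \<phi> y"
     "form e R" "X \<inter> nz R ~= {}" "\<forall>y\<in>X \<inter> nz R. \<psi> y"
    using assms(3,4) unfolding generically_iff by blast
  then have "X \<inter> nz P \<inter> nz R ~= {}"
    using assms(1) unfolding zariski_irreducible_iff[OF assms(2)] by blast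
  with * show ?thesis
    unfolding generically_iff
    by (intro exI[of _ "d + e"] exI[of _ "\<lambda>v. P v * R v"]) (auto simp: nz_mult form_mult)
qed

lemma generically_not_False: "\<not> generically X (\<lambda>_. False)"
  unfolding generically_iff by blast

lemma eventually_imp_generically:
  assumes "X \<subseteq> pts" "x \<in> X" "eventually \<phi> (nhdsin (zariski_on X) x)"
  shows "generically X \<phi>"
  using assms(3) unfolding eventually_zariski[OF assms(1,2)] generically_iff using assms(2) by blast

definition quot ::
  "((nat => 'a::field) => 'a) => ((nat => 'a) => 'a) => ('a ppoint => 'a) => 'a ppoint => bool"
  where
  "quot F G f x \<longleftrightarrow> (\<forall>v\<in>x. G v ~= 0 \<and> f x = F v / G v)"

text \<open>Passes between forms as functions and the polynomials used in the definitions, for an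
  arbitrary property of the pair.\<close>

lemma ex_form_pair:
  "(\<exists>d F G. form d F \<and> form d G \<and> \<Phi> F G) \<longleftrightarrow>
     (\<exists>d p q. homogeneous d p \<and> homogeneous d q \<and> \<Phi> (peval p) (peval q))"
proof
  assume "\<exists>d F G. form d F \<and> form d G \<and> \<Phi> F G"
  then obtain d F G where F: "form d F" "form d G" "\<Phi> F G" by blast
  obtain p q where "homogeneous d p" "F = peval p" "homogeneous d q" "G = peval q"
    using F(1,2) unfolding form_def by blast
  with F(3) show "\<exists>d p q. homogeneous d p \<and> homogeneous d q \<and> \<Phi> (peval p) (peval q)" by blast
next
  assume "\<exists>d p q. homogeneous d p \<and> homogeneous d q \<and> \<Phi> (peval p) (peval q)"
  then obtain d p q where F: "homogeneous d p" "homogeneous d q" "\<Phi> (peval p) (peval q)" by blast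
  have "form d (peval p)" "form d (peval q)"
    unfolding form_def using F(1,2) by blast+
  with F(3) show "\<exists>d F G. form d F \<and> form d G \<and> \<Phi> F G" by blast
qed

lemma quotient_at_quot: "quotient_at p q = quot (peval p) (peval q)"
  by (simp add: quotient_at_def quot_def fun_eq_iff)

lemma rational_function_iff:
  "rational_function X f \<longleftrightarrow> (\<exists>d F G. form d F \<and> form d G \<and> generically X (quot F G f))"
  unfolding rational_function_def quotient_at_quot ex_form_pair ..

lemma regular_at_iff:
  "regular_at X x f \<longleftrightarrow> (\<exists>d F G. form d F \<and> form d G \<and> eventually (quot F G f) (nhdsin (zariski_on X) x))"
  unfolding regular_at_def quotient_at_quot ex_form_pair ..

lemma ex_form_family:
  "(\<exists>F. (\<forall>i. homogeneous d (F i)) \<and> \<Phi> (\<lambda>i. peval (F i))) \<longleftrightarrow> (\<exists>F. (\<forall>i::nat. form d (F i)) \<and> \<Phi> F)"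
proof
    assume "\<exists>F. (\<forall>i. form d (F i)) \<and> \<Phi> F"
    then obtain F where F: "\<forall>i. form d (F i)" "\<Phi> F" by blast
    then obtain p where p: "\<forall>i. homogeneous d (p i) \<and> F i = peval (p i)"
      unfolding form_def by metis
    then have eq: "F = (\<lambda>i. peval (p i))" by auto
    show "\<exists>F. (\<forall>i. homogeneous d (F i)) \<and> \<Phi> (\<lambda>i. peval (F i))"
    proof (intro exI conjI)
      show "\<forall>i. homogeneous d (p i)" using p by simp
      show "\<Phi> (\<lambda>i. peval (p i))" using F(2) unfolding eq .
    qed
  next
    assume "\<exists>F. (\<forall>i. homogeneous d (F i)) \<and> \<Phi> (\<lambda>i. peval (F i))"
    then obtain F where "\<forall>i. homogeneous d (F i)" "\<Phi> (\<lambda>i. peval (F i))" by blast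
    then show "\<exists>F. (\<forall>i. form d (F i)) \<and> \<Phi> F"
      by (intro exI[of _ "\<lambda>i. peval (F i)"]) (auto simp: form_def)
  qed

lemma morphism_iff:
  assumes "X \<subseteq> pts"
  shows "morphism X Y \<phi> \<longleftrightarrow> \<phi> ` X \<subseteq> Y \<and>
     (\<forall>x\<in>X. \<exists>d F e R. (\<forall>i. form d (F i)) \<and> form e R \<and> x \<in> nz R \<and>
        (\<forall>y\<in>X \<inter> nz R. \<forall>v\<in>y. (\<lambda>i. F i v) \<in> \<phi> y))"
proof -
  have "(\<exists>d F. (\<forall>i. homogeneous d (F i)) \<and>
        (\<forall>\<^sub>F y in nhdsin (zariski_on X) x. \<forall>v\<in>y. (\<lambda>i. peval (F i) v) \<in> \<phi> y)) \<longleftrightarrow>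
      (\<exists>d F e R. (\<forall>i. form d (F i)) \<and> form e R \<and> x \<in> nz R \<and>
        (\<forall>y\<in>X \<inter> nz R. \<forall>v\<in>y. (\<lambda>i. F i v) \<in> \<phi> y))" if x: "x \<in> X" for x
  proof (rule iff_exI)
    fix d
    have "(\<exists>F. (\<forall>i. homogeneous d (F i)) \<and>
        (\<forall>\<^sub>F y in nhdsin (zariski_on X) x. \<forall>v\<in>y. (\<lambda>i. peval (F i) v) \<in> \<phi> y)) \<longleftrightarrow>
        (\<exists>F. (\<forall>i. form d (F i)) \<and>
        (\<forall>\<^sub>F y in nhdsin (zariski_on X) x. \<forall>v\<in>y. (\<lambda>i. F i v) \<in> \<phi> y))"
      by (rule ex_form_family[of d "\<lambda>F. \<forall>\<^sub>F y in nhdsin (zariski_on X) x. \<forall>v\<in>y. (\<lambda>i. F i v) \<in> \<phi> y"])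
    then show "(\<exists>F. (\<forall>i. homogeneous d (F i)) \<and>
        (\<forall>\<^sub>F y in nhdsin (zariski_on X) x. \<forall>v\<in>y. (\<lambda>i. peval (F i) v) \<in> \<phi> y)) \<longleftrightarrow>
      (\<exists>F e R. (\<forall>i. form d (F i)) \<and> form e R \<and> x \<in> nz R \<and>
        (\<forall>y\<in>X \<inter> nz R. \<forall>v\<in>y. (\<lambda>i. F i v) \<in> \<phi> y))"
      unfolding eventually_zariski[OF assms x] by (simp only: ex_simps)
  qed
  then show ?thesis
    unfolding morphism_def by simp
qed

section \<open>Local rings and orders\<close>

lemma quot_addI:
  assumes "quot F G f y" "quot F' G' g y"
  shows "quot (\<lambda>v. F v * G' v + G v * F' v) (\<lambda>v. G v * G' v) (\<lambda>y. f y + g y) y"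
  unfolding quot_def
proof (intro ballI)
  fix v assume "v \<in> y"
  with assms have "G v ~= 0" "G' v ~= 0" "f y = F v / G v" "g y = F' v / G' v"
    unfolding quot_def by blast+
  then show "G v * G' v ~= 0 \<and> f y + g y = (F v * G' v + G v * F' v) / (G v * G' v)"
    by (simp add: add_frac_eq mult.commute)
qed

lemma quot_multI:
  assumes "quot F G f y" "quot F' G' g y"
  shows "quot (\<lambda>v. F v * F' v) (\<lambda>v. G v * G' v) (\<lambda>y. f y * g y) y"
  unfolding quot_def
proof (intro ballI)
  fix v assume "v \<in> y"
  with assms have "G v ~= 0" "G' v ~= 0" "f y = F v / G v" "g y = F' v / G' v"
    unfolding quot_def by blast+
  then show "G v * G' v ~= 0 \<and> f y * g y = F v * F' v / (G v * G' v)"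
    by simp
qed

locale irreducible_set =
  fixes X :: "'k::field_char_0 alg_closure ppoint set"
  assumes irr: "zariski_irreducible X" and sub: "X \<subseteq> pts"
begin

lemma generically_conjI: "generically X \<phi> ==> generically X \<psi> ==> generically X (\<lambda>x. \<phi> x \<and> \<psi> x)"
  by (rule generically_conj[OF irr sub])

lemma generically_mp2:
  "generically X \<phi> ==> generically X \<psi> ==> (!!x. x \<in> X ==> \<phi> x ==> \<psi> x ==> \<theta> x) ==> generically X \<theta>"
  using generically_mono[OF generically_conjI] by blast

lemma generically_ex: "generically X \<phi> ==> \<exists>x\<in>X. \<phi> x"
  unfolding generically_iff by blast

lemma eventually_generically: "x \<in> X ==> eventually \<phi> (nhdsin (zariski_on X) x) ==> generically X \<phi>"
  by (rule eventually_imp_generically[OF sub])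

lemma eventually_at: "x \<in> X ==> eventually \<phi> (nhdsin (zariski_on X) x) ==> \<phi> x"
  unfolding eventually_zariski[OF sub] by blast

lemma regular_const: "regular_at X x (\<lambda>_. to_ac c)"
proof -
  have "form 0 (\<lambda>_. to_ac c)" "form 0 (\<lambda>_. to_ac 1)" by (rule form_const)+
  moreover have "eventually (quot (\<lambda>_. to_ac c) (\<lambda>_. to_ac 1) (\<lambda>_. to_ac c)) (nhdsin (zariski_on X) x)"
    by (rule eventuallyI) (simp add: quot_def)
  ultimately show ?thesis unfolding regular_at_iff by blast
qed

lemma regular_add:
  assumes "regular_at X x f" "regular_at X x g"
  shows "regular_at X x (\<lambda>y. f y + g y)"
proof -
  obtain d F G e F' G' where *: "form d F" "form d G" "eventually (quot F G f) (nhdsin (zariski_on X) x)"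
     "form e F'" "form e G'" "eventually (quot F' G' g) (nhdsin (zariski_on X) x)"
    using assms unfolding regular_at_iff by blast
  have "form (d + e) (\<lambda>v. F v * G' v + G v * F' v)" "form (d + e) (\<lambda>v. G v * G' v)"
    using * by (auto intro!: form_add form_mult)
  moreover have "eventually (quot (\<lambda>v. F v * G' v + G v * F' v) (\<lambda>v. G v * G' v) (\<lambda>y. f y + g y)) (nhdsin (zariski_on X) x)"
    using *(3,6) by eventually_elim (rule quot_addI)
  ultimately show ?thesis unfolding regular_at_iff by blast
qed

lemma regular_mult:
  assumes "regular_at X x f" "regular_at X x g"
  shows "regular_at X x (\<lambda>y. f y * g y)"
proof -
  obtain d F G e F' G' where *: "form d F" "form d G" "eventually (quot F G f) (nhdsin (zariski_on X) x)"
     "form e F'" "form e G'" "eventually (quot F' G' g) (nhdsin (zariski_on X) x)"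
    using assms unfolding regular_at_iff by blast
  have "form (d + e) (\<lambda>v. F v * F' v)" "form (d + e) (\<lambda>v. G v * G' v)"
    using * by (auto intro!: form_mult)
  moreover have "eventually (quot (\<lambda>v. F v * F' v) (\<lambda>v. G v * G' v) (\<lambda>y. f y * g y)) (nhdsin (zariski_on X) x)"
    using *(3,6) by eventually_elim (rule quot_multI)
  ultimately show ?thesis unfolding regular_at_iff by blast
qed

lemma regular_minus: "regular_at X x f ==> regular_at X x (\<lambda>y. - f y)"
  using regular_mult[OF regular_const[of _ "-1"]] by simp

lemma regular_diff: "regular_at X x f ==> regular_at X x g ==> regular_at X x (\<lambda>y. f y - g y)"
  using regular_add[OF _ regular_minus] by simp

lemma regular_power: "regular_at X x f ==> regular_at X x (\<lambda>y. f y ^ n)"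
proof (induction n)
  case 0
  then show ?case using regular_const[of _ 1] by simp
next
  case (Suc n)
  then show ?case using regular_mult by simp
qed

lemma regular_nonzero:
  assumes "x \<in> X" "regular_at X x f" "f x ~= 0"
  shows "eventually (\<lambda>y. f y ~= 0) (nhdsin (zariski_on X) x)" "regular_at X x (\<lambda>y. inverse (f y))"
proof -
  obtain d F G where *: "form d F" "form d G" "eventually (quot F G f) (nhdsin (zariski_on X) x)"
    using assms(2) unfolding regular_at_iff by blast
  obtain v where v: "v \<in> x" using assms(1) sub pts_obtain by blast
  have "quot F G f x" using eventually_at[OF assms(1) *(3)] .
  with v assms(3) have "F v ~= 0" by (auto simp: quot_def)
  then have "x \<in> nz F" using nz_iff[OF *(1) _ v] assms(1) sub by blast
  then have ev: "eventually (\<lambda>y. y \<in> X \<inter> nz F) (nhdsin (zariski_on X) x)"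
    unfolding eventually_zariski[OF sub assms(1)] using *(1) by blast
  have ev2: "eventually (\<lambda>y. f y ~= 0 \<and> quot G F (\<lambda>y. inverse (f y)) y) (nhdsin (zariski_on X) x)"
    using *(3) ev
  proof eventually_elim
    case (elim y)
    then have y: "y \<in> pts" using sub by blast
    have F: "\<forall>v\<in>y. F v ~= 0" using nz_iff[OF *(1) y] elim by blast
    obtain v where v: "v \<in> y" using pts_obtain[OF y] by blast
    have "f y = F w / G w" "G w ~= 0" if "w \<in> y" for w
      using elim that unfolding quot_def by blast+
    with F v show ?case by (simp add: quot_def)
  qed
  show "eventually (\<lambda>y. f y ~= 0) (nhdsin (zariski_on X) x)"
    using ev2 by eventually_elim simp
  have "eventually (quot G F (\<lambda>y. inverse (f y))) (nhdsin (zariski_on X) x)"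
    using ev2 by eventually_elim simp
  with * show "regular_at X x (\<lambda>y. inverse (f y))" unfolding regular_at_iff by blast
qed

lemma regular_powi:
  assumes "x \<in> X" "regular_at X x f" "f x ~= 0"
  shows "regular_at X x (\<lambda>y. f y powi n)"
  using regular_power[OF assms(2), of "nat n"] regular_power[OF regular_nonzero(2)[OF assms], of "nat (-n)"]
  by (cases "n \<ge> 0") (simp_all add: power_int_def)

text \<open>A nonzero value would persist on an open neighbourhood, and by irreducibility this meets
  the open set where f vanishes.\<close>

lemma regular_generic_zero:
  assumes "x \<in> X" "regular_at X x f" "generically X (\<lambda>y. f y = 0)"
  shows "f x = 0"
proof (rule ccontr)
  assume "f x ~= 0"
  from eventually_generically[OF assms(1) regular_nonzero(1)[OF assms(1,2) this]]
  have "generically X (\<lambda>y. False)" by (rule generically_mp2[OF _ assms(3)]) simp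
  then show False using generically_not_False by blast
qed

lemma regular_generic_eq:
  assumes "x \<in> X" "regular_at X x f" "regular_at X x g" "generically X (\<lambda>y. f y = g y)"
  shows "f x = g x"
  proof -
  have "generically X (\<lambda>y. f y - g y = 0)" by (rule generically_mono[OF assms(4)]) simp
  from regular_generic_zero[OF assms(1) regular_diff[OF assms(2,3)] this] show ?thesis by simp
qed

text \<open>A quotient of forms over k has a value in k at a vector with coordinates in k. This is
  how rationality of a point of the surface is turned into rationality of coordinates.\<close>

lemma regular_rational_value:
  assumes "x \<in> rational_points X" "regular_at X x f"
  shows "f x \<in> range to_ac"
proof -
  obtain v where v: "v \<in> x" "\<forall>i. v i \<in> range to_ac" "x \<in> X"
    using assms(1) by (auto simp: rational_points_def)
  obtain d F G where *: "form d F" "form d G" "eventually (quot F G f) (nhdsin (zariski_on X) x)"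
    using assms(2) unfolding regular_at_iff by blast
  have "quot F G f x" using eventually_at[OF v(3) *(3)] .
  then have "f x = F v / G v" using v by (auto simp: quot_def)
  then show ?thesis using form_rational[OF *(1)] form_rational[OF *(2)] v(2) range_to_ac_closed(3) by metis
qed

lemma regular_imp_rational_function: "x \<in> X ==> regular_at X x f ==> rational_function X f"
  unfolding regular_at_iff rational_function_iff using eventually_generically by blast

lemma rational_function_regular:
  assumes "rational_function X f"
  shows "generically X (\<lambda>x. regular_at X x f)"
proof -
  obtain d F G where *: "form d F" "form d G" "generically X (quot F G f)"
    using assms(1) unfolding rational_function_iff by blast
  then obtain e R where R: "form e R" "X \<inter> nz R ~= {}" "\<forall>y\<in>X \<inter> nz R. quot F G f y"
    unfolding generically_iff by blast
  have "regular_at X x f" if "x \<in> X \<inter> nz R" for x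
    unfolding regular_at_iff
    using * R that by (intro exI[of _ d] exI[of _ F] exI[of _ G] conjI)
      (auto simp: eventually_zariski[OF sub])
  with R show ?thesis unfolding generically_iff by blast
qed

lemma rational_function_mult:
  assumes "rational_function X f" "rational_function X g"
  shows "rational_function X (\<lambda>x. f x * g x)"
proof -
  obtain x where "x \<in> X" "regular_at X x f" "regular_at X x g"
    using generically_ex[OF generically_conjI[OF rational_function_regular[OF assms(1)]
      rational_function_regular[OF assms(2)]]] by blast
  then show ?thesis using regular_imp_rational_function regular_mult by blast
qed

lemma rational_function_add:
  assumes "rational_function X f" "rational_function X g"
  shows "rational_function X (\<lambda>x. f x + g x)"
proof -
  obtain x where "x \<in> X" "regular_at X x f" "regular_at X x g"
    using generically_ex[OF generically_conjI[OF rational_function_regular[OF assms(1)]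
      rational_function_regular[OF assms(2)]]] by blast
  then show ?thesis using regular_imp_rational_function regular_add by blast
qed

lemma rational_function_inverse:
  assumes "rational_function X f" "generically X (\<lambda>x. f x ~= 0)"
  shows "rational_function X (\<lambda>x. inverse (f x))"
proof -
  obtain x where "x \<in> X" "regular_at X x f" "f x ~= 0"
    using generically_ex[OF generically_conjI[OF rational_function_regular[OF assms(1)] assms(2)]] by blast
  then show ?thesis using regular_imp_rational_function regular_nonzero(2) by blast
qed

text \<open>Each uniformizer divides the other; the product of the two quotients is generically 1,
  hence 1 at x. Cancelling t requires that it is generically nonzero.\<close>

lemma uniformizer_ratio:
  assumes x: "x \<in> X" and t: "uniformizer X x t" and t': "uniformizer X x t'"
    and nz: "generically X (\<lambda>y. t y ~= 0)"
  obtains a where "regular_at X x a" "a x ~= 0" "generically X (\<lambda>y. t' y = t y * a y)"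
proof -
  obtain a where a: "regular_at X x a" "eventually (\<lambda>y. t' y = t y * a y) (nhdsin (zariski_on X) x)"
    using t t' unfolding uniformizer_def by blast
  obtain b where b: "regular_at X x b" "eventually (\<lambda>y. t y = t' y * b y) (nhdsin (zariski_on X) x)"
    using t t' unfolding uniformizer_def by blast
  have "generically X (\<lambda>y. t y = t y * a y * b y)"
    by (rule generically_mp2[OF eventually_generically[OF x a(2)] eventually_generically[OF x b(2)]]) simp
  then have "generically X (\<lambda>y. a y * b y = to_ac 1)"
    by (rule generically_mp2[OF _ nz]) (simp add: mult.assoc)
  then have "a x * b x = to_ac 1"
    using regular_generic_eq[OF x regular_mult[OF a(1) b(1)] regular_const] by blast
  then have "a x ~= 0" by auto
  with a x that show ?thesis using eventually_generically by blast
qed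

text \<open>The order can be measured with any fixed uniformizer: the n-th power of the unit
  relating two of them is absorbed in the unit factor.\<close>

lemma has_order_wrt:
  assumes x: "x \<in> X" and t: "uniformizer X x t" and nz: "generically X (\<lambda>y. t y ~= 0)"
    and "has_order X x f n"
  obtains u where "regular_at X x u" "u x ~= 0" "generically X (\<lambda>y. f y = u y * t y powi n)"
proof -
  obtain t' u where *: "uniformizer X x t'" "regular_at X x u" "u x ~= 0" "generically X (\<lambda>y. f y = u y * t' y powi n)"
    using assms(4) unfolding has_order_def by blast
  obtain a where a: "regular_at X x a" "a x ~= 0" "generically X (\<lambda>y. t' y = t y * a y)"
    using uniformizer_ratio[OF x t *(1) nz] .
  show ?thesis
  proof (rule that)
    show "regular_at X x (\<lambda>y. u y * a y powi n)"
      using regular_mult[OF *(2) regular_powi[OF x a(1,2)]] .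
    show "u x * a x powi n ~= 0" using * a by simp
    show "generically X (\<lambda>y. f y = u y * a y powi n * t y powi n)"
      by (rule generically_mp2[OF *(4) a(3)]) (simp add: power_int_mult_distrib)
  qed
qed

lemma has_order_mult:
  assumes x: "x \<in> X" and t: "uniformizer X x t" and nz: "generically X (\<lambda>y. t y ~= 0)"
    and "has_order X x f n" "has_order X x g m"
  shows "has_order X x (\<lambda>y. f y * g y) (n + m)"
proof -
  obtain u where u: "regular_at X x u" "u x ~= 0" "generically X (\<lambda>y. f y = u y * t y powi n)"
    using has_order_wrt[OF x t nz assms(4)] .
  obtain w where w: "regular_at X x w" "w x ~= 0" "generically X (\<lambda>y. g y = w y * t y powi m)"
    using has_order_wrt[OF x t nz assms(5)] .
  have "generically X (\<lambda>y. f y * g y = (u y * w y) * t y powi (n + m))"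
    by (rule generically_mp2[OF generically_conjI[OF u(3) w(3)] nz]) (simp add: power_int_add)
  with t u w show ?thesis unfolding has_order_def
    by (intro exI[of _ t] exI[of _ "\<lambda>y. u y * w y"]) (simp add: regular_mult)
qed

lemma has_order_inverse:
  assumes x: "x \<in> X" and "has_order X x f n"
  shows "has_order X x (\<lambda>y. inverse (f y)) (- n)"
proof -
  obtain t u where *: "uniformizer X x t" "regular_at X x u" "u x ~= 0" "generically X (\<lambda>y. f y = u y * t y powi n)"
    using assms(2) unfolding has_order_def by blast
  have "generically X (\<lambda>y. inverse (f y) = inverse (u y) * t y powi (- n))"
    by (rule generically_mono[OF *(4)]) (simp add: power_int_minus)
  with * x show ?thesis unfolding has_order_def
    by (intro exI[of _ t] exI[of _ "\<lambda>y. inverse (u y)"]) (simp add: regular_nonzero(2))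
qed

lemma has_order_cong:
  assumes "has_order X x f n" "generically X (\<lambda>y. f y = g y)"
  shows "has_order X x g n"
proof -
  obtain t u where *: "uniformizer X x t" "regular_at X x u" "u x ~= 0" "generically X (\<lambda>y. f y = u y * t y powi n)"
    using assms(1) unfolding has_order_def by blast
  have "generically X (\<lambda>y. g y = u y * t y powi n)"
    by (rule generically_mp2[OF *(4) assms(2)]) simp
  with * show ?thesis unfolding has_order_def by blast
qed

lemma has_order_nonzero:
  assumes x: "x \<in> X" and t: "uniformizer X x t" and nz: "generically X (\<lambda>y. t y ~= 0)"
    and "has_order X x f n"
  shows "generically X (\<lambda>y. f y ~= 0)"
proof -
  obtain u where u: "regular_at X x u" "u x ~= 0" "generically X (\<lambda>y. f y = u y * t y powi n)"
    using has_order_wrt[OF x t nz assms(4)] .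
  show ?thesis
    by (rule generically_mp2[OF generically_conjI[OF u(3) nz] eventually_generically[OF x regular_nonzero(1)[OF x u(1,2)]]])
       simp
qed

text \<open>For different orders a unit would agree generically with a regular function times a
  positive power of t, which vanishes at x.\<close>

lemma has_order_unique:
  assumes x: "x \<in> X" and t: "uniformizer X x t" and nz: "generically X (\<lambda>y. t y ~= 0)"
    and f: "has_order X x f n" "has_order X x f m"
  shows "n = m"
proof -
  have *: "\<not> n > m" if f: "has_order X x f n" "has_order X x f m" for n m
  proof
    assume "n > m"
    obtain u where u: "regular_at X x u" "u x ~= 0" "generically X (\<lambda>y. f y = u y * t y powi n)"
      using has_order_wrt[OF x t nz f(1)] .
    obtain w where w: "regular_at X x w" "w x ~= 0" "generically X (\<lambda>y. f y = w y * t y powi m)"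
      using has_order_wrt[OF x t nz f(2)] .
    have "generically X (\<lambda>y. u y * t y ^ nat (n - m) = w y)"
    proof (rule generically_mp2[OF generically_conjI[OF u(3) w(3)] nz])
      fix y assume *: "f y = u y * t y powi n \<and> f y = w y * t y powi m" "t y ~= 0"
      have "t y powi n = t y ^ nat (n - m) * t y powi m"
        using power_int_add[of "t y" "n - m" m] *(2) \<open>n > m\<close> by (simp add: power_int_def)
      with * show "u y * t y ^ nat (n - m) = w y" by auto
    qed
    moreover have "regular_at X x t" "t x = 0" using t by (auto simp: uniformizer_def)
    ultimately have "u x * t x ^ nat (n - m) = w x"
      using regular_generic_eq[OF x regular_mult[OF u(1) regular_power] w(1)] by blast
    moreover have "t x ^ nat (n - m) = 0" using \<open>t x = 0\<close> \<open>n > m\<close> by (simp add: zero_power)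
    ultimately show False using w(2) by simp
  qed
  from *[OF f] *[OF f(2,1)] show ?thesis by simp
qed

lemma generically_True: "generically X (\<lambda>_. True)"
  using eventually_generically[OF _ eventually_True] irr
  by (auto simp: zariski_irreducible_def)

lemma generically_all: "(!!x. x \<in> X ==> \<phi> x) ==> generically X \<phi>"
  by (rule generically_mono[OF generically_True])

lemma has_orderI:
  assumes "uniformizer X x t" "regular_at X x u" "u x ~= 0" "generically X (\<lambda>y. f y = u y * t y ^ n)"
  shows "has_order X x f (int n)"
  using assms unfolding has_order_def by (intro exI[of _ t] exI[of _ u]) simp

lemma has_order_zeroI:
  assumes "uniformizer X x t" "regular_at X x f" "f x ~= 0"
  shows "has_order X x f 0"
  using has_orderI[OF assms, of f 0] generically_True by simp

text \<open>f is controlled only generically, so the regular function is in general another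
  representative of the same rational function.\<close>

lemma has_order_nonneg_regular:
  assumes x: "x \<in> X" and t: "uniformizer X x t" and "has_order X x f n" "n \<ge> 0"
  obtains r where "regular_at X x r" "generically X (\<lambda>y. f y = r y)"
proof -
  obtain t u where *: "uniformizer X x t" "regular_at X x u" "u x ~= 0" "generically X (\<lambda>y. f y = u y * t y powi n)"
    using assms(3) unfolding has_order_def by blast
  show ?thesis
  proof (rule that)
    show "regular_at X x (\<lambda>y. u y * t y ^ nat n)"
      using regular_mult[OF *(2) regular_power] *(1) by (auto simp: uniformizer_def)
    show "generically X (\<lambda>y. f y = u y * t y ^ nat n)"
      using *(4) assms(4) by (simp add: power_int_def)
  qed
qed

end

section \<open>Genus one curves\<close>

text \<open>Both affine charts of the curve in one formula: (1 : u : u^2 : w) for c = 0 and (u^2 : u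
  : 1 : w) for c = 2. The index c is the coordinate normalized to 1.\<close>

definition coords :: "nat => 'a::field => 'a => nat => 'a" where
  "coords c u w i = (if i = c then 1 else if i = 1 then u else if i = 2 - c then u ^ 2 else if i = 3 then w else 0)"

definition pt :: "nat => 'a::field => 'a => 'a ppoint" where
  "pt c u w = hline (coords c u w)"

lemma coords_simps:
  "coords 0 u w 0 = 1" "coords 0 u w (Suc 0) = u" "coords 0 u w 2 = u ^ 2" "coords 0 u w 3 = w"
  "coords 2 u w 0 = u ^ 2" "coords 2 u w (Suc 0) = u" "coords 2 u w 2 = 1" "coords 2 u w 3 = w"
  by (simp_all add: coords_def)

lemma coords_beyond: "c \<in> {0,2} ==> i > 3 ==> coords c u w i = 0"
  by (auto simp: coords_def)

lemma coords_center: "coords c u w c = 1"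
  by (simp add: coords_def)

lemma coords_nonzero: "coords c u w ~= (\<lambda>_. 0)"
  using coords_center[of c u w] by (auto simp: fun_eq_iff intro!: exI[of _ c])

lemma pt_pts: "pt c u w \<in> pts"
  unfolding pt_def by (rule hline_pts[OF coords_nonzero])

lemma pt_eq_iff: "c \<in> {0,2} ==> pt c u w = pt c u' w' \<longleftrightarrow> u = u' \<and> w = (w' :: 'a::field)"
proof
  assume c: "c \<in> {0,2}" and "pt c u w = pt c u' w'"
  then obtain d where d: "coords c u w = (\<lambda>i. d * coords c u' w' i)"
    unfolding pt_def hline_eq_iff by blast
  from fun_cong[OF d, of c] have "d = 1" by (simp add: coords_center)
  with fun_cong[OF d, of 1] fun_cong[OF d, of 3] c show "u = u' \<and> w = w'"
    by (auto simp: coords_simps)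
qed simp

text \<open>Forms with coefficients in the algebraic closure. They arise when one factor of a
  product is frozen at a geometric point, which need not be rational.\<close>

inductive Kform :: "nat => ((nat => 'a::field) => 'a) => bool" where
  zero: "Kform d (\<lambda>_. 0)"
| const: "Kform 0 (\<lambda>_. c)"
| coord: "Kform d P ==> Kform (Suc d) (\<lambda>v. v i * P v)"
| add: "Kform d P ==> Kform d R ==> Kform d (\<lambda>v. P v + R v)"

lemma form_imp_Kform: "form d P ==> Kform d P"
  by (induction rule: form_induct) (auto intro: Kform.intros)

lemma Kform_cmult: "Kform d P ==> Kform d (\<lambda>v. c * P v)"
proof (induction rule: Kform.induct)
  case (coord d P i)
  from Kform.coord[OF coord.IH, of i] show ?case by (simp add: mult.left_commute)
qed (auto intro: Kform.intros simp: distrib_left)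

lemma Kform_scale: "Kform d P ==> P (\<lambda>i. c * v i) = c ^ d * P v"
  by (induction rule: Kform.induct) (auto simp: algebra_simps)

lemma nz_iff_Kform:
  assumes "Kform d P" "x \<in> pts" "v \<in> x"
  shows "x \<in> nz P \<longleftrightarrow> P v ~= 0"
proof -
  have xv: "x = hline v" "v ~= (\<lambda>_. 0)" using pts_cases[OF assms(2,3)] by auto
  show ?thesis
  proof
    assume "x \<in> nz P"
    then obtain w where w: "hline v = hline w" "P w ~= 0"
      by (auto simp: nz_def xv)
    then obtain c where "c ~= 0" "v = (\<lambda>i. c * w i)"
      by (auto simp: hline_eq_iff)
    then show "P v ~= 0" using Kform_scale[OF assms(1), of c w] w by simp
  qed (use xv in \<open>auto simp: nz_def\<close>)
qed

lemma form_slices: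
  fixes P :: "(nat => 'k::field alg_closure) => 'k alg_closure"
  assumes "form d P"
  shows "Kform d (\<lambda>w. P (tensor v w))" "Kform d (\<lambda>v. P (tensor v w))"
proof -
  have "Kform d (\<lambda>w. P (tensor v w)) \<and> Kform d (\<lambda>v. P (tensor v w))"
    using assms
  proof (induction rule: form_induct)
    case (coord d P i)
    obtain j k where "prod_decode i = (j, k)" by force
    then have t: "tensor v w i = v j * w k" for v w :: "nat => 'k alg_closure"
      by (simp add: tensor_def)
    have "Kform (Suc d) (\<lambda>w. v j * (w k * P (tensor v w)))" "Kform (Suc d) (\<lambda>v. w k * (v j * P (tensor v w)))"
      using coord.IH by (intro Kform_cmult Kform.coord; blast)+
    then show ?case by (simp add: t mult.assoc mult.left_commute)
  qed (auto intro: Kform.intros)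
  then show "Kform d (\<lambda>w. P (tensor v w))" "Kform d (\<lambda>v. P (tensor v w))" by auto
qed

text \<open>At a root of H, which is simple, the left side vanishes to even order and the right side
  to odd order, unless both sides are zero.\<close>

lemma norm_eq_zero:
  fixes A B H :: "'a::{alg_closed_field, field_char_0} poly"
  assumes H: "rsquarefree H" "Polynomial.degree H > 0" and eq: "A ^ 2 = B ^ 2 * H"
  shows "A = 0" "B = 0"
proof -
  have "B = 0"
  proof (rule ccontr)
    assume B: "B ~= 0"
    obtain r where r: "poly H r = 0" using alg_closed_imp_poly_has_root[OF H(2)] by blast
    have H0: "H ~= 0" using H(1) by (simp add: rsquarefree_def)
    have "order r H ~= 0" using r H0 by (simp add: order_root)
    moreover have "order r H = 0 \<or> order r H = 1" using H(1) by (simp add: rsquarefree_def)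
    ultimately have "order r H = 1" by simp
    moreover from eq B H0 have A: "A ~= 0" by auto
    have "order r (A ^ 2) = 2 * order r A" using A by (simp add: order_mult power2_eq_square)
    moreover have "order r (B ^ 2 * H) = 2 * order r B + order r H"
      using B H0 by (subst order_mult) (auto simp: order_mult power2_eq_square)
    ultimately have "2 * order r A = 2 * order r B + 1" using eq by simp
    then show False by presburger
  qed
  with eq show "A = 0" "B = 0" by auto
qed

text \<open>A zero of A + B w is a zero of the norm A^2 - B^2 H, a nonzero polynomial in u, and each
  u carries at most two values of w.\<close>

lemma finite_affine_zeros:
  fixes A B H :: "'a::{alg_closed_field, field_char_0} poly"
  assumes H: "rsquarefree H" "Polynomial.degree H > 0" and nz: "A ~= 0 \<or> B ~= 0"
  shows "finite {(u, w). w ^ 2 = poly H u \<and> poly A u + poly B u * w = 0}"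
proof -
  define N where "N = A ^ 2 - B ^ 2 * H"
  have "N ~= 0" using norm_eq_zero[OF H, of A B] nz by (auto simp: N_def)
  have "poly N u = 0" if "w ^ 2 = poly H u" "poly A u + poly B u * w = 0" for u w
  proof -
    have "poly N u = (poly A u + poly B u * w) * (poly A u - poly B u * w)"
      unfolding N_def by (simp flip: that(1) add: algebra_simps power2_eq_square)
    with that show ?thesis by simp
  qed
  then have "{(u, w). w ^ 2 = poly H u \<and> poly A u + poly B u * w = 0} \<subseteq>
      Sigma {u. poly N u = 0} (\<lambda>u. {w. poly [:- poly H u, 0, 1:] w = 0})"
    by (auto simp: power2_eq_square)
  moreover have "finite (Sigma {u. poly N u = 0} (\<lambda>u. {w. poly [:- poly H u, 0, 1:] w = 0}))"
    using \<open>N ~= 0\<close> by (intro finite_SigmaI poly_roots_finite) auto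
  ultimately show ?thesis by (rule finite_subset)
qed

lemma ex_sqrt: "\<exists>w :: 'a::alg_closed_field. w ^ 2 = a"
  using alg_closed_imp_poly_has_root[of "[:- a, 0, 1:]"] by (auto simp: power2_eq_square)

text \<open>Interpreted both with all polynomials and with those over k, so that one computation
  serves \<open>Kform_chart\<close> and \<open>form_chart\<close>.\<close>

locale poly_subring =
  fixes S :: "'a::field poly set" and H :: "'a poly"
  assumes S_add: "!!p q. p \<in> S ==> q \<in> S ==> p + q \<in> S"
    and S_mult: "!!p q. p \<in> S ==> q \<in> S ==> p * q \<in> S"
    and S_H: "H \<in> S" and S_0: "0 \<in> S" and S_1: "1 \<in> S" and S_X: "[:0, 1:] \<in> S"
begin

text \<open>The coordinate ring of w^2 = H(u), in which w^2 can be eliminated.\<close>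

definition cf :: "('a => 'a => 'a) => bool" where
  "cf \<phi> \<longleftrightarrow> (\<exists>A\<in>S. \<exists>B\<in>S. \<forall>u w. w ^ 2 = poly H u --> \<phi> u w = poly A u + poly B u * w)"

lemma cf_poly: "A \<in> S ==> cf (\<lambda>u w. poly A u)"
  unfolding cf_def using S_0 by (intro bexI[of _ A] bexI[of _ 0]) auto

lemma cf_const: "[:c:] \<in> S ==> cf (\<lambda>u w. c)"
  using cf_poly[of "[:c:]"] by simp

lemma cf_w: "cf (\<lambda>u w. w)"
  unfolding cf_def using S_0 S_1 by (intro bexI[of _ 0] bexI[of _ 1]) auto

lemma cf_add: "cf \<phi> ==> cf \<psi> ==> cf (\<lambda>u w. \<phi> u w + \<psi> u w)"
  unfolding cf_def
proof (elim bexE)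
  fix A B A' B'
  assume "A \<in> S" "B \<in> S" "A' \<in> S" "B' \<in> S"
    and *: "\<forall>u w. w\<^sup>2 = poly H u --> \<phi> u w = poly A u + poly B u * w"
           "\<forall>u w. w\<^sup>2 = poly H u --> \<psi> u w = poly A' u + poly B' u * w"
  then show "\<exists>A\<in>S. \<exists>B\<in>S. \<forall>u w. w\<^sup>2 = poly H u --> \<phi> u w + \<psi> u w = poly A u + poly B u * w"
    by (intro bexI[of _ "A + A'"] bexI[of _ "B + B'"]) (auto simp: algebra_simps S_add)
qed

lemma cf_mult: "cf \<phi> ==> cf \<psi> ==> cf (\<lambda>u w. \<phi> u w * \<psi> u w)"
  unfolding cf_def
proof (elim bexE)
  fix A B A' B'
  assume S: "A \<in> S" "B \<in> S" "A' \<in> S" "B' \<in> S"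
    and *: "\<forall>u w. w\<^sup>2 = poly H u --> \<phi> u w = poly A u + poly B u * w"
           "\<forall>u w. w\<^sup>2 = poly H u --> \<psi> u w = poly A' u + poly B' u * w"
  have "\<phi> u w * \<psi> u w = poly (A * A' + B * B' * H) u + poly (A * B' + B * A') u * w"
    if w: "w ^ 2 = poly H u" for u w
    using * w by (simp flip: w add: algebra_simps power2_eq_square)
  with S show "\<exists>A\<in>S. \<exists>B\<in>S. \<forall>u w. w\<^sup>2 = poly H u --> \<phi> u w * \<psi> u w = poly A u + poly B u * w"
    by (intro bexI[of _ "A * A' + B * B' * H"] bexI[of _ "A * B' + B * A'"]) (auto simp: S_add S_mult S_H)
qed

lemma cf_coords: "cf (\<lambda>u w. coords c u w i)"
proof -
  have "cf (\<lambda>u w. u)" "cf (\<lambda>u w. 1)" "cf (\<lambda>u w. 0)"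
    using cf_poly[OF S_X] cf_poly[OF S_1] cf_poly[OF S_0] by simp_all
  with cf_mult[OF this(1) this(1)] cf_w show ?thesis
    unfolding coords_def power2_eq_square
    by (cases "i = c"; cases "i = 1"; cases "i = 2 - c"; cases "i = 3") simp_all
qed

end

interpretation all_polys: poly_subring UNIV H for H
  by standard auto

lemma map_ac_add [simp]: "map_poly to_ac (p + q) = map_poly to_ac p + map_poly to_ac q"
  and map_ac_mult [simp]: "map_poly to_ac (p * q) = map_poly to_ac p * map_poly to_ac q"
  and map_ac_diff [simp]: "map_poly to_ac (p - q) = map_poly to_ac p - map_poly to_ac q"
  and map_ac_smult [simp]: "map_poly to_ac (smult a p) = smult (to_ac a) (map_poly to_ac p)"
  and map_ac_pCons [simp]: "map_poly to_ac (pCons a p) = pCons (to_ac a) (map_poly to_ac p)"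
  by (auto simp: poly_eq_iff coeff_map_poly coeff_mult to_ac_sum coeff_pCons split: nat.splits)

lemma map_ac_power [simp]: "map_poly to_ac (p ^ n) = map_poly to_ac p ^ n"
  by (induction n) auto

lemma poly_subring_map_poly:
  fixes h :: "'k::field poly"
  shows "poly_subring (range (map_poly to_ac :: 'k poly => _)) (map_poly to_ac h)"
proof -
  have "(0 :: 'k alg_closure poly) = map_poly to_ac 0" "(1 :: 'k alg_closure poly) = map_poly to_ac 1"
     "[:0, 1 :: 'k alg_closure:] = map_poly to_ac [:0, 1:]"
    by simp_all
  then have "(0 :: 'k alg_closure poly) \<in> range (map_poly to_ac)" "(1 :: 'k alg_closure poly) \<in> range (map_poly to_ac)"
     "[:0, 1 :: 'k alg_closure:] \<in> range (map_poly to_ac)"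
    by blast+
  moreover have "p + q \<in> range (map_poly to_ac)" "p * q \<in> range (map_poly to_ac)"
    if "p \<in> range (map_poly to_ac)" "q \<in> range (map_poly to_ac)" for p q :: "'k alg_closure poly"
    using that by (auto simp flip: map_ac_add map_ac_mult)
  ultimately show ?thesis
    by (intro poly_subring.intro) auto
qed

interpretation k_polys: poly_subring "range (map_poly to_ac)" "map_poly to_ac h" for h :: "'k::field poly"
  by (rule poly_subring_map_poly)

lemma Kform_chart:
  assumes "Kform d P"
  shows "\<exists>A B. \<forall>u w. w ^ 2 = poly H u --> P (coords c u w) = poly A u + poly B u * w"
proof -
  have "all_polys.cf H (\<lambda>u w. P (coords c u w))"
    using assms
    by (induction rule: Kform.induct)
       (auto intro!: all_polys.cf_add all_polys.cf_mult all_polys.cf_coords all_polys.cf_const)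
  then show ?thesis by (simp add: all_polys.cf_def)
qed

lemma form_chart:
  assumes "form d P"
  shows "\<exists>A B. \<forall>u w. w ^ 2 = poly (map_poly to_ac h) u -->
     P (coords c u w) = poly (map_poly to_ac A) u + poly (map_poly to_ac B) u * w"
proof -
  have "k_polys.cf h (\<lambda>u w. P (coords c u w))"
    using assms
  proof (induction rule: form_induct)
    case (const c)
    have "map_poly to_ac [:c:] \<in> range (map_poly to_ac)" by blast
    from k_polys.cf_poly[OF this, of h] show ?case by simp
  next
    case (zero d) then show ?case using k_polys.cf_poly[of "0" h] k_polys.S_0 by simp
  qed (auto intro!: k_polys.cf_add k_polys.cf_mult k_polys.cf_coords)
  then show ?thesis by (auto simp: k_polys.cf_def)
qed

text \<open>This is u^4 g(1/u), with g treated as a quartic even if its degree is 3. A cubic then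
  acquires the root 0, the branch point at infinity.\<close>

definition grev :: "'a::zero poly => 'a poly" where
  "grev g = Poly [Polynomial.coeff g 4, Polynomial.coeff g 3, Polynomial.coeff g 2,
     Polynomial.coeff g 1, Polynomial.coeff g 0]"

lemma grev_pCons: "grev g = [:Polynomial.coeff g 4, Polynomial.coeff g 3, Polynomial.coeff g 2,
     Polynomial.coeff g 1, Polynomial.coeff g 0:]"
  by (simp add: grev_def)

lemma quartic_expand:
  assumes "Polynomial.degree p \<le> 4"
  shows "p = [:Polynomial.coeff p 0, Polynomial.coeff p 1, Polynomial.coeff p 2,
     Polynomial.coeff p 3, Polynomial.coeff p 4:]"
proof (rule poly_eqI)
  fix n :: nat
  consider "n = 0" | "n = 1" | "n = 2" | "n = 3" | "n = 4" | "n > 4" by linarith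
  then show "Polynomial.coeff p n = Polynomial.coeff [:Polynomial.coeff p 0, Polynomial.coeff p 1,
     Polynomial.coeff p 2, Polynomial.coeff p 3, Polynomial.coeff p 4:] n"
  proof cases
    case 6
    then have "\<exists>m. n = Suc (Suc (Suc (Suc (Suc m))))" by presburger
    with 6 assms show ?thesis by (auto simp: coeff_eq_0)
  qed (auto simp: numeral_2_eq_2 numeral_3_eq_3 eval_nat_numeral)
qed

lemma grev_eval:
  fixes p :: "'a::field poly"
  assumes "Polynomial.degree p \<le> 4" "r ~= 0"
  shows "poly (grev p) r = r ^ 4 * poly p (1 / r)"
    "poly (pderiv (grev p)) r = 4 * r ^ 3 * poly p (1 / r) - r ^ 2 * poly (pderiv p) (1 / r)"
proof -
  obtain a0 a1 a2 a3 a4 where p: "p = [:a0, a1, a2, a3, a4:]"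
    using quartic_expand[OF assms(1)] by blast
  have "grev p = [:a4, a3, a2, a1, a0:]"
    unfolding grev_pCons p by (simp add: numeral_2_eq_2 numeral_3_eq_3 eval_nat_numeral)
  then show "poly (grev p) r = r ^ 4 * poly p (1 / r)"
    "poly (pderiv (grev p)) r = 4 * r ^ 3 * poly p (1 / r) - r ^ 2 * poly (pderiv p) (1 / r)"
    using assms(2) by (simp_all add: p pderiv_pCons field_simps eval_nat_numeral)
qed

text \<open>A multiple root r \<noteq> 0 would give the multiple root 1/r of p; a multiple root 0
  would make the coefficients of degree 4 and 3 vanish together.\<close>

lemma rsquarefree_grev:
  fixes p :: "'a::field_char_0 poly"
  assumes "Polynomial.degree p \<le> 4" "3 \<le> Polynomial.degree p" "rsquarefree p"
  shows "rsquarefree (grev p)"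
  unfolding rsquarefree_roots
proof (intro allI notI, elim conjE)
  fix r assume r: "poly (grev p) r = 0" "poly (pderiv (grev p)) r = 0"
  show False
  proof (cases "r = 0")
    case True
    with r have "Polynomial.coeff p 4 = 0" "Polynomial.coeff p 3 = 0"
      by (auto simp: grev_pCons pderiv_pCons)
    with assms(1,2) have "Polynomial.coeff p (Polynomial.degree p) = 0"
      by (metis le_antisym not_less_eq_eq numeral_3_eq_3 numeral_eq_Suc pred_numeral_simps(2) semiring_norm(26,27))
    with assms(2) show False by auto
  next
    case False
    with r grev_eval[OF assms(1) False] have "poly p (1 / r) = 0" "poly (pderiv p) (1 / r) = 0"
      by auto
    with assms(3) show False by (auto simp: rsquarefree_roots)
  qed
qed

lemma map_ac_grev: "map_poly to_ac (grev g) = grev (map_poly to_ac g)"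
  by (simp add: grev_pCons coeff_map_poly)

lemma degree_map_ac [simp]: "Polynomial.degree (map_poly to_ac p) = Polynomial.degree p"
  by (rule degree_map_poly) simp

lemma rsquarefree_smult:
  "c ~= 0 ==> rsquarefree (p :: 'a::field_char_0 poly) ==> rsquarefree (smult c p)"
  by (simp add: rsquarefree_roots pderiv_smult)

lemma degree_grev_pos:
  fixes p :: "'a::field_char_0 poly"
  assumes "rsquarefree p"
  shows "Polynomial.degree (grev p) > 0"
proof -
  have "Polynomial.coeff p 0 ~= 0 \<or> Polynomial.coeff p 1 ~= 0"
    using assms unfolding rsquarefree_roots
    by (metis One_nat_def coeff_pderiv mult_eq_0_iff poly_0_coeff_0)
  then have "Polynomial.coeff (grev p) 4 ~= 0 \<or> Polynomial.coeff (grev p) 3 ~= 0"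
    by (auto simp: grev_pCons numeral_3_eq_3 eval_nat_numeral)
  then show ?thesis by (metis gr0I le_degree not_numeral_le_zero)
qed

locale genus_one =
  fixes g :: "'k::field_char_0 poly" and C :: 'k
  assumes C_nonzero: "C ~= 0" and deg_ge: "3 \<le> Polynomial.degree g" and deg_le: "Polynomial.degree g \<le> 4"
    and sqfree: "rsquarefree (map_poly to_ac g)"
begin

abbreviation E :: "'k alg_closure ppoint set" where "E \<equiv> twisted_curve g C"

text \<open>The right-hand side of the equation in chart c, solved for w^2.\<close>

definition hp :: "nat => 'k poly" where
  "hp c = smult (inverse C) (if c = 0 then g else grev g)"

abbreviation HP :: "nat => 'k alg_closure poly" where "HP c \<equiv> map_poly to_ac (hp c)"

lemma HP_sqfree: "rsquarefree (HP c)"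
  using C_nonzero sqfree rsquarefree_grev[of "map_poly to_ac g"] deg_ge deg_le
  by (auto simp: hp_def map_ac_grev intro!: rsquarefree_smult)

lemma HP_degree: "Polynomial.degree (HP c) > 0"
  using C_nonzero deg_ge degree_grev_pos[OF sqfree, folded map_ac_grev]
  by (simp only: degree_map_ac) (auto simp: hp_def)

lemma HP_simple_root: "poly (HP c) u = 0 ==> poly (pderiv (HP c)) u ~= 0"
  using HP_sqfree[of c] by (auto simp: rsquarefree_roots)

lemma E_sub: "E \<subseteq> pts"
  by (auto simp: twisted_curve_def proj_space_def pts_def)

lemma E_iff:
  assumes "v ~= (\<lambda>_. 0)"
  shows "hline v \<in> E \<longleftrightarrow> (\<forall>i>3. v i = 0) \<and> v 0 * v 2 = v 1 ^ 2 \<and>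
     to_ac C * v 3 ^ 2 =
       to_ac (Polynomial.coeff g 4) * v 2 ^ 2 + to_ac (Polynomial.coeff g 3) * v 1 * v 2 +
       to_ac (Polynomial.coeff g 2) * v 0 * v 2 + to_ac (Polynomial.coeff g 1) * v 0 * v 1 +
       to_ac (Polynomial.coeff g 0) * v 0 ^ 2" (is "_ \<longleftrightarrow> ?R v")
proof
  assume "hline v \<in> E"
  moreover from this obtain w where "hline v = hline w" "\<forall>i>3. w i = 0"
    by (auto simp: twisted_curve_def proj_space_def)
  then have "\<forall>i>3. v i = 0" by (auto simp: hline_eq_iff)
  ultimately show "?R v" using hline_self[of v] by (auto simp: twisted_curve_def)
next
  assume R: "?R v"
  have "?R (\<lambda>i. c * v i)" for c
  proof -
    have "to_ac C * (c * v 3) ^ 2 = c ^ 2 * (to_ac C * v 3 ^ 2)" by (simp add: power_mult_distrib)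
    also note R[THEN conjunct2, THEN conjunct2]
    finally show ?thesis using R by (auto simp: algebra_simps power2_eq_square)
  qed
  then show "hline v \<in> E"
    using R assms hline_memD[of _ v] unfolding twisted_curve_def proj_space_def by fastforce
qed

lemma poly_HP:
  "to_ac C * poly (HP 0) u = to_ac (Polynomial.coeff g 4) * u ^ 4 + to_ac (Polynomial.coeff g 3) * u ^ 3 +
       to_ac (Polynomial.coeff g 2) * u ^ 2 + to_ac (Polynomial.coeff g 1) * u + to_ac (Polynomial.coeff g 0)"
  "to_ac C * poly (HP 2) u = to_ac (Polynomial.coeff g 4) + to_ac (Polynomial.coeff g 3) * u +
       to_ac (Polynomial.coeff g 2) * u ^ 2 + to_ac (Polynomial.coeff g 1) * u ^ 3 + to_ac (Polynomial.coeff g 0) * u ^ 4"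
proof -
  have C: "to_ac C * to_ac (inverse C) = 1" using C_nonzero by simp
  have "to_ac C * poly (HP c) u = poly (map_poly to_ac (if c = 0 then g else grev g)) u" for c
    unfolding hp_def map_ac_smult poly_smult mult.assoc[symmetric] C by simp
  note * = this[of 0] this[of 2]
  have "poly (map_poly to_ac g) u = poly (map_poly to_ac [:Polynomial.coeff g 0, Polynomial.coeff g 1, Polynomial.coeff g 2,
     Polynomial.coeff g 3, Polynomial.coeff g 4:]) u"
    using quartic_expand[OF deg_le] by simp
  with * show "to_ac C * poly (HP 0) u = to_ac (Polynomial.coeff g 4) * u ^ 4 + to_ac (Polynomial.coeff g 3) * u ^ 3 +
       to_ac (Polynomial.coeff g 2) * u ^ 2 + to_ac (Polynomial.coeff g 1) * u + to_ac (Polynomial.coeff g 0)"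
    by (simp add: algebra_simps power4_eq_xxxx power3_eq_cube power2_eq_square)
  from * show "to_ac C * poly (HP 2) u = to_ac (Polynomial.coeff g 4) + to_ac (Polynomial.coeff g 3) * u +
       to_ac (Polynomial.coeff g 2) * u ^ 2 + to_ac (Polynomial.coeff g 1) * u ^ 3 + to_ac (Polynomial.coeff g 0) * u ^ 4"
    by (simp add: grev_pCons algebra_simps power4_eq_xxxx power3_eq_cube power2_eq_square)
qed

lemma pt_in_E: "c \<in> {0, 2} ==> pt c u w \<in> E \<longleftrightarrow> w ^ 2 = poly (HP c) u"
proof -
  assume c: "c \<in> {0, 2}"
  have C: "to_ac C ~= 0" using C_nonzero by simp
  have "pt c u w \<in> E \<longleftrightarrow> to_ac C * w ^ 2 = to_ac C * poly (HP c) u"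
    unfolding pt_def E_iff[OF coords_nonzero]
  proof (cases "c = 0")
    case True
    show "((\<forall>i>3. coords c u w i = 0) \<and> coords c u w 0 * coords c u w 2 = (coords c u w 1)\<^sup>2 \<and>
     to_ac C * (coords c u w 3)\<^sup>2 =
     to_ac (poly.coeff g 4) * (coords c u w 2)\<^sup>2 + to_ac (poly.coeff g 3) * coords c u w 1 * coords c u w 2 +
     to_ac (poly.coeff g 2) * coords c u w 0 * coords c u w 2 +
     to_ac (poly.coeff g 1) * coords c u w 0 * coords c u w 1 +
     to_ac (poly.coeff g 0) * (coords c u w 0)\<^sup>2) =
    (to_ac C * w\<^sup>2 = to_ac C * poly (HP c) u)"
      unfolding True poly_HP using coords_beyond[OF c, of _ u w] True
      by (simp add: coords_simps algebra_simps power4_eq_xxxx power3_eq_cube power2_eq_square)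
  next
    case False
    with c have c2: "c = 2" by simp
    show "((\<forall>i>3. coords c u w i = 0) \<and> coords c u w 0 * coords c u w 2 = (coords c u w 1)\<^sup>2 \<and>
     to_ac C * (coords c u w 3)\<^sup>2 =
     to_ac (poly.coeff g 4) * (coords c u w 2)\<^sup>2 + to_ac (poly.coeff g 3) * coords c u w 1 * coords c u w 2 +
     to_ac (poly.coeff g 2) * coords c u w 0 * coords c u w 2 +
     to_ac (poly.coeff g 1) * coords c u w 0 * coords c u w 1 +
     to_ac (poly.coeff g 0) * (coords c u w 0)\<^sup>2) =
    (to_ac C * w\<^sup>2 = to_ac C * poly (HP c) u)"
      unfolding c2 poly_HP using coords_beyond[OF c, of _ u w] c2
      by (simp add: coords_simps algebra_simps power4_eq_xxxx power3_eq_cube power2_eq_square)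
  qed
  then show ?thesis using C by simp
qed

lemma E_chart:
  assumes "x \<in> E" "v \<in> x" "v c ~= 0" "c \<in> {0, 2}"
  shows "x = pt c (v 1 / v c) (v 3 / v c)" "(v 3 / v c) ^ 2 = poly (HP c) (v 1 / v c)"
proof -
  have xv: "x = hline v" "v ~= (\<lambda>_. 0)" using pts_cases[of x v] E_sub assms by auto
  from assms(1) xv have *: "\<forall>i>3. v i = 0" "v 0 * v 2 = v 1 ^ 2" using E_iff by auto
  have "v i = v c * coords c (v 1 / v c) (v 3 / v c) i" for i
  proof -
    consider "i = 0" | "i = 1" | "i = 2" | "i = 3" | "i > 3" by linarith
    then show ?thesis
    proof cases
      case 5
      then show ?thesis using * coords_beyond[OF assms(4) 5, of "v 1 / v c" "v 3 / v c"] by simp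
    qed (use assms(3,4) *(2) in \<open>auto simp: coords_def field_simps power2_eq_square\<close>)
  qed
  then have "v = (\<lambda>i. v c * coords c (v 1 / v c) (v 3 / v c) i)" by (rule ext)
  then show "x = pt c (v 1 / v c) (v 3 / v c)"
    unfolding xv pt_def hline_eq_iff using assms(3) by blast
  with assms(1) pt_in_E[OF assms(4)] show "(v 3 / v c) ^ 2 = poly (HP c) (v 1 / v c)"
    by metis
qed

text \<open>If v 0 = 0, then v 1 = 0 as well, and v 2 = 0 would force v 3 = 0 by the curve equation;
  so the point lies in the chart c = 2 at u = 0.\<close>

lemma E_cases [consumes 1, case_names affine infinite]:
  assumes "x \<in> E"
  obtains (affine) u w where "x = pt 0 u w" "w ^ 2 = poly (HP 0) u"
    | (infinite) w where "x = pt 2 0 w" "w ^ 2 = poly (HP 2) 0"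
proof -
  obtain v where v: "v \<in> x" "x = hline v" "v ~= (\<lambda>_. 0)"
    using pts_obtain[of x] E_sub assms by blast
  from assms v have *: "\<forall>i>3. v i = 0" "v 0 * v 2 = v 1 ^ 2" "to_ac C * v 3 ^ 2 =
       to_ac (Polynomial.coeff g 4) * v 2 ^ 2 + to_ac (Polynomial.coeff g 3) * v 1 * v 2 +
       to_ac (Polynomial.coeff g 2) * v 0 * v 2 + to_ac (Polynomial.coeff g 1) * v 0 * v 1 +
       to_ac (Polynomial.coeff g 0) * v 0 ^ 2"
    using E_iff[OF v(3)] by auto
  show ?thesis
  proof (cases "v 0 = 0")
    case False
    then show ?thesis using E_chart[OF assms v(1), of 0] affine by simp
  next
    case True
    with *(2) have 1: "v 1 = 0" by simp
    have "v 2 ~= 0"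
    proof
      assume "v 2 = 0"
      with True 1 *(3) C_nonzero have "v 3 = 0" by simp
      with True 1 \<open>v 2 = 0\<close> *(1) have "v i = 0" for i
        by (metis One_nat_def Suc_1 less_Suc_eq linorder_less_linear not_less0 numeral_3_eq_3)
      with v(3) show False by auto
    qed
    then show ?thesis using E_chart[OF assms v(1), of 2] infinite 1 by simp
  qed
qed

lemma pt_swap: "u ~= 0 ==> pt 0 u w = pt 2 (1 / u) (w / u ^ 2)"
  unfolding pt_def hline_eq_iff
  by (intro exI[of _ "u ^ 2"]) (auto simp: coords_def fun_eq_iff field_simps power2_eq_square)

lemma E_nz_chart: "c \<in> {0, 2} ==> E \<inter> nz (\<lambda>v. v c) = {pt c u w | u w. w ^ 2 = poly (HP c) u}"
proof (intro equalityI subsetI)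
  fix x assume c: "c \<in> {0, 2}" and x: "x \<in> E \<inter> nz (\<lambda>v. v c)"
  obtain v where v: "v \<in> x" using x pts_obtain E_sub by blast
  then have "v c ~= 0" using x nz_iff[OF form_coord[of c], of x v] E_sub by blast
  with E_chart[of x v c] x c v show "x \<in> {pt c u w | u w. w ^ 2 = poly (HP c) u}" by blast
next
  fix x assume c: "c \<in> {0, 2}" and "x \<in> {pt c u w | u w. w ^ 2 = poly (HP c) u}"
  then obtain u w where x: "x = pt c u w" "w ^ 2 = poly (HP c) u" by blast
  have "coords c u w \<in> x" by (simp add: x pt_def)
  then have "x \<in> nz (\<lambda>v. v c)"
    using nz_iff[OF form_coord[of c] pt_pts[of c u w]] x(1) by (simp add: coords_center)
  with x pt_in_E[OF c] show "x \<in> E \<inter> nz (\<lambda>v. v c)" by blast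
qed

lemma pt_nz: "Kform d P ==> pt c u w \<in> nz P \<longleftrightarrow> P (coords c u w) ~= 0"
  by (rule nz_iff_Kform[OF _ pt_pts]) (simp_all add: pt_def)

lemma infinite_chart: "infinite {(u, w). w ^ 2 = poly (HP c) u \<and> u ~= 0}"
proof
  assume "finite {(u, w). w ^ 2 = poly (HP c) u \<and> u ~= 0}"
  then have "finite (fst ` {(u, w). w ^ 2 = poly (HP c) u \<and> u ~= 0})" by (rule finite_imageI)
  moreover have "fst ` {(u, w). w ^ 2 = poly (HP c) u \<and> u ~= 0} = UNIV - {0}"
    using ex_sqrt by (force simp: image_iff)
  ultimately have "finite (UNIV :: 'k alg_closure set)" by simp
  then show False using infinite_UNIV_char_0 by blast
qed

lemma infinite_E: "infinite E"
proof
  assume "finite E"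
  moreover have "(\<lambda>(u, w). pt 0 u w) ` {(u, w). w ^ 2 = poly (HP 0) u \<and> u ~= 0} \<subseteq> E"
    using pt_in_E[of 0] by auto
  moreover have "inj_on (\<lambda>(u, w). pt 0 u w) {(u, w). w ^ 2 = poly (HP 0) u \<and> u ~= 0}"
    using pt_eq_iff[of 0] by (auto simp: inj_on_def)
  ultimately have "finite {(u, w). w ^ 2 = poly (HP 0) u \<and> u ~= 0}"
    using finite_imageD[OF finite_subset] by blast
  with infinite_chart[of 0] show False by blast
qed

lemma finite_at_infinity: "finite (E - nz (\<lambda>v. v 0))"
proof -
  have "E - nz (\<lambda>v. v 0) \<subseteq> (\<lambda>w. pt 2 0 w) ` {w. poly [:- poly (HP 2) 0, 0, 1:] w = 0}"
  proof
    fix x assume x: "x \<in> E - nz (\<lambda>v. v 0)"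
    then have "x \<in> E" by blast
    then show "x \<in> (\<lambda>w. pt 2 0 w) ` {w. poly [:- poly (HP 2) 0, 0, 1:] w = 0}"
    proof (cases rule: E_cases)
      case (affine u w)
      then have "x \<in> E \<inter> nz (\<lambda>v. v 0)" unfolding E_nz_chart[of 0, simplified] by blast
      with x show ?thesis by blast
    qed (auto simp: power2_eq_square)
  qed
  then show ?thesis by (rule finite_subset) (intro finite_imageI poly_roots_finite, simp)
qed

text \<open>In the chart c = 0 the form becomes A + B w. If A = B = 0, it vanishes on the overlap,
  hence at infinitely many points of the other chart, hence on the whole curve.\<close>

lemma finite_vanish:
  assumes P: "Kform d P" and ne: "E \<inter> nz P ~= {}"
  shows "finite (E - nz P)"
proof -
  obtain A B where AB: "!!u w. w ^ 2 = poly (HP 0) u ==> P (coords 0 u w) = poly A u + poly B u * w"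
    using Kform_chart[OF P] by metis
  have "A ~= 0 \<or> B ~= 0"
  proof (rule ccontr)
    assume "\<not> (A ~= 0 \<or> B ~= 0)"
    then have z: "P (coords 0 u w) = 0" if "w ^ 2 = poly (HP 0) u" for u w using AB[OF that] by simp
    obtain A' B' where AB': "!!u w. w ^ 2 = poly (HP 2) u ==> P (coords 2 u w) = poly A' u + poly B' u * w"
      using Kform_chart[OF P] by metis
    have "poly A' u + poly B' u * w = 0" if "w ^ 2 = poly (HP 2) u" "u ~= 0" for u w
    proof -
      have *: "pt 0 (1 / u) (w / u ^ 2) = pt 2 u w" using pt_swap[of "1 / u" "w / u ^ 2"] that(2)
        by (simp add: power2_eq_square)
      then have "(w / u ^ 2) ^ 2 = poly (HP 0) (1 / u)" using pt_in_E[of 2] pt_in_E[of 0] that by force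
      from z[OF this] have "pt 2 u w \<notin> nz P" using pt_nz[OF P, of 0 "1 / u" "w / u ^ 2"] * by simp
      then show ?thesis using pt_nz[OF P, of 2 u w] AB'[OF that(1)] by simp
    qed
    then have "{(u, w). w ^ 2 = poly (HP 2) u \<and> u ~= 0} \<subseteq>
        {(u, w). w ^ 2 = poly (HP 2) u \<and> poly A' u + poly B' u * w = 0}"
      by auto
    then have "A' = 0" "B' = 0"
      using finite_affine_zeros[OF HP_sqfree HP_degree, of A' B' 2] infinite_chart[of 2] finite_subset by blast+
    then have z': "P (coords 2 u w) = 0" if "w ^ 2 = poly (HP 2) u" for u w using AB'[OF that] by simp
    obtain x where "x \<in> E" "x \<in> nz P" using ne by blast
    then show False
      by (cases rule: E_cases) (use z z' pt_nz[OF P] in auto)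
  qed
  then have "finite {(u, w). w ^ 2 = poly (HP 0) u \<and> poly A u + poly B u * w = 0}"
    by (rule finite_affine_zeros[OF HP_sqfree HP_degree])
  then have "finite ((\<lambda>(u, w). pt 0 u w) ` {(u, w). w ^ 2 = poly (HP 0) u \<and> poly A u + poly B u * w = 0})"
    by (rule finite_imageI)
  moreover have "E - nz P \<subseteq> (\<lambda>(u, w). pt 0 u w) ` {(u, w). w ^ 2 = poly (HP 0) u \<and> poly A u + poly B u * w = 0}
      \<union> (E - nz (\<lambda>v. v 0))"
  proof
    fix x assume x: "x \<in> E - nz P"
    show "x \<in> (\<lambda>(u, w). pt 0 u w) ` {(u, w). w ^ 2 = poly (HP 0) u \<and> poly A u + poly B u * w = 0}
      \<union> (E - nz (\<lambda>v. v 0))"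
    proof (cases "x \<in> nz (\<lambda>v. v 0)")
      case True
      have "E \<inter> nz (\<lambda>v. v 0) = {pt 0 u w | u w. w ^ 2 = poly (HP 0) u}"
        using E_nz_chart[of 0] by simp
      with x True obtain u w where "x = pt 0 u w" "w ^ 2 = poly (HP 0) u"
        by blast
      moreover from this x have "poly A u + poly B u * w = 0" using pt_nz[OF P] AB by force
      ultimately show ?thesis by blast
    qed (use x in blast)
  qed
  ultimately show ?thesis using finite_subset[OF _ finite_UnI[OF _ finite_at_infinity]] by blast
qed

lemma E_irreducible: "zariski_irreducible E"
  unfolding zariski_irreducible_iff[OF E_sub]
proof (intro conjI allI impI)
  show "E ~= {}" using infinite_E by auto
next
  fix d P e R assume *: "form d P" "form e R" "E \<inter> nz P ~= {}" "E \<inter> nz R ~= {}"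
  have "finite (E - nz P)" "finite (E - nz R)"
    using * finite_vanish form_imp_Kform by blast+
  then have fin: "finite ((E - nz P) \<union> (E - nz R))" by blast
  show "E \<inter> nz P \<inter> nz R ~= {}"
  proof
    assume "E \<inter> nz P \<inter> nz R = {}"
    then have "E \<subseteq> (E - nz P) \<union> (E - nz R)" by blast
    with fin infinite_E show False using finite_subset by blast
  qed
qed

sublocale irreducible_set E
  by standard (rule E_irreducible, rule E_sub)

end

section \<open>Products of two curves\<close>

definition rep :: "'a ppoint => nat => 'a" where
  "rep x = (SOME v. v \<in> x)"

lemma rep:
  assumes "x \<in> pts"
  shows "rep x \<in> x" "hline (rep x) = x" "rep x ~= (\<lambda>_. 0)"
proof -
  show 1: "rep x \<in> x" unfolding rep_def using pts_obtain[OF assms] someI[of "\<lambda>v. v \<in> x"] by blast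
  from pts_cases[OF assms 1] show "hline (rep x) = x" "rep x ~= (\<lambda>_. 0)" by auto
qed

lemma tensor_scale: "tensor (\<lambda>i. c * v i) (\<lambda>i. d * w i) = (\<lambda>l. (c * d) * tensor v w l)"
  by (auto simp: tensor_def fun_eq_iff split: prod.splits)

lemma tensor_encode: "tensor v w (prod_encode (i, j)) = v i * w j"
  by (simp add: tensor_def)

lemma tensor_nonzero:
  assumes "v ~= (\<lambda>_. 0)" "w ~= (\<lambda>_. 0)"
  shows "tensor v w ~= (\<lambda>_. 0)"
proof
  assume *: "tensor v w = (\<lambda>_. 0)"
  from assms obtain i j where "v i ~= 0" "w j ~= 0" by (auto simp: fun_eq_iff)
  with fun_cong[OF *, of "prod_encode (i, j)"] show False by (simp add: tensor_encode)
qed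

lemma tensor_hline: "{tensor v' w' | v' w'. v' \<in> hline v \<and> w' \<in> hline w} = hline (tensor v w)"
proof (intro equalityI subsetI)
  fix z assume "z \<in> {tensor v' w' | v' w'. v' \<in> hline v \<and> w' \<in> hline w}"
  then obtain v' w' where z: "z = tensor v' w'" "v' \<in> hline v" "w' \<in> hline w" by blast
  from hline_memD[OF z(2)] hline_memD[OF z(3)] obtain c d
    where "c ~= 0" "v' = (\<lambda>i. c * v i)" "d ~= 0" "w' = (\<lambda>i. d * w i)" by blast
  then show "z \<in> hline (tensor v w)" unfolding z(1) hline_def
    by (auto simp: tensor_scale intro!: exI[of _ "c * d"])
next
  fix z assume "z \<in> hline (tensor v w)"
  from hline_memD[OF this] obtain c where c: "c ~= 0" "z = (\<lambda>i. c * tensor v w i)" by blast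
  have "z = tensor (\<lambda>i. c * v i) (\<lambda>i. 1 * w i)" unfolding c(2) tensor_scale by simp
  moreover have "(\<lambda>i. c * v i) \<in> hline v" unfolding hline_def using c(1) by blast
  moreover have "w \<in> hline w" by simp
  ultimately show "z \<in> {tensor v' w' | v' w'. v' \<in> hline v \<and> w' \<in> hline w}"
    by (simp only: mult_1) blast
qed

definition ppair :: "'a::field ppoint => 'a ppoint => 'a ppoint" where
  "ppair x y = hline (tensor (rep x) (rep y))"

lemma ppair_hline:
  assumes "v ~= (\<lambda>_. 0)" "w ~= (\<lambda>_. 0)"
  shows "ppair (hline v) (hline w) = hline (tensor v w)"
proof -
  have "rep (hline v) \<in> hline v" "rep (hline w) \<in> hline w" using rep(1)[OF hline_pts] assms by blast+
  then have "tensor (rep (hline v)) (rep (hline w)) \<in> hline (tensor v w)"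
    unfolding tensor_hline[symmetric] by blast
  then show ?thesis unfolding ppair_def by (rule hline_eqI)
qed

lemma product_variety_ppair:
  assumes "X \<subseteq> pts" "Y \<subseteq> pts"
  shows "product_variety X Y = {ppair x y | x y. x \<in> X \<and> y \<in> Y}"
proof -
  have "{tensor v w | v w. v \<in> x \<and> w \<in> y} = ppair x y" if "x \<in> X" "y \<in> Y" for x y
  proof -
    have "hline (rep x) = x" "hline (rep y) = y" using rep(2) that assms by blast+
    with tensor_hline[of "rep x" "rep y"] show ?thesis by (simp only: ppair_def)
  qed
  then show ?thesis unfolding product_variety_def by blast
qed

locale curve_pair = E1: genus_one g C + E2: genus_one f C
  for g f :: "'k::field_char_0 poly" and C :: 'k
begin

abbreviation A where "A \<equiv> product_variety E1.E E2.E"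

lemma A_eq: "A = {ppair x y | x y. x \<in> E1.E \<and> y \<in> E2.E}"
  by (rule product_variety_ppair[OF E1.E_sub E2.E_sub])

lemma ppair_tensor_nonzero:
  assumes "x \<in> E1.E" "y \<in> E2.E"
  shows "tensor (rep x) (rep y) ~= (\<lambda>_. 0)"
  by (rule tensor_nonzero; rule rep(3)) (use assms E1.E_sub E2.E_sub in blast)+

lemma A_sub: "A \<subseteq> pts"
  unfolding A_eq ppair_def using hline_pts[OF ppair_tensor_nonzero] by blast

lemma ppair_nz:
  assumes "x \<in> E1.E" "y \<in> E2.E" "form d P"
  shows "ppair x y \<in> nz P \<longleftrightarrow> P (tensor (rep x) (rep y)) ~= 0"
proof -
  have "ppair x y \<in> pts" using assms A_sub A_eq by blast
  then show ?thesis using nz_iff[OF assms(3), of "ppair x y" "tensor (rep x) (rep y)"]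
    unfolding ppair_def by simp
qed

text \<open>Freezing one factor leaves a form over the algebraic closure on the other curve, to
  which \<open>finite_vanish\<close> applies.\<close>

lemma slice_finite:
  assumes P: "form d P"
  shows "x \<in> E1.E ==> y \<in> E2.E ==> P (tensor (rep x) (rep y)) ~= 0 ==> finite {x' \<in> E1.E. P (tensor (rep x') (rep y)) = 0}"
    "x \<in> E1.E ==> y \<in> E2.E ==> P (tensor (rep x) (rep y)) ~= 0 ==> finite {y' \<in> E2.E. P (tensor (rep x) (rep y')) = 0}"
proof -
  assume xy: "x \<in> E1.E" "y \<in> E2.E" "P (tensor (rep x) (rep y)) ~= 0"
  have 1: "Kform d (\<lambda>v. P (tensor v (rep y)))" and 2: "Kform d (\<lambda>w. P (tensor (rep x) w))"
    using form_slices[OF P] by blast+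
  have n1: "x' \<in> nz (\<lambda>v. P (tensor v (rep y))) \<longleftrightarrow> P (tensor (rep x') (rep y)) ~= 0" if "x' \<in> E1.E" for x'
    using nz_iff_Kform[OF 1, of x' "rep x'"] rep(1)[of x'] that E1.E_sub by blast
  have n2: "y' \<in> nz (\<lambda>w. P (tensor (rep x) w)) \<longleftrightarrow> P (tensor (rep x) (rep y')) ~= 0" if "y' \<in> E2.E" for y'
    using nz_iff_Kform[OF 2, of y' "rep y'"] rep(1)[of y'] that E2.E_sub by blast
  have "finite (E1.E - nz (\<lambda>v. P (tensor v (rep y))))" using E1.finite_vanish[OF 1] n1 xy by blast
  moreover have "{x' \<in> E1.E. P (tensor (rep x') (rep y)) = 0} \<subseteq> E1.E - nz (\<lambda>v. P (tensor v (rep y)))"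
    using n1 by blast
  ultimately show "finite {x' \<in> E1.E. P (tensor (rep x') (rep y)) = 0}" by (rule rev_finite_subset)
  have "finite (E2.E - nz (\<lambda>v. P (tensor (rep x) v)))" using E2.finite_vanish[OF 2] n2 xy by blast
  moreover have "{y' \<in> E2.E. P (tensor (rep x) (rep y')) = 0} \<subseteq> E2.E - nz (\<lambda>v. P (tensor (rep x) v))"
    using n2 by blast
  ultimately show "finite {y' \<in> E2.E. P (tensor (rep x) (rep y')) = 0}" by (rule rev_finite_subset)
qed

lemma A_nz_witness:
  assumes "form d P" "A \<inter> nz P ~= {}"
  obtains x y where "x \<in> E1.E" "y \<in> E2.E" "P (tensor (rep x) (rep y)) ~= 0"
  using assms(2) ppair_nz[OF _ _ assms(1)] unfolding A_eq by blast

lemma infinite_minus_finite: "infinite S ==> finite T ==> \<exists>x\<in>S. x \<notin> T"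
  by (meson finite_subset subsetI)

text \<open>From a point where P does not vanish, one factor is moved into its infinite set and then
  the other; each slice has only finitely many zeros to avoid.\<close>

lemma product_dense:
  assumes "infinite S1" "S1 \<subseteq> E1.E" "infinite S2" "S2 \<subseteq> E2.E" "form d P" "A \<inter> nz P ~= {}"
  obtains x y where "x \<in> S1" "y \<in> S2" "ppair x y \<in> nz P"
proof -
  obtain x0 y0 where 0: "x0 \<in> E1.E" "y0 \<in> E2.E" "P (tensor (rep x0) (rep y0)) ~= 0"
    using A_nz_witness[OF assms(5,6)] .
  obtain x where x: "x \<in> S1" "P (tensor (rep x) (rep y0)) ~= 0"
    using infinite_minus_finite[OF assms(1) slice_finite(1)[OF assms(5) 0]] assms(2) by blast
  obtain y where y: "y \<in> S2" "P (tensor (rep x) (rep y)) ~= 0"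
    using infinite_minus_finite[OF assms(3) slice_finite(2)[OF assms(5) _ 0(2) x(2)]] x(1) assms(2,4) by blast
  show ?thesis using that[OF x(1) y(1)] ppair_nz[OF _ _ assms(5)] x y assms(2,4) by blast
qed

lemma A_irreducible: "zariski_irreducible A"
  unfolding zariski_irreducible_iff[OF A_sub]
proof (intro conjI allI impI)
  have "E1.E ~= {}" "E2.E ~= {}" using E1.infinite_E E2.infinite_E by auto
  then show "A ~= {}" unfolding A_eq by blast
next
  fix d P e R assume P: "form d P" and R: "form e R" and PR: "A \<inter> nz P ~= {}" "A \<inter> nz R ~= {}"
  obtain x0 y0 where 0: "x0 \<in> E1.E" "y0 \<in> E2.E" "P (tensor (rep x0) (rep y0)) ~= 0"
    using A_nz_witness[OF P PR(1)] .
  obtain x1 y1 where 1: "x1 \<in> E1.E" "y1 \<in> E2.E" "R (tensor (rep x1) (rep y1)) ~= 0"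
    using A_nz_witness[OF R PR(2)] .
  \<comment> \<open>One x serves both forms, although their witnesses \<open>y0\<close> and
    \<open>y1\<close> differ.\<close>
  obtain x where x: "x \<in> E1.E" "P (tensor (rep x) (rep y0)) ~= 0" "R (tensor (rep x) (rep y1)) ~= 0"
    using infinite_minus_finite[OF E1.infinite_E finite_UnI[OF slice_finite(1)[OF P 0] slice_finite(1)[OF R 1]]] by blast
  obtain y where y: "y \<in> E2.E" "P (tensor (rep x) (rep y)) ~= 0" "R (tensor (rep x) (rep y)) ~= 0"
    using infinite_minus_finite[OF E2.infinite_E finite_UnI[OF slice_finite(2)[OF P x(1) 0(2) x(2)]
        slice_finite(2)[OF R x(1) 1(2) x(3)]]] by blast
  have "ppair x y \<in> A \<inter> nz P \<inter> nz R"
    using ppair_nz[OF x(1) y(1) P] ppair_nz[OF x(1) y(1) R] x y A_eq by blast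
  then show "A \<inter> nz P \<inter> nz R ~= {}" by blast
qed

sublocale AA: irreducible_set A
  by standard (rule A_irreducible, rule A_sub)

lemma E_equation_form:
  "form 2 (\<lambda>v. v (a 0) * v (a 2) - v (a 1) ^ 2)"
  "form 2 (\<lambda>v. to_ac C * v (a 3) ^ 2 -
       (to_ac c4 * v (a 2) ^ 2 + to_ac c3 * (v (a 1) * v (a 2)) +
       to_ac c2 * (v (a 0) * v (a 2)) + to_ac c1 * (v (a 0) * v (a 1)) +
       to_ac c0 * v (a 0) ^ 2))"
proof -
  have m: "form 2 (\<lambda>v. v i * v j)" for i j using form_mult[OF form_coord[of i] form_coord[of j]]
    by (simp add: numeral_2_eq_2)
  then have s: "form 2 (\<lambda>v. v i ^ 2)" for i by (simp add: power2_eq_square)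
  show "form 2 (\<lambda>v. v (a 0) * v (a 2) - v (a 1) ^ 2)" by (intro form_diff m s)
  show "form 2 (\<lambda>v. to_ac C * v (a 3) ^ 2 -
       (to_ac c4 * v (a 2) ^ 2 + to_ac c3 * (v (a 1) * v (a 2)) +
       to_ac c2 * (v (a 0) * v (a 2)) + to_ac c1 * (v (a 0) * v (a 1)) +
       to_ac c0 * v (a 0) ^ 2))" by (intro form_diff form_add form_cmult m s)
qed

text \<open>The Segre embedded product is cut out by the \<open>2 \<times> 2\<close> minors and the equations of
  the two curves, applied to the columns and to the rows.\<close>

lemma A_closed_aux:
  assumes z: "z ~= (\<lambda>_. 0)" and van: "!!d P. form d P ==> A \<inter> nz P = {} ==> P z = 0"
  shows "hline z \<in> A"
proof -
  define Z where "Z i j = z (prod_encode (i, j))" for i j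
  have AI: "P z = 0" if P: "form d P"
    and v: "!!v w. hline v \<in> E1.E ==> hline w \<in> E2.E ==> v ~= (\<lambda>_. 0) ==> w ~= (\<lambda>_. 0) ==> P (tensor v w) = 0" for d P
  proof (rule van[OF P])
    have "P (tensor (rep x) (rep y)) = 0" if "x \<in> E1.E" "y \<in> E2.E" for x y
    proof -
      have "x \<in> pts" "y \<in> pts" using that E1.E_sub E2.E_sub by blast+
      with v[of "rep x" "rep y"] rep[of x] rep[of y] that show ?thesis by simp
    qed
    then show "A \<inter> nz P = {}" using A_nz_witness[OF P] by blast
  qed
  obtain l where "z l ~= 0" using z by (auto simp: fun_eq_iff)
  moreover obtain i0 j0 where "prod_decode l = (i0, j0)" by force
  then have "l = prod_encode (i0, j0)" by (metis prod_decode_inverse)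
  ultimately have ij: "Z i0 j0 ~= 0" by (simp add: Z_def)
  have minors: "Z i j * Z i0 j0 = Z i j0 * Z i0 j" for i j
  proof -
    have "form 2 (\<lambda>z. z (prod_encode (i, j)) * z (prod_encode (i0, j0)) - z (prod_encode (i, j0)) * z (prod_encode (i0, j)))"
      by (intro form_diff) (use form_mult[OF form_coord form_coord] in \<open>simp_all add: numeral_2_eq_2\<close>)
    from AI[OF this] show ?thesis by (simp add: Z_def tensor_encode)
  qed
  \<comment> \<open>A matrix of rank one with a nonzero entry at (i0, j0) is its column j0 times its
    row i0, divided by that entry.\<close>
  define v where "v i = Z i j0" for i
  define w where "w j = Z i0 j / Z i0 j0" for j
  have zt: "z = tensor v w"
  proof
    fix l
    obtain i j where "prod_decode l = (i, j)" by force
    then have l: "l = prod_encode (i, j)" by (metis prod_decode_inverse)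
    show "z l = tensor v w l" using minors[of i j] ij
      by (simp add: l tensor_encode v_def w_def Z_def[symmetric] field_simps)
  qed
  have v0: "v ~= (\<lambda>_. 0)" using ij by (auto simp: v_def fun_eq_iff)
  have w0: "w ~= (\<lambda>_. 0)" using ij by (auto simp: w_def fun_eq_iff intro!: exI[of _ j0])
  have beyond: "v i = 0" "w i = 0" if "i > 3" for i
  proof -
    have "z (prod_encode (i, j0)) = 0"
      using AI[OF form_coord[of "prod_encode (i, j0)"]] E1.E_iff that by (simp add: tensor_encode)
    then show "v i = 0" by (simp add: v_def Z_def)
    have "z (prod_encode (i0, i)) = 0"
      using AI[OF form_coord[of "prod_encode (i0, i)"]] E2.E_iff that by (simp add: tensor_encode)
    then show "w i = 0" by (simp add: w_def Z_def)
  qed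
  have "hline v \<in> E1.E"
  proof -
    have 1: "Z 0 j0 * Z 2 j0 - Z 1 j0 ^ 2 = 0"
      unfolding Z_def by (rule AI[OF E_equation_form(1)[of "\<lambda>i. prod_encode (i, j0)"]])
        (simp add: tensor_encode E1.E_iff power_mult_distrib, simp add: algebra_simps power2_eq_square)
    have 2: "to_ac C * Z 3 j0 ^ 2 - (to_ac (Polynomial.coeff g 4) * Z 2 j0 ^ 2 + to_ac (Polynomial.coeff g 3) * (Z 1 j0 * Z 2 j0) +
       to_ac (Polynomial.coeff g 2) * (Z 0 j0 * Z 2 j0) + to_ac (Polynomial.coeff g 1) * (Z 0 j0 * Z 1 j0) +
       to_ac (Polynomial.coeff g 0) * Z 0 j0 ^ 2) = 0"
      unfolding Z_def
    proof (rule AI[OF E_equation_form(2)[of "\<lambda>i. prod_encode (i, j0)"]])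
      fix v' w' :: "nat => 'k alg_closure" assume "hline v' \<in> E1.E" "v' ~= (\<lambda>_. 0)"
      then have *: "to_ac C * v' 3 ^ 2 = to_ac (Polynomial.coeff g 4) * v' 2 ^ 2 + to_ac (Polynomial.coeff g 3) * v' 1 * v' 2 +
       to_ac (Polynomial.coeff g 2) * v' 0 * v' 2 + to_ac (Polynomial.coeff g 1) * v' 0 * v' 1 +
       to_ac (Polynomial.coeff g 0) * v' 0 ^ 2" using E1.E_iff by blast
      have "to_ac C * (v' 3 * w' j0) ^ 2 = w' j0 ^ 2 * (to_ac C * v' 3 ^ 2)" by (simp add: power_mult_distrib)
      then show "to_ac C * tensor v' w' (prod_encode (3, j0)) ^ 2 - (to_ac (Polynomial.coeff g 4) * tensor v' w' (prod_encode (2, j0)) ^ 2 + to_ac (Polynomial.coeff g 3) * (tensor v' w' (prod_encode (1, j0)) * tensor v' w' (prod_encode (2, j0))) +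
       to_ac (Polynomial.coeff g 2) * (tensor v' w' (prod_encode (0, j0)) * tensor v' w' (prod_encode (2, j0))) + to_ac (Polynomial.coeff g 1) * (tensor v' w' (prod_encode (0, j0)) * tensor v' w' (prod_encode (1, j0))) +
       to_ac (Polynomial.coeff g 0) * tensor v' w' (prod_encode (0, j0)) ^ 2) = 0"
        unfolding * tensor_encode by (simp add: algebra_simps power2_eq_square)
    qed
    from 1 2 beyond show ?thesis unfolding E1.E_iff[OF v0] by (simp add: v_def algebra_simps)
  qed
  moreover have "hline w \<in> E2.E"
  proof -
    let ?c = "Z i0 j0"
    have 1: "Z i0 0 * Z i0 2 - Z i0 1 ^ 2 = 0"
      unfolding Z_def by (rule AI[OF E_equation_form(1)[of "\<lambda>i. prod_encode (i0, i)"]])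
        (simp add: tensor_encode E2.E_iff power_mult_distrib, simp add: algebra_simps power2_eq_square)
    have 2: "to_ac C * Z i0 3 ^ 2 - (to_ac (Polynomial.coeff f 4) * Z i0 2 ^ 2 + to_ac (Polynomial.coeff f 3) * (Z i0 1 * Z i0 2) +
       to_ac (Polynomial.coeff f 2) * (Z i0 0 * Z i0 2) + to_ac (Polynomial.coeff f 1) * (Z i0 0 * Z i0 1) +
       to_ac (Polynomial.coeff f 0) * Z i0 0 ^ 2) = 0"
      unfolding Z_def
    proof (rule AI[OF E_equation_form(2)[of "\<lambda>i. prod_encode (i0, i)"]])
      fix v' w' :: "nat => 'k alg_closure" assume "hline w' \<in> E2.E" "w' ~= (\<lambda>_. 0)"
      then have *: "to_ac C * w' 3 ^ 2 = to_ac (Polynomial.coeff f 4) * w' 2 ^ 2 + to_ac (Polynomial.coeff f 3) * w' 1 * w' 2 +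
       to_ac (Polynomial.coeff f 2) * w' 0 * w' 2 + to_ac (Polynomial.coeff f 1) * w' 0 * w' 1 +
       to_ac (Polynomial.coeff f 0) * w' 0 ^ 2" using E2.E_iff by blast
      have "to_ac C * (v' i0 * w' 3) ^ 2 = v' i0 ^ 2 * (to_ac C * w' 3 ^ 2)" by (simp add: power_mult_distrib)
      then show "to_ac C * tensor v' w' (prod_encode (i0, 3)) ^ 2 - (to_ac (Polynomial.coeff f 4) * tensor v' w' (prod_encode (i0, 2)) ^ 2 + to_ac (Polynomial.coeff f 3) * (tensor v' w' (prod_encode (i0, 1)) * tensor v' w' (prod_encode (i0, 2))) +
       to_ac (Polynomial.coeff f 2) * (tensor v' w' (prod_encode (i0, 0)) * tensor v' w' (prod_encode (i0, 2))) + to_ac (Polynomial.coeff f 1) * (tensor v' w' (prod_encode (i0, 0)) * tensor v' w' (prod_encode (i0, 1))) +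
       to_ac (Polynomial.coeff f 0) * tensor v' w' (prod_encode (i0, 0)) ^ 2) = 0"
        unfolding * tensor_encode by (simp add: algebra_simps power2_eq_square)
    qed
    have h: "hline w = hline (\<lambda>j. Z i0 j)"
      unfolding hline_eq_iff using ij by (intro exI[of _ "1 / ?c"]) (auto simp: w_def)
    have "(\<lambda>j. Z i0 j) ~= (\<lambda>_. 0)" using ij by (auto simp: fun_eq_iff)
    moreover have "Z i0 i = 0" if "i > 3" for i using beyond(2)[OF that] ij by (simp add: w_def)
    ultimately show ?thesis using 1 2 unfolding h by (subst E2.E_iff) (simp_all add: algebra_simps)
  qed
  ultimately have "ppair (hline v) (hline w) \<in> A" unfolding A_eq by blast
  then show ?thesis using ppair_hline[OF v0 w0] zt by simp
qed

lemma A_closed: "closedin zariski A"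
proof -
  have "openin zariski (pts - A)"
    unfolding openin_zariski
  proof
    fix x assume x: "x \<in> pts - A"
    then obtain z where z: "z \<in> x" "x = hline z" "z ~= (\<lambda>_. 0)" using pts_obtain by blast
    with x obtain d P where P: "form d P" "A \<inter> nz P = {}" "P z ~= 0" using A_closed_aux by blast
    then have "x \<in> nz P" using nz_iff[of d P x z] x z by blast
    then show "\<exists>d P. form d P \<and> x \<in> nz P \<and> nz P \<subseteq> pts - A" using P nz_subset by blast
  qed
  then show ?thesis unfolding closedin_def topspace_zariski using A_sub by blast
qed

lemma A_integral: "integral_variety A"
proof -
  \<comment> \<open>24 is \<open>prod_encode (3, 3)\<close>, the largest Segre index that
    occurs.\<close>
  have "A \<subseteq> proj_space 24"
  proof
    fix a assume "a \<in> A"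
    then obtain x y where xy: "a = ppair x y" "x \<in> E1.E" "y \<in> E2.E" unfolding A_eq by blast
    have "tensor (rep x) (rep y) l = 0" if "l > 24" for l
    proof -
      obtain i j where "prod_decode l = (i, j)" by force
      then have l: "l = prod_encode (i, j)" by (metis prod_decode_inverse)
      have "i > 3 \<or> j > 3"
      proof (rule ccontr)
        assume "\<not> (i > 3 \<or> j > 3)"
        then have "i \<in> {0, 1, 2, 3}" "j \<in> {0, 1, 2, 3}" by auto
        with that show False by (auto simp: l prod_encode_def triangle_def)
      qed
      moreover have "rep x i = 0" if "i > 3" for i
        using E1.E_iff[of "rep x"] rep[of x] xy E1.E_sub that by auto
      moreover have "rep y i = 0" if "i > 3" for i
        using E2.E_iff[of "rep y"] rep[of y] xy E2.E_sub that by auto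
      ultimately show ?thesis by (auto simp: l tensor_encode)
    qed
    moreover have "tensor (rep x) (rep y) ~= (\<lambda>_. 0)"
      using xy ppair_tensor_nonzero by blast
    ultimately show "a \<in> proj_space 24" unfolding xy(1) ppair_def proj_space_def by blast
  qed
  then have "A = proj_space 24 \<inter> A \<inter> topspace zariski" using A_sub topspace_zariski by blast
  then show ?thesis unfolding integral_variety_def
    using A_irreducible A_closed openin_topspace by blast
qed

end

section \<open>Uniformizers\<close>

lemma map_ac_eq_0_iff [simp]: "map_poly to_ac p = 0 \<longleftrightarrow> p = 0"
  by (simp add: poly_eq_iff coeff_map_poly)

text \<open>Local rings consist of functions over k, so a point is seen only up to conjugation: the
  prime of k[u] at x is generated by this p rather than by u - x.\<close>

lemma minimal_polynomial:
  fixes x :: "'k::field_char_0 alg_closure"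
  obtains p :: "'k poly" where "p ~= 0" "poly (map_poly to_ac p) x = 0"
    "!!q. poly (map_poly to_ac q) x = 0 ==> p dvd q"
proof -
  define S where "S = {p :: 'k poly. p ~= 0 \<and> poly (map_poly to_ac p) x = 0}"
  obtain p0 where "p0 \<in> S" using alg_closure_algebraic[of x] unfolding S_def by blast
  then obtain p where p: "p \<in> S" and min: "!!q. q \<in> S ==> Polynomial.degree p \<le> Polynomial.degree q"
    using ex_has_least_nat[of "\<lambda>p. p \<in> S" p0 Polynomial.degree] by blast
  show ?thesis
  proof (rule that)
    show "p ~= 0" "poly (map_poly to_ac p) x = 0" using p by (auto simp: S_def)
    fix q assume q: "poly (map_poly to_ac q) x = 0"
    have "map_poly to_ac q = map_poly to_ac (q div p) * map_poly to_ac p + map_poly to_ac (q mod p)"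
      by (simp flip: map_ac_mult map_ac_add)
    with q \<open>poly (map_poly to_ac p) x = 0\<close> have "poly (map_poly to_ac (q mod p)) x = 0" by simp
    then have "q mod p = 0 \<or> q mod p \<in> S" by (auto simp: S_def)
    with min degree_mod_less[OF \<open>p ~= 0\<close>, of q] have "q mod p = 0" by fastforce
    then show "p dvd q" by (simp add: mod_eq_0_iff_dvd)
  qed
qed

context genus_one
begin

definition U :: "nat => 'k alg_closure ppoint => 'k alg_closure" where "U c y = rep y 1 / rep y c"
definition W :: "nat => 'k alg_closure ppoint => 'k alg_closure" where "W c y = rep y 3 / rep y c"

definition fn :: "nat => 'k poly => 'k poly => 'k alg_closure ppoint => 'k alg_closure" where
  "fn c A B y = poly (map_poly to_ac A) (U c y) + poly (map_poly to_ac B) (U c y) * W c y"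

lemma UW_eq:
  assumes "y \<in> pts" "v \<in> y"
  shows "U c y = v 1 / v c" "W c y = v 3 / v c"
proof -
  have "rep y \<in> hline v" using rep(1)[OF assms(1)] pts_cases[OF assms] by simp
  then obtain d where "d ~= 0" "rep y = (\<lambda>i. d * v i)" using hline_memD by blast
  then show "U c y = v 1 / v c" "W c y = v 3 / v c" by (simp_all add: U_def W_def)
qed

lemma UW_pt: "c \<in> {0, 2} ==> U c (pt c u w) = u" "c \<in> {0, 2} ==> W c (pt c u w) = w"
  using UW_eq[OF pt_pts[of c u w], of "coords c u w" c] by (auto simp: pt_def coords_simps)

lemma fn_pt: "c \<in> {0, 2} ==> fn c A B (pt c u w) = poly (map_poly to_ac A) u + poly (map_poly to_ac B) u * w"
  by (simp add: fn_def UW_pt)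

lemma chart_point:
  assumes "y \<in> E \<inter> nz (\<lambda>v. v c)" "c \<in> {0, 2}"
  shows "y = pt c (U c y) (W c y)" "W c y ^ 2 = poly (HP c) (U c y)"
  using assms E_nz_chart[OF assms(2)] UW_pt by auto

lemma pt_chart:
  assumes "c \<in> {0, 2}" "w ^ 2 = poly (HP c) u"
  shows "pt c u w \<in> E \<inter> nz (\<lambda>v. v c)"
  unfolding E_nz_chart[OF assms(1)] using assms(2) by blast

lemma eventually_chart:
  assumes "c \<in> {0, 2}" "x \<in> E \<inter> nz (\<lambda>v. v c)"
  shows "eventually (\<lambda>y. y \<in> E \<inter> nz (\<lambda>v. v c)) (nhdsin (zariski_on E) x)"
  unfolding eventually_zariski[OF E_sub IntD1[OF assms(2)]] using assms(2) form_coord[of c] by blast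

lemma regular_UW:
  assumes "x \<in> E \<inter> nz (\<lambda>v. v c)"
  shows "regular_at E x (U c)" "regular_at E x (W c)"
proof -
  have "eventually (\<lambda>y. y \<in> E \<inter> nz (\<lambda>v. v c)) (nhdsin (zariski_on E) x)"
    unfolding eventually_zariski[OF E_sub IntD1[OF assms]] using assms form_coord[of c] by blast
  then have "eventually (\<lambda>y. quot (\<lambda>v. v 1) (\<lambda>v. v c) (U c) y \<and> quot (\<lambda>v. v 3) (\<lambda>v. v c) (W c) y) (nhdsin (zariski_on E) x)"
  proof eventually_elim
    case (elim y)
    then have y: "y \<in> pts" using E_sub by blast
    show ?case unfolding quot_def
      using UW_eq[OF y] nz_iff[OF form_coord[of c] y] elim by auto
  qed
  then have "eventually (quot (\<lambda>v. v 1) (\<lambda>v. v c) (U c)) (nhdsin (zariski_on E) x)"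
     "eventually (quot (\<lambda>v. v 3) (\<lambda>v. v c) (W c)) (nhdsin (zariski_on E) x)"
    by (auto elim: eventually_mono)
  then show "regular_at E x (U c)" "regular_at E x (W c)"
    unfolding regular_at_iff using form_coord by blast+
qed

lemma regular_poly:
  assumes "regular_at E x f"
  shows "regular_at E x (\<lambda>y. poly (map_poly to_ac p) (f y))"
proof (induction p)
  case 0
  then show ?case using regular_const[of x 0] by simp
next
  case (pCons a p)
  from regular_add[OF regular_const[of x a] regular_mult[OF assms pCons.IH]] show ?case by simp
qed

lemma regular_fn: "x \<in> E \<inter> nz (\<lambda>v. v c) ==> regular_at E x (fn c A B)"
  unfolding fn_def by (intro regular_add regular_mult regular_poly regular_UW)

lemma generically_fn_nonzero:
  assumes "c \<in> {0, 2}" "A ~= 0 \<or> B ~= 0"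
  shows "generically E (\<lambda>y. fn c A B y ~= 0)"
proof -
  have "map_poly to_ac A ~= 0 \<or> map_poly to_ac B ~= 0" using assms(2) by auto
  then have fin: "finite {(u, w). w ^ 2 = poly (HP c) u \<and> poly (map_poly to_ac A) u + poly (map_poly to_ac B) u * w = 0}"
    by (rule finite_affine_zeros[OF HP_sqfree HP_degree])
  have "\<not> {(u, w). w ^ 2 = poly (HP c) u \<and> u ~= 0} \<subseteq>
     {(u, w). w ^ 2 = poly (HP c) u \<and> poly (map_poly to_ac A) u + poly (map_poly to_ac B) u * w = 0}"
    using finite_subset[OF _ fin] infinite_chart[of c] by blast
  then obtain u w where uw: "w ^ 2 = poly (HP c) u" "poly (map_poly to_ac A) u + poly (map_poly to_ac B) u * w ~= 0"
    by auto
  have P: "pt c u w \<in> E \<inter> nz (\<lambda>v. v c)" by (rule pt_chart[OF assms(1) uw(1)])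
  show ?thesis
    using eventually_generically[OF IntD1[OF P] regular_nonzero(1)[OF IntD1[OF P] regular_fn[OF P]]]
      fn_pt[OF assms(1)] uw(2) by simp
qed

lemma local_form:
  assumes c: "c \<in> {0, 2}" and P: "w0 ^ 2 = poly (HP c) u0" and f: "regular_at E (pt c u0 w0) f"
  obtains A B S T where "fn c S T (pt c u0 w0) ~= 0" "f (pt c u0 w0) = fn c A B (pt c u0 w0) / fn c S T (pt c u0 w0)"
    "eventually (\<lambda>y. f y = fn c A B y / fn c S T y) (nhdsin (zariski_on E) (pt c u0 w0))"
proof -
  let ?P = "pt c u0 w0"
  have PE: "?P \<in> E \<inter> nz (\<lambda>v. v c)" by (rule pt_chart[OF c P])
  obtain d F G where *: "form d F" "form d G" "eventually (quot F G f) (nhdsin (zariski_on E) ?P)"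
    using f unfolding regular_at_iff by blast
  obtain A B where AB: "!!u w. w ^ 2 = poly (HP c) u ==> F (coords c u w) = poly (map_poly to_ac A) u + poly (map_poly to_ac B) u * w"
    using form_chart[OF *(1), of "hp c" c] by blast
  obtain S T where ST: "!!u w. w ^ 2 = poly (HP c) u ==> G (coords c u w) = poly (map_poly to_ac S) u + poly (map_poly to_ac T) u * w"
    using form_chart[OF *(2), of "hp c" c] by blast
  have val: "fn c S T y ~= 0 \<and> f y = fn c A B y / fn c S T y" if "y \<in> E \<inter> nz (\<lambda>v. v c)" "quot F G f y" for y
  proof -
    note y = chart_point[OF that(1) c]
    have "coords c (U c y) (W c y) \<in> y" by (subst (3) y(1)) (simp add: pt_def)
    with that(2) show ?thesis unfolding quot_def fn_def using AB[OF y(2)] ST[OF y(2)] by auto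
  qed
  have ev: "eventually (\<lambda>y. fn c S T y ~= 0 \<and> f y = fn c A B y / fn c S T y) (nhdsin (zariski_on E) ?P)"
    using *(3) eventually_chart[OF c PE] by eventually_elim (rule val)
  show ?thesis
  proof (rule that)
    show "fn c S T ?P ~= 0" "f ?P = fn c A B ?P / fn c S T ?P"
      using eventually_at[OF IntD1[OF PE] ev] by simp_all
    show "eventually (\<lambda>y. f y = fn c A B y / fn c S T y) (nhdsin (zariski_on E) ?P)"
      using ev by eventually_elim simp
  qed
qed

lemma fn_mult: "y \<in> E \<inter> nz (\<lambda>v. v c) ==> c \<in> {0, 2} ==>
    fn c A B y * fn c A' B' y = fn c (A * A' + B * B' * hp c) (A * B' + B * A') y"
  unfolding fn_def using chart_point(2)[of y c, symmetric]
  by (simp add: algebra_simps power2_eq_square)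

lemma fn_pure: "fn c A 0 y = poly (map_poly to_ac A) (U c y)"
  by (simp add: fn_def)

text \<open>By the product rule, a zero of r at u would make u a multiple root of q.\<close>

lemma simple_factor:
  assumes "p dvd q" "poly (map_poly to_ac p) u = 0" "poly (map_poly to_ac q) u = 0"
    "poly (pderiv (map_poly to_ac q)) u ~= 0"
  obtains r where "q = p * r" "poly (map_poly to_ac r) u ~= 0"
proof -
  obtain r where r: "q = p * r" using assms(1) by (auto simp: dvd_def)
  then have "pderiv (map_poly to_ac q) = map_poly to_ac p * pderiv (map_poly to_ac r) + map_poly to_ac r * pderiv (map_poly to_ac p)"
    by (simp add: pderiv_mult)
  with assms(2,4) have "poly (map_poly to_ac r) u ~= 0" by auto
  with r that show ?thesis by blast
qed

text \<open>Write the numerator of f as A + B w. If the conjugate A - B w vanishes at the point too,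
  m divides A and B because w0 \<noteq> 0. Otherwise the conjugate is a unit and m divides the norm
  A^2 - B^2 h.\<close>

lemma uniformizer_unramified:
  assumes c: "c \<in> {0, 2}" and P: "w0 ^ 2 = poly (HP c) u0" and w0: "w0 ~= 0"
    and m: "m ~= 0" "poly (map_poly to_ac m) u0 = 0" "!!q. poly (map_poly to_ac q) u0 = 0 ==> m dvd q"
  shows "uniformizer E (pt c u0 w0) (fn c m 0)"
  unfolding uniformizer_def
proof (intro conjI allI impI, goal_cases)
  let ?P = "pt c u0 w0"
  have PE: "?P \<in> E \<inter> nz (\<lambda>v. v c)" by (rule pt_chart[OF c P])
  case 1 show ?case by (rule regular_fn[OF PE])
  case 2 show ?case using m(2) by (simp add: fn_pt[OF c])
  case (3 f)
  then have f: "regular_at E ?P f" "f ?P = 0" by auto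
  obtain A B S T where ABST: "fn c S T ?P ~= 0" "f ?P = fn c A B ?P / fn c S T ?P"
    "eventually (\<lambda>y. f y = fn c A B y / fn c S T y) (nhdsin (zariski_on E) ?P)"
    using local_form[OF c P f(1)] .
  have zero: "fn c A B ?P = 0" using ABST(1,2) f(2) by simp
  note rST = regular_nonzero(2)[OF IntD1[OF PE] regular_fn[OF PE] ABST(1)]
  show ?case
  proof (cases "fn c A (- B) ?P = 0")
    case True
    have "map_poly to_ac (- B) = - map_poly to_ac B"
      by (simp add: poly_eq_iff coeff_map_poly)
    with True zero have "poly (map_poly to_ac A) u0 = 0" "poly (map_poly to_ac B) u0 = 0"
      using w0 by (simp_all add: fn_pt[OF c])
    then obtain a b where ab: "A = m * a" "B = m * b" using m(3) by (metis dvd_def)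
    have "regular_at E ?P (\<lambda>y. fn c a b y * inverse (fn c S T y))"
      by (rule regular_mult[OF regular_fn[OF PE] rST])
    moreover have "eventually (\<lambda>y. f y = fn c m 0 y * (fn c a b y * inverse (fn c S T y))) (nhdsin (zariski_on E) ?P)"
      using ABST(3) by eventually_elim (simp add: ab fn_def algebra_simps divide_inverse)
    ultimately show ?thesis by blast
  next
    case False
    have N: "fn c A B y * fn c A (- B) y = fn c (A * A - B * B * hp c) 0 y" if "y \<in> E \<inter> nz (\<lambda>v. v c)" for y
      using fn_mult[OF that c, of A B A "- B"] by (simp add: mult.commute)
    have "poly (map_poly to_ac (A * A - B * B * hp c)) u0 = 0"
      using N[OF PE] zero by (simp add: fn_pt[OF c])
    then obtain q where q: "A * A - B * B * hp c = m * q" using m(3) by (metis dvd_def)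
    note rc = regular_nonzero[OF IntD1[OF PE] regular_fn[OF PE] False]
    have "regular_at E ?P (\<lambda>y. fn c q 0 y * inverse (fn c A (- B) y) * inverse (fn c S T y))"
      by (intro regular_mult regular_fn[OF PE] rST rc(2))
    moreover have "eventually (\<lambda>y. f y = fn c m 0 y * (fn c q 0 y * inverse (fn c A (- B) y) * inverse (fn c S T y))) (nhdsin (zariski_on E) ?P)"
      using ABST(3) eventually_chart[OF c PE] rc(1)
    proof eventually_elim
      case (elim y)
      have "fn c A B y * fn c A (- B) y = fn c m 0 y * fn c q 0 y"
        using N[OF elim(2)] by (simp add: q fn_pure)
      then have "fn c A B y = fn c m 0 y * fn c q 0 y * inverse (fn c A (- B) y)"
        using elim(3) by (simp add: field_simps)
      with elim(1) show ?case by (simp add: divide_inverse mult.assoc)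
    qed
    ultimately show ?thesis by blast
  qed
qed

text \<open>Over a branch point W^2 = h = m h1 with h1 a unit there. So m, and with it every
  polynomial vanishing at u0, is W^2 times a regular function.\<close>

lemma ramified_factor:
  assumes c: "c \<in> {0, 2}" and P: "poly (HP c) u0 = 0" and p: "poly (map_poly to_ac p) u0 = 0"
  obtains r where "regular_at E (pt c u0 0) r" "poly (pderiv (map_poly to_ac p)) u0 ~= 0 --> r (pt c u0 0) ~= 0"
    "eventually (\<lambda>y. fn c p 0 y = W c y * W c y * r y) (nhdsin (zariski_on E) (pt c u0 0))"
proof -
  let ?P = "pt c u0 0"
  have PE: "?P \<in> E \<inter> nz (\<lambda>v. v c)" by (rule pt_chart[OF c]) (simp add: P)
  obtain m where m: "m ~= 0" "poly (map_poly to_ac m) u0 = 0" "!!q. poly (map_poly to_ac q) u0 = 0 ==> m dvd q"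
    using minimal_polynomial[of u0] by blast
  obtain h1 where h1: "hp c = m * h1" "poly (map_poly to_ac h1) u0 ~= 0"
    using simple_factor[OF m(3)[OF P] m(2) P HP_simple_root[OF P]] .
  obtain q where q1: "p = m * q" using m(3)[OF p] by (auto simp: dvd_def)
  have "poly (map_poly to_ac q) u0 ~= 0" if d: "poly (pderiv (map_poly to_ac p)) u0 ~= 0"
  proof -
    obtain r where "p = m * r" "poly (map_poly to_ac r) u0 ~= 0"
      using simple_factor[OF m(3)[OF p] m(2) p d] .
    with q1 m(1) show ?thesis by simp
  qed
  note q = q1 this
  have h1P: "fn c h1 0 ?P ~= 0" using h1(2) by (simp add: fn_pt[OF c])
  note rh = regular_nonzero[OF IntD1[OF PE] regular_fn[OF PE] h1P]
  show ?thesis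
  proof (rule that)
    show "regular_at E ?P (\<lambda>y. fn c q 0 y * inverse (fn c h1 0 y))"
      by (intro regular_mult regular_fn[OF PE] rh(2))
    show "poly (pderiv (map_poly to_ac p)) u0 ~= 0 --> fn c q 0 ?P * inverse (fn c h1 0 ?P) ~= 0"
      using h1P q(2) by (simp add: fn_pt[OF c])
    show "eventually (\<lambda>y. fn c p 0 y = W c y * W c y * (fn c q 0 y * inverse (fn c h1 0 y))) (nhdsin (zariski_on E) ?P)"
      using eventually_chart[OF c PE] rh(1)
    proof eventually_elim
      case (elim y)
      have "W c y * W c y = fn c m 0 y * fn c h1 0 y"
        using chart_point(2)[OF elim(1) c] by (simp add: h1(1) fn_pure power2_eq_square)
      with elim(2) show ?case by (simp add: q(1) fn_pure)
    qed
  qed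
qed

lemma W_fn: "W c = fn c 0 1"
  by (auto simp: fn_def fun_eq_iff)

text \<open>In a numerator A + B W vanishing at the point, A vanishes at u0 and is divisible by W^2,
  while the other term is divisible by W.\<close>

lemma uniformizer_ramified:
  assumes c: "c \<in> {0, 2}" and P: "poly (HP c) u0 = 0"
  shows "uniformizer E (pt c u0 0) (W c)"
  unfolding uniformizer_def
proof (intro conjI allI impI, goal_cases)
  let ?P = "pt c u0 0"
  have PE: "?P \<in> E \<inter> nz (\<lambda>v. v c)" by (rule pt_chart[OF c]) (simp add: P)
  case 1 show ?case by (rule regular_UW[OF PE])
  case 2 show ?case by (simp add: UW_pt[OF c])
  case (3 f)
  then have f: "regular_at E ?P f" "f ?P = 0" by auto
  have P': "0 ^ 2 = poly (HP c) u0" using P by simp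
  obtain A B S T where ABST: "fn c S T ?P ~= 0" "f ?P = fn c A B ?P / fn c S T ?P"
    "eventually (\<lambda>y. f y = fn c A B y / fn c S T y) (nhdsin (zariski_on E) ?P)"
    using local_form[OF c P' f(1)] .
  have "poly (map_poly to_ac A) u0 = 0" using ABST(1,2) f(2) by (simp add: fn_pt[OF c])
  then obtain r where r: "regular_at E ?P r" "eventually (\<lambda>y. fn c A 0 y = W c y * W c y * r y) (nhdsin (zariski_on E) ?P)"
    using ramified_factor[OF c P] by blast
  note rST = regular_nonzero(2)[OF IntD1[OF PE] regular_fn[OF PE] ABST(1)]
  have "regular_at E ?P (\<lambda>y. (W c y * r y + fn c B 0 y) * inverse (fn c S T y))"
    by (intro regular_mult regular_add regular_fn[OF PE] rST r(1) regular_UW[OF PE])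
  moreover have "eventually (\<lambda>y. f y = W c y * ((W c y * r y + fn c B 0 y) * inverse (fn c S T y))) (nhdsin (zariski_on E) ?P)"
    using ABST(3) r(2)
  proof eventually_elim
    case (elim y)
    have "fn c A B y = fn c A 0 y + fn c B 0 y * W c y" by (simp add: fn_def)
    with elim show ?case by (simp add: divide_inverse algebra_simps)
  qed
  ultimately show ?case by blast
qed

lemma point_cases [consumes 1]:
  assumes "x \<in> E"
  obtains c u w where "c \<in> {0, 2}" "x = pt c u w" "w ^ 2 = poly (HP c) u" "c = 2 --> u = 0"
  using assms
proof (cases rule: E_cases)
  case (affine u w) then show ?thesis using that[of 0 u w] by simp
next
  case (infinite w) then show ?thesis using that[of 2 0 w] by simp
qed

lemma uniformizer_exists:
  assumes "x \<in> E"
  obtains t where "uniformizer E x t" "generically E (\<lambda>y. t y ~= 0)"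
proof -
  obtain c u w where x: "c \<in> {0, 2}" "x = pt c u w" "w ^ 2 = poly (HP c) u" and "c = 2 --> u = 0"
    using point_cases[OF assms] .
  obtain m where m: "m ~= 0" "poly (map_poly to_ac m) u = 0" "!!q. poly (map_poly to_ac q) u = 0 ==> m dvd q"
    using minimal_polynomial[of u] by blast
  show ?thesis
  proof (cases "w = 0")
    case True
    then have "poly (HP c) u = 0" using x(3) by simp
    from uniformizer_ramified[OF x(1) this] show ?thesis
      using that[of "W c"] generically_fn_nonzero[OF x(1), of 0 1] x(2) True by (simp add: W_fn)
  next
    case False
    from uniformizer_unramified[OF x(1,3) False m] that[of "fn c m 0"] show ?thesis
      using generically_fn_nonzero[OF x(1), of m 0] m(1) x(2) by simp
  qed
qed

lemma order_mult: "x \<in> E ==> has_order E x f n ==> has_order E x f' m ==> has_order E x (\<lambda>y. f y * f' y) (n + m)"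
  by (rule uniformizer_exists[of x], assumption) (rule has_order_mult)

lemma order_unique: "x \<in> E ==> has_order E x f n ==> has_order E x f m ==> n = m"
  by (rule uniformizer_exists[of x], assumption) (rule has_order_unique)

lemma order_nonzero: "x \<in> E ==> has_order E x f n ==> generically E (\<lambda>y. f y ~= 0)"
  by (rule uniformizer_exists[of x], assumption) (rule has_order_nonzero)

lemma order_zeroI: "x \<in> E ==> regular_at E x f ==> f x ~= 0 ==> has_order E x f 0"
  by (rule uniformizer_exists[of x], assumption) (rule has_order_zeroI)

lemma order_one: "x \<in> E ==> has_order E x (\<lambda>_. 1) 0"
  using order_zeroI[of x "\<lambda>_. to_ac 1"] regular_const[of x 1] by simp

lemma order_regular:
  assumes "x \<in> E" "has_order E x f n" "n \<ge> 0"
  obtains r where "regular_at E x r" "generically E (\<lambda>y. f y = r y)"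
proof -
  obtain t where "uniformizer E x t" "generically E (\<lambda>y. t y ~= 0)" using uniformizer_exists[OF assms(1)] .
  from has_order_nonneg_regular[OF assms(1) this(1) assms(2,3)] that show ?thesis by blast
qed

text \<open>The two values are the ramification indices of x: 2 over a branch point and 1
  elsewhere.\<close>

lemma order_simple_root:
  assumes c: "c \<in> {0, 2}" and P: "w0 ^ 2 = poly (HP c) u0"
    and p: "poly (map_poly to_ac p) u0 = 0" "poly (pderiv (map_poly to_ac p)) u0 ~= 0"
  shows "has_order E (pt c u0 w0) (fn c p 0) (if w0 = 0 then 2 else 1)"
proof -
  let ?P = "pt c u0 w0"
  have PE: "?P \<in> E \<inter> nz (\<lambda>v. v c)" by (rule pt_chart[OF c P])
  show ?thesis
  proof (cases "w0 = 0")
    case True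
    then have P0: "poly (HP c) u0 = 0" using P by simp
    obtain r where r': "regular_at E (pt c u0 0) r" "poly (pderiv (map_poly to_ac p)) u0 ~= 0 --> r (pt c u0 0) ~= 0"
      "eventually (\<lambda>y. fn c p 0 y = W c y * W c y * r y) (nhdsin (zariski_on E) (pt c u0 0))"
      using ramified_factor[OF c P0 p(1)] .
    then have r: "regular_at E ?P r" "r ?P ~= 0" "eventually (\<lambda>y. fn c p 0 y = W c y * W c y * r y) (nhdsin (zariski_on E) ?P)"
      using p(2) True by simp_all
    have "generically E (\<lambda>y. fn c p 0 y = r y * W c y ^ 2)"
      by (rule generically_mono[OF eventually_generically[OF IntD1[OF PE] r(3)]]) (simp add: power2_eq_square mult.commute)
    from has_orderI[OF _ r(1,2) this] uniformizer_ramified[OF c P0] True show ?thesis by simp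
  next
    case False
    obtain m where m: "m ~= 0" "poly (map_poly to_ac m) u0 = 0" "!!q. poly (map_poly to_ac q) u0 = 0 ==> m dvd q"
      using minimal_polynomial[of u0] by blast
    obtain q where q: "p = m * q" "poly (map_poly to_ac q) u0 ~= 0" using simple_factor[OF m(3)[OF p(1)] m(2) p] .
    have "generically E (\<lambda>y. fn c p 0 y = fn c q 0 y * fn c m 0 y ^ 1)"
      by (rule generically_all) (simp add: q fn_pure)
    from has_orderI[OF uniformizer_unramified[OF c P False m] regular_fn[OF PE] _ this]
    show ?thesis using False q(2) by (simp add: fn_pt[OF c])
  qed
qed

text \<open>The intersection multiplicity of y = q(x) with the curve. Away from branch points q + w
  is a unit, so the norm q^2 - h carries the whole order. At a branch point q - w and q + w both
  have order 1, which forces exactly one linear factor of the norm to vanish there.\<close>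

lemma order_plane:
  assumes c: "c \<in> {0, 2}" and P: "w0 ^ 2 = poly (HP c) u0" and q: "poly (map_poly to_ac q) u0 = w0"
    and N: "q ^ 2 - hp c = smult \<kappa> (\<Prod>i\<in>I. [:- b i, a i:])" "\<kappa> ~= 0" "finite I"
    and nd: "!!i. i \<in> I ==> a i ~= 0 \<or> b i ~= 0"
  shows "has_order E (pt c u0 w0) (fn c q (- 1)) (int (card {i\<in>I. to_ac (a i) * u0 = to_ac (b i)}))"
proof -
  let ?P = "pt c u0 w0"
  define J where "J = {i\<in>I. to_ac (a i) * u0 = to_ac (b i)}"
  have PE: "?P \<in> E \<inter> nz (\<lambda>v. v c)" by (rule pt_chart[OF c P])
  have J: "finite J" "J \<subseteq> I" using N(3) by (auto simp: J_def)
  define p where "p = (\<Prod>i\<in>J. [:- b i, a i:])"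
  define r where "r = smult \<kappa> (\<Prod>i\<in>I - J. [:- b i, a i:])"
  have Npr: "q ^ 2 - hp c = p * r"
    unfolding N(1) p_def r_def by (simp add: prod.subset_diff[OF J(2) N(3)] mult.commute)
  have map_prod: "map_poly to_ac (prod h S) = (\<Prod>i\<in>S. map_poly to_ac (h i))" for h :: "'i => 'k poly" and S
    by (induction S rule: infinite_finite_induct) auto
  have r0: "poly (map_poly to_ac r) u0 ~= 0"
    using N(2,3) by (auto simp: r_def map_prod poly_prod prod_zero_iff J_def mult.commute)
  have map_minus: "map_poly to_ac (- p) = - map_poly to_ac p" for p :: "'k poly"
    by (simp add: poly_eq_iff coeff_map_poly)
  have lin: "has_order E ?P (fn c [:- b i, a i:] 0) (if w0 = 0 then 2 else 1)" if "i \<in> J" for i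
  proof (rule order_simple_root[OF c P])
    show "poly (map_poly to_ac [:- b i, a i:]) u0 = 0" using that by (simp add: J_def mult.commute)
    have "a i ~= 0" using that nd[of i] by (auto simp: J_def)
    then show "poly (pderiv (map_poly to_ac [:- b i, a i:])) u0 ~= 0" by (simp add: pderiv_pCons)
  qed
  have ordp: "has_order E ?P (fn c (\<Prod>i\<in>S. [:- b i, a i:]) 0) (card S * (if w0 = 0 then 2 else 1))" if "S \<subseteq> J" for S
    using finite_subset[OF that J(1)] that
  proof (induction S rule: finite_induct)
    case empty
    show ?case using order_one[OF IntD1[OF PE]] by (simp add: fn_pure)
  next
    case (insert i S)
    have "fn c (\<Prod>i\<in>insert i S. [:- b i, a i:]) 0 = (\<lambda>y. fn c [:- b i, a i:] 0 y * fn c (\<Prod>i\<in>S. [:- b i, a i:]) 0 y)"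
      unfolding prod.insert[OF insert.hyps(1,2)] by (rule ext) (simp only: fn_pure map_ac_mult poly_mult)
    then show ?case
      using order_mult[OF IntD1[OF PE] lin[of i] insert.IH] insert by (simp add: algebra_simps split: if_splits)
  qed
  have q2: "fn c q (- 1) y * fn c q 1 y = fn c p 0 y * fn c r 0 y" if "y \<in> E \<inter> nz (\<lambda>v. v c)" for y
  proof -
    have "fn c q (- 1) y * fn c q 1 y = fn c (p * r) 0 y"
      using fn_mult[OF that c, of q "- 1" q 1] by (simp add: Npr[symmetric] power2_eq_square)
    then show ?thesis by (simp add: fn_pure)
  qed
  have gq2: "generically E (\<lambda>y. fn c q (- 1) y * fn c q 1 y = fn c p 0 y * fn c r 0 y)"
    by (rule generically_mono[OF eventually_generically[OF IntD1[OF PE] eventually_chart[OF c PE]]]) (rule q2)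
  have "fn c q 1 ?P = 2 * w0" using q by (simp add: fn_pt[OF c])
  show ?thesis
  proof (cases "w0 = 0")
    case False
    then have q1: "fn c q 1 ?P ~= 0" using \<open>fn c q 1 ?P = 2 * w0\<close> by simp
    note rq = regular_nonzero[OF IntD1[OF PE] regular_fn[OF PE] q1]
    have "has_order E ?P (\<lambda>y. fn c p 0 y * (fn c r 0 y * inverse (fn c q 1 y))) (int (card J) + 0)"
    proof (rule order_mult[OF IntD1[OF PE]])
      show "has_order E ?P (fn c p 0) (int (card J))" using ordp[OF order_refl] False by (simp add: p_def)
      show "has_order E ?P (\<lambda>y. fn c r 0 y * inverse (fn c q 1 y)) 0"
      proof (rule order_zeroI[OF IntD1[OF PE]])
        show "regular_at E ?P (\<lambda>y. fn c r 0 y * inverse (fn c q 1 y))"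
          by (rule regular_mult[OF regular_fn[OF PE] rq(2)])
        show "fn c r 0 ?P * inverse (fn c q 1 ?P) ~= 0" using q1 r0 by (simp add: fn_pt[OF c])
      qed
    qed
    moreover have "generically E (\<lambda>y. fn c p 0 y * (fn c r 0 y * inverse (fn c q 1 y)) = fn c q (- 1) y)"
      by (rule generically_mp2[OF gq2 eventually_generically[OF IntD1[OF PE] rq(1)]])
         (simp add: mult.assoc[symmetric] flip: divide_inverse, simp add: field_simps)
    ultimately show ?thesis using has_order_cong unfolding J_def by simp
  next
    case True
    then have P0: "poly (HP c) u0 = 0" using P by simp
    have q0: "poly (map_poly to_ac q) u0 = 0" using q True by simp
    obtain s where "regular_at E (pt c u0 0) s" "poly (pderiv (map_poly to_ac q)) u0 ~= 0 --> s (pt c u0 0) ~= 0"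
      "eventually (\<lambda>y. fn c q 0 y = W c y * W c y * s y) (nhdsin (zariski_on E) (pt c u0 0))"
      using ramified_factor[OF c P0 q0] .
    then have s: "regular_at E ?P s" "eventually (\<lambda>y. fn c q 0 y = W c y * W c y * s y) (nhdsin (zariski_on E) ?P)"
      using True by simp_all
    have W0: "W c ?P = 0" using True by (simp add: UW_pt[OF c])
    have ord1: "has_order E ?P (fn c q (- 1)) (int 1)"
    proof (rule has_orderI[where t = "W c" and u = "\<lambda>y. W c y * s y - to_ac 1"])
      show "uniformizer E ?P (W c)" using uniformizer_ramified[OF c P0] True by simp
      show "regular_at E ?P (\<lambda>y. W c y * s y - to_ac 1)"
        by (intro regular_diff regular_mult regular_UW[OF PE] s(1) regular_const)
      show "W c ?P * s ?P - to_ac 1 ~= 0" using W0 by simp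
      show "generically E (\<lambda>y. fn c q (- 1) y = (W c y * s y - to_ac 1) * W c y ^ 1)"
      proof (rule generically_mono[OF eventually_generically[OF IntD1[OF PE] s(2)]])
        fix y assume "fn c q 0 y = W c y * W c y * s y"
        moreover have "fn c q (- 1) y = fn c q 0 y - W c y" by (simp add: fn_def map_minus)
        ultimately show "fn c q (- 1) y = (W c y * s y - to_ac 1) * W c y ^ 1" by (simp add: algebra_simps)
      qed
    qed
    have "has_order E ?P (fn c q 1) (int 1)"
    proof (rule has_orderI[where t = "W c" and u = "\<lambda>y. W c y * s y + to_ac 1"])
      show "uniformizer E ?P (W c)" using uniformizer_ramified[OF c P0] True by simp
      show "regular_at E ?P (\<lambda>y. W c y * s y + to_ac 1)"
        by (intro regular_add regular_mult regular_UW[OF PE] s(1) regular_const)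
      show "W c ?P * s ?P + to_ac 1 ~= 0" using W0 by simp
      show "generically E (\<lambda>y. fn c q 1 y = (W c y * s y + to_ac 1) * W c y ^ 1)"
      proof (rule generically_mono[OF eventually_generically[OF IntD1[OF PE] s(2)]])
        fix y assume "fn c q 0 y = W c y * W c y * s y"
        moreover have "fn c q 1 y = fn c q 0 y + W c y" by (simp add: fn_def)
        ultimately show "fn c q 1 y = (W c y * s y + to_ac 1) * W c y ^ 1" by (simp add: algebra_simps)
      qed
    qed
    from order_mult[OF IntD1[OF PE] ord1 this]
    have "has_order E ?P (\<lambda>y. fn c q (- 1) y * fn c q 1 y) 2" by simp
    from has_order_cong[OF this gq2] have "has_order E ?P (\<lambda>y. fn c p 0 y * fn c r 0 y) 2" .
    moreover have "has_order E ?P (\<lambda>y. fn c p 0 y * fn c r 0 y) (int (card J * 2) + 0)"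
    proof (rule order_mult[OF IntD1[OF PE]])
      show "has_order E ?P (fn c p 0) (int (card J * 2))" using ordp[OF order_refl] True by (simp add: p_def)
      show "has_order E ?P (fn c r 0) 0"
        by (rule order_zeroI[OF IntD1[OF PE] regular_fn[OF PE]]) (use r0 in \<open>simp add: fn_pt[OF c]\<close>)
    qed
    ultimately have "2 = int (card J * 2) + 0" using order_unique[OF IntD1[OF PE]] by blast
    then have "card J = 1" by simp
    with ord1 show ?thesis unfolding J_def by simp
  qed
qed

end

section \<open>The group law\<close>

lemma infinite_agree_poly:
  fixes p q :: "'a::field_char_0 poly"
  assumes "!!x. x ~= t ==> poly p x = poly q x"
  shows "p = q"
proof (rule ccontr)
  assume "p ~= q"
  then have "finite {x. poly (p - q) x = 0}" by (intro poly_roots_finite) simp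
  moreover have "UNIV - {t} \<subseteq> {x. poly (p - q) x = 0}" using assms by auto
  ultimately have "finite (UNIV - {t})" using finite_subset by blast
  then have "finite (UNIV :: 'a set)" by simp
  then show False using infinite_UNIV_char_0 by blast
qed

lemma quadratic_expand:
  assumes "Polynomial.degree p \<le> 2"
  shows "p = [:Polynomial.coeff p 0, Polynomial.coeff p 1, Polynomial.coeff p 2:]"
proof (rule poly_eqI)
  fix n :: nat
  consider "n = 0" | "n = 1" | "n = 2" | m where "n = Suc (Suc (Suc m))"
    by (metis One_nat_def Suc_1 not0_implies_Suc)
  then show "Polynomial.coeff p n = Polynomial.coeff [:Polynomial.coeff p 0, Polynomial.coeff p 1, Polynomial.coeff p 2:] n"
    using assms by cases (auto simp: numeral_2_eq_2 coeff_eq_0)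
qed

text \<open>One step of Hermite interpolation on \<open>y\<^sup>2 = h(x)\<close>: the second alternative is the confluent case.\<close>

lemma hermite_step:
  fixes h q M :: "'a::field_char_0 poly"
  assumes "M dvd q ^ 2 - h" "y ^ 2 = poly h x" "poly M x ~= 0 \<or> (poly q x = y \<and> y ~= 0)"
  obtains \<mu> where "M * [:- x, 1:] dvd (q + smult \<mu> M) ^ 2 - h" "poly (q + smult \<mu> M) x = y"
proof -
  obtain r where r: "q ^ 2 - h = M * r" using assms(1) by (auto simp: dvd_def)
  have exp: "(q + smult \<mu> M) ^ 2 - h = M * (r + smult (2 * \<mu>) q + smult (\<mu> ^ 2) M)" for \<mu>
  proof -
    have "(q + smult \<mu> M) ^ 2 - h = (q ^ 2 - h) + M * (smult (2 * \<mu>) q + smult (\<mu> ^ 2) M)"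
      by (subst poly_eq_poly_eq_iff[symmetric]) (rule ext, simp add: power2_eq_square algebra_simps)
    then show ?thesis by (simp add: r algebra_simps)
  qed
  have fin: "M * [:- x, 1:] dvd (q + smult \<mu> M) ^ 2 - h"
    if "poly (r + smult (2 * \<mu>) q + smult (\<mu> ^ 2) M) x = 0" for \<mu>
    using that unfolding exp poly_eq_0_iff_dvd by (rule mult_dvd_mono[OF dvd_refl])
  show ?thesis
  proof (cases "poly M x = 0")
    case False
    define \<mu> where "\<mu> = (y - poly q x) / poly M x"
    have val: "poly (q + smult \<mu> M) x = y" using False by (simp add: \<mu>_def)
    then have "poly ((q + smult \<mu> M) ^ 2 - h) x = 0" using assms(2) by simp
    then have "poly (r + smult (2 * \<mu>) q + smult (\<mu> ^ 2) M) x = 0" using False unfolding exp by simp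
    from that[OF fin[OF this] val] show ?thesis .
  next
    case True
    with assms(3) have qy: "poly q x = y" "y ~= 0" by auto
    define \<mu> where "\<mu> = - poly r x / (2 * y)"
    have "poly (r + smult (2 * \<mu>) q + smult (\<mu> ^ 2) M) x = 0" using True qy by (simp add: \<mu>_def)
    moreover have "poly (q + smult \<mu> M) x = y" using True qy by simp
    ultimately show ?thesis using that[OF fin] by blast
  qed
qed

text \<open>Newton interpolation of the square root of h, one point at a time. Since opposite points
  are excluded, a repeated abscissa carries the same nonzero y, which is the confluent case of
  \<open>hermite_step\<close>.\<close>

lemma hermite_three:
  fixes h :: "'a::field_char_0 poly" and x y :: "nat => 'a"
  assumes on: "!!i. i < 3 ==> y i ^ 2 = poly h (x i)"
    and nc: "!!i j. i < 3 ==> j < 3 ==> i ~= j ==> x i ~= x j \<or> y i + y j ~= 0"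
  obtains q where "Polynomial.degree q \<le> 2" "[:- x 0, 1:] * [:- x 1, 1:] * [:- x 2, 1:] dvd q ^ 2 - h"
    "!!i. i < 3 ==> poly q (x i) = y i"
proof -
  have same: "y i = y j \<and> y i ~= 0" if "i < 3" "j < 3" "i ~= j" "x i = x j" for i j
  proof -
    have "(y i - y j) * (y i + y j) = 0"
      using on[OF that(1)] on[OF that(2)] that(4) by (simp add: algebra_simps power2_eq_square)
    with nc[OF that(1-3)] that(4) show ?thesis by auto
  qed
  let ?l = "\<lambda>i. [:- x i, 1:]"
  obtain \<mu>0 where 0: "1 * ?l 0 dvd (0 + smult \<mu>0 1) ^ 2 - h" "poly (0 + smult \<mu>0 1) (x 0) = y 0"
    by (rule hermite_step[of 1 0 h "y 0" "x 0"]) (use on[of 0] in auto)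
  define q0 where "q0 = [:\<mu>0:]"
  have q0: "?l 0 dvd q0 ^ 2 - h" "poly q0 (x 0) = y 0" using 0 by (simp_all add: q0_def one_pCons)
  obtain \<mu>1 where 1: "?l 0 * ?l 1 dvd (q0 + smult \<mu>1 (?l 0)) ^ 2 - h" "poly (q0 + smult \<mu>1 (?l 0)) (x 1) = y 1"
  proof (rule hermite_step[OF q0(1), of "y 1" "x 1"])
    show "y 1 ^ 2 = poly h (x 1)" using on by simp
    show "poly (?l 0) (x 1) ~= 0 \<or> poly q0 (x 1) = y 1 \<and> y 1 ~= 0"
      using q0(2) same[of 0 1] by (cases "x 0 = x 1") auto
  qed (rule that)
  define q1 where "q1 = q0 + smult \<mu>1 (?l 0)"
  have q1: "?l 0 * ?l 1 dvd q1 ^ 2 - h" "poly q1 (x 1) = y 1" "poly q1 (x 0) = y 0"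
    using 1 q0(2) by (simp_all add: q1_def)
  obtain \<mu>2 where 2: "?l 0 * ?l 1 * ?l 2 dvd (q1 + smult \<mu>2 (?l 0 * ?l 1)) ^ 2 - h"
      "poly (q1 + smult \<mu>2 (?l 0 * ?l 1)) (x 2) = y 2"
  proof (rule hermite_step[OF q1(1), of "y 2" "x 2"])
    show "y 2 ^ 2 = poly h (x 2)" using on by simp
    show "poly (?l 0 * ?l 1) (x 2) ~= 0 \<or> poly q1 (x 2) = y 2 \<and> y 2 ~= 0"
    proof -
      have "poly (?l 0 * ?l 1) (x 2) = (x 2 - x 0) * (x 2 - x 1)" by (simp add: algebra_simps)
      then show ?thesis
        using q1(2,3) same[of 0 2] same[of 1 2] by (cases "x 0 = x 2"; cases "x 1 = x 2") auto
    qed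
  qed (rule that)
  define q2 where "q2 = q1 + smult \<mu>2 (?l 0 * ?l 1)"
  show ?thesis
  proof (rule that[of q2])
    show "Polynomial.degree q2 \<le> 2"
      unfolding q2_def q1_def q0_def by (simp add: degree_pCons_eq_if)
    show "?l 0 * ?l 1 * ?l 2 dvd q2 ^ 2 - h" using 2(1) by (simp only: q2_def)
    fix i :: nat assume "i < 3"
    then consider "i = 0" | "i = 1" | "i = 2" by linarith
    then show "poly q2 (x i) = y i"
      using 2(2) q1(2,3) by cases (simp_all add: q2_def algebra_simps)
  qed
qed

section \<open>Rational points as triples and the conics through them\<close>

context genus_one
begin

abbreviation h0 :: "'k poly" where "h0 \<equiv> hp 0"

text \<open>A triple (a, b, y) names the projective root of a x - b: a = 1 is the affine point (b,
  y), and a = 0, b = 1 is the point at infinity with w = y in the chart c = 2.\<close>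

definition kpt :: "'k => 'k => 'k => 'k alg_closure ppoint" where
  "kpt a b y = (if a = 0 then pt 2 0 (to_ac y) else pt 0 (to_ac b) (to_ac y))"

definition kon :: "'k => 'k => 'k => bool" where
  "kon a b y \<longleftrightarrow> (a = 1 \<and> y ^ 2 = poly h0 b) \<or> (a = 0 \<and> b = 1 \<and> y ^ 2 = Polynomial.coeff h0 4)"

text \<open>At infinity the value of the conic is its coefficient of degree 2.\<close>

definition qv :: "'k poly => 'k => 'k => 'k" where
  "qv q a b = (if a = 0 then Polynomial.coeff q 2 else poly q b)"

text \<open>The four points, with multiplicity, form the intersection with y = q(x). A point at
  infinity contributes a constant factor, so it is counted by a drop in the degree of q^2 -
  h0.\<close>

definition cop :: "(nat => 'k) => (nat => 'k) => (nat => 'k) => bool" where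
  "cop a b y \<longleftrightarrow> (\<exists>q \<kappa>. Polynomial.degree q \<le> 2 \<and> \<kappa> ~= 0 \<and>
     q ^ 2 - h0 = smult \<kappa> (\<Prod>i<4. [:- b i, a i:]) \<and> (\<forall>i<4. qv q (a i) (b i) = y i))"

lemma poly_map_to_ac: "poly (map_poly to_ac p) (to_ac x) = to_ac (poly p x)"
  by (induction p) auto

lemma h0_degree: "Polynomial.degree h0 \<le> 4" "Polynomial.degree h0 \<ge> 3"
  using C_nonzero deg_le deg_ge by (simp_all add: hp_def)

lemma hp2_grev: "hp 2 = grev h0"
  by (simp add: hp_def grev_pCons)

lemma hp2_0: "poly (HP 2) 0 = to_ac (Polynomial.coeff h0 4)"
  by (simp add: hp2_grev grev_pCons)

lemma q_square_ne: "q ^ 2 - h0 ~= 0"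
proof
  assume "q ^ 2 - h0 = 0"
  then have "(map_poly to_ac q) ^ 2 = 1 ^ 2 * HP 0" by (simp flip: map_ac_power)
  from norm_eq_zero(2)[OF HP_sqfree HP_degree this] show False by simp
qed

lemma kon_signed: "kon a b y ==> kon a b (- y)"
  by (simp add: kon_def)

lemma kpt_E: "kon a b y ==> kpt a b y \<in> E"
  unfolding kon_def kpt_def by (auto simp: pt_in_E hp2_0 poly_map_to_ac simp flip: to_ac_power)

lemma affine_not_infinite: "pt 0 u w ~= pt 2 0 (w' :: 'k alg_closure)"
proof
  assume "pt 0 u w = pt 2 0 w'"
  then obtain c where "coords 0 u w = (\<lambda>i. c * coords 2 0 w' i)" by (auto simp: pt_def hline_eq_iff)
  from fun_cong[OF this, of 0] show False by (simp add: coords_simps)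
qed

lemma kpt_eq_iff: "kon a b y ==> kon a' b' y' ==> kpt a b y = kpt a' b' y' \<longleftrightarrow> a = a' \<and> b = b' \<and> y = y'"
  using affine_not_infinite[of "to_ac b" "to_ac y" "to_ac y'"]
    affine_not_infinite[of "to_ac b'" "to_ac y'" "to_ac y", symmetric]
  unfolding kpt_def kon_def by (elim disjE conjE) (simp_all add: pt_eq_iff)

lemma rational_points_kpt: "rational_points E = {kpt a b y | a b y. kon a b y}"
proof (intro equalityI subsetI)
  fix x assume "x \<in> rational_points E"
  then obtain v where v: "x \<in> E" "v \<in> x" "!!i. v i \<in> range to_ac" by (auto simp: rational_points_def)
  have xp: "x \<in> pts" using v E_sub by blast
  have UWr: "U c x \<in> range to_ac" "W c x \<in> range to_ac" for c
    unfolding UW_eq[OF xp v(2)] by (auto intro!: range_to_ac_closed(3) v(3))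
  from v(1) show "x \<in> {kpt a b y | a b y. kon a b y}"
  proof (cases rule: E_cases)
    case (affine u w)
    then obtain b y where "u = to_ac b" "w = to_ac y" using UWr[of 0] by (auto simp: UW_pt)
    moreover from this affine have "kon 1 b y"
      by (simp add: kon_def poly_map_to_ac flip: to_ac_power)
    ultimately have "x = kpt 1 b y \<and> kon 1 b y" using affine by (simp add: kpt_def)
    then show ?thesis by blast
  next
    case (infinite w)
    then obtain y where "w = to_ac y" using UWr[of 2] by (auto simp: UW_pt)
    moreover from this infinite have "kon 0 1 y"
      by (simp add: kon_def hp2_0 flip: to_ac_power)
    ultimately have "x = kpt 0 1 y \<and> kon 0 1 y" using infinite by (simp add: kpt_def)
    then show ?thesis by blast
  qed
next
  fix x assume "x \<in> {kpt a b y | a b y. kon a b y}"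
  then obtain a b y where x: "x = kpt a b y" "kon a b y" by blast
  have cr: "\<forall>i. coords c (to_ac u) (to_ac w) i \<in> range to_ac" for c and u w :: 'k
    using rangeI[of to_ac "0::'k"] rangeI[of to_ac "1::'k"] by (simp add: coords_def flip: to_ac_power)
  have "\<exists>v\<in>x. \<forall>i. v i \<in> range to_ac"
  proof (cases "a = 0")
    case True
    then have "coords 2 (to_ac 0) (to_ac y) \<in> x" by (simp add: x(1) kpt_def pt_def)
    with cr show ?thesis by blast
  next
    case False
    then have "coords 0 (to_ac b) (to_ac y) \<in> x" by (simp add: x(1) kpt_def pt_def)
    with cr show ?thesis by blast
  qed
  then show "x \<in> rational_points E" using kpt_E[OF x(2)] x(1) by (simp add: rational_points_def)
qed

text \<open>The substitution \<open>x = t + 1/X\<close> moves the three points away from infinity.\<close>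

lemma fourth_point:
  assumes on: "!!i. i < 3 ==> kon (a i) (b i) (y i)"
    and nc: "!!i j. i < 3 ==> j < 3 ==> i ~= j ==> \<not> (a i = a j \<and> b i = b j \<and> y i = - y j)"
  obtains a3 b3 y3 where "kon a3 b3 y3" "cop (a(3 := a3)) (b(3 := b3)) (y(3 := y3))"
proof -
  \<comment> \<open>t avoids the three abscissae, so X = 1/(x - t) is finite at each of the
    points.\<close>
  have "\<exists>t. t \<notin> b ` {..<3}" by (rule ex_new_if_finite[OF infinite_UNIV_char_0]) simp
  then obtain t where "t \<notin> b ` {..<3}" ..
  then have t: "b i ~= t" if "i < 3" for i using that by auto
  \<comment> \<open>The homogeneous version of b - t: it is nonzero for a point at infinity as well,
    where X = a/e becomes 0.\<close>
  define e where "e i = b i - t * a i" for i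
  have ab: "a i = 1 \<or> (a i = 0 \<and> b i = 1)" if "i < 3" for i using on[OF that] by (auto simp: kon_def)
  have e: "e i ~= 0" if "i < 3" for i using t[OF that] ab[OF that] by (auto simp: e_def)
  define hh where "hh = grev (pcompose h0 [:t, 1:])"
  have hh: "poly hh X = X ^ 4 * poly h0 (t + 1 / X)" if "X ~= 0" for X
    unfolding hh_def by (subst grev_eval(1)) (use that h0_degree in \<open>simp_all add: poly_pcompose degree_pcompose\<close>)
  have coeff4: "Polynomial.coeff (pcompose p [:c, 1:]) 4 = Polynomial.coeff p 4" if "Polynomial.degree p \<le> 4" for p :: "'k poly" and c
  proof (cases "Polynomial.degree p = 4")
    case True
    then show ?thesis using lead_coeff_comp[of "[:c, 1:]" p] by (simp add: degree_pcompose)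
  next
    case False
    with that show ?thesis by (simp add: coeff_eq_0 degree_pcompose)
  qed
  have hh0: "poly hh 0 = Polynomial.coeff h0 4"
    unfolding hh_def using coeff4[OF h0_degree(1), of t] by (simp add: grev_pCons)
  define X where "X i = a i / e i" for i
  define Y where "Y i = y i / e i ^ 2" for i
  have onX: "Y i ^ 2 = poly hh (X i)" if i: "i < 3" for i
  proof (cases "a i = 0")
    case True
    with on[OF i] have *: "b i = 1" "y i ^ 2 = Polynomial.coeff h0 4" by (auto simp: kon_def)
    then show ?thesis using True by (simp add: X_def Y_def e_def hh0)
  next
    case False
    with on[OF i] have *: "a i = 1" "y i ^ 2 = poly h0 (b i)" by (auto simp: kon_def)
    have "poly hh (X i) = X i ^ 4 * poly h0 (b i)"
      using hh[of "X i"] e[OF i] * by (simp add: X_def e_def)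
    also have "\<dots> = Y i ^ 2"
      unfolding *(2)[symmetric] X_def Y_def *(1) by (simp add: power_divide)
    finally show ?thesis ..
  qed
  have ncX: "X i ~= X j \<or> Y i + Y j ~= 0" if ij: "i < 3" "j < 3" "i ~= j" for i j
  proof (rule ccontr)
    assume "\<not> (X i ~= X j \<or> Y i + Y j ~= 0)"
    then have eq: "X i = X j" "Y i + Y j = 0" by auto
    from eq(1) ab[OF ij(1)] ab[OF ij(2)] e[OF ij(1)] e[OF ij(2)] have *: "a i = a j" "b i = b j"
      by (auto simp: X_def e_def field_simps)
    then have "e i = e j" by (simp add: e_def)
    with eq(2) e[OF ij(1)] have "y i = - y j"
      by (simp add: Y_def add_divide_distrib[symmetric] add_eq_0_iff2)
    with * nc[OF ij] show False by simp
  qed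
  obtain Q where Q: "Polynomial.degree Q \<le> 2" "[:- X 0, 1:] * [:- X 1, 1:] * [:- X 2, 1:] dvd Q ^ 2 - hh"
    "!!i. i < 3 ==> poly Q (X i) = Y i"
    using hermite_three[of Y hh X] onX ncX by blast
  define c0 c1 c2 where "c0 = Polynomial.coeff Q 0" and "c1 = Polynomial.coeff Q 1" and "c2 = Polynomial.coeff Q 2"
  have Qc: "Q = [:c0, c1, c2:]" unfolding c0_def c1_def c2_def by (rule quadratic_expand[OF Q(1)])
  \<comment> \<open>This is (x - t)^2 Q(1/(x - t)), multiplied out.\<close>
  define q where "q = [:c2 - c1 * t + c0 * t ^ 2, c1 - 2 * c0 * t, c0:]"
  have q_eval: "poly q x = (x - t) ^ 2 * poly Q (1 / (x - t))" if "x ~= t" for x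
  proof -
    have "s ^ 2 * poly Q (1 / s) = c0 * s ^ 2 + c1 * s + c2" if "s ~= 0" for s
      using that by (simp add: Qc field_simps power2_eq_square)
    from this[of "x - t"] that
    have "(x - t) ^ 2 * poly Q (1 / (x - t)) = c0 * (x - t) ^ 2 + c1 * (x - t) + c2" by simp
    then show ?thesis by (simp add: q_def algebra_simps power2_eq_square)
  qed
  have N_eval: "poly (q ^ 2 - h0) x = (x - t) ^ 4 * poly (Q ^ 2 - hh) (1 / (x - t))" if x: "x ~= t" for x
  proof -
    have "poly hh (1 / (x - t)) = (1 / (x - t)) ^ 4 * poly h0 x" using hh[of "1 / (x - t)"] x by simp
    then have 1: "(x - t) ^ 4 * poly hh (1 / (x - t)) = poly h0 x"
      using x by (simp add: power_divide)
    have 2: "poly q x ^ 2 = (x - t) ^ 4 * poly Q (1 / (x - t)) ^ 2"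
      unfolding q_eval[OF x] by (simp add: power_mult_distrib flip: power_mult)
    show ?thesis using 1 2 by (simp add: right_diff_distrib)
  qed
  let ?M = "[:- X 0, 1:] * [:- X 1, 1:] * [:- X 2, 1:]"
  \<comment> \<open>The cofactor of the three known factors has the shape d + c X; its projective
    root is the fourth point.\<close>
  obtain l where l: "Q ^ 2 - hh = ?M * l" using Q(2) by (auto simp: dvd_def)
  have "Q ^ 2 - hh ~= 0"
  proof
    assume "Q ^ 2 - hh = 0"
    then have "q ^ 2 - h0 = 0" using N_eval by (intro infinite_agree_poly[of t]) simp
    with q_square_ne show False by blast
  qed
  then have l0: "l ~= 0" using l by auto
  have "Polynomial.degree (Q ^ 2) \<le> 4" using Q(1) order_trans[OF degree_power_le[of Q 2]] by simp
  moreover have "Polynomial.degree hh \<le> 4" unfolding hh_def grev_pCons by (simp add: degree_pCons_eq_if)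
  ultimately have "Polynomial.degree (Q ^ 2 - hh) \<le> 4" by (rule degree_diff_le)
  moreover have "Polynomial.degree ?M = 3" by (simp add: degree_mult_eq)
  ultimately have "Polynomial.degree l \<le> 1" using l0 unfolding l by (subst (asm) degree_mult_eq) auto
  then have lc: "l = [:Polynomial.coeff l 0, Polynomial.coeff l 1:]"
    using quadratic_expand[of l] by (simp add: coeff_eq_0)
  define c d where "c = Polynomial.coeff l 1" and "d = Polynomial.coeff l 0"
  have ldc: "l = [:d, c:]" using lc by (simp add: c_def d_def)
  \<comment> \<open>X = 0 corresponds to infinity, so d = 0 places the fourth point there.\<close>
  define a3 b3 \<kappa>3 where "a3 = (if d = 0 then 0 else 1 :: 'k)" and "b3 = (if d = 0 then 1 else t - c / d)"
    and "\<kappa>3 = (if d = 0 then - c else d)"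
  have \<kappa>3: "\<kappa>3 ~= 0" using l0 by (auto simp: \<kappa>3_def ldc)
  have l3: "d * (x - t) + c = \<kappa>3 * (- b3 + a3 * x)" for x
    by (simp add: a3_def b3_def \<kappa>3_def field_simps)
  have li: "1 - X i * (x - t) = (- 1 / e i) * (- b i + a i * x)" if "i < 3" for i x
    using e[OF that] by (simp add: X_def e_def field_simps)
  define \<kappa> where "\<kappa> = (- 1 / e 0) * (- 1 / e 1) * (- 1 / e 2) * \<kappa>3"
  have \<kappa>: "\<kappa> ~= 0" using e[of 0] e[of 1] e[of 2] \<kappa>3 by (simp add: \<kappa>_def)
  have N: "q ^ 2 - h0 = smult \<kappa> ([:- b 0, a 0:] * [:- b 1, a 1:] * [:- b 2, a 2:] * [:- b3, a3:])"
  proof (rule infinite_agree_poly[of t])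
    fix x assume x: "x ~= t"
    have lin: "1 / (x - t) - X i = (1 - X i * (x - t)) / (x - t)" for i using x by (simp add: field_simps)
    have linl: "d + c * (1 / (x - t)) = (d * (x - t) + c) / (x - t)" using x by (simp add: field_simps)
    have "poly (q ^ 2 - h0) x = (x - t) ^ 4 * ((1 / (x - t) - X 0) * (1 / (x - t) - X 1) * (1 / (x - t) - X 2) * (d + c * (1 / (x - t))))"
    proof -
      have "poly [:- X i, 1:] z = z - X i" "poly [:d, c:] z = d + c * z" for i z by simp_all
      then show ?thesis unfolding N_eval[OF x] l ldc poly_mult by (simp only:)
    qed
    also have "\<dots> = (1 - X 0 * (x - t)) * (1 - X 1 * (x - t)) * (1 - X 2 * (x - t)) * (d * (x - t) + c)"
      unfolding lin linl using x by (simp add: power4_eq_xxxx)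
    also have "\<dots> = ((- 1 / e 0) * (- b 0 + a 0 * x)) * ((- 1 / e 1) * (- b 1 + a 1 * x)) * ((- 1 / e 2) * (- b 2 + a 2 * x)) * (\<kappa>3 * (- b3 + a3 * x))"
      unfolding l3 using li[of 0 x] li[of 1 x] li[of 2 x] by simp
    also have "\<dots> = \<kappa> * ((- b 0 + a 0 * x) * (- b 1 + a 1 * x) * (- b 2 + a 2 * x) * (- b3 + a3 * x))"
      unfolding \<kappa>_def by (simp only: mult_ac)
    also have "\<dots> = poly (smult \<kappa> ([:- b 0, a 0:] * [:- b 1, a 1:] * [:- b 2, a 2:] * [:- b3, a3:])) x"
      unfolding poly_smult poly_mult by (simp add: mult.commute)
    finally show "poly (q ^ 2 - h0) x = poly (smult \<kappa> ([:- b 0, a 0:] * [:- b 1, a 1:] * [:- b 2, a 2:] * [:- b3, a3:])) x" .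
  qed
  define y3 where "y3 = qv q a3 b3"
  have "Polynomial.degree q \<le> 2" by (simp add: q_def degree_pCons_eq_if)
  have kon3: "kon a3 b3 y3"
  proof (cases "d = 0")
    case False
    then have "a3 = 1" by (simp add: a3_def)
    have "poly (q ^ 2 - h0) b3 = 0" unfolding N poly_smult poly_mult using \<open>a3 = 1\<close> by simp
    then show ?thesis using \<open>a3 = 1\<close> by (simp add: kon_def y3_def qv_def)
  next
    case True
    then have a3: "a3 = 0" "b3 = 1" by (simp_all add: a3_def b3_def)
    have lin: "Polynomial.degree [:u, v:] \<le> 1" for u v :: 'k by simp
    have "Polynomial.degree [:- b3, a3:] = 0" using a3 by simp
    then have "Polynomial.degree ([:- b 0, a 0:] * [:- b 1, a 1:] * [:- b 2, a 2:] * [:- b3, a3:]) \<le> 3"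
      using degree_mult_le[of "[:- b 0, a 0:]" "[:- b 1, a 1:]"] lin[of "- b 0" "a 0"] lin[of "- b 1" "a 1"]
        degree_mult_le[of "[:- b 0, a 0:] * [:- b 1, a 1:]" "[:- b 2, a 2:]"] lin[of "- b 2" "a 2"]
        degree_mult_le[of "[:- b 0, a 0:] * [:- b 1, a 1:] * [:- b 2, a 2:]" "[:- b3, a3:]"]
      by linarith
    then have "Polynomial.degree ([:- b 0, a 0:] * [:- b 1, a 1:] * [:- b 2, a 2:] * [:- b3, a3:]) < 4"
      by linarith
    from coeff_eq_0[OF this] have "Polynomial.coeff (q ^ 2 - h0) 4 = 0"
      unfolding N coeff_smult by (simp only: mult_zero_right)
    moreover have "Polynomial.coeff (q ^ 2) 4 = c0 ^ 2"
      by (simp add: q_def power2_eq_square numeral_eq_Suc)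
    ultimately show ?thesis using a3 by (simp add: kon_def y3_def qv_def q_def numeral_2_eq_2)
  qed
  have qvi: "qv q (a i) (b i) = y i" if i: "i < 3" for i
  proof (cases "a i = 0")
    case True
    with ab[OF i] have "b i = 1" by auto
    with True Q(3)[OF i] show ?thesis
      by (simp add: qv_def q_def X_def Y_def e_def Qc numeral_2_eq_2)
  next
    case False
    with ab[OF i] have "a i = 1" by auto
    with Q(3)[OF i] e[OF i] q_eval[OF t[OF i]] show ?thesis by (simp add: qv_def X_def Y_def e_def)
  qed
  have prod4: "(\<Prod>i<4. F i) = F 0 * F 1 * F 2 * F 3" for F :: "nat => 'k poly"
  proof -
    have "{..<4::nat} = {0, 1, 2, 3}" by auto
    then show ?thesis by (simp add: mult.assoc)
  qed
  have u3: "(F(3 := z)) 0 = F 0" "(F(3 := z)) 1 = F 1" "(F(3 := z)) 2 = F 2" "(F(3 := z)) 3 = z" for F :: "nat => 'k" and z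
    by simp_all
  show ?thesis
  proof (rule that[OF kon3])
    show "cop (a(3 := a3)) (b(3 := b3)) (y(3 := y3))"
      unfolding cop_def
    proof (intro exI conjI allI impI)
      show "Polynomial.degree q \<le> 2" "\<kappa> ~= 0" by fact+
      show "q ^ 2 - h0 = smult \<kappa> (\<Prod>i<4. [:- (b(3 := b3)) i, (a(3 := a3)) i:])"
        unfolding N prod4 u3 ..
      fix i :: nat assume "i < 4"
      then have "i < 3 \<or> i = 3" by auto
      then show "qv q ((a(3 := a3)) i) ((b(3 := b3)) i) = (y(3 := y3)) i"
        using qvi by (auto simp: y3_def)
    qed
  qed
qed

subsection \<open>Principal divisors\<close>

definition dv :: "('k alg_closure ppoint => 'k alg_closure) => ('k alg_closure ppoint => int) => bool" where
  "dv f D \<longleftrightarrow> rational_function E f \<and> (\<forall>x\<in>E. has_order E x f (D x))"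

definition single :: "'k alg_closure ppoint => 'k alg_closure ppoint => int" where
  "single p x = of_bool (x = p)"

text \<open>The pole divisor of x: two points at infinity, or a single one counted twice if it is a
  branch point, which is the case \<open>W 2 x = 0\<close>.\<close>

definition Dinf :: "'k alg_closure ppoint => int" where
  "Dinf x = (if x \<in> nz (\<lambda>v. v 0) then 0 else if W 2 x = 0 then 2 else 1)"

lemma principal_dv: "principal_divisor E D \<longleftrightarrow> (\<exists>f. dv f D)"
  by (simp add: principal_divisor_def dv_def)

lemma E_nonempty: "\<exists>x. x \<in> E"
  using infinite_E by (metis finite.emptyI ex_in_conv)

lemma dv_mult: "dv f D ==> dv f' D' ==> dv (\<lambda>y. f y * f' y) (\<lambda>x. D x + D' x)"
  unfolding dv_def using rational_function_mult order_mult by blast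

lemma dv_inverse: "dv f D ==> dv (\<lambda>y. inverse (f y)) (\<lambda>x. - D x)"
proof -
  assume *: "dv f D"
  obtain x where "x \<in> E" using E_nonempty by blast
  with * have "generically E (\<lambda>y. f y ~= 0)" unfolding dv_def using order_nonzero by blast
  with * show ?thesis unfolding dv_def using rational_function_inverse has_order_inverse by blast
qed

lemma principal_add: "principal_divisor E D ==> principal_divisor E D' ==> principal_divisor E (\<lambda>x. D x + D' x)"
  unfolding principal_dv using dv_mult by blast

lemma principal_neg: "principal_divisor E D ==> principal_divisor E (\<lambda>x. - D x)"
  unfolding principal_dv using dv_inverse by blast

lemma principal_diff: "principal_divisor E D ==> principal_divisor E D' ==> principal_divisor E (\<lambda>x. D x - D' x)"
  using principal_add[OF _ principal_neg, of D D'] by simp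

lemma principal_zero: "principal_divisor E (\<lambda>x. 0)"
proof -
  obtain x where x: "x \<in> E" using E_nonempty by blast
  have "rational_function E (\<lambda>_. to_ac 1)" using regular_imp_rational_function[OF x regular_const] .
  then have "dv (\<lambda>_. 1) (\<lambda>x. 0)" using order_one by (simp add: dv_def)
  then show ?thesis unfolding principal_dv by blast
qed

lemma generically_affine: "generically E (\<lambda>y. y \<in> E \<inter> nz (\<lambda>v. v 0))"
proof -
  obtain w where "w ^ 2 = poly (HP 0) 0" using ex_sqrt by blast
  from pt_chart[of 0, OF _ this] have P: "pt 0 0 w \<in> E \<inter> nz (\<lambda>v. v 0)" by simp
  from eventually_generically[OF IntD1[OF P] eventually_chart[OF _ P]] show ?thesis by simp
qed

lemma generically_overlap:
  "generically E (\<lambda>y. U 0 y ~= 0 \<and> U 2 y ~= 0 \<and> U 0 y = inverse (U 2 y) \<and> W 0 y = W 2 y * inverse (U 2 y) ^ 2)"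
proof -
  have "generically E (\<lambda>y. fn 0 [:0, 1:] 0 y ~= 0)" by (rule generically_fn_nonzero) auto
  from generically_affine this show ?thesis
  proof (rule generically_mp2)
    fix y assume y: "y \<in> E \<inter> nz (\<lambda>v. v 0)" "fn 0 [:0, 1:] 0 y ~= 0"
    then have u: "U 0 y ~= 0" by (simp add: fn_def)
    have "y = pt 2 (1 / U 0 y) (W 0 y / U 0 y ^ 2)"
      using chart_point(1)[OF y(1)] pt_swap[OF u, of "W 0 y"] by simp
    then have *: "U 2 y = 1 / U 0 y" "W 2 y = W 0 y / U 0 y ^ 2"
      using UW_pt[of 2 "1 / U 0 y" "W 0 y / U 0 y ^ 2"] by simp_all
    then show "U 0 y ~= 0 \<and> U 2 y ~= 0 \<and> U 0 y = inverse (U 2 y) \<and> W 0 y = W 2 y * inverse (U 2 y) ^ 2"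
      using u by (simp add: *)
  qed
qed

lemma infinite_not_nz: "pt 2 0 (w :: 'k alg_closure) \<notin> nz (\<lambda>v. v 0)"
  using nz_iff[OF form_coord[of 0] pt_pts[of 2 0 w], of "coords 2 0 w"]
  by (simp add: pt_def coords_simps)

lemma rational_U: "rational_function E (U 0)" "rational_function E (W 0)"
proof -
  obtain w where "w ^ 2 = poly (HP 0) 0" using ex_sqrt by blast
  from pt_chart[of 0, OF _ this] have P: "pt 0 0 w \<in> E \<inter> nz (\<lambda>v. v 0)" by simp
  then show "rational_function E (U 0)" "rational_function E (W 0)"
    using regular_imp_rational_function regular_UW by blast+
qed

lemma order_U2:
  assumes "w ^ 2 = poly (HP 2) 0"
  shows "has_order E (pt 2 0 w) (U 2) (Dinf (pt 2 0 w))"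
proof -
  have "fn 2 [:0, 1:] 0 = U 2" by (auto simp: fn_def)
  moreover have "has_order E (pt 2 0 w) (fn 2 [:0, 1:] 0) (if w = 0 then 2 else 1)"
    by (rule order_simple_root) (use assms in \<open>auto simp: pderiv_pCons\<close>)
  ultimately show ?thesis using infinite_not_nz[of w] by (simp add: Dinf_def UW_pt)
qed

lemma fn_linear: "fn 0 [:- a, 1:] 0 y = U 0 y - to_ac a"
  by (simp add: fn_def)

lemma dv_linear:
  "dv (\<lambda>y. U 0 y - to_ac a) (\<lambda>x. (if x \<in> nz (\<lambda>v. v 0) \<and> U 0 x = to_ac a then (if W 0 x = 0 then 2 else 1) else 0) - Dinf x)"
  unfolding dv_def
proof (intro conjI ballI)
  have "rational_function E (\<lambda>y. to_ac (- a))"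
    using regular_imp_rational_function[OF _ regular_const] E_nonempty by blast
  from rational_function_add[OF rational_U(1) this] show "rational_function E (\<lambda>y. U 0 y - to_ac a)" by simp
next
  fix x assume x: "x \<in> E"
  show "has_order E x (\<lambda>y. U 0 y - to_ac a)
     ((if x \<in> nz (\<lambda>v. v 0) \<and> U 0 x = to_ac a then (if W 0 x = 0 then 2 else 1) else 0) - Dinf x)"
    using x
  proof (cases rule: E_cases)
    case (affine u w)
    have xc: "x \<in> E \<inter> nz (\<lambda>v. v 0)" using pt_chart[of 0 w u] affine by simp
    then have D: "Dinf x = 0" by (simp add: Dinf_def)
    show ?thesis
    proof (cases "u = to_ac a")
      case True
      have "has_order E (pt 0 u w) (fn 0 [:- a, 1:] 0) (if w = 0 then 2 else 1)"
        by (rule order_simple_root) (use affine True in \<open>auto simp: pderiv_pCons\<close>)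
      then show ?thesis using affine True xc D by (simp add: UW_pt fn_linear[abs_def])
    next
      case False
      have "has_order E x (fn 0 [:- a, 1:] 0) 0"
        by (rule order_zeroI[OF x regular_fn[OF xc]]) (use False affine in \<open>simp add: fn_linear UW_pt\<close>)
      then show ?thesis using affine False D by (simp add: UW_pt fn_linear[abs_def])
    qed
  next
    case (infinite w)
    have xc: "x \<in> E \<inter> nz (\<lambda>v. v 2)" using pt_chart[of 2 w 0] infinite by simp
    \<comment> \<open>With u = 1/x one has x - a = (1 - a u)/u near infinity, and the numerator is a
      unit.\<close>
    have "has_order E x (\<lambda>y. inverse (U 2 y) * fn 2 [:1, - a:] 0 y) (- Dinf x + 0)"
    proof (rule order_mult[OF x])
      show "has_order E x (\<lambda>y. inverse (U 2 y)) (- Dinf x)"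
        using has_order_inverse[OF x] order_U2[OF infinite(2)] infinite(1) by simp
      show "has_order E x (fn 2 [:1, - a:] 0) 0"
        by (rule order_zeroI[OF x regular_fn[OF xc]]) (use infinite in \<open>simp add: fn_def UW_pt\<close>)
    qed
    moreover have "generically E (\<lambda>y. inverse (U 2 y) * fn 2 [:1, - a:] 0 y = U 0 y - to_ac a)"
      by (rule generically_mono[OF generically_overlap]) (simp add: fn_def field_simps)
    ultimately show ?thesis using has_order_cong infinite_not_nz infinite by simp
  qed
qed

text \<open>For an affine point this is the divisor of x - b; for a point at infinity the
  combination is identically zero on the curve.\<close>

lemma principal_fibre:
  assumes "kon a b y"
  shows "principal_divisor E (\<lambda>x. single (kpt a b y) x + single (kpt a b (- y)) x - Dinf x)"
proof (cases "a = 0")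
  case False
  with assms have a: "a = 1" "y ^ 2 = poly h0 b" by (auto simp: kon_def)
  have "single (kpt a b y) x + single (kpt a b (- y)) x - Dinf x =
      (if x \<in> nz (\<lambda>v. v 0) \<and> U 0 x = to_ac b then (if W 0 x = 0 then 2 else 1) else 0) - Dinf x" if x: "x \<in> E" for x
    using x
  proof (cases rule: E_cases)
    case (affine u w)
    have xc: "x \<in> E \<inter> nz (\<lambda>v. v 0)" using pt_chart[of 0 w u] affine by simp
    have "w = to_ac y \<or> w = - to_ac y" if "u = to_ac b"
      using affine(2) that a(2) by (simp add: poly_map_to_ac flip: to_ac_power) (metis power2_eq_iff to_ac_power)
    then show ?thesis using xc a affine
      by (auto simp: single_def kpt_def pt_eq_iff UW_pt)
  next
    case (infinite w)
    then show ?thesis using a infinite_not_nz affine_not_infinite by (auto simp: single_def kpt_def dest: sym)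
  qed
  then have "dv (\<lambda>y. U 0 y - to_ac b) (\<lambda>x. single (kpt a b y) x + single (kpt a b (- y)) x - Dinf x)"
    using dv_linear[of b] unfolding dv_def by simp
  then show ?thesis unfolding principal_dv by blast
next
  case True
  with assms have a: "b = 1" "y ^ 2 = Polynomial.coeff h0 4" by (auto simp: kon_def)
  have "single (kpt a b y) x + single (kpt a b (- y)) x - Dinf x = 0" if x: "x \<in> E" for x
    using x
  proof (cases rule: E_cases)
    case (affine u w)
    have "x \<in> nz (\<lambda>v. v 0)" using pt_chart[of 0 w u] affine by simp
    then show ?thesis using affine True affine_not_infinite by (auto simp: single_def kpt_def Dinf_def)
  next
    case (infinite w)
    have "w = to_ac y \<or> w = - to_ac y"
      using infinite(2) a(2) unfolding hp2_0 by (metis power2_eq_iff to_ac_power)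
    then show ?thesis using infinite True infinite_not_nz
      by (auto simp: single_def kpt_def Dinf_def pt_eq_iff UW_pt)
  qed
  then show ?thesis using principal_zero unfolding principal_divisor_def by simp
qed

text \<open>The divisor of q(x) - y. Near infinity, with u = 1/x, this function is u^-2 (q'(u) - w),
  where \<open>q'\<close> is q reversed as a quadratic.\<close>

lemma principal_cop:
  assumes on: "!!i. i < 4 ==> kon (a i) (b i) (y i)" and "cop a b y"
  shows "principal_divisor E (\<lambda>x. (\<Sum>i<4. single (kpt (a i) (b i) (y i)) x) - 2 * Dinf x)"
proof -
  obtain q \<kappa> where q: "Polynomial.degree q \<le> 2" "\<kappa> ~= 0" "q ^ 2 - h0 = smult \<kappa> (\<Prod>i<4. [:- b i, a i:])"
    "!!i. i < 4 ==> qv q (a i) (b i) = y i"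
    using assms(2) unfolding cop_def by blast
  have ab: "a i = 1 \<or> (a i = 0 \<and> b i = 1)" if "i < 4" for i using on[OF that] by (auto simp: kon_def)
  define q' where "q' = [:Polynomial.coeff q 2, Polynomial.coeff q 1, Polynomial.coeff q 0:]"
  have q_eval: "poly q z = Polynomial.coeff q 0 + Polynomial.coeff q 1 * z + Polynomial.coeff q 2 * z ^ 2" for z
    by (subst quadratic_expand[OF q(1)]) (simp add: power2_eq_square algebra_simps)
  \<comment> \<open>The same factorization read in the coordinate 1/x.\<close>
  have N2: "q' ^ 2 - hp 2 = smult \<kappa> (\<Prod>i<4. [:a i, - b i:])"
  proof (rule infinite_agree_poly[of 0])
    fix u :: 'k assume u: "u ~= 0"
    have q'u: "poly q' u = u ^ 2 * poly q (1 / u)"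
      unfolding q_eval using u by (simp add: q'_def field_simps power2_eq_square)
    have lin: "poly [:a i, - b i:] u = u * poly [:- b i, a i:] (1 / u)" for i using u by (simp add: field_simps)
    have "poly (hp 2) u = u ^ 4 * poly h0 (1 / u)"
      unfolding hp2_grev by (rule grev_eval(1)[OF h0_degree(1) u])
    then have "poly (q' ^ 2 - hp 2) u = u ^ 4 * poly (q ^ 2 - h0) (1 / u)"
      by (simp add: q'u power_mult_distrib right_diff_distrib flip: power_mult)
    also have "\<dots> = poly (smult \<kappa> (\<Prod>i<4. [:a i, - b i:])) u"
      unfolding q(3) poly_smult poly_prod lin prod.distrib by simp
    finally show "poly (q' ^ 2 - hp 2) u = poly (smult \<kappa> (\<Prod>i<4. [:a i, - b i:])) u" .
  qed
  have sum_card: "(\<Sum>i<4. single (kpt (a i) (b i) (y i)) x) = int (card {i\<in>{..<4}. x = kpt (a i) (b i) (y i)})" for x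
    by (simp add: single_def sum.If_cases of_bool_def Int_def)
  have ord: "has_order E x (fn 0 q (- 1)) ((\<Sum>i<4. single (kpt (a i) (b i) (y i)) x) - 2 * Dinf x)" if x: "x \<in> E" for x
    using x
  proof (cases rule: E_cases)
    case (affine u w)
    have xc: "x \<in> E \<inter> nz (\<lambda>v. v 0)" using pt_chart[of 0 w u] affine by simp
    have D: "Dinf x = 0" using xc by (simp add: Dinf_def)
    have eq: "x = kpt (a i) (b i) (y i) \<longleftrightarrow> to_ac (a i) * u = to_ac (b i) \<and> poly (map_poly to_ac q) u = w" if i: "i < 4" for i
    proof (cases "a i = 0")
      case True
      then show ?thesis using ab[OF i] affine affine_not_infinite by (auto simp: kpt_def)
    next
      case False
      then have "a i = 1" using ab[OF i] by auto
      then show ?thesis using q(4)[OF i] affine by (auto simp: kpt_def pt_eq_iff qv_def poly_map_to_ac)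
    qed
    show ?thesis
    proof (cases "poly (map_poly to_ac q) u = w")
      case True
      have "has_order E (pt 0 u w) (fn 0 q (- 1)) (int (card {i\<in>{..<4}. to_ac (a i) * u = to_ac (b i)}))"
        by (rule order_plane[OF _ affine(2) True q(3,2)]) (use ab in fastforce)+
      moreover have "{i\<in>{..<4}. x = kpt (a i) (b i) (y i)} = {i\<in>{..<4}. to_ac (a i) * u = to_ac (b i)}"
        using eq True by auto
      ultimately show ?thesis unfolding sum_card using D affine by simp
    next
      case False
      have "{i\<in>{..<4}. x = kpt (a i) (b i) (y i)} = {}" using eq False by auto
      moreover have "has_order E x (fn 0 q (- 1)) 0"
      proof (rule order_zeroI[OF x regular_fn[OF xc]])
        have "map_poly to_ac (- 1 :: 'k poly) = - 1" by (simp add: poly_eq_iff coeff_map_poly)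
        then show "fn 0 q (- 1) x ~= 0" using False affine by (simp add: fn_pt)
      qed
      ultimately show ?thesis unfolding sum_card using D by (simp only:) simp
    qed
  next
    case (infinite w)
    have xc: "x \<in> E \<inter> nz (\<lambda>v. v 2)" using pt_chart[of 2 w 0] infinite by simp
    have m1: "map_poly to_ac (- 1 :: 'k poly) = - 1" by (simp add: poly_eq_iff coeff_map_poly)
    have q'0: "poly (map_poly to_ac q') 0 = to_ac (Polynomial.coeff q 2)" by (simp add: q'_def)
    have eq: "x = kpt (a i) (b i) (y i) \<longleftrightarrow> to_ac (- b i) * 0 = to_ac (- a i) \<and> poly (map_poly to_ac q') 0 = w" if i: "i < 4" for i
    proof (cases "a i = 0")
      case False
      then show ?thesis using ab[OF i] infinite affine_not_infinite[THEN not_sym] by (auto simp: kpt_def)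
    next
      case True
      then show ?thesis using q(4)[OF i] infinite q'0 by (auto simp: kpt_def pt_eq_iff qv_def)
    qed
    have "has_order E x (fn 2 q' (- 1)) (int (card {i\<in>{..<4}. x = kpt (a i) (b i) (y i)}))"
    proof (cases "poly (map_poly to_ac q') 0 = w")
      case True
      have "q' ^ 2 - hp 2 = smult \<kappa> (\<Prod>i<4. [:- (- a i), - b i:])" using N2 by simp
      then have "has_order E (pt 2 0 w) (fn 2 q' (- 1)) (int (card {i\<in>{..<4}. to_ac (- b i) * 0 = to_ac (- a i)}))"
        by (intro order_plane[OF _ infinite(2) True _ q(2)]) (use ab in fastforce)+
      moreover have "{i\<in>{..<4}. x = kpt (a i) (b i) (y i)} = {i\<in>{..<4}. to_ac (- b i) * 0 = to_ac (- a i)}"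
        using eq True by auto
      ultimately show ?thesis using infinite by simp
    next
      case False
      have "{i\<in>{..<4}. x = kpt (a i) (b i) (y i)} = {}" using eq False by auto
      moreover have "has_order E x (fn 2 q' (- 1)) 0"
        by (rule order_zeroI[OF x regular_fn[OF xc]]) (use False infinite m1 in \<open>simp add: fn_pt\<close>)
      ultimately show ?thesis by (simp only:) simp
    qed
    moreover have "has_order E x (\<lambda>y. inverse (U 2 y)) (- Dinf x)"
      using has_order_inverse[OF x] order_U2[OF infinite(2)] infinite(1) by simp
    ultimately have "has_order E x (\<lambda>z. fn 2 q' (- 1) z * (inverse (U 2 z) * inverse (U 2 z)))
       (int (card {i\<in>{..<4}. x = kpt (a i) (b i) (y i)}) + (- Dinf x + - Dinf x))"
      by (intro order_mult[OF x])
    moreover have "generically E (\<lambda>z. fn 2 q' (- 1) z * (inverse (U 2 z) * inverse (U 2 z)) = fn 0 q (- 1) z)"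
    proof (rule generically_mono[OF generically_overlap])
      fix z assume z: "U 0 z ~= 0 \<and> U 2 z ~= 0 \<and> U 0 z = inverse (U 2 z) \<and> W 0 z = W 2 z * (inverse (U 2 z))\<^sup>2"
      have "map_poly to_ac q = map_poly to_ac [:Polynomial.coeff q 0, Polynomial.coeff q 1, Polynomial.coeff q 2:]"
        using quadratic_expand[OF q(1)] by simp
      then have *: "poly (map_poly to_ac q) (U 0 z) = to_ac (Polynomial.coeff q 0) + to_ac (Polynomial.coeff q 1) * U 0 z + to_ac (Polynomial.coeff q 2) * U 0 z ^ 2"
        by (simp add: power2_eq_square algebra_simps)
      then show "fn 2 q' (- 1) z * (inverse (U 2 z) * inverse (U 2 z)) = fn 0 q (- 1) z"
      proof -
        have gen: "(c2 + u * (c1 + u * c0) - w') * (inverse u * inverse u) = c0 + c1 * inverse u + c2 * inverse u ^ 2 - w' * inverse u ^ 2"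
          if "u ~= 0" for u w' c0 c1 c2 :: "'k alg_closure"
        proof -
          have ut: "u * inverse u = 1" using that by simp
          have "(c2 + u * (c1 + u * c0) - w') * (t * t) = c0 + c1 * t + c2 * t ^ 2 - w' * t ^ 2" if "u * t = 1" for t
          proof -
            have "(c2 + u * (c1 + u * c0) - w') * (t * t) = c2 * t ^ 2 + c1 * t * (u * t) + c0 * (u * t) ^ 2 - w' * t ^ 2"
              by (simp add: algebra_simps power2_eq_square)
            then show ?thesis using that by simp
          qed
          from this[OF ut] show ?thesis .
        qed
        have "fn 2 q' (- 1) z = to_ac (Polynomial.coeff q 2) + U 2 z * (to_ac (Polynomial.coeff q 1) + U 2 z * to_ac (Polynomial.coeff q 0)) - W 2 z"
          by (simp add: fn_def q'_def m1)
        moreover have "fn 0 q (- 1) z = poly (map_poly to_ac q) (U 0 z) - W 0 z" by (simp add: fn_def m1)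
        moreover have "U 2 z ~= 0" using z by blast
        ultimately show ?thesis using z gen[OF \<open>U 2 z ~= 0\<close>] * by (simp only:)
      qed
    qed
    ultimately show ?thesis unfolding sum_card using has_order_cong by simp
  qed
  obtain x where x: "x \<in> E \<inter> nz (\<lambda>v. v 0)" using generically_ex[OF generically_affine] by blast
  have "rational_function E (fn 0 q (- 1))"
    by (rule regular_imp_rational_function[OF IntD1[OF x] regular_fn[OF x]])
  with ord have "dv (fn 0 q (- 1)) (\<lambda>x. (\<Sum>i<4. single (kpt (a i) (b i) (y i)) x) - 2 * Dinf x)"
    unfolding dv_def by blast
  then show ?thesis unfolding principal_dv by blast
qed

end

section \<open>Functions with restricted poles\<close>

definition rv :: "nat => 'a::comm_ring_1 poly => 'a poly" where
  "rv N p = (\<Sum>i\<le>N. Polynomial.monom (Polynomial.coeff p i) (N - i))"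

lemma poly_map_rv:
  fixes p :: "'k::field_char_0 poly"
  assumes "Polynomial.degree p \<le> N" "u ~= 0"
  shows "poly (map_poly to_ac (rv N p)) u = u ^ N * poly (map_poly to_ac p) (inverse u)"
proof -
  have ms: "map_poly to_ac (sum h S) = (\<Sum>i\<in>S. map_poly to_ac (h i))" for h :: "nat => 'k poly" and S
    by (induction S rule: infinite_finite_induct) auto
  have "poly (map_poly to_ac (rv N p)) u = (\<Sum>i\<le>N. to_ac (Polynomial.coeff p i) * u ^ (N - i))"
    by (simp add: rv_def ms poly_sum map_poly_monom poly_monom)
  also have "\<dots> = (\<Sum>i\<le>N. u ^ N * (to_ac (Polynomial.coeff p i) * inverse u ^ i))"
    by (rule sum.cong) (use assms(2) in \<open>auto simp: power_diff divide_inverse power_inverse\<close>)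
  also have "\<dots> = u ^ N * (\<Sum>i\<le>N. Polynomial.coeff (map_poly to_ac p) i * inverse u ^ i)"
    by (simp add: sum_distrib_left coeff_map_poly)
  also have "(\<Sum>i\<le>N. Polynomial.coeff (map_poly to_ac p) i * inverse u ^ i) = poly (map_poly to_ac p) (inverse u)"
    unfolding poly_altdef
    by (rule sum.mono_neutral_right) (use assms(1) in \<open>auto simp: coeff_map_poly coeff_eq_0\<close>)
  finally show ?thesis .
qed

lemma poly_rv_0: "poly (rv N p) 0 = Polynomial.coeff p N"
proof -
  have "poly (rv N p) 0 = (\<Sum>i\<le>N. if i = N then Polynomial.coeff p i else 0)"
    unfolding rv_def poly_sum poly_monom by (rule sum.cong) (auto simp: power_0_left)
  then show ?thesis by simp
qed

context genus_one
begin

lemma fn_split: "fn c A B y = fn c A 0 y + fn c B 0 y * W c y"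
  by (simp add: fn_def)

text \<open>If w0 \<noteq> 0, the values at the two conjugate points are A + B w0 = A - B w0 = 0. At
  a branch point they coincide, and B is read off after cancelling one factor W.\<close>

lemma chart_vanish:
  assumes c: "c \<in> {0, 2}" and P: "w0 ^ 2 = poly (HP c) u0" and D: "poly (map_poly to_ac D) u0 = 0"
    and r: "!!w. w ^ 2 = w0 ^ 2 ==> \<exists>r. regular_at E (pt c u0 w) r \<and> generically E (\<lambda>y. fn c A B y = fn c D 0 y * r y)"
  shows "poly (map_poly to_ac A) u0 = 0" "poly (map_poly to_ac B) u0 = 0"
proof -
  have val: "poly (map_poly to_ac A) u0 + poly (map_poly to_ac B) u0 * w = 0" if w: "w ^ 2 = w0 ^ 2" for w
  proof -
    obtain r' where r': "regular_at E (pt c u0 w) r'" "generically E (\<lambda>y. fn c A B y = fn c D 0 y * r' y)"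
      using r[OF w] by blast
    have PE: "pt c u0 w \<in> E \<inter> nz (\<lambda>v. v c)" by (rule pt_chart[OF c]) (simp add: w P)
    from regular_generic_eq[OF IntD1[OF PE] regular_fn[OF PE] regular_mult[OF regular_fn[OF PE] r'(1)] r'(2)]
    show ?thesis using D by (simp add: fn_pt[OF c])
  qed
  from val[of w0] val[of "- w0"]
  have "2 * poly (map_poly to_ac A) u0 = 0" "2 * poly (map_poly to_ac B) u0 * w0 = 0"
    by (simp_all add: algebra_simps)
  then show A: "poly (map_poly to_ac A) u0 = 0" by simp
  show "poly (map_poly to_ac B) u0 = 0"
  proof (cases "w0 = 0")
    case False
    with \<open>2 * poly (map_poly to_ac B) u0 * w0 = 0\<close> show ?thesis by simp
  next
    case True
    then have P0: "poly (HP c) u0 = 0" using P by simp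
    have PE: "pt c u0 0 \<in> E \<inter> nz (\<lambda>v. v c)" by (rule pt_chart[OF c]) (simp add: P0)
    obtain r' where r': "regular_at E (pt c u0 0) r'" "generically E (\<lambda>y. fn c A B y = fn c D 0 y * r' y)"
      using r[of 0] True by auto
    obtain sA where sA: "regular_at E (pt c u0 0) sA" "poly (pderiv (map_poly to_ac A)) u0 ~= 0 --> sA (pt c u0 0) ~= 0"
      "eventually (\<lambda>y. fn c A 0 y = W c y * W c y * sA y) (nhdsin (zariski_on E) (pt c u0 0))"
      using ramified_factor[OF c P0 A] .
    obtain sD where sD: "regular_at E (pt c u0 0) sD" "poly (pderiv (map_poly to_ac D)) u0 ~= 0 --> sD (pt c u0 0) ~= 0"
      "eventually (\<lambda>y. fn c D 0 y = W c y * W c y * sD y) (nhdsin (zariski_on E) (pt c u0 0))"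
      using ramified_factor[OF c P0 D] .
    have "generically E (\<lambda>y. fn c 0 1 y ~= 0)" by (rule generically_fn_nonzero[OF c]) simp
    then have gW: "generically E (\<lambda>y. W c y ~= 0)" by (simp add: W_fn)
    have "generically E (\<lambda>y. W c y * sA y + fn c B 0 y = W c y * (sD y * r' y))"
    proof (rule generically_mp2[OF generically_conjI[OF r'(2) gW]
        generically_conjI[OF eventually_generically[OF IntD1[OF PE] sA(3)] eventually_generically[OF IntD1[OF PE] sD(3)]]])
      fix y assume *: "fn c A B y = fn c D 0 y * r' y \<and> W c y ~= 0"
        "fn c A 0 y = W c y * W c y * sA y \<and> fn c D 0 y = W c y * W c y * sD y"
      then have "W c y * (W c y * sA y + fn c B 0 y) = W c y * (W c y * (sD y * r' y))"
        using fn_split[of c A B y] by (simp add: algebra_simps)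
      with * show "W c y * sA y + fn c B 0 y = W c y * (sD y * r' y)" by (simp only: mult_cancel_left) simp
    qed
    note gen = this
    have rL: "regular_at E (pt c u0 0) (\<lambda>y. W c y * sA y + fn c B 0 y)"
      by (intro regular_add regular_mult regular_UW[OF PE] regular_fn[OF PE] sA(1))
    have rR: "regular_at E (pt c u0 0) (\<lambda>y. W c y * (sD y * r' y))"
      by (intro regular_mult regular_UW[OF PE] sD(1) r'(1))
    have "W c (pt c u0 0) * sA (pt c u0 0) + fn c B 0 (pt c u0 0) = W c (pt c u0 0) * (sD (pt c u0 0) * r' (pt c u0 0))"
      by (rule regular_generic_eq[OF IntD1[OF PE] rL rR gen])
    then show ?thesis by (simp add: UW_pt[OF c] fn_pt[OF c])
  qed
qed

text \<open>Extending by the conjugate S - T w turns the denominator into the norm S^2 - T^2 h, a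
  polynomial in x alone.\<close>

lemma rational_function_fraction:
  assumes "rational_function E f"
  obtains A B D where "D ~= 0" "generically E (\<lambda>y. fn 0 D 0 y * f y = fn 0 A B y)"
proof -
  obtain x where x: "x \<in> E" "regular_at E x f" "x \<in> E \<inter> nz (\<lambda>v. v 0)"
    using generically_ex[OF generically_conjI[OF rational_function_regular[OF assms] generically_affine]] by blast
  then obtain u w where uw: "x = pt 0 u w" "w ^ 2 = poly (HP 0) u" using E_nz_chart[of 0] by auto
  have z: "0 \<in> {0, 2 :: nat}" and reg: "regular_at E (pt 0 u w) f" using x(2) uw(1) by simp_all
  obtain A B S T where *: "fn 0 S T (pt 0 u w) ~= 0" "f (pt 0 u w) = fn 0 A B (pt 0 u w) / fn 0 S T (pt 0 u w)"
    "eventually (\<lambda>y. f y = fn 0 A B y / fn 0 S T y) (nhdsin (zariski_on E) (pt 0 u w))"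
    using local_form[OF z uw(2) reg] .
  have ST: "S ~= 0 \<or> T ~= 0" using *(1) by (auto simp: fn_def)
  define D where "D = S * S - T * T * h0"
  have "D ~= 0"
  proof
    assume "D = 0"
    then have "(map_poly to_ac S) ^ 2 = (map_poly to_ac T) ^ 2 * HP 0"
      by (simp add: D_def power2_eq_square flip: map_ac_mult)
    from norm_eq_zero[OF HP_sqfree HP_degree this] ST show False by simp
  qed
  moreover have "generically E (\<lambda>y. fn 0 D 0 y * f y = fn 0 (A * S + B * - T * h0) (A * - T + B * S) y)"
  proof (rule generically_mp2[OF generically_conjI[OF eventually_generically[OF _ *(3)] generically_fn_nonzero[OF _ ST]] generically_affine])
    fix y assume y: "f y = fn 0 A B y / fn 0 S T y \<and> fn 0 S T y ~= 0" "y \<in> E \<inter> nz (\<lambda>v. v 0)"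
    have "fn 0 S T y * fn 0 S (- T) y = fn 0 D 0 y"
      using fn_mult[OF y(2), of S T S "- T"] by (simp add: D_def mult.commute)
    then have "fn 0 D 0 y * f y = fn 0 A B y * fn 0 S (- T) y" using y(1) by (simp flip: \<open>fn 0 S T y * fn 0 S (- T) y = fn 0 D 0 y\<close>)
    then show "fn 0 D 0 y * f y = fn 0 (A * S + B * - T * h0) (A * - T + B * S) y"
      using fn_mult[OF y(2), of A B S "- T"] by simp
  qed (use x(1) uw(1) in auto)
  ultimately show ?thesis by (rule that)
qed

text \<open>The coordinate ring k[x, y] is integrally closed. At a root of a denominator D of least
  degree, \<open>chart_vanish\<close> shows that the minimal polynomial of the root cancels from A,
  B and D.\<close>

lemma integral_affine:
  assumes f: "rational_function E f"
    and reg: "!!x. x \<in> E \<inter> nz (\<lambda>v. v 0) ==> \<exists>r. regular_at E x r \<and> generically E (\<lambda>y. f y = r y)"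
  obtains a b where "generically E (\<lambda>y. f y = fn 0 a b y)"
proof -
  define S where "S = {(A, B, D). D ~= 0 \<and> generically E (\<lambda>y. fn 0 D 0 y * f y = fn 0 A B y)}"
  obtain A0 B0 D0 where "D0 ~= 0" "generically E (\<lambda>y. fn 0 D0 0 y * f y = fn 0 A0 B0 y)"
    using rational_function_fraction[OF f] .
  then have "(A0, B0, D0) \<in> S" by (simp add: S_def)
  then have "\<exists>s. s \<in> S \<and> (\<forall>s'. s' \<in> S --> Polynomial.degree (snd (snd s)) \<le> Polynomial.degree (snd (snd s')))"
    by (rule ex_has_least_nat)
  then obtain s where s: "s \<in> S" and min: "\<forall>s'. s' \<in> S --> Polynomial.degree (snd (snd s)) \<le> Polynomial.degree (snd (snd s'))"
    by (elim exE conjE)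
  obtain A B D where sABD: "s = (A, B, D)" by (cases s)
  with s have D: "D ~= 0" "generically E (\<lambda>y. fn 0 D 0 y * f y = fn 0 A B y)" by (auto simp: S_def)
  have "Polynomial.degree D = 0"
  proof (rule ccontr)
    assume "Polynomial.degree D ~= 0"
    then obtain u0 where u0: "poly (map_poly to_ac D) u0 = 0"
      using alg_closed_imp_poly_has_root[of "map_poly to_ac D"] by auto
    obtain w0 where w0: "w0 ^ 2 = poly (HP 0) u0" using ex_sqrt by blast
    have r: "\<exists>r. regular_at E (pt 0 u0 w) r \<and> generically E (\<lambda>y. fn 0 A B y = fn 0 D 0 y * r y)" if w: "w ^ 2 = w0 ^ 2" for w
    proof -
      have "pt 0 u0 w \<in> E \<inter> nz (\<lambda>v. v 0)" using pt_chart[of 0 w u0] w w0 by simp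
      then obtain r where r: "regular_at E (pt 0 u0 w) r" "generically E (\<lambda>y. f y = r y)" using reg by blast
      have "generically E (\<lambda>y. fn 0 A B y = fn 0 D 0 y * r y)" by (rule generically_mp2[OF D(2) r(2)]) simp
      with r show ?thesis by blast
    qed
    have AB: "poly (map_poly to_ac A) u0 = 0" "poly (map_poly to_ac B) u0 = 0"
      using chart_vanish[OF _ w0 u0 r] by simp_all
    obtain m where m: "m ~= 0" "poly (map_poly to_ac m) u0 = 0" "!!q. poly (map_poly to_ac q) u0 = 0 ==> m dvd q"
      using minimal_polynomial[of u0] by blast
    obtain A1 where A1: "A = m * A1" using m(3)[OF AB(1)] by (auto simp: dvd_def)
    obtain B1 where B1: "B = m * B1" using m(3)[OF AB(2)] by (auto simp: dvd_def)
    obtain D1 where D1: "D = m * D1" using m(3)[OF u0] by (auto simp: dvd_def)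
    have "generically E (\<lambda>y. fn 0 m 0 y ~= 0)" by (rule generically_fn_nonzero) (use m(1) in auto)
    then have "generically E (\<lambda>y. fn 0 D1 0 y * f y = fn 0 A1 B1 y)"
    proof (rule generically_mp2[OF D(2)])
      fix y assume y: "fn 0 D 0 y * f y = fn 0 A B y" "fn 0 m 0 y ~= 0"
      then have "fn 0 m 0 y * (fn 0 D1 0 y * f y) = fn 0 m 0 y * fn 0 A1 B1 y"
        by (simp add: A1 B1 D1 fn_def algebra_simps)
      with y(2) show "fn 0 D1 0 y * f y = fn 0 A1 B1 y" by (simp only: mult_cancel_left) simp
    qed
    moreover have "D1 ~= 0" using D D1 by auto
    ultimately have "(A1, B1, D1) \<in> S" by (simp add: S_def)
    with min have "Polynomial.degree D \<le> Polynomial.degree D1" by (force simp: sABD)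
    moreover have "Polynomial.degree D = Polynomial.degree m + Polynomial.degree D1"
      unfolding D1 using m(1) \<open>D1 ~= 0\<close> by (rule degree_mult_eq)
    ultimately have "Polynomial.degree m = 0" by simp
    then obtain e where "m = [:e:]" by (rule degree_eq_zeroE)
    with m show False by simp
  qed
  then obtain d where d: "D = [:d:]" by (rule degree_eq_zeroE)
  have "generically E (\<lambda>y. f y = fn 0 (smult (inverse d) A) (smult (inverse d) B) y)"
  proof (rule generically_mono[OF D(2)])
    fix y assume "fn 0 D 0 y * f y = fn 0 A B y"
    then have "to_ac (inverse d) * (to_ac d * f y) = to_ac (inverse d) * fn 0 A B y" by (simp add: d fn_pure)
    moreover have "to_ac (inverse d) * to_ac d = 1" using D(1) d by simp
    then have "to_ac (inverse d) * (to_ac d * f y) = f y" by (simp only: mult.assoc[symmetric] mult_1)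
    ultimately show "f y = fn 0 (smult (inverse d) A) (smult (inverse d) B) y"
      by (simp add: fn_def algebra_simps)
  qed
  then show ?thesis by (rule that)
qed

text \<open>The space L(Dinf) is spanned by 1 and x: a function with larger degrees would have at
  infinity a pole of higher order than x.\<close>

lemma linear_growth:
  assumes f: "generically E (\<lambda>y. f y = fn 0 a b y)"
    and reg: "!!w. w ^ 2 = poly (HP 2) 0 ==> \<exists>r. regular_at E (pt 2 0 w) r \<and> generically E (\<lambda>y. U 2 y * f y = r y)"
  shows "b = 0" "Polynomial.degree a \<le> 1"
proof -
  \<comment> \<open>The excess of the pole order over the permitted one, counted in powers of 1/u; y
    contributes two such powers.\<close>
  define n where "n = max (Polynomial.degree a - 1) (if b = 0 then 0 else Polynomial.degree b + 1)"
  have "n = 0"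
  proof (rule ccontr)
    assume "n ~= 0"
    then obtain n' where n': "n = Suc n'" by (cases n) auto
    have da: "Polynomial.degree a \<le> n + 1" and db: "Polynomial.degree b \<le> n'" using n' unfolding n_def by (auto split: if_splits)
    define \<alpha> \<beta> where "\<alpha> = rv (n + 1) a" and "\<beta> = rv n' b"
    have key: "generically E (\<lambda>y. U 2 y ^ n * (U 2 y * f y) = fn 2 \<alpha> \<beta> y)"
    proof (rule generically_mp2[OF f generically_overlap])
      fix y assume y: "f y = fn 0 a b y" "U 0 y ~= 0 \<and> U 2 y ~= 0 \<and> U 0 y = inverse (U 2 y) \<and> W 0 y = W 2 y * (inverse (U 2 y))\<^sup>2"
      have 1: "poly (map_poly to_ac \<alpha>) (U 2 y) = U 2 y ^ (n + 1) * poly (map_poly to_ac a) (U 0 y)"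
        unfolding \<alpha>_def using poly_map_rv[OF da] y(2) by simp
      have 2: "poly (map_poly to_ac \<beta>) (U 2 y) = U 2 y ^ n' * poly (map_poly to_ac b) (U 0 y)"
        unfolding \<beta>_def using poly_map_rv[OF db] y(2) by simp
      have "U 2 y ^ 2 * inverse (U 2 y) ^ 2 = 1" using y(2) by (simp flip: power_mult_distrib)
      then have "U 2 y ^ 2 * W 0 y = W 2 y" using y(2) by (simp add: mult.left_commute)
      then have "fn 2 \<alpha> \<beta> y = U 2 y ^ (n + 1) * poly (map_poly to_ac a) (U 0 y) + U 2 y ^ n' * poly (map_poly to_ac b) (U 0 y) * (U 2 y ^ 2 * W 0 y)"
        unfolding fn_def 1 2 by simp
      then show "U 2 y ^ n * (U 2 y * f y) = fn 2 \<alpha> \<beta> y"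
        unfolding y(1) n' by (simp add: fn_def algebra_simps power2_eq_square)
    qed
    obtain w0 where w0: "w0 ^ 2 = poly (HP 2) 0" using ex_sqrt by blast
    define D where "D = Polynomial.monom (1::'k) n"
    have D: "fn 2 D 0 y = U 2 y ^ n" for y by (simp add: D_def fn_pure map_poly_monom poly_monom)
    have D0: "poly (map_poly to_ac D) 0 = 0" using n' by (simp add: D_def map_poly_monom poly_monom)
    have r: "\<exists>r. regular_at E (pt 2 0 w) r \<and> generically E (\<lambda>y. fn 2 \<alpha> \<beta> y = fn 2 D 0 y * r y)" if w: "w ^ 2 = w0 ^ 2" for w
    proof -
      obtain r where r: "regular_at E (pt 2 0 w) r" "generically E (\<lambda>y. U 2 y * f y = r y)" using reg[of w] w w0 by auto
      have "generically E (\<lambda>y. fn 2 \<alpha> \<beta> y = fn 2 D 0 y * r y)" by (rule generically_mp2[OF key r(2)]) (simp add: D)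
      with r show ?thesis by blast
    qed
    have "poly (map_poly to_ac \<alpha>) (to_ac 0) = 0" "poly (map_poly to_ac \<beta>) (to_ac 0) = 0"
      using chart_vanish[OF _ w0 D0 r] by simp_all
    then have "Polynomial.coeff a (n + 1) = 0" "Polynomial.coeff b n' = 0"
      unfolding poly_map_to_ac \<alpha>_def \<beta>_def poly_rv_0 by simp_all
    moreover have "Polynomial.degree a = n + 1 \<or> (b ~= 0 \<and> Polynomial.degree b = n')"
      using n' unfolding n_def by (auto simp: max_def split: if_splits)
    ultimately show False using n' by (metis Suc_eq_plus1 degree_0 leading_coeff_0_iff nat.distinct(1))
  qed
  then show "b = 0" "Polynomial.degree a \<le> 1" unfolding n_def by (auto split: if_splits)
qed

lemma order_const: "x \<in> E ==> d ~= 0 ==> has_order E x (\<lambda>_. to_ac d) 0"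
  by (rule order_zeroI) (auto intro: regular_const)

text \<open>This is where the genus enters. A function with divisor p - q, multiplied by x - x(q),
  has divisor p + q' - Dinf with q' opposite to q, so it is linear in x by
  \<open>linear_growth\<close>. Such a function has equal orders at q and q', and even order at a
  branch point; both are violated if p \<noteq> q.\<close>

lemma single_point_unique:
  assumes P: "kon ap bp yp" and Q: "kon aq bq yq"
    and pr: "principal_divisor E (\<lambda>x. single (kpt ap bp yp) x - single (kpt aq bq yq) x)"
  shows "kpt ap bp yp = kpt aq bq yq"
proof (rule ccontr)
  assume ne: "kpt ap bp yp ~= kpt aq bq yq"
  define p q q' where "p = kpt ap bp yp" and "q = kpt aq bq yq" and "q' = kpt aq bq (- yq)"
  have qE: "q \<in> E" "q' \<in> E" using kpt_E Q kpt_E[OF kon_signed[OF Q]] by (auto simp: q_def q'_def)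
  obtain f where f: "rational_function E f" "!!x. x \<in> E ==> has_order E x f (single p x - single q x)"
    using pr unfolding principal_dv dv_def p_def q_def by blast
  \<comment> \<open>If q is at infinity, q + q' equals Dinf already and the factor is 1.\<close>
  define L where "L = (\<lambda>y. if aq = 0 then 1 else U 0 y - to_ac bq)"
  define DL where "DL x = (if aq = 0 then 0 else (if x \<in> nz (\<lambda>v. v 0) \<and> U 0 x = to_ac bq then (if W 0 x = 0 then 2 else 1) else 0) - Dinf x)" for x
  have L: "rational_function E L" "!!x. x \<in> E ==> has_order E x L (DL x)"
  proof -
    have "rational_function E (\<lambda>_. to_ac 1)" using regular_imp_rational_function[OF qE(1) regular_const] .
    then show "rational_function E L" using dv_linear[of bq] unfolding L_def dv_def by (cases "aq = 0") auto
    show "has_order E x L (DL x)" if "x \<in> E" for x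
      using dv_linear[of bq] order_one[OF that] that unfolding L_def DL_def dv_def by (cases "aq = 0") auto
  qed
  define f1 where "f1 y = f y * L y" for y
  have f1: "rational_function E f1" "!!x. x \<in> E ==> has_order E x f1 (single p x - single q x + DL x)"
    unfolding f1_def using rational_function_mult[OF f(1) L(1)] order_mult[OF _ f(2) L(2)] by blast+
  have Dnn: "Dinf x \<ge> 0" for x by (simp add: Dinf_def)
  have snn: "single p x \<ge> 0" "single q x \<le> 1" for x by (simp_all add: single_def)
  have qaff: "aq ~= 0 ==> aq = 1 \<and> q = pt 0 (to_ac bq) (to_ac yq) \<and> q' = pt 0 (to_ac bq) (- to_ac yq) \<and>
     q \<in> E \<inter> nz (\<lambda>v. v 0) \<and> q' \<in> E \<inter> nz (\<lambda>v. v 0)"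
  proof -
    assume "aq ~= 0"
    then have *: "aq = 1" "yq ^ 2 = poly h0 bq" using Q by (auto simp: kon_def)
    then have "(to_ac yq) ^ 2 = poly (HP 0) (to_ac bq)" by (simp add: poly_map_to_ac flip: to_ac_power)
    then show ?thesis using * pt_chart[of 0 "to_ac yq" "to_ac bq"] pt_chart[of 0 "- to_ac yq" "to_ac bq"]
      by (simp add: q_def q'_def kpt_def)
  qed
  have qinf: "aq = 0 ==> q = pt 2 0 (to_ac yq) \<and> q' = pt 2 0 (- to_ac yq) \<and> q \<notin> nz (\<lambda>v. v 0) \<and> q' \<notin> nz (\<lambda>v. v 0)"
    using infinite_not_nz by (auto simp: q_def q'_def kpt_def)
  have reg_aff: "\<exists>r. regular_at E x r \<and> generically E (\<lambda>y. f1 y = r y)" if x: "x \<in> E \<inter> nz (\<lambda>v. v 0)" for x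
  proof -
    have "single p x - single q x + DL x \<ge> 0"
    proof (cases "x = q")
      case True
      with x qinf have "aq ~= 0" by auto
      with qaff True x have "DL x \<ge> 1" unfolding DL_def by (auto simp: UW_pt Dinf_def)
      with snn[of x] show ?thesis by linarith
    next
      case False
      then have "single q x = 0" by (simp add: single_def)
      moreover have "DL x \<ge> 0" using x by (auto simp: DL_def Dinf_def)
      ultimately show ?thesis using snn[of x] by linarith
    qed
    from order_regular[OF IntD1[OF x] f1(2)[OF IntD1[OF x]] this] show ?thesis by blast
  qed
  obtain a b where ab: "generically E (\<lambda>y. f1 y = fn 0 a b y)" using integral_affine[OF f1(1) reg_aff] .
  have reg_inf: "\<exists>r. regular_at E (pt 2 0 w) r \<and> generically E (\<lambda>y. U 2 y * f1 y = r y)" if w: "w ^ 2 = poly (HP 2) 0" for w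
  proof -
    have x: "pt 2 0 w \<in> E" using pt_in_E[of 2] w by simp
    have "has_order E (pt 2 0 w) (\<lambda>y. U 2 y * f1 y) (Dinf (pt 2 0 w) + (single p (pt 2 0 w) - single q (pt 2 0 w) + DL (pt 2 0 w)))"
      by (rule order_mult[OF x order_U2[OF w] f1(2)[OF x]])
    moreover have "Dinf (pt 2 0 w) + (single p (pt 2 0 w) - single q (pt 2 0 w) + DL (pt 2 0 w)) \<ge> 0"
    proof (cases "aq = 0")
      case True
      then have "DL (pt 2 0 w) = 0" "Dinf (pt 2 0 w) \<ge> 1" using infinite_not_nz by (auto simp: DL_def Dinf_def)
      with snn[of "pt 2 0 w"] show ?thesis by linarith
    next
      case False
      then have "single q (pt 2 0 w) = 0" "DL (pt 2 0 w) = - Dinf (pt 2 0 w)"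
        using qaff[OF False] False infinite_not_nz[of w] affine_not_infinite[of "to_ac bq" "to_ac yq" w, symmetric]
        by (simp_all add: DL_def single_def)
      with snn[of "pt 2 0 w"] show ?thesis by linarith
    qed
    ultimately show ?thesis using order_regular[OF x] by blast
  qed
  note growth = linear_growth[OF ab reg_inf]
  have fa: "generically E (\<lambda>y. f1 y = fn 0 a 0 y)" using ab growth(1) by simp
  obtain a0 a1 where a: "a = [:a0, a1:]"
    using quadratic_expand[of a] growth(2) by (simp add: coeff_eq_0)
  have orda: "has_order E x (fn 0 a 0) (single p x - single q x + DL x)" if "x \<in> E" for x
    using has_order_cong[OF f1(2)[OF that] fa] .
  have "a ~= 0"
  proof
    assume "a = 0"
    then have "generically E (\<lambda>_. False)" using order_nonzero[OF qE(1) orda[OF qE(1)]] by (simp add: fn_def)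
    then show False using generically_not_False by blast
  qed
  have pq: "single p q = 0" "single q q = 1" using ne by (simp_all add: single_def p_def q_def)
  have lin: "has_order E x (fn 0 (smult a1 [:- d, 1:]) 0) ((if x \<in> nz (\<lambda>v. v 0) \<and> U 0 x = to_ac d then (if W 0 x = 0 then 2 else 1) else 0) - Dinf x)"
    if "x \<in> E" "a1 ~= 0" for x d
  proof -
    have "has_order E x (\<lambda>y. to_ac a1 * (U 0 y - to_ac d)) (0 + ((if x \<in> nz (\<lambda>v. v 0) \<and> U 0 x = to_ac d then (if W 0 x = 0 then 2 else 1) else 0) - Dinf x))"
      using order_mult[OF that(1) order_const[OF that]] dv_linear[of d] that(1) unfolding dv_def by blast
    moreover have "fn 0 (smult a1 [:- d, 1:]) 0 = (\<lambda>y. to_ac a1 * (U 0 y - to_ac d))"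
      by (auto simp: fn_def fun_eq_iff algebra_simps)
    ultimately show ?thesis by simp
  qed
  show False
  proof (cases "aq = 0")
    case False
    note qa = qaff[OF False]
    have DLq: "DL q = (if yq = 0 then 2 else 1)" "DL q' = (if yq = 0 then 2 else 1)"
      using qa False unfolding DL_def by (auto simp: UW_pt Dinf_def)
    show False
    proof (cases "poly a bq = 0")
      case True
      then have "a = smult a1 [:- bq, 1:]" "a1 ~= 0" using a \<open>a ~= 0\<close> by (auto simp: add_eq_0_iff2 algebra_simps)
      with lin[OF qE(1), of bq] have "has_order E q (fn 0 a 0) (if yq = 0 then 2 else 1)"
        using qa by (auto simp: UW_pt Dinf_def)
      from order_unique[OF qE(1) this orda[OF qE(1)]] pq DLq show False by simp
    next
      case False
      have o: "has_order E x (fn 0 a 0) 0" if "x \<in> E \<inter> nz (\<lambda>v. v 0)" "U 0 x = to_ac bq" for x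
        by (rule order_zeroI[OF IntD1[OF that(1)] regular_fn[OF that(1)]])
           (use that(2) False in \<open>simp add: fn_def poly_map_to_ac\<close>)
      have "has_order E q (fn 0 a 0) 0" "has_order E q' (fn 0 a 0) 0" using o qa by (auto simp: UW_pt)
      from order_unique[OF qE(1) this(1) orda[OF qE(1)]] order_unique[OF qE(2) this(2) orda[OF qE(2)]]
      have *: "0 = single p q - single q q + DL q" "0 = single p q' - single q q' + DL q'" by auto
      then have "yq ~= 0" using pq DLq by (auto split: if_splits)
      then have "q' ~= q" using qa by (auto simp: pt_eq_iff)
      then have "single q q' = 0" by (simp add: single_def)
      with * DLq snn[of q'] show False by (auto split: if_splits)
    qed
  next
    case True
    note qi = qinf[OF True]
    have DL0: "DL x = 0" for x using True by (simp add: DL_def)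
    show False
    proof (cases "a1 = 0")
      case True
      then have "a0 ~= 0" using a \<open>a ~= 0\<close> by simp
      have "fn 0 a 0 = (\<lambda>_. to_ac a0)" using True a by (auto simp: fn_def fun_eq_iff)
      with order_const[OF qE(1) \<open>a0 ~= 0\<close>] have "has_order E q (fn 0 a 0) 0" by simp
      from order_unique[OF qE(1) this orda[OF qE(1)]] pq DL0 show False by simp
    next
      case False
      have "a = smult a1 [:- (- a0 / a1), 1:]" using a False by simp
      with lin[OF _ False, of _ "- a0 / a1"] qi
      have "has_order E q (fn 0 a 0) (- Dinf q)" "has_order E q' (fn 0 a 0) (- Dinf q')" using qE by force+
      from order_unique[OF qE(1) this(1) orda[OF qE(1)]] order_unique[OF qE(2) this(2) orda[OF qE(2)]]
      have *: "- Dinf q = single p q - single q q + DL q" "- Dinf q' = single p q' - single q q' + DL q'" by auto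
      then have "Dinf q = 1" using pq DL0 by simp
      then have "yq ~= 0" using qi by (auto simp: Dinf_def UW_pt split: if_splits)
      then have "q' ~= q" using qi by (auto simp: pt_eq_iff)
      then have "single q q' = 0" by (simp add: single_def)
      moreover have "q' \<notin> nz (\<lambda>v. v 0)" using qi by blast
      then have "Dinf q' \<ge> 1" unfolding Dinf_def by simp
      ultimately show False using * DL0 snn[of q'] by simp
    qed
  qed
qed

end

section \<open>The Mordell-Weil group through explicit addition\<close>

context genus_one
begin

definition on :: "'k \<times> 'k \<times> 'k => bool" where "on P = (case P of (a, b, y) => kon a b y)"
definition KP :: "'k \<times> 'k \<times> 'k => 'k alg_closure ppoint" where "KP P = (case P of (a, b, y) => kpt a b y)"

end

definition neg :: "'a \<times> 'a \<times> 'a => 'a \<times> 'a \<times> ('a :: uminus)" where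
  "neg P = (fst P, fst (snd P), - snd (snd P))"

lemma neg_neg [simp]: "neg (neg P) = (P :: 'a \<times> 'a \<times> 'a::group_add)"
  by (simp add: neg_def)

definition linf :: "'a \<times> 'a \<times> 'a => 'a :: comm_ring_1 poly" where
  "linf P = [:- fst (snd P), fst P:]"

definition qvp :: "'a::comm_ring_1 poly => 'a \<times> 'a \<times> 'a => 'a" where
  "qvp q P = (if fst P = 0 then Polynomial.coeff q 2 else poly q (fst (snd P)))"

text \<open>Four points of \<open>y\<^sup>2 = h(x)\<close> are the intersection of the curve with a conic \<open>y = q(x)\<close>.\<close>

definition cop4 :: "'a::field poly => 'a \<times> 'a \<times> 'a => 'a \<times> 'a \<times> 'a => 'a \<times> 'a \<times> 'a => 'a \<times> 'a \<times> 'a => bool" where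
  "cop4 h P1 P2 P3 P4 \<longleftrightarrow> (\<exists>q \<kappa>. Polynomial.degree q \<le> 2 \<and> \<kappa> ~= 0 \<and>
     q ^ 2 - h = smult \<kappa> (linf P1 * linf P2 * linf P3 * linf P4) \<and>
     qvp q P1 = snd (snd P1) \<and> qvp q P2 = snd (snd P2) \<and> qvp q P3 = snd (snd P3) \<and> qvp q P4 = snd (snd P4))"

text \<open>Encodes P + Q \<sim> S + Z, that is, S is the sum for the origin Z. In general P, Q, -Z,
  -S are cut out by a conic. The other three alternatives are those in which two of P, Q, -Z are
  opposite, so that no conic can be interpolated.\<close>

definition srel :: "'a::field poly => 'a \<times> 'a \<times> 'a => 'a \<times> 'a \<times> 'a => 'a \<times> 'a \<times> 'a => 'a \<times> 'a \<times> 'a => bool" where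
  "srel h P Q Z S \<longleftrightarrow> (P = Z \<and> S = Q) \<or> (Q = Z \<and> S = P) \<or> (P = neg Q \<and> S = neg Z) \<or> cop4 h P Q (neg Z) (neg S)"

context genus_one
begin

lemma on_neg: "on P ==> on (neg P)"
  by (auto simp: on_def neg_def kon_signed split: prod.splits)

lemma rational_points_KP: "rational_points E = KP ` {P. on P}"
  unfolding rational_points_kpt KP_def on_def by (auto simp: image_iff split: prod.splits) blast

lemma KP_eq_iff: "on P ==> on Q ==> KP P = KP Q \<longleftrightarrow> P = Q"
  by (auto simp: KP_def on_def kpt_eq_iff split: prod.splits)

lemma prod4: "(\<Prod>i<4. F i) = F 0 * F 1 * F 2 * F (3::nat)" for F :: "nat => 'b::comm_monoid_mult"
proof -
  have "{..<4::nat} = {0, 1, 2, 3}" by auto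
  then show ?thesis by (simp add: mult.assoc)
qed

lemma all4: "(\<forall>i<4. R i) \<longleftrightarrow> R 0 \<and> R 1 \<and> R 2 \<and> R (3::nat)"
proof -
  have "{..<4::nat} = {0, 1, 2, 3}" by auto
  then have "(\<forall>i\<in>{..<4}. R i) \<longleftrightarrow> R 0 \<and> R 1 \<and> R 2 \<and> R 3" by simp
  then show ?thesis by auto
qed

lemma cop_cop4:
  "cop a b y \<longleftrightarrow> cop4 h0 (a 0, b 0, y 0) (a 1, b 1, y 1) (a 2, b 2, y 2) (a 3, b 3, y 3)"
  unfolding cop_def cop4_def prod4 all4 linf_def qvp_def qv_def by simp

lemma fourth_point4:
  assumes "on P" "on Q" "on R" "P ~= neg Q" "P ~= neg R" "Q ~= neg R"
  obtains S where "on S" "cop4 h0 P Q R S"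
proof -
  define a b y where "a = (\<lambda>i::nat. fst (if i = 0 then P else if i = 1 then Q else R))"
    and "b = (\<lambda>i::nat. fst (snd (if i = 0 then P else if i = 1 then Q else R)))"
    and "y = (\<lambda>i::nat. snd (snd (if i = 0 then P else if i = 1 then Q else R)))"
  have aby: "(a i, b i, y i) = (if i = 0 then P else if i = 1 then Q else R)" for i
    by (simp add: a_def b_def y_def)
  have kon: "kon (a i) (b i) (y i)" for i
    using assms(1-3) aby[of i] by (cases "i = 0"; cases "i = 1") (auto simp: on_def)
  have nc: "\<not> (a i = a j \<and> b i = b j \<and> y i = - y j)" if "i < 3" "j < 3" "i ~= j" for i j
  proof
    assume "a i = a j \<and> b i = b j \<and> y i = - y j"
    then have *: "(a i, b i, y i) = neg (a j, b j, y j)" by (simp add: neg_def)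
    have "i \<in> {0, 1, 2}" "j \<in> {0, 1, 2}" using that by auto
    with that * assms(4-6) show False unfolding aby
      by (auto split: if_splits)
  qed
  obtain a3 b3 y3 where 3: "kon a3 b3 y3" "cop (a(3 := a3)) (b(3 := b3)) (y(3 := y3))"
    using fourth_point[of a b y] kon nc by blast
  show ?thesis
  proof (rule that[of "(a3, b3, y3)"])
    show "on (a3, b3, y3)" using 3(1) by (simp add: on_def)
    have "cop4 h0 (a 0, b 0, y 0) (a 1, b 1, y 1) (a 2, b 2, y 2) (a3, b3, y3)"
      using 3(2) unfolding cop_cop4 by simp
    then show "cop4 h0 P Q R (a3, b3, y3)" unfolding aby by simp
  qed
qed

lemma srel_exists:
  assumes "on P" "on Q" "on Z"
  shows "\<exists>S. on S \<and> srel h0 P Q Z S"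
proof (cases "P = Z \<or> Q = Z \<or> P = neg Q")
  case True
  then show ?thesis using assms on_neg unfolding srel_def by metis
next
  case False
  then have "P ~= neg (neg Z)" "Q ~= neg (neg Z)" "P ~= neg Q" by auto
  then obtain S where S: "on S" "cop4 h0 P Q (neg Z) S" using fourth_point4[OF assms(1,2) on_neg[OF assms(3)]] by blast
  have "on (neg S) \<and> srel h0 P Q Z (neg S)" using S on_neg unfolding srel_def by simp
  then show ?thesis by blast
qed

definition sg :: "'k \<times> 'k \<times> 'k => 'k alg_closure ppoint => int" where "sg P = single (KP P)"

lemma principal_KP_fibre: "on P ==> principal_divisor E (\<lambda>x. sg P x + sg (neg P) x - Dinf x)"
  using principal_fibre by (auto simp: on_def sg_def KP_def neg_def split: prod.splits)

lemma principal_cop4: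
  assumes "on P1" "on P2" "on P3" "on P4" "cop4 h0 P1 P2 P3 P4"
  shows "principal_divisor E (\<lambda>x. sg P1 x + sg P2 x + sg P3 x + sg P4 x - 2 * Dinf x)"
proof -
  define F where "F i = (if i = 0 then P1 else if i = 1 then P2 else if i = 2 then P3 else P4)" for i :: nat
  have "cop (\<lambda>i. fst (F i)) (\<lambda>i. fst (snd (F i))) (\<lambda>i. snd (snd (F i)))"
    unfolding cop_cop4 using assms(5) by (simp add: F_def)
  note cop = this
  have "kon (fst (F i)) (fst (snd (F i))) (snd (snd (F i)))" for i
    using assms(1-4) by (auto simp: F_def on_def split: prod.splits)
  from principal_cop[OF this cop]
  have "principal_divisor E (\<lambda>x. (\<Sum>i<4. single (kpt (fst (F i)) (fst (snd (F i))) (snd (snd (F i)))) x) - 2 * Dinf x)" .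
  moreover have "{..<4::nat} = {0, 1, 2, 3}" by auto
  ultimately show ?thesis by (simp add: F_def sg_def KP_def case_prod_beta add.assoc)
qed

text \<open>In the conic case the fibres Z + (-Z) and S + (-S), each equivalent to
  \<open>Dinf\<close>, are subtracted from the divisor of the four points.\<close>

lemma srel_principal:
  assumes "on P" "on Q" "on Z" "on S" "srel h0 P Q Z S"
  shows "principal_divisor E (\<lambda>x. sg P x + sg Q x - sg S x - sg Z x)"
proof -
  have fz: "principal_divisor E (\<lambda>x. sg Z x + sg (neg Z) x - Dinf x)" using principal_KP_fibre[OF assms(3)] .
  have fs: "principal_divisor E (\<lambda>x. sg S x + sg (neg S) x - Dinf x)" using principal_KP_fibre[OF assms(4)] .
  consider "P = Z \<and> S = Q \<or> Q = Z \<and> S = P" | "P = neg Q" "S = neg Z" | "cop4 h0 P Q (neg Z) (neg S)"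
    using assms(5) unfolding srel_def by blast
  then show ?thesis
  proof cases
    case 1
    then have "(\<lambda>x. sg P x + sg Q x - sg S x - sg Z x) = (\<lambda>x. 0)" by auto
    then show ?thesis using principal_zero by simp
  next
    case 2
    have "principal_divisor E (\<lambda>x. sg Q x + sg (neg Q) x - Dinf x)" using principal_KP_fibre[OF assms(2)] .
    from principal_diff[OF this fz] 2 show ?thesis by (simp add: algebra_simps)
  next
    case 3
    from principal_diff[OF principal_diff[OF principal_cop4[OF assms(1,2) on_neg[OF assms(3)] on_neg[OF assms(4)] 3] fz] fs]
    show ?thesis by (simp add: algebra_simps)
  qed
qed

lemma sg_unique:
  assumes "on P" "on Q" "principal_divisor E (\<lambda>x. sg P x - sg Q x)"
  shows "P = Q"
proof -
  obtain a b y a' b' y' where PQ: "P = (a, b, y)" "Q = (a', b', y')" by (cases P, cases Q)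
  with assms have "KP P = KP Q"
    using single_point_unique[of a b y a' b' y'] by (simp add: on_def sg_def KP_def)
  with KP_eq_iff[OF assms(1,2)] show ?thesis by simp
qed

abbreviation MW where "MW Z \<equiv> mordell_weil_group E (KP Z)"

text \<open>Existence of the sum comes from the conic and uniqueness from \<open>sg_unique\<close>,
  which resolves the THE in the group. From here on sums are computed by divisors for formal
  identities and by \<open>srel\<close> for explicit points.\<close>

lemma MW_mult:
  assumes "on P" "on Q" "on Z" "on S"
  shows "KP P \<otimes>\<^bsub>MW Z\<^esub> KP Q = KP S \<longleftrightarrow> principal_divisor E (\<lambda>x. sg P x + sg Q x - sg S x - sg Z x)"
    "KP P \<otimes>\<^bsub>MW Z\<^esub> KP Q = KP S \<longleftrightarrow> srel h0 P Q Z S"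
proof -
  define R where "R r \<longleftrightarrow> r \<in> rational_points E \<and>
        principal_divisor E (\<lambda>x. of_bool (x = KP P) + of_bool (x = KP Q) - of_bool (x = r) - of_bool (x = KP Z))" for r
  have RKP: "R (KP T) \<longleftrightarrow> principal_divisor E (\<lambda>x. sg P x + sg Q x - sg T x - sg Z x)" if "on T" for T
    using that unfolding R_def rational_points_KP sg_def single_def by auto
  have uniq: "T = T'" if "on T" "on T'" "R (KP T)" "R (KP T')" for T T'
  proof -
    have "principal_divisor E (\<lambda>x. sg T x - sg T' x)"
      using principal_diff[OF that(4)[unfolded RKP[OF that(2)]] that(3)[unfolded RKP[OF that(1)]]]
      by (simp add: algebra_simps)
    from sg_unique[OF that(1,2) this] show ?thesis .
  qed
  obtain T where T: "on T" "srel h0 P Q Z T" using srel_exists[OF assms(1-3)] by blast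
  have RT: "R (KP T)" unfolding RKP[OF T(1)] by (rule srel_principal[OF assms(1-3) T])
  have "r = KP T" if r: "R r" for r
  proof -
    obtain T' where "on T'" "r = KP T'" using r unfolding R_def rational_points_KP by blast
    with uniq[OF T(1) _ RT, of T'] r show ?thesis by simp
  qed
  then have "(THE r. R r) = KP T" using RT by (intro the_equality) blast
  then have m: "KP P \<otimes>\<^bsub>MW Z\<^esub> KP Q = KP T"
    unfolding mordell_weil_group_def R_def by simp
  show 1: "KP P \<otimes>\<^bsub>MW Z\<^esub> KP Q = KP S \<longleftrightarrow> principal_divisor E (\<lambda>x. sg P x + sg Q x - sg S x - sg Z x)"
    unfolding m RKP[OF assms(4), symmetric] using uniq[OF T(1) assms(4) RT] RT by auto
  show "KP P \<otimes>\<^bsub>MW Z\<^esub> KP Q = KP S \<longleftrightarrow> srel h0 P Q Z S"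
  proof
    assume "KP P \<otimes>\<^bsub>MW Z\<^esub> KP Q = KP S"
    then have "T = S" using m KP_eq_iff[OF T(1) assms(4)] by simp
    then show "srel h0 P Q Z S" using T by simp
  next
    assume "srel h0 P Q Z S"
    then show "KP P \<otimes>\<^bsub>MW Z\<^esub> KP Q = KP S" unfolding 1 by (rule srel_principal[OF assms])
  qed
qed

lemma MW_carrier: "carrier (MW Z) = KP ` {P. on P}"
  by (simp add: mordell_weil_group_def rational_points_KP)

lemma MW_one: "\<one>\<^bsub>MW Z\<^esub> = KP Z"
  by (simp add: mordell_weil_group_def)

lemma MW_closed:
  assumes "on P" "on Q" "on Z"
  obtains S where "on S" "KP P \<otimes>\<^bsub>MW Z\<^esub> KP Q = KP S"
  using srel_exists[OF assms] MW_mult(2)[OF assms] by blast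

text \<open>Through \<open>MW_mult\<close> the axioms reduce to adding and subtracting principal
  divisors.\<close>

lemma MW_comm_group:
  assumes Z: "on Z"
  shows "comm_group (MW Z)"
proof (rule comm_groupI; (unfold MW_carrier MW_one)?)
  fix x y assume "x \<in> KP ` {P. on P}" "y \<in> KP ` {P. on P}"
  then obtain P Q where PQ: "on P" "on Q" "x = KP P" "y = KP Q" by blast
  obtain S where S: "on S" "x \<otimes>\<^bsub>MW Z\<^esub> y = KP S" using MW_closed[OF PQ(1,2) Z] PQ(3,4) by metis
  then show "x \<otimes>\<^bsub>MW Z\<^esub> y \<in> KP ` {P. on P}" by blast
  have "y \<otimes>\<^bsub>MW Z\<^esub> x = KP S"
    using S(2) unfolding PQ(3,4) MW_mult(1)[OF PQ(1,2) Z S(1)] MW_mult(1)[OF PQ(2,1) Z S(1)]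
    by (simp add: algebra_simps)
  then show "x \<otimes>\<^bsub>MW Z\<^esub> y = y \<otimes>\<^bsub>MW Z\<^esub> x" using S(2) by simp
next
  show "KP Z \<in> KP ` {P. on P}" using Z by blast
next
  fix x y z assume "x \<in> KP ` {P. on P}" "y \<in> KP ` {P. on P}" "z \<in> KP ` {P. on P}"
  then obtain P Q R where P: "on P" "x = KP P" and Q: "on Q" "y = KP Q" and R: "on R" "z = KP R" by blast
  obtain S where S: "on S" "KP P \<otimes>\<^bsub>MW Z\<^esub> KP Q = KP S" using MW_closed[OF P(1) Q(1) Z] .
  obtain T where T: "on T" "KP S \<otimes>\<^bsub>MW Z\<^esub> KP R = KP T" using MW_closed[OF S(1) R(1) Z] .
  obtain S' where S': "on S'" "KP Q \<otimes>\<^bsub>MW Z\<^esub> KP R = KP S'" using MW_closed[OF Q(1) R(1) Z] .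
  have "KP P \<otimes>\<^bsub>MW Z\<^esub> KP S' = KP T"
    unfolding MW_mult(1)[OF P(1) S'(1) Z T(1)]
    using principal_diff[OF principal_add[OF S(2)[unfolded MW_mult(1)[OF P(1) Q(1) Z S(1)]] T(2)[unfolded MW_mult(1)[OF S(1) R(1) Z T(1)]]]
      S'(2)[unfolded MW_mult(1)[OF Q(1) R(1) Z S'(1)]]]
    by (simp add: algebra_simps)
  then show "x \<otimes>\<^bsub>MW Z\<^esub> y \<otimes>\<^bsub>MW Z\<^esub> z = x \<otimes>\<^bsub>MW Z\<^esub> (y \<otimes>\<^bsub>MW Z\<^esub> z)"
    using S T S' by (simp add: P(2) Q(2) R(2))
next
  fix x assume "x \<in> KP ` {P. on P}"
  then obtain P where P: "on P" "x = KP P" by blast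
  show "KP Z \<otimes>\<^bsub>MW Z\<^esub> x = x"
    unfolding P(2) MW_mult(2)[OF Z P(1) Z P(1)] by (simp add: srel_def)
  \<comment> \<open>The inverse of P is the S with S + P \<sim> Z + Z, that is, the double of Z for
    the origin P.\<close>
  obtain S where S: "on S" "KP Z \<otimes>\<^bsub>MW P\<^esub> KP Z = KP S" using MW_closed[OF Z Z P(1)] .
  have "KP S \<otimes>\<^bsub>MW Z\<^esub> x = KP Z"
    using principal_neg[OF S(2)[unfolded MW_mult(1)[OF Z Z P(1) S(1)]]]
    unfolding P(2) MW_mult(1)[OF S(1) P(1) Z Z] by (simp add: algebra_simps)
  then show "\<exists>y\<in>KP ` {P. on P}. y \<otimes>\<^bsub>MW Z\<^esub> x = KP Z" using S(1) by blast
qed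

text \<open>Turns a relation for one origin into an identity in the group with another one; needed
  because the origin of a twist is not carried to that of the cubic.\<close>

lemma MW_balance:
  assumes "on P" "on Q" "on S" "on Z" "on Z0" "srel h0 P Q Z S"
  shows "KP P \<otimes>\<^bsub>MW Z0\<^esub> KP Q = KP S \<otimes>\<^bsub>MW Z0\<^esub> KP Z"
proof -
  obtain T where T: "on T" "KP P \<otimes>\<^bsub>MW Z0\<^esub> KP Q = KP T" using MW_closed[OF assms(1,2,5)] .
  have "KP S \<otimes>\<^bsub>MW Z0\<^esub> KP Z = KP T"
    unfolding MW_mult(1)[OF assms(3,4,5) T(1)]
    using principal_diff[OF T(2)[unfolded MW_mult(1)[OF assms(1,2,5) T(1)]] srel_principal[OF assms(1,2,4,3,6)]]
    by (simp add: algebra_simps)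
  with T show ?thesis by simp
qed

text \<open>In a finite group the group order annihilates every element, so no nonempty set is
  independent.\<close>

lemma rank_positive_infinite:
  assumes Z: "on Z" and r: "group_rank (MW Z) > 0"
  shows "infinite (rational_points E)"
proof
  assume fin: "finite (rational_points E)"
  interpret G: comm_group "MW Z" by (rule MW_comm_group[OF Z])
  have carr: "carrier (MW Z) = rational_points E" by (simp add: mordell_weil_group_def)
  define Ind where "Ind S \<longleftrightarrow> finite S \<and> S \<subseteq> carrier (MW Z) \<and>
     (\<forall>c :: _ => int. finprod (MW Z) (\<lambda>s. s [^]\<^bsub>MW Z\<^esub> c s) S = \<one>\<^bsub>MW Z\<^esub> --> (\<forall>s\<in>S. c s = 0))" for S
  have "group_rank (MW Z) = Sup {enat (card S) | S. Ind S}" unfolding group_rank_def Ind_def ..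
  with r have "\<exists>x\<in>{enat (card S) | S. Ind S}. 0 < x" by (simp only: less_Sup_iff)
  then obtain S where Ind: "Ind S" and pos: "0 < enat (card S)" by auto
  have S: "S \<subseteq> carrier (MW Z)" and indep: "finprod (MW Z) (\<lambda>s. s [^]\<^bsub>MW Z\<^esub> c s) S = \<one>\<^bsub>MW Z\<^esub> ==> s \<in> S ==> c s = 0"
    for c :: "_ => int" and s using Ind unfolding Ind_def by auto
  from pos obtain s where s: "s \<in> S" by (cases "S = {}") (auto simp: zero_enat_def)
  define c where "c t = (if t = s then int (Coset.order (MW Z)) else 0)" for t
  have "t [^]\<^bsub>MW Z\<^esub> c t = \<one>\<^bsub>MW Z\<^esub>" if "t \<in> S" for t
    using that S G.pow_order_eq_1[of t] by (auto simp: c_def int_pow_int)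
  then have "finprod (MW Z) (\<lambda>t. t [^]\<^bsub>MW Z\<^esub> c t) S = \<one>\<^bsub>MW Z\<^esub>" by (rule G.finprod_one_eqI)
  from indep[OF this s] have "c s = 0" .
  then have "Coset.order (MW Z) = 0" by (simp add: c_def)
  with fin carr G.one_closed show False by (simp add: Coset.order_def card_eq_0_iff)
qed

text \<open>Otherwise the set consisting of P alone would be independent.\<close>

lemma rank_zero_torsion:
  assumes Z: "on Z" and r: "\<not> group_rank (MW Z) > 0" and P: "on P"
  obtains n :: nat where "n > 0" "KP P [^]\<^bsub>MW Z\<^esub> n = \<one>\<^bsub>MW Z\<^esub>"
proof -
  interpret G: comm_group "MW Z" by (rule MW_comm_group[OF Z])
  have PC: "KP P \<in> carrier (MW Z)" using P by (simp add: MW_carrier)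
  have "\<exists>c :: _ => int. finprod (MW Z) (\<lambda>s. s [^]\<^bsub>MW Z\<^esub> c s) {KP P} = \<one>\<^bsub>MW Z\<^esub> \<and> c (KP P) ~= 0"
  proof (rule ccontr)
    assume "\<not> (\<exists>c :: _ => int. finprod (MW Z) (\<lambda>s. s [^]\<^bsub>MW Z\<^esub> c s) {KP P} = \<one>\<^bsub>MW Z\<^esub> \<and> c (KP P) ~= 0)"
    then have "enat (card {KP P}) \<in> {enat (card S) | S. finite S \<and> S \<subseteq> carrier (MW Z) \<and>
     (\<forall>c :: _ => int. finprod (MW Z) (\<lambda>s. s [^]\<^bsub>MW Z\<^esub> c s) S = \<one>\<^bsub>MW Z\<^esub> --> (\<forall>s\<in>S. c s = 0))}"
      using PC by (intro CollectI exI[of _ "{KP P}"]) auto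
    then have "enat 1 \<le> group_rank (MW Z)" unfolding group_rank_def by (intro Sup_upper) simp
    moreover have "0 < enat 1" by (simp add: zero_enat_def)
    ultimately show False using r less_le_trans by blast
  qed
  then obtain c :: "_ => int" where c: "finprod (MW Z) (\<lambda>s. s [^]\<^bsub>MW Z\<^esub> c s) {KP P} = \<one>\<^bsub>MW Z\<^esub>" "c (KP P) ~= 0"
    by blast
  define d where "d = c (KP P)"
  have "KP P [^]\<^bsub>MW Z\<^esub> d = \<one>\<^bsub>MW Z\<^esub>" using c(1) PC by (simp add: d_def)
  moreover have "KP P [^]\<^bsub>MW Z\<^esub> (- d) = inv\<^bsub>MW Z\<^esub> (KP P [^]\<^bsub>MW Z\<^esub> d)" by (rule G.int_pow_neg[OF PC])
  ultimately have "KP P [^]\<^bsub>MW Z\<^esub> \<bar>d\<bar> = \<one>\<^bsub>MW Z\<^esub>" by (simp add: abs_if)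
  then have "KP P [^]\<^bsub>MW Z\<^esub> (int (nat \<bar>d\<bar>)) = \<one>\<^bsub>MW Z\<^esub>" by simp
  then have "KP P [^]\<^bsub>MW Z\<^esub> nat \<bar>d\<bar> = \<one>\<^bsub>MW Z\<^esub>" by (simp only: int_pow_int)
  with that[of "nat \<bar>d\<bar>"] c(2) show ?thesis by (simp add: d_def)
qed

end

section \<open>A 2-adic valuation ring\<close>

definition is_subring :: "'a::field set => bool" where
  "is_subring V \<longleftrightarrow> 1 \<in> V \<and> (\<forall>a\<in>V. \<forall>b\<in>V. a + b \<in> V \<and> a * b \<in> V \<and> - a \<in> V)"

lemma subring_ops:
  assumes "is_subring V"
  shows "1 \<in> V" "0 \<in> V" "a \<in> V ==> b \<in> V ==> a + b \<in> V" "a \<in> V ==> b \<in> V ==> a * b \<in> V"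
    "a \<in> V ==> - a \<in> V" "a \<in> V ==> b \<in> V ==> a - b \<in> V" "a \<in> V ==> a ^ n \<in> V" "of_nat m \<in> V" "of_int i \<in> V"
    "(!!j. j \<in> T ==> f j \<in> V) ==> sum f T \<in> V"
proof -
  show 1: "1 \<in> V" and add: "a \<in> V ==> b \<in> V ==> a + b \<in> V" and m: "a \<in> V ==> b \<in> V ==> a * b \<in> V"
    and neg: "a \<in> V ==> - a \<in> V" for a b
    using assms by (auto simp: is_subring_def)
  show 0: "0 \<in> V" using add[OF 1 neg[OF 1]] by simp
  show "a \<in> V ==> b \<in> V ==> a - b \<in> V" using add[of a "- b"] neg[of b] by simp
  show "a \<in> V ==> a ^ n \<in> V" by (induction n) (auto simp: 1 m)
  show n: "of_nat m \<in> V" for m by (induction m) (auto simp: 0 1 add)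
  show "of_int i \<in> V" using n[of "nat i"] neg[OF n[of "nat (- i)"]] by (cases "i \<ge> 0") auto
  show "(!!j. j \<in> T ==> f j \<in> V) ==> sum f T \<in> V"
    by (induction T rule: infinite_finite_induct) (auto simp: 0 add)
qed

text \<open>The ring V[x].\<close>

definition adj :: "'a::field set => 'a => 'a set" where
  "adj V x = {poly p x | p. \<forall>i. Polynomial.coeff p i \<in> V}"

lemma adj_subring:
  assumes V: "is_subring V"
  shows "is_subring (adj V x)" "V \<subseteq> adj V x" "x \<in> adj V x"
proof -
  note ops = subring_ops[OF V]
  have mem: "poly p x \<in> adj V x" if "!!i. Polynomial.coeff p i \<in> V" for p using that by (auto simp: adj_def)
  show "is_subring (adj V x)"
    unfolding is_subring_def
  proof (intro conjI ballI)
    show "1 \<in> adj V x" using mem[of 1] ops(1,2) by (simp add: coeff_1)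
    fix a b assume "a \<in> adj V x" "b \<in> adj V x"
    then obtain p q where pq: "a = poly p x" "b = poly q x" "!!i. Polynomial.coeff p i \<in> V" "!!i. Polynomial.coeff q i \<in> V"
      by (auto simp: adj_def)
    show "a + b \<in> adj V x" using mem[of "p + q"] pq ops(3) by simp
    have "Polynomial.coeff (p * q) i \<in> V" for i
      unfolding coeff_mult by (intro ops(10) ops(4) pq(3,4))
    from mem[OF this] show "a * b \<in> adj V x" using pq by simp
    show "- a \<in> adj V x" using mem[of "- p"] pq ops(5) by simp
  qed
  show "V \<subseteq> adj V x"
  proof
    fix a assume "a \<in> V"
    then show "a \<in> adj V x" using mem[of "[:a:]"] ops(2) by (simp add: coeff_pCons split: nat.splits)
  qed
  show "x \<in> adj V x" using mem[of "[:0, 1:]"] ops(1,2) by (simp add: coeff_pCons split: nat.splits)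
qed

locale valuation_ring_2 =
  fixes V :: "'a::field_char_0 set"
  assumes sub: "is_subring V" and half: "inverse 2 \<notin> V" and val: "!!x. x \<in> V \<or> inverse x \<in> V"

text \<open>A subring maximal among those without 1/2 is a valuation ring. If x and 1/x were both
  outside V, then 1/2 would lie in V[x] and in V[1/x], and of two such expressions of least degree
  one could still be shortened with the help of the other.\<close>

lemma valuation_ring_exists: "\<exists>V :: 'a::field_char_0 set. valuation_ring_2 V"
proof -
  define A where "A = {V :: 'a set. is_subring V \<and> inverse 2 \<notin> V}"
  have "range of_int \<in> A"
  proof -
    have "is_subring (range (of_int :: int => 'a))"
      unfolding is_subring_def
      using rangeI[of of_int 1] by (auto simp flip: of_int_add of_int_mult of_int_minus)
    moreover have "inverse 2 \<notin> range (of_int :: int => 'a)"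
    proof
      assume "inverse 2 \<in> range (of_int :: int => 'a)"
      then obtain n where "inverse 2 = (of_int n :: 'a)" by auto
      then have "1 = (of_int (2 * n) :: 'a)" by (simp add: field_simps)
      then have "1 = 2 * n" using of_int_eq_iff[where ?'a = 'a, of 1 "2 * n"] by simp
      then show False by presburger
    qed
    ultimately show ?thesis by (simp add: A_def)
  qed
  moreover have "\<Union>Ch \<in> A" if ne: "Ch ~= {}" and ch: "subset.chain A Ch" for Ch
  proof -
    have sub: "is_subring W" "inverse 2 \<notin> W" if "W \<in> Ch" for W
      using ch that by (auto simp: subset.chain_def A_def)
    have two: "\<exists>W\<in>Ch. a \<in> W \<and> b \<in> W" if ab: "a \<in> \<Union>Ch" "b \<in> \<Union>Ch" for a b
    proof -
      obtain W W' where W: "a \<in> W" "W \<in> Ch" "b \<in> W'" "W' \<in> Ch" using ab by auto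
      then have "W \<subseteq> W' \<or> W' \<subseteq> W" using ch unfolding subset.chain_def by blast
      with W show ?thesis by auto
    qed
    have "is_subring (\<Union>Ch)"
      unfolding is_subring_def
    proof (intro conjI ballI)
      show "1 \<in> \<Union>Ch" using ne sub subring_ops(1) by blast
      fix a b assume "a \<in> \<Union>Ch" "b \<in> \<Union>Ch"
      then obtain W where "W \<in> Ch" "a \<in> W" "b \<in> W" using two by blast
      then show "a + b \<in> \<Union>Ch" "a * b \<in> \<Union>Ch" "- a \<in> \<Union>Ch"
        using sub(1)[of W] subring_ops(3)[of W a b] subring_ops(4)[of W a b] subring_ops(5)[of W a] by blast+
    qed
    with sub show ?thesis by (auto simp: A_def)
  qed
  ultimately have "\<exists>V\<in>A. \<forall>W\<in>A. V \<subseteq> W --> W = V"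
    using subset_Zorn_nonempty[of A] by auto
  then obtain V where V: "V \<in> A" and max: "!!W. W \<in> A ==> V \<subseteq> W ==> W = V"
    by auto
  have sub: "is_subring V" and half: "inverse 2 \<notin> V" using V by (auto simp: A_def)
  note ops = subring_ops[OF sub]
  have adj_half: "inverse 2 \<in> adj V x" if "x \<notin> V" for x
  proof (rule ccontr)
    assume "inverse 2 \<notin> adj V x"
    then have "adj V x \<in> A" using adj_subring(1)[OF sub] by (simp add: A_def)
    from max[OF this adj_subring(2)[OF sub]] adj_subring(3)[OF sub, of x] that show False by simp
  qed
  \<comment> \<open>Otherwise 1/2 is a polynomial in 1/u with u = 1 - 2 a. Clearing denominators by
    u^d, which has the form 1 - 2 b, brings 1/2 into V.\<close>
  have unit: "inverse (1 - 2 * a) \<in> V" if a: "a \<in> V" for a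
  proof (rule ccontr)
    assume n: "inverse (1 - 2 * a) \<notin> V"
    define u where "u = 1 - 2 * a"
    have u0: "u ~= 0"
    proof
      assume "u = 0"
      then have "a = inverse 2" by (simp add: u_def field_simps)
      with a half show False by simp
    qed
    have uV: "u \<in> V" using a ops(1) ops(6) ops(4)[of 2 a] ops(8)[of 2] by (simp add: u_def)
    obtain p where p: "inverse 2 = poly p (inverse u)" "!!i. Polynomial.coeff p i \<in> V"
      using adj_half[OF n] by (auto simp: adj_def u_def)
    define d where "d = Polynomial.degree p"
    have pw: "\<exists>b\<in>V. u ^ k = 1 - 2 * b" for k
    proof (induction k)
      case 0
      then show ?case using ops(2) by (intro bexI[of _ 0]) auto
    next
      case (Suc k)
      then obtain b where b: "b \<in> V" "u ^ k = 1 - 2 * b" by blast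
      have "u ^ Suc k = 1 - 2 * (b + a - 2 * a * b)"
        unfolding power_Suc b(2) by (simp add: u_def algebra_simps)
      moreover have "b + a - 2 * a * b \<in> V"
        using ops(3)[OF b(1) a] ops(6) ops(4)[OF ops(4)[OF _ a] b(1), of 2] ops(8)[of 2] by simp
      ultimately show ?case by blast
    qed
    then obtain b where b: "b \<in> V" "u ^ d = 1 - 2 * b" by blast
    have "u ^ d * inverse 2 = (\<Sum>i\<le>d. Polynomial.coeff p i * u ^ (d - i))"
      unfolding p(1) poly_altdef d_def[symmetric] sum_distrib_left
      by (rule sum.cong) (use u0 in \<open>auto simp: power_diff power_inverse divide_inverse\<close>)
    also have "\<dots> \<in> V" by (intro ops(10) ops(4) ops(7) p(2) uV)
    finally have "u ^ d * inverse 2 \<in> V" .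
    then have "u ^ d * inverse 2 + b \<in> V" using b ops(3) by blast
    moreover have "u ^ d * inverse 2 + b = inverse 2" unfolding b(2) by (simp add: algebra_simps)
    ultimately have "inverse 2 \<in> V" by (simp only:)
    with half show False by blast
  qed
  have degree_sum_less_aux: "Polynomial.degree (sum F T) < n"
    if "n > 0" "!!j. j \<in> T ==> Polynomial.degree (F j) < n" for F :: "nat => 'a poly" and T n
    using that by (induction T rule: infinite_finite_induct) (auto intro: degree_add_less)
  \<comment> \<open>With the unit 1 - 2 q0 the relation for 1/x writes 1 as a combination of
    positive powers of 1/x. Multiplying the leading term of p by it replaces this term by lower
    ones.\<close>
  have reduce: "\<exists>p'. Polynomial.degree p' < Polynomial.degree p \<and> (\<forall>i. Polynomial.coeff p' i \<in> V) \<and> poly p' x = inverse 2"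
    if x0: "x ~= 0" and p: "!!i. Polynomial.coeff p i \<in> V" "poly p x = inverse 2"
      and q: "!!i. Polynomial.coeff q i \<in> V" "poly q (inverse x) = inverse 2"
      and deg: "Polynomial.degree q \<le> Polynomial.degree p" for p q x
  proof -
    define n m where "n = Polynomial.degree p" and "m = Polynomial.degree q"
    define q0 where "q0 = Polynomial.coeff q 0"
    define u where "u = inverse (1 - 2 * q0)"
    have uV: "u \<in> V" using unit q(1) by (simp add: u_def q0_def)
    have u1: "u * (1 - 2 * q0) = 1"
    proof -
      have "1 - 2 * q0 ~= 0"
      proof
        assume "1 - 2 * q0 = 0"
        then have "q0 = inverse 2" by (simp add: field_simps)
        moreover have "q0 \<in> V" using q(1) by (simp add: q0_def)
        ultimately show False using half by (simp only:)
      qed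
      then show ?thesis by (simp add: u_def)
    qed
    have pos: "Polynomial.degree p > 0"
    proof (rule ccontr)
      assume "\<not> Polynomial.degree p > 0"
      then obtain a where "p = [:a:]" using degree_eq_zeroE by auto
      with p half show False by (metis coeff_pCons_0 poly_pCons poly_0 mult_zero_right add.right_neutral)
    qed
    have qsum: "inverse 2 = q0 + (\<Sum>j\<in>{1..m}. Polynomial.coeff q j * inverse x ^ j)"
    proof -
      have "{..m} = insert 0 {1..m}" by auto
      then show ?thesis unfolding q(2)[symmetric] poly_altdef m_def[symmetric] q0_def by simp
    qed
    define s where "s = (\<Sum>j\<in>{1..m}. Polynomial.coeff q j * inverse x ^ j)"
    have "2 * s = 1 - 2 * q0" using qsum unfolding s_def[symmetric] by (simp add: field_simps)
    then have us: "u * (2 * s) = 1" using u1 by simp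
    define cn where "cn = Polynomial.coeff p n"
    define p' where "p' = (p - Polynomial.monom cn n) + (\<Sum>j\<in>{1..m}. Polynomial.monom (2 * cn * u * Polynomial.coeff q j) (n - j))"
    have "poly (\<Sum>j\<in>{1..m}. Polynomial.monom (2 * cn * u * Polynomial.coeff q j) (n - j)) x
       = (\<Sum>j\<in>{1..m}. cn * x ^ n * (u * 2) * (Polynomial.coeff q j * inverse x ^ j))"
      unfolding poly_sum poly_monom
      by (rule sum.cong) (use x0 deg in \<open>auto simp: n_def m_def power_diff power_inverse divide_inverse\<close>)
    also have "\<dots> = cn * x ^ n * (u * (2 * s))" by (simp add: s_def sum_distrib_left mult.assoc)
    also have "\<dots> = cn * x ^ n" using us by simp
    finally have "poly p' x = inverse 2" using p(2) by (simp add: p'_def poly_monom)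
    moreover have "Polynomial.coeff p' i \<in> V" for i
    proof -
      have cnV: "cn \<in> V" using p(1) by (simp add: cn_def)
      have "2 * cn * u * Polynomial.coeff q j \<in> V" for j
        using ops(4)[OF ops(4)[OF ops(4)[OF _ cnV] uV] q(1), of 2] ops(8)[of 2] by simp
      then show ?thesis unfolding p'_def coeff_add coeff_diff coeff_sum coeff_monom
        using p(1) cnV ops(2) by (intro ops(3,6,10)) auto
    qed
    moreover have "Polynomial.degree p' < n"
    proof -
      have 1: "Polynomial.degree (p - Polynomial.monom cn n) < n"
      proof -
        have "Polynomial.degree (p - Polynomial.monom cn n) \<le> n"
          by (intro degree_diff_le) (auto simp: n_def degree_monom_le)
        moreover have "Polynomial.coeff (p - Polynomial.monom cn n) n = 0" by (simp add: cn_def)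
        ultimately show ?thesis using pos n_def
          by (metis degree_0 eq_zero_or_degree_less order_le_imp_less_or_eq leading_coeff_0_iff)
      qed
      have 2: "Polynomial.degree (\<Sum>j\<in>{1..m}. Polynomial.monom (2 * cn * u * Polynomial.coeff q j) (n - j)) < n"
        using pos by (intro degree_sum_less_aux) (auto simp: n_def intro!: le_less_trans[OF degree_monom_le])
      show ?thesis unfolding p'_def by (rule degree_add_less[OF 1 2])
    qed
    ultimately show ?thesis unfolding n_def by blast
  qed
  have "x \<in> V \<or> inverse x \<in> V" for x
  proof (rule ccontr)
    assume n: "\<not> (x \<in> V \<or> inverse x \<in> V)"
    then have x0: "x ~= 0" using ops(2) by auto
    define R where "R n z \<longleftrightarrow> (\<exists>p. Polynomial.degree p = n \<and> (\<forall>i. Polynomial.coeff p i \<in> V) \<and> poly p z = inverse 2)" for n z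
    have ex: "\<exists>n. R n z" if zV: "z \<notin> V" for z
    proof -
      obtain p where "poly p z = inverse 2" "\<forall>i. Polynomial.coeff p i \<in> V"
        using adj_half[OF zV] unfolding adj_def by auto
      then have "R (Polynomial.degree p) z" unfolding R_def by auto
      then show ?thesis ..
    qed
    define n m where "n = (LEAST n. R n x)" and "m = (LEAST n. R n (inverse x))"
    have Rn: "R n x" "R m (inverse x)" using ex n LeastI_ex[of "\<lambda>n. R n x"] LeastI_ex[of "\<lambda>n. R n (inverse x)"]
      unfolding n_def m_def by auto
    obtain p where p: "Polynomial.degree p = n" "!!i. Polynomial.coeff p i \<in> V" "poly p x = inverse 2"
      using Rn(1) unfolding R_def by auto
    obtain q where q: "Polynomial.degree q = m" "!!i. Polynomial.coeff q i \<in> V" "poly q (inverse x) = inverse 2"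
      using Rn(2) unfolding R_def by auto
    show False
    proof (cases "m \<le> n")
      case True
      then obtain p' where "Polynomial.degree p' < n" "\<forall>i. Polynomial.coeff p' i \<in> V" "poly p' x = inverse 2"
        using reduce[OF x0 p(2,3) q(2,3)] p(1) q(1) by auto
      then have "R (Polynomial.degree p') x" "Polynomial.degree p' < n" by (auto simp: R_def)
      then show False unfolding n_def using not_less_Least by blast
    next
      case False
      then obtain p' where "Polynomial.degree p' < m" "\<forall>i. Polynomial.coeff p' i \<in> V" "poly p' (inverse x) = inverse 2"
        using reduce[of "inverse x" q p] x0 p q by auto
      then have "R (Polynomial.degree p') (inverse x)" "Polynomial.degree p' < m" by (auto simp: R_def)
      then show False unfolding m_def using not_less_Least by blast
    qed
  qed
  with sub half have "valuation_ring_2 V" by unfold_locales auto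
  then show ?thesis by blast
qed

context valuation_ring_2
begin

lemmas ops = subring_ops[OF sub]

lemma two_pow: "2 ^ n \<in> V"
  using ops(7)[OF ops(8)[of 2]] by simp

text \<open>Suppose w = 1/(1 + 2 a) is outside V. If 2 w is in V, then so is w = 1 - 2 w a; if not,
  then 1/(2 w) = 1/2 + a is in V, and hence 1/2.\<close>

lemma unit: "a \<in> V ==> inverse (1 + 2 * a) \<in> V" "a \<in> V ==> 1 + 2 * a ~= 0"
proof -
  assume a: "a \<in> V"
  show ne: "1 + 2 * a ~= 0"
  proof
    assume "1 + 2 * a = 0"
    then have "- a = inverse 2" by (simp add: field_simps add_eq_0_iff2)
    with ops(5)[OF a] half show False by simp
  qed
  show "inverse (1 + 2 * a) \<in> V"
  proof (rule ccontr)
    assume n: "inverse (1 + 2 * a) \<notin> V"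
    have "1 + 2 * a \<in> V" using ops(1,3) ops(4)[OF ops(8)[of 2] a] by simp
    define w where "w = inverse (1 + 2 * a)"
    have w: "w * (1 + 2 * a) = 1" using ne by (simp add: w_def)
    have w2: "inverse (2 * w) \<in> V \<or> 2 * w \<in> V" using val[of "2 * w"] by blast
    have "2 * w \<notin> V"
    proof
      assume "2 * w \<in> V"
      then have "1 - (2 * w) * a \<in> V" using a ops(1,4,6) by blast
      moreover have "1 - (2 * w) * a = w" using w by (simp add: algebra_simps)
      ultimately show False using n by (simp add: w_def)
    qed
    with w2 have "inverse (2 * w) \<in> V" by blast
    moreover have "inverse (2 * w) = inverse 2 + a"
      using ne unfolding w_def by (simp add: field_simps)
    ultimately have "inverse 2 + a - a \<in> V" using a ops(6) by metis
    then show False using half by simp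
  qed
qed

definition sm :: "nat => 'a => bool" where "sm n a \<longleftrightarrow> a / 2 ^ n \<in> V"

lemma sm_iff: "sm n a \<longleftrightarrow> (\<exists>v\<in>V. a = 2 ^ n * v)"
  unfolding sm_def by (auto intro!: bexI[of _ "a / 2 ^ n"])

lemma sm_0: "sm 0 a \<longleftrightarrow> a \<in> V" by (simp add: sm_def)
lemma sm_zero: "sm n 0" using ops(2) by (simp add: sm_def)
lemma sm_add: "sm n a ==> sm n b ==> sm n (a + b)" using ops(3) by (simp add: sm_def add_divide_distrib)
lemma sm_minus: "sm n a ==> sm n (- a)" using ops(5) by (simp add: sm_def)
lemma sm_diff: "sm n a ==> sm n b ==> sm n (a - b)" using ops(6) by (simp add: sm_def diff_divide_distrib)
text \<open>If z is outside V, then 1/z is in V, and dividing the equation by z^(d - 1) writes z as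
  a polynomial in 1/z.\<close>

lemma integral_closed:
  assumes "z ^ d = (\<Sum>i<d. b i * z ^ i)" "!!i. i < d ==> b i \<in> V" "d > 0"
  shows "z \<in> V"
proof (rule ccontr)
  assume z: "z \<notin> V"
  then have iz: "inverse z \<in> V" and z0: "z ~= 0" using val[of z] ops(2) by auto
  have "z = z ^ d * inverse z ^ (d - 1)"
    using z0 assms(3) by (cases d) (auto simp: power_inverse)
  also have "\<dots> = (\<Sum>i<d. b i * inverse z ^ (d - 1 - i))"
    unfolding assms(1) sum_distrib_right
  proof (rule sum.cong[OF refl])
    fix i assume "i \<in> {..<d}"
    then have "inverse z ^ (d - 1) = inverse z ^ i * inverse z ^ (d - 1 - i)"
      by (simp flip: power_add)
    then show "b i * z ^ i * inverse z ^ (d - 1) = b i * inverse z ^ (d - 1 - i)"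
      using z0 by (simp add: power_inverse field_simps)
  qed
  also have "\<dots> \<in> V" using assms(2) iz by (intro ops(10) ops(4) ops(7)) auto
  finally show False using z by simp
qed

end

section \<open>Arithmetic of a number field for the valuation\<close>

lemma common_denominator:
  fixes r :: "nat => rat"
  shows "\<exists>D::int. D > 0 \<and> (\<forall>i\<le>n. \<exists>z. r i * of_int D = of_int z)"
proof (induction n)
  case 0
  obtain a b where ab: "quotient_of (r 0) = (a, b)" by force
  then have "r 0 = of_int a / of_int b" "b > 0" by (simp_all add: quotient_of_div quotient_of_denom_pos)
  then show ?case by (intro exI[of _ b]) auto
next
  case (Suc n)
  then obtain D where D: "D > 0" "!!i. i \<le> n ==> \<exists>z. r i * of_int D = of_int z" by blast
  obtain a b where ab: "quotient_of (r (Suc n)) = (a, b)" by force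
  then have r: "r (Suc n) = of_int a / of_int b" "b > 0" by (simp_all add: quotient_of_div quotient_of_denom_pos)
  have "\<exists>z. r i * of_int (D * b) = of_int z" if i: "i \<le> Suc n" for i
  proof (cases "i = Suc n")
    case True
    with r show ?thesis by (intro exI[of _ "a * D"]) simp
  next
    case False
    with i D(2)[of i] obtain z where "r i * of_int D = of_int z" by auto
    then have "r i * of_int (D * b) = of_int (z * b)" by (simp flip: mult.assoc)
    then show ?thesis ..
  qed
  with D r show ?case by (intro exI[of _ "D * b"]) auto
qed

text \<open>n is the dimension over the rationals. A nontrivial integer relation of least total size
  has an odd coefficient, since a wholly even one could be halved; so it stays nontrivial modulo
  2.\<close>

lemma number_field_relation:
  assumes "number_field TYPE('k::field_char_0)"
  shows "\<exists>n. \<forall>f :: nat => 'k. \<exists>c :: nat => int. (\<exists>i\<le>n. odd (c i)) \<and> (\<Sum>i\<le>n. of_int (c i) * f i) = 0"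
proof -
  obtain B where B: "finite_dimensional_vector_space (\<lambda>(q::rat) (x::'k). of_rat q * x) B"
    using assms by (auto simp: number_field_def)
  interpret vs: finite_dimensional_vector_space "\<lambda>(q::rat) (x::'k). of_rat q * x" B by (rule B)
  define n where "n = card B"
  have "\<exists>c :: nat => int. (\<exists>i\<le>n. odd (c i)) \<and> (\<Sum>i\<le>n. of_int (c i) * f i) = 0" for f :: "nat => 'k"
  proof -
    have "\<exists>r :: nat => rat. (\<exists>i\<le>n. r i ~= 0) \<and> (\<Sum>i\<le>n. of_rat (r i) * f i) = 0"
    proof (cases "inj_on f {..n}")
      case False
      then obtain i j where ij: "i \<le> n" "j \<le> n" "i ~= j" "f i = f j" by (auto simp: inj_on_def)
      define r where "r k = (if k = i then 1 else 0) - (if k = j then 1 else 0 :: rat)" for k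
      have "(\<Sum>k\<le>n. of_rat (r k) * f k) = (\<Sum>k\<le>n. (if k = i then f k else 0)) - (\<Sum>k\<le>n. (if k = j then f k else 0))"
        unfolding sum_subtractf[symmetric] by (rule sum.cong) (auto simp: r_def)
      then have "(\<Sum>k\<le>n. of_rat (r k) * f k) = 0" using ij by simp
      moreover have "r i ~= 0" using ij by (simp add: r_def)
      ultimately show ?thesis using ij(1) by blast
    next
      case True
      have "card (f ` {..n}) = Suc n" using True by (simp add: card_image)
      then have "vs.dependent (f ` {..n})"
        using vs.independent_bound_general[of "f ` {..n}"] vs.dim_subset_UNIV[of "f ` {..n}"]
        unfolding vs.dimension_def n_def[symmetric] by auto
      then obtain u where u: "\<exists>v\<in>f ` {..n}. u v ~= 0" "(\<Sum>v\<in>f ` {..n}. of_rat (u v) * v) = 0"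
        using vs.dependent_finite[of "f ` {..n}"] by auto
      then have "(\<exists>i\<le>n. u (f i) ~= 0) \<and> (\<Sum>i\<le>n. of_rat (u (f i)) * f i) = 0"
        using True by (auto simp: sum.reindex)
      then show ?thesis by (intro exI[of _ "\<lambda>i. u (f i)"])
    qed
    then obtain r :: "nat => rat" where r: "\<exists>i\<le>n. r i ~= 0" "(\<Sum>i\<le>n. of_rat (r i) * f i) = 0" by blast
    obtain D :: int where D: "D > 0" "!!i. i \<le> n ==> \<exists>z. r i * of_int D = of_int z"
      using common_denominator[of n r] by blast
    define d0 where "d0 i = \<lfloor>r i * of_int D\<rfloor>" for i
    have d0: "of_int (d0 i) = r i * of_int D" if "i \<le> n" for i
      using D(2)[OF that] by (auto simp: d0_def)
    define P where "P d \<longleftrightarrow> (\<exists>i\<le>n. d i ~= 0) \<and> (\<Sum>i\<le>n. of_int (d i) * f i) = 0" for d :: "nat => int"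
    have "P d0"
    proof -
      have "(\<Sum>i\<le>n. of_int (d0 i) * f i) = (\<Sum>i\<le>n. of_int D * (of_rat (r i) * f i))"
      proof (rule sum.cong[OF refl])
        fix i assume "i \<in> {..n}"
        then have "(of_rat (of_int (d0 i)) :: 'k) = of_rat (r i * of_int D)" using d0 by simp
        then show "of_int (d0 i) * f i = of_int D * (of_rat (r i) * f i)"
          by (simp add: of_rat_mult mult.left_commute mult.assoc)
      qed
      also have "\<dots> = 0" using r(2) by (simp flip: sum_distrib_left)
      finally have "(\<Sum>i\<le>n. of_int (d0 i) * f i) = 0" .
      moreover obtain i where "i \<le> n" "r i ~= 0" using r(1) by blast
      then have "d0 i ~= 0" using d0[of i] D(1) by auto
      ultimately show ?thesis unfolding P_def using \<open>i \<le> n\<close> by blast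
    qed
    then obtain d where d: "P d" and min: "\<forall>d'. P d' --> (\<Sum>i\<le>n. nat \<bar>d i\<bar>) \<le> (\<Sum>i\<le>n. nat \<bar>d' i\<bar>)"
      using ex_has_least_nat[of P d0 "\<lambda>d. \<Sum>i\<le>n. nat \<bar>d i\<bar>"] by auto
    have "\<exists>i\<le>n. odd (d i)"
    proof (rule ccontr)
      assume "\<not> (\<exists>i\<le>n. odd (d i))"
      then have ev: "d i = 2 * (d i div 2)" if "i \<le> n" for i using that by auto
      have "(\<Sum>i\<le>n. of_int (d i) * f i) = (\<Sum>i\<le>n. 2 * (of_int (d i div 2) * f i))"
      proof (rule sum.cong[OF refl])
        fix i assume "i \<in> {..n}"
        then have "(of_int (d i) :: 'k) = of_int (2 * (d i div 2))" using ev[of i] by simp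
        then show "of_int (d i) * f i = 2 * (of_int (d i div 2) * f i)" by simp
      qed
      then have "2 * (\<Sum>i\<le>n. of_int (d i div 2) * f i) = 0" using d by (simp add: P_def sum_distrib_left)
      moreover obtain j where j: "j \<le> n" "d j ~= 0" using d by (auto simp: P_def)
      then have j2: "d j div 2 ~= 0" using ev[of j] by auto
      ultimately have "P (\<lambda>i. d i div 2)" unfolding P_def using j(1) by auto
      with min have "(\<Sum>i\<le>n. nat \<bar>d i\<bar>) \<le> (\<Sum>i\<le>n. nat \<bar>d i div 2\<bar>)" by blast
      moreover have "(\<Sum>i\<le>n. nat \<bar>d i div 2\<bar>) < (\<Sum>i\<le>n. nat \<bar>d i\<bar>)"
      proof (rule sum_strict_mono_ex1)
        show "\<forall>i\<in>{..n}. nat \<bar>d i div 2\<bar> \<le> nat \<bar>d i\<bar>" using ev by fastforce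
        have "nat \<bar>d j div 2\<bar> < nat \<bar>d j\<bar>" using ev[OF j(1)] j2 by linarith
        then show "\<exists>i\<in>{..n}. nat \<bar>d i div 2\<bar> < nat \<bar>d i\<bar>" using j(1) by auto
      qed simp
      ultimately show False by simp
    qed
    with d show ?thesis unfolding P_def by blast
  qed
  then show ?thesis by blast
qed

lemma (in valuation_ring_2) sm_sum: "(!!i. i \<in> T ==> sm n (F i)) ==> sm n (sum F T)"
  by (induction T rule: infinite_finite_induct) (auto simp: sm_zero sm_add)

locale number_field_valuation = valuation_ring_2 V for V :: "'k::field_char_0 alg_closure set" +
  assumes nf: "number_field TYPE('k)"
begin

lemma odd_unit: "odd n ==> inverse (of_int n) \<in> V \<and> of_int n ~= (0 :: 'k alg_closure)"
proof -
  assume "odd n"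
  then obtain m where "n = 2 * m + 1" by (auto elim: oddE)
  then have "of_int n = 1 + 2 * (of_int m :: 'k alg_closure)" by simp
  with unit[OF ops(9)[of m]] show ?thesis by simp
qed

text \<open>No element of k is larger than all powers of 1/2. In an integer relation between powers
  of c let 2^e m, with m odd, be the top nonzero coefficient; then 2^e c is integral over V because
  m is a unit.\<close>

lemma scaled_base: "\<exists>N. 2 ^ N * to_ac c \<in> V"
proof -
  obtain n where n: "!!f :: nat => 'k. \<exists>c :: nat => int. (\<exists>i\<le>n. odd (c i)) \<and> (\<Sum>i\<le>n. of_int (c i) * f i) = 0"
    using number_field_relation[OF nf] by blast
  obtain a :: "nat => int" where a: "\<exists>i\<le>n. odd (a i)" "(\<Sum>i\<le>n. of_int (a i) * c ^ i) = 0"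
    using n[of "\<lambda>i. c ^ i"] by blast
  define d where "d = Max {i. i \<le> n \<and> a i ~= 0}"
  have ne: "{i. i \<le> n \<and> a i ~= 0} ~= {}" using a(1) by (metis (mono_tags, lifting) empty_Collect_eq even_zero)
  then have d: "d \<le> n" "a d ~= 0" using Max_in[of "{i. i \<le> n \<and> a i ~= 0}"] by (auto simp: d_def)
  have above: "a i = 0" if "i \<le> n" "i > d" for i
  proof (rule ccontr)
    assume "a i ~= 0"
    then have "i \<in> {i. i \<le> n \<and> a i ~= 0}" using that(1) by simp
    then have "i \<le> d" unfolding d_def by (rule Max_ge[rotated]) simp
    with that(2) show False by simp
  qed
  have "(\<Sum>i\<le>n. of_int (a i) * c ^ i) = (\<Sum>i\<le>d. of_int (a i) * c ^ i)"
    using d(1) above by (intro sum.mono_neutral_right) auto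
  then have rel: "of_int (a d) * c ^ d = - (\<Sum>i<d. of_int (a i) * c ^ i)"
    using a(2) by (simp add: lessThan_Suc_atMost[symmetric] add_eq_0_iff2)
  have "d > 0" using rel d(2) by (cases d) auto
  obtain e m where m: "a d = 2 ^ e * m" "odd m"
  proof -
    fix w assume w: "!!e m. a d = 2 ^ e * m ==> odd m ==> w"
    have "\<not> is_unit (2::int)" by simp
    from multiplicity_decompose'[OF d(2) this] obtain y where "a d = 2 ^ multiplicity 2 (a d) * y" "\<not> 2 dvd y" .
    with w show w by blast
  qed
  define z where "z = 2 ^ e * to_ac c"
  have cz: "to_ac c ^ i * 2 ^ (e * i) = z ^ i" for i
    by (simp add: z_def power_mult_distrib power_mult mult.commute)
  have relK: "of_int (a d) * to_ac c ^ d = - (\<Sum>i<d. of_int (a i) * to_ac c ^ i)"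
  proof -
    have "to_ac (of_int (a d) * c ^ d) = to_ac (- (\<Sum>i<d. of_int (a i) * c ^ i))" using rel by simp
    then show ?thesis by (simp add: to_ac_sum)
  qed
  have im: "inverse (of_int m) * of_int m = (1 :: 'k alg_closure)" using odd_unit[OF m(2)] by simp
  have split: "(2::'k alg_closure) ^ (e * (d - 1)) = 2 ^ (e * i) * 2 ^ (e * (d - 1 - i))" if "i < d" for i
  proof -
    have "d - 1 = i + (d - 1 - i)" using that by simp
    then show ?thesis by (metis distrib_left power_add)
  qed
  have "z ^ d = inverse (of_int m) * (of_int (a d) * to_ac c ^ d * 2 ^ (e * (d - 1)))"
  proof -
    have "e * d = e + e * (d - 1)" using \<open>d > 0\<close> by (cases d) auto
    then have "z ^ d = to_ac c ^ d * (2 ^ e * 2 ^ (e * (d - 1)))" using cz[of d] by (simp add: power_add)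
    also have "\<dots> = (inverse (of_int m) * of_int m) * (to_ac c ^ d * (2 ^ e * 2 ^ (e * (d - 1))))" by (simp only: im mult_1)
    also have "\<dots> = inverse (of_int m) * (of_int (a d) * to_ac c ^ d * 2 ^ (e * (d - 1)))"
      unfolding m(1) by (simp only: of_int_mult of_int_power of_int_numeral mult_ac)
    finally show ?thesis .
  qed
  also have "\<dots> = (\<Sum>i<d. (- (inverse (of_int m) * of_int (a i) * 2 ^ (e * (d - 1 - i)))) * z ^ i)"
    unfolding relK sum_negf[symmetric] sum_distrib_left sum_distrib_right
  proof (rule sum.cong[OF refl])
    fix i assume "i \<in> {..<d}"
    then show "inverse (of_int m) * (- (of_int (a i) * to_ac c ^ i) * 2 ^ (e * (d - 1))) =
         - (inverse (of_int m) * of_int (a i) * 2 ^ (e * (d - 1 - i))) * z ^ i"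
      unfolding cz[symmetric] using split[of i] by (simp add: mult_ac)
  qed
  finally have "z \<in> V"
    by (rule integral_closed) (use \<open>d > 0\<close> odd_unit[OF m(2)] in \<open>auto intro!: ops(4,5,9) two_pow\<close>)
  then show ?thesis unfolding z_def by blast
qed

lemma scaled_base_finite: "finite T ==> \<exists>N. \<forall>c\<in>T. 2 ^ N * to_ac c \<in> V"
proof (induction T rule: finite_induct)
  case (insert c T)
  then obtain N where N: "\<forall>c\<in>T. 2 ^ N * to_ac c \<in> V" by blast
  obtain M where M: "2 ^ M * to_ac c \<in> V" using scaled_base by blast
  have "\<forall>b\<in>insert c T. 2 ^ (N + M) * to_ac b \<in> V"
  proof
    fix b assume "b \<in> insert c T"
    then have "2 ^ M * (2 ^ N * to_ac b) \<in> V \<or> 2 ^ N * (2 ^ M * to_ac b) \<in> V"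
      using N M ops(4)[OF two_pow] by blast
    then show "2 ^ (N + M) * to_ac b \<in> V" by (simp add: power_add mult_ac)
  qed
  then show ?case by blast
qed auto

text \<open>In the monic equation of x over k a common power 2^N makes all coefficients integral,
  and then 2^N x is integral over V.\<close>

lemma scaled_closure: "\<exists>N. 2 ^ N * x \<in> V"
proof -
  obtain p :: "'k poly" where p: "p ~= 0" "poly (map_poly to_ac p) x = 0" using alg_closure_algebraic[of x] .
  define d where "d = Polynomial.degree p"
  define l where "l = Polynomial.coeff p d"
  have l: "l ~= 0" using p(1) by (simp add: l_def d_def)
  define b where "b i = Polynomial.coeff p i / l" for i
  have "d ~= 0"
  proof
    assume "d = 0"
    then obtain a where "p = [:a:]" unfolding d_def by (rule degree_eq_zeroE)
    with p show False by (simp add: map_poly_pCons)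
  qed
  obtain N where N: "\<forall>c\<in>b ` {..<d}. 2 ^ N * to_ac c \<in> V" using scaled_base_finite[of "b ` {..<d}"] by auto
  have dK: "Polynomial.degree (map_poly to_ac p) = d" unfolding d_def by (rule degree_map_poly) simp
  have "(\<Sum>i\<le>d. to_ac (Polynomial.coeff p i) * x ^ i) = 0"
    using p(2) unfolding poly_altdef dK by (simp add: coeff_map_poly)
  then have rel0: "to_ac l * x ^ d + (\<Sum>i<d. to_ac (Polynomial.coeff p i) * x ^ i) = 0"
    by (simp add: lessThan_Suc_atMost[symmetric] l_def add.commute)
  have "x ^ d = - (\<Sum>i<d. to_ac (b i) * x ^ i)"
  proof -
    have "to_ac l * x ^ d = - (\<Sum>i<d. to_ac (Polynomial.coeff p i) * x ^ i)"
      using rel0 by (simp add: add_eq_0_iff2)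
    then have Lx: "to_ac l * x ^ d = - (\<Sum>i<d. to_ac (Polynomial.coeff p i) * x ^ i)" .
    have L: "inverse (to_ac l) * to_ac l = 1" using l by simp
    have "x ^ d = (inverse (to_ac l) * to_ac l) * x ^ d" unfolding L by (simp only: mult_1)
    also have "\<dots> = inverse (to_ac l) * (- (\<Sum>i<d. to_ac (Polynomial.coeff p i) * x ^ i))"
      unfolding mult.assoc Lx ..
    also have "\<dots> = - (\<Sum>i<d. inverse (to_ac l) * (to_ac (Polynomial.coeff p i) * x ^ i))"
      by (simp only: sum_distrib_left mult_minus_right)
    also have "\<dots> = - (\<Sum>i<d. to_ac (b i) * x ^ i)"
      by (simp only: b_def divide_inverse to_ac_mult to_ac_inverse mult_ac)
    finally show ?thesis .
  qed
  then have "(2 ^ N * x) ^ d = (\<Sum>i<d. (- (2 ^ (N * (d - i)) * to_ac (b i))) * (2 ^ N * x) ^ i)"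
  proof -
    assume xd: "x ^ d = - (\<Sum>i<d. to_ac (b i) * x ^ i)"
    have "(2 ^ N * x) ^ d = 2 ^ (N * d) * x ^ d" by (simp add: power_mult_distrib power_mult)
    also have "\<dots> = (\<Sum>i<d. - (2 ^ (N * d) * (to_ac (b i) * x ^ i)))" unfolding xd by (simp add: sum_distrib_left sum_negf)
    also have "\<dots> = (\<Sum>i<d. (- (2 ^ (N * (d - i)) * to_ac (b i))) * (2 ^ N * x) ^ i)"
    proof (rule sum.cong[OF refl])
      fix i assume "i \<in> {..<d}"
      then have "N * d = N * (d - i) + N * i" by (simp flip: distrib_left)
      then have "(2::'k alg_closure) ^ (N * d) = 2 ^ (N * (d - i)) * 2 ^ (N * i)" by (metis power_add)
      then show "- (2 ^ (N * d) * (to_ac (b i) * x ^ i)) = - (2 ^ (N * (d - i)) * to_ac (b i)) * (2 ^ N * x) ^ i"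
        by (simp add: power_mult_distrib power_mult mult_ac)
    qed
    finally show ?thesis .
  qed
  then have "2 ^ N * x \<in> V"
  proof (rule integral_closed)
    fix i assume i: "i < d"
    then have "N * (d - i) = N * (d - i - 1) + N" by (metis Suc_diff_Suc diff_Suc_eq_diff_pred add.commute mult_Suc_right diff_Suc_1)
    then have e: "(2::'k alg_closure) ^ (N * (d - i)) = 2 ^ (N * (d - i - 1)) * 2 ^ N" by (metis power_add)
    have "2 ^ N * to_ac (b i) \<in> V" using N i by blast
    then have "- (2 ^ (N * (d - i - 1)) * (2 ^ N * to_ac (b i))) \<in> V" by (rule ops(5)[OF ops(4)[OF two_pow]])
    then show "- (2 ^ (N * (d - i)) * to_ac (b i)) \<in> V" unfolding e mult.assoc .
  qed (use \<open>d ~= 0\<close> in simp)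
  then show ?thesis ..
qed

lemma bounded_finite: "finite T ==> \<exists>N. \<forall>c\<in>T. 2 ^ N * c \<in> V"
proof (induction T rule: finite_induct)
  case (insert c T)
  then obtain N where N: "\<forall>c\<in>T. 2 ^ N * c \<in> V" by blast
  obtain M where M: "2 ^ M * c \<in> V" using scaled_closure by blast
  have "\<forall>b\<in>insert c T. 2 ^ (N + M) * b \<in> V"
  proof
    fix b assume "b \<in> insert c T"
    then have "2 ^ M * (2 ^ N * b) \<in> V \<or> 2 ^ N * (2 ^ M * b) \<in> V"
      using N M ops(4)[OF two_pow] by blast
    then show "2 ^ (N + M) * b \<in> V" by (simp add: power_add mult_ac)
  qed
  then show ?case by blast
qed auto

text \<open>k \<inter> V has finitely many residues modulo 2 V: by
  \<open>number_field_relation\<close> a set independent over F2 has at most n elements, and modulo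
  2 V every other element is a subset sum of a maximal such set.\<close>

lemma pigeonhole_mod_2:
  assumes S: "infinite S" "S \<subseteq> {x :: 'k. to_ac x \<in> V}"
  obtains S' where "infinite S'" "S' \<subseteq> S" "\<forall>x\<in>S'. \<forall>y\<in>S'. sm 1 (to_ac (x - y))"
proof -
  define M where "M = {x :: 'k. to_ac x \<in> V}"
  obtain n where n: "!!f :: nat => 'k. \<exists>c :: nat => int. (\<exists>i\<le>n. odd (c i)) \<and> (\<Sum>i\<le>n. of_int (c i) * f i) = 0"
    using number_field_relation[OF nf] by blast
  \<comment> \<open>Independence over F2 in terms of subset sums, the coefficients being 0 or
    1.\<close>
  define ind where "ind B \<longleftrightarrow> finite B \<and> B \<subseteq> M \<and> (\<forall>T\<subseteq>B. T ~= {} --> \<not> sm 1 (to_ac (\<Sum>T)))" for B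
  have small: "card B \<le> n" if "ind B" for B
  proof (rule ccontr)
    assume "\<not> card B \<le> n"
    then have "Suc n \<le> card B" by simp
    from obtain_subset_with_card_n[OF this] obtain B' where B': "B' \<subseteq> B" "card B' = Suc n" "finite B'" .
    have fin: "finite B'" by (rule B'(3))
    from ex_bij_betw_nat_finite[OF fin, unfolded B'(2) lessThan_atLeast0[symmetric]]
    obtain f where f: "bij_betw f {..<Suc n} B'" ..
    obtain c :: "nat => int" where c: "\<exists>i\<le>n. odd (c i)" "(\<Sum>i\<le>n. of_int (c i) * f i) = 0" using n[of f] by blast
    define J where "J = {i. i \<le> n \<and> odd (c i)}"
    have fB: "f i \<in> B" if "i \<le> n" for i using f that B' by (auto simp: bij_betw_def)
    have inj: "inj_on f J" using f by (auto simp: bij_betw_def J_def inj_on_def)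
    have "sm 1 (to_ac (\<Sum>i\<le>n. (of_int (c i) - of_bool (odd (c i))) * f i))"
      unfolding to_ac_sum
    proof (rule sm_sum)
      fix i assume "i \<in> {..n}"
      then have fV: "to_ac (f i) \<in> V" using fB that unfolding ind_def M_def by auto
      have "even (c i - of_bool (odd (c i)))" by simp
      then obtain k where "c i - of_bool (odd (c i)) = 2 * k" by (rule evenE)
      then have "(of_int (c i) - of_bool (odd (c i)) :: 'k) = 2 * of_int k"
        by (metis of_int_diff of_int_of_bool of_int_mult of_int_numeral)
      then have "to_ac ((of_int (c i) - of_bool (odd (c i))) * f i) = 2 ^ 1 * (of_int k * to_ac (f i))" by simp
      then show "sm 1 (to_ac ((of_int (c i) - of_bool (odd (c i))) * f i))"
        unfolding sm_iff using ops(4)[OF ops(9) fV] by blast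
    qed
    moreover have "(\<Sum>i\<le>n. (of_int (c i) - of_bool (odd (c i))) * f i) = - (\<Sum>i\<le>n. of_bool (odd (c i)) * f i)"
      using c(2) by (simp add: left_diff_distrib sum_subtractf)
    moreover have "(\<Sum>i\<le>n. of_bool (odd (c i)) * f i) = (\<Sum>i\<in>J. f i)"
      by (rule sum.mono_neutral_cong_right) (auto simp: J_def)
    ultimately have "sm 1 (to_ac (\<Sum>(f ` J)))" using sm_minus[of 1] inj by (simp add: sum.reindex) fastforce
    moreover have "f ` J \<subseteq> B" "f ` J ~= {}" using fB c(1) by (auto simp: J_def)
    ultimately show False using that unfolding ind_def by blast
  qed
  have "ind {}" by (auto simp: ind_def)
  then have "\<exists>B. ind B \<and> card B = 0" by (intro exI[of _ "{}"]) simp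
  moreover have "\<forall>c. (\<exists>B. ind B \<and> card B = c) --> c \<le> n" using small by auto
  ultimately have "\<exists>c. (\<exists>B. ind B \<and> card B = c) \<and> (\<forall>c'. (\<exists>B. ind B \<and> card B = c') --> c' \<le> c)"
    by (rule Nat.ex_has_greatest_nat[of "\<lambda>c. \<exists>B. ind B \<and> card B = c" 0 n])
  then obtain B where B: "ind B" and "\<forall>c'. (\<exists>B. ind B \<and> card B = c') --> c' \<le> card B" by auto
  then have max: "card B' \<le> card B" if "ind B'" for B' using that by auto
  have ex: "\<exists>T\<subseteq>B. sm 1 (to_ac (m + \<Sum>T))" if m: "m \<in> M - B" for m
  proof -
    have "\<not> ind (insert m B)"
      using max[of "insert m B"] m B by (auto simp: ind_def)
    then obtain T where T: "T \<subseteq> insert m B" "T ~= {}" "sm 1 (to_ac (\<Sum>T))" using B m by (auto simp: ind_def)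
    have "m \<in> T" using T B unfolding ind_def by blast
    then have "\<Sum>T = m + \<Sum>(T - {m})" using T(1) B finite_subset[of T "insert m B"] by (simp add: ind_def sum.remove)
    with T show ?thesis by (intro exI[of _ "T - {m}"]) auto
  qed
  define F where "F m = (SOME T. T \<subseteq> B \<and> sm 1 (to_ac (m + \<Sum>T)))" for m
  have F: "F m \<subseteq> B \<and> sm 1 (to_ac (m + \<Sum>(F m)))" if "m \<in> M - B" for m
    unfolding F_def by (rule someI_ex) (rule ex[OF that])
  have fB: "finite B" using B by (simp add: ind_def)
  have inf: "infinite (S - B)" using S(1) fB by simp
  have "finite (F ` (S - B))" by (rule finite_subset[of _ "Pow B"]) (use F S(2) fB in \<open>auto simp: M_def\<close>)
  from pigeonhole_infinite[OF inf this] obtain a where a: "infinite {b \<in> S - B. F b = F a}" by auto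
  show ?thesis
  proof (rule that[OF a])
    show "\<forall>x\<in>{b \<in> S - B. F b = F a}. \<forall>y\<in>{b \<in> S - B. F b = F a}. sm 1 (to_ac (x - y))"
    proof (intro ballI)
      fix x y assume "x \<in> {b \<in> S - B. F b = F a}" "y \<in> {b \<in> S - B. F b = F a}"
      then have "sm 1 (to_ac (x + \<Sum>(F a)))" "sm 1 (to_ac (y + \<Sum>(F a)))" using F[of x] F[of y] S(2) by (auto simp: M_def)
      from sm_diff[OF this] show "sm 1 (to_ac (x - y))" by simp
    qed
  qed auto
qed

text \<open>Differences from a base point that are divisible by 2^N are divided by 2^N and sorted
  modulo 2 once more.\<close>

lemma pigeonhole:
  assumes "infinite S" "S \<subseteq> {x :: 'k. to_ac x \<in> V}"
  shows "\<exists>S'. infinite S' \<and> S' \<subseteq> S \<and> (\<forall>x\<in>S'. \<forall>y\<in>S'. sm N (to_ac (x - y)))"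
proof (induction N)
  case 0
  have "sm 0 (to_ac (x - y))" if "x \<in> S" "y \<in> S" for x y
    using that assms(2) ops(6) by (auto simp: sm_0)
  with assms(1) show ?case by blast
next
  case (Suc N)
  then obtain S1 where S1: "infinite S1" "S1 \<subseteq> S" "!!x y. x \<in> S1 ==> y \<in> S1 ==> sm N (to_ac (x - y))" by blast
  obtain s where s: "s \<in> S1" using S1(1) by (metis finite.emptyI ex_in_conv)
  define \<phi> where "\<phi> x = (x - s) / 2 ^ N" for x
  have inj: "inj_on \<phi> T" for T by (auto simp: \<phi>_def inj_on_def)
  have i1: "infinite (\<phi> ` S1)" using S1(1) inj finite_imageD by blast
  have i2: "\<phi> ` S1 \<subseteq> {x. to_ac x \<in> V}" using S1(3)[OF _ s] by (auto simp: \<phi>_def sm_def)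
  from pigeonhole_mod_2[OF i1 i2] obtain T where T: "infinite T" "T \<subseteq> \<phi> ` S1" "\<forall>x\<in>T. \<forall>y\<in>T. sm 1 (to_ac (x - y))" .
  define S2 where "S2 = {x \<in> S1. \<phi> x \<in> T}"
  have "T = \<phi> ` S2" using T(2) by (auto simp: S2_def)
  then have "infinite S2" using T(1) by auto
  moreover have "sm (Suc N) (to_ac (x - y))" if "x \<in> S2" "y \<in> S2" for x y
  proof -
    have "sm 1 (to_ac (\<phi> x - \<phi> y))" using T(3) that by (simp add: S2_def)
    moreover have "\<phi> x - \<phi> y = (x - y) / 2 ^ N" by (simp add: \<phi>_def diff_divide_distrib)
    ultimately show ?thesis by (simp add: sm_def mult.commute)
  qed
  moreover have "S2 \<subseteq> S" using S1(2) by (auto simp: S2_def)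
  ultimately show ?case by blast
qed

end

section \<open>Uniform finiteness of torsion abscissae\<close>

lemma bezout_no_common_root:
  fixes p q :: "'a::alg_closed_field poly"
  assumes nc: "!!r. poly p r = 0 ==> poly q r ~= 0"
  shows "\<exists>a b. a * p + b * q = 1"
proof -
  define I where "I = {a * p + b * q | a b. True}"
  have pI: "p \<in> I" unfolding I_def by (rule CollectI, rule exI[of _ 1], rule exI[of _ 0]) simp
  have qI: "q \<in> I" unfolding I_def by (rule CollectI, rule exI[of _ 0], rule exI[of _ 1]) simp
  have mI: "c * u \<in> I" if u: "u \<in> I" for c u
  proof -
    obtain a b where "u = a * p + b * q" using u unfolding I_def by blast
    then have "c * u = (c * a) * p + (c * b) * q" by (simp add: algebra_simps)
    then show ?thesis unfolding I_def by blast
  qed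
  have dI: "u - v \<in> I" if u: "u \<in> I" "v \<in> I" for u v
  proof -
    obtain a b a' b' where "u = a * p + b * q" "v = a' * p + b' * q" using u unfolding I_def by blast
    then have "u - v = (a - a') * p + (b - b') * q" by (simp add: algebra_simps)
    then show ?thesis unfolding I_def by blast
  qed
  have ne: "\<exists>u. u \<in> I \<and> u ~= 0" using pI qI nc by (metis poly_0)
  define d where "d = (ARG_MIN Polynomial.degree u. u \<in> I \<and> u ~= 0)"
  have d: "d \<in> I" "d ~= 0" and dmin: "!!u. u \<in> I ==> u ~= 0 ==> Polynomial.degree d \<le> Polynomial.degree u"
    using arg_min_nat_lemma[of "\<lambda>u. u \<in> I \<and> u ~= 0" _ Polynomial.degree] ne unfolding d_def by blast+
  have dvd: "d dvd u" if u: "u \<in> I" for u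
  proof (rule ccontr)
    assume nd: "\<not> d dvd u"
    have "u mod d = u - (u div d) * d" by (simp add: minus_div_mult_eq_mod)
    then have "u mod d \<in> I" using dI[OF u mI[OF d(1)]] by simp
    moreover have "u mod d ~= 0" using nd by (simp add: dvd_eq_mod_eq_0)
    ultimately show False using dmin[of "u mod d"] degree_mod_less[OF d(2), of u] by simp
  qed
  have "Polynomial.degree d = 0"
  proof (rule ccontr)
    assume "Polynomial.degree d ~= 0"
    then obtain r where r: "poly d r = 0" using alg_closed_imp_poly_has_root[of d] by auto
    have "poly p r = 0" "poly q r = 0" using dvd[OF pI] dvd[OF qI] r by (auto elim!: dvdE)
    with nc show False by blast
  qed
  then obtain c where c: "d = [:c:]" by (rule degree_eq_zeroE)
  have "[:inverse c:] * d \<in> I" by (rule mI[OF d(1)])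
  moreover have "[:inverse c:] * d = 1" using c d(2) by (simp add: one_pCons)
  ultimately show ?thesis unfolding I_def by fastforce
qed

text \<open>An identity a p + b p' = 1 persists in every larger field. It is needed here because
  \<open>genus_one\<close> with base field the algebraic closure speaks of a further algebraic
  closure on top of it.\<close>

lemma rsquarefree_map_to_ac:
  fixes p :: "'k::field_char_0 alg_closure poly"
  assumes "rsquarefree p"
  shows "rsquarefree (map_poly to_ac p)"
proof -
  have nz: "p ~= 0" using assms by (auto simp: rsquarefree_def)
  obtain a b where ab: "a * p + b * pderiv p = 1"
    using bezout_no_common_root[of p "pderiv p"] assms unfolding rsquarefree_roots by blast
  have der: "pderiv (map_poly to_ac u) = map_poly to_ac (pderiv u)" for u :: "'k alg_closure poly"
    by (rule poly_eqI) (simp add: coeff_pderiv coeff_map_poly)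
  have "map_poly to_ac a * map_poly to_ac p + map_poly to_ac b * pderiv (map_poly to_ac p) = 1"
    unfolding der map_ac_mult[symmetric] map_ac_add[symmetric] ab by (simp add: one_pCons map_poly_pCons)
  then have "poly (map_poly to_ac a) r * poly (map_poly to_ac p) r + poly (map_poly to_ac b) r * poly (pderiv (map_poly to_ac p)) r = 1" for r
    by (metis poly_add poly_mult poly_1)
  then show ?thesis unfolding rsquarefree_roots by (metis add_0 mult_zero_right zero_neq_one)
qed

section \<open>Transporting conics to a cubic over the algebraic closure\<close>

lemma poly_map_ac: "poly (map_poly to_ac p) (to_ac x) = to_ac (poly p x)"
  by (induction p) auto

text \<open>Extension of scalars; with r^2 = C the factor r also removes the twist, as C y^2 = (r
  y)^2.\<close>

definition bc :: "'k::field alg_closure => 'k \<times> 'k \<times> 'k => 'k alg_closure \<times> 'k alg_closure \<times> 'k alg_closure" where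
  "bc r P = (to_ac (fst P), to_ac (fst (snd P)), r * to_ac (snd (snd P)))"

text \<open>The map x \<mapsto> 1/(x - e): the root e goes to infinity and infinity goes to
  0.\<close>

definition moebius :: "'a::field => 'a \<times> 'a \<times> 'a => 'a \<times> 'a \<times> 'a" where
  "moebius e P = (if fst P = 0 then (1, 0, snd (snd P)) else if fst (snd P) = e then (0, 1, 0)
     else (1, 1 / (fst (snd P) - e), snd (snd P) / (fst (snd P) - e) ^ 2))"

lemma bc_neg: "bc r (neg P) = neg (bc r P)" for r :: "'k::field_char_0 alg_closure" by (simp add: bc_def neg_def)

lemma moebius_neg: "moebius e (neg P) = neg (moebius e P)" by (simp add: moebius_def neg_def)

lemma cop4_bc:
  fixes h :: "'k::field_char_0 poly"
  assumes "cop4 h P1 P2 P3 P4" "r ~= 0"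
  shows "cop4 (smult (r ^ 2) (map_poly to_ac h)) (bc r P1) (bc r P2) (bc r P3) (bc r P4)"
proof -
  obtain q \<kappa> where q: "Polynomial.degree q \<le> 2" "\<kappa> ~= 0" "q ^ 2 - h = smult \<kappa> (linf P1 * linf P2 * linf P3 * linf P4)"
     "qvp q P1 = snd (snd P1)" "qvp q P2 = snd (snd P2)" "qvp q P3 = snd (snd P3)" "qvp q P4 = snd (snd P4)"
    using assms(1) unfolding cop4_def by blast
  define q' where "q' = smult r (map_poly to_ac q)"
  have lin: "map_poly to_ac (linf P) = linf (bc r P)" for P :: "'k \<times> 'k \<times> 'k"
    by (simp add: linf_def bc_def map_poly_pCons)
  have qv: "qvp q' (bc r P) = snd (snd (bc r P))" if "qvp q P = snd (snd P)" for P
    using that[symmetric] by (simp add: qvp_def q'_def bc_def coeff_map_poly poly_map_ac)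
  have "q' ^ 2 - smult (r ^ 2) (map_poly to_ac h) = smult (r ^ 2) (map_poly to_ac (q ^ 2 - h))"
    by (simp add: q'_def map_ac_diff map_ac_power power2_eq_square map_ac_mult smult_diff_right)
  also have "\<dots> = smult (r ^ 2 * to_ac \<kappa>) (linf (bc r P1) * linf (bc r P2) * linf (bc r P3) * linf (bc r P4))"
    unfolding q(3) by (simp add: map_ac_smult map_ac_mult lin)
  finally show ?thesis unfolding cop4_def
    by (intro exI[of _ q'] exI[of _ "r ^ 2 * to_ac \<kappa>"]) (use q assms(2) qv in \<open>auto simp: q'_def degree_map_ac\<close>)
qed

text \<open>The polynomial t^4 G(e + 1/t). Its coefficient of degree 4 is G(e), so a root e of G
  makes it a cubic.\<close>

definition moebius_poly :: "'a::field poly => 'a => 'a poly" where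
  "moebius_poly G e = grev (pcompose G [:e, 1:])"

lemma degree_shift: "Polynomial.degree (pcompose p [:e, 1:]) = Polynomial.degree p" for p :: "'a::field poly"
  by (simp add: degree_pcompose)

lemma moebius_poly_eval:
  fixes G :: "'a::field poly"
  assumes "Polynomial.degree G \<le> 4" "t ~= 0"
  shows "poly (moebius_poly G e) t = t ^ 4 * poly G (e + 1 / t)"
  unfolding moebius_poly_def by (subst grev_eval(1)) (use assms in \<open>simp_all add: poly_pcompose degree_shift\<close>)

lemma moebius_poly_coeff:
  fixes G :: "'a::field poly"
  assumes "Polynomial.degree G \<le> 4"
  shows "Polynomial.coeff (moebius_poly G e) 4 = poly G e" "Polynomial.coeff (moebius_poly G e) 0 = Polynomial.coeff G 4"
    "Polynomial.coeff (moebius_poly G e) 3 = poly (pderiv G) e"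
proof -
  have *: "Polynomial.coeff (moebius_poly G e) 4 = poly (pcompose G [:e, 1:]) 0"
    "Polynomial.coeff (moebius_poly G e) 0 = Polynomial.coeff (pcompose G [:e, 1:]) 4"
    "Polynomial.coeff (moebius_poly G e) 3 = poly (pderiv (pcompose G [:e, 1:])) 0"
    by (simp_all add: moebius_poly_def grev_pCons eval_nat_numeral poly_0_coeff_0 coeff_pderiv)
  show "Polynomial.coeff (moebius_poly G e) 4 = poly G e" unfolding *(1) by (simp add: poly_pcompose)
  show "Polynomial.coeff (moebius_poly G e) 3 = poly (pderiv G) e" unfolding *(3) by (simp add: pderiv_pcompose poly_pcompose pderiv_pCons)
  show "Polynomial.coeff (moebius_poly G e) 0 = Polynomial.coeff G 4" unfolding *(2)
  proof (cases "Polynomial.degree G = 4")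
    case True
    then show "Polynomial.coeff (pcompose G [:e, 1:]) 4 = Polynomial.coeff G 4"
      using lead_coeff_comp[of "[:e, 1:]" G] by (simp add: degree_shift)
  next
    case False
    then show "Polynomial.coeff (pcompose G [:e, 1:]) 4 = Polynomial.coeff G 4"
      using assms by (simp add: coeff_eq_0 degree_shift)
  qed
qed

lemma moebius_linf:
  fixes e :: "'a::field"
  assumes "fst P = 1 \<or> (fst P = 0 \<and> fst (snd P) = 1)"
  shows "\<exists>\<sigma>. \<sigma> ~= 0 \<and> (\<forall>t. t ~= 0 --> t * poly (linf P) (e + 1 / t) = \<sigma> * poly (linf (moebius e P)) t)"
proof -
  obtain a b y where P: "P = (a, b, y)" by (cases P) auto
  consider "a = 0" "b = 1" | "a = 1" "b = e" | "a = 1" "b ~= e" using assms P by auto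
  then show ?thesis
  proof cases
    case 1
    then show ?thesis by (intro exI[of _ "-1"]) (simp add: P linf_def moebius_def)
  next
    case 2
    then show ?thesis by (intro exI[of _ "-1"]) (simp add: P linf_def moebius_def)
  next
    case 3
    then have ne: "b - e ~= 0" "e - b ~= 0" by auto
    have "t * (- b + (e + 1 / t)) = (e - b) * (- (1 / (b - e)) + t)" if "t ~= 0" for t
      using that ne by (simp add: field_simps)
    then show ?thesis using 3 ne by (intro exI[of _ "e - b"]) (simp add: P linf_def moebius_def)
  qed
qed

text \<open>The conic q goes to t^2 q(e + 1/t), which is q(x + e) with its coefficients reversed.
  The linear factors change by nonzero scalars, which are collected in the new \<kappa>.\<close>

lemma cop4_moebius:
  fixes G :: "'a::field_char_0 poly"
  assumes deg: "Polynomial.degree G \<le> 4" and e: "poly G e = 0"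
    and P: "!!P. P \<in> {P1, P2, P3, P4} ==> (fst P = 1 \<and> snd (snd P) ^ 2 = poly G (fst (snd P))) \<or> (fst P = 0 \<and> fst (snd P) = 1)"
    and c: "cop4 G P1 P2 P3 P4"
  shows "cop4 (moebius_poly G e) (moebius e P1) (moebius e P2) (moebius e P3) (moebius e P4)"
proof -
  obtain q \<kappa> where q: "Polynomial.degree q \<le> 2" "\<kappa> ~= 0" "q ^ 2 - G = smult \<kappa> (linf P1 * linf P2 * linf P3 * linf P4)"
     "qvp q P1 = snd (snd P1)" "qvp q P2 = snd (snd P2)" "qvp q P3 = snd (snd P3)" "qvp q P4 = snd (snd P4)"
    using c unfolding cop4_def by blast
  have sig: "\<exists>\<sigma>. \<sigma> ~= 0 \<and> (\<forall>t. t ~= 0 --> t * poly (linf Q) (e + 1 / t) = \<sigma> * poly (linf (moebius e Q)) t)"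
    if "Q \<in> {P1, P2, P3, P4}" for Q by (rule moebius_linf) (use P[OF that] in auto)
  obtain s1 where s1: "s1 ~= 0" "!!t. t ~= 0 ==> t * poly (linf P1) (e + 1 / t) = s1 * poly (linf (moebius e P1)) t" using sig[of P1] by auto
  obtain s2 where s2: "s2 ~= 0" "!!t. t ~= 0 ==> t * poly (linf P2) (e + 1 / t) = s2 * poly (linf (moebius e P2)) t" using sig[of P2] by auto
  obtain s3 where s3: "s3 ~= 0" "!!t. t ~= 0 ==> t * poly (linf P3) (e + 1 / t) = s3 * poly (linf (moebius e P3)) t" using sig[of P3] by auto
  obtain s4 where s4: "s4 ~= 0" "!!t. t ~= 0 ==> t * poly (linf P4) (e + 1 / t) = s4 * poly (linf (moebius e P4)) t" using sig[of P4] by auto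
  define s where "s = pcompose q [:e, 1:]"
  have ds: "Polynomial.degree s \<le> 2" using q(1) by (simp add: s_def degree_shift)
  obtain r0 r1 r2 where s: "s = [:r0, r1, r2:]" using quadratic_expand[OF ds] by blast
  define q' where "q' = [:r2, r1, r0:]"
  have q'1: "poly q' t = t ^ 2 * poly q (e + 1 / t)" if "t ~= 0" for t
  proof -
    have "poly q (e + 1 / t) = poly s (1 / t)" by (simp add: s_def poly_pcompose)
    then show ?thesis using that by (simp add: s q'_def field_simps power2_eq_square)
  qed
  have q'0: "poly q' 0 = Polynomial.coeff q 2"
  proof -
    have "Polynomial.coeff s 2 = Polynomial.coeff q 2"
    proof (cases "Polynomial.degree q = 2")
      case True
      then show ?thesis using lead_coeff_comp[of "[:e, 1:]" q] by (simp add: s_def degree_shift)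
    next
      case False
      then show ?thesis using q(1) by (simp add: coeff_eq_0 degree_shift s_def)
    qed
    then show ?thesis by (simp add: q'_def s numeral_2_eq_2)
  qed
  have q'2: "Polynomial.coeff q' 2 = poly q e"
  proof -
    have "poly q e = poly s 0" by (simp add: s_def poly_pcompose)
    then show ?thesis by (simp add: q'_def s numeral_2_eq_2)
  qed
  have qv: "qvp q' (moebius e Q) = snd (snd (moebius e Q))" if Q: "Q \<in> {P1, P2, P3, P4}" for Q
  proof -
    obtain a b y where abc: "Q = (a, b, y)" by (cases Q) auto
    have v: "qvp q Q = y" using q(4-7) Q abc by auto
    consider "a = 0" "b = 1" | "a = 1" "b = e" "y ^ 2 = poly G e" | "a = 1" "b ~= e" using P[OF Q] abc by auto
    then show ?thesis
    proof cases
      case 1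
      then show ?thesis using v by (simp add: abc qvp_def moebius_def q'0)
    next
      case 2
      then have "y = 0" using e by simp
      then show ?thesis using v 2 by (simp add: abc qvp_def moebius_def q'2)
    next
      case 3
      then have "poly q' (1 / (b - e)) = (1 / (b - e)) ^ 2 * y" using v by (subst q'1) (simp_all add: abc qvp_def)
      then show ?thesis using 3 by (simp add: abc qvp_def moebius_def power_divide)
    qed
  qed
  have "q' ^ 2 - moebius_poly G e = smult (\<kappa> * s1 * s2 * s3 * s4)
      (linf (moebius e P1) * linf (moebius e P2) * linf (moebius e P3) * linf (moebius e P4))"
  proof (rule infinite_agree_poly[where t = 0])
    fix t :: 'a assume t: "t ~= 0"
    have "poly (q' ^ 2 - moebius_poly G e) t = t ^ 4 * poly (q ^ 2 - G) (e + 1 / t)"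
      by (simp add: moebius_poly_eval[OF deg t] q'1[OF t] power_mult_distrib right_diff_distrib flip: power_mult)
    also have "\<dots> = \<kappa> * (t * poly (linf P1) (e + 1 / t)) * (t * poly (linf P2) (e + 1 / t)) *
        (t * poly (linf P3) (e + 1 / t)) * (t * poly (linf P4) (e + 1 / t))"
      unfolding q(3) by (simp add: power4_eq_xxxx mult_ac)
    also have "\<dots> = poly (smult (\<kappa> * s1 * s2 * s3 * s4)
      (linf (moebius e P1) * linf (moebius e P2) * linf (moebius e P3) * linf (moebius e P4))) t"
      unfolding s1(2)[OF t] s2(2)[OF t] s3(2)[OF t] s4(2)[OF t] by (simp only: poly_smult poly_mult mult_ac)
    finally show "poly (q' ^ 2 - moebius_poly G e) t = poly (smult (\<kappa> * s1 * s2 * s3 * s4)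
      (linf (moebius e P1) * linf (moebius e P2) * linf (moebius e P3) * linf (moebius e P4))) t" .
  qed
  moreover have "Polynomial.degree q' \<le> 2" unfolding q'_def by simp
  ultimately show ?thesis unfolding cop4_def
    by (intro exI[of _ q'] exI[of _ "\<kappa> * s1 * s2 * s3 * s4"]) (use q(2) s1(1) s2(1) s3(1) s4(1) qv in simp)
qed

lemma on_moebius:
  fixes G :: "'a::field_char_0 poly"
  assumes deg: "Polynomial.degree G \<le> 4" and e: "poly G e = 0"
    and P: "(a = 1 \<and> y ^ 2 = poly G b) \<or> (a = 0 \<and> b = 1 \<and> y ^ 2 = Polynomial.coeff G 4)"
  shows "let (a', b', y') = moebius e (a, b, y) in
     (a' = 1 \<and> y' ^ 2 = poly (moebius_poly G e) b') \<or> (a' = 0 \<and> b' = 1 \<and> y' ^ 2 = Polynomial.coeff (moebius_poly G e) 4)"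
proof -
  consider "a = 0" "b = 1" "y ^ 2 = Polynomial.coeff G 4" | "a = 1" "b = e" | "a = 1" "b ~= e" "y ^ 2 = poly G b" using P by auto
  then show ?thesis
  proof cases
    case 1
    then show ?thesis by (simp add: moebius_def moebius_poly_coeff[OF deg] poly_0_coeff_0)
  next
    case 2
    then show ?thesis using e by (simp add: moebius_def moebius_poly_coeff[OF deg])
  next
    case 3
    then have "poly (moebius_poly G e) (1 / (b - e)) = (1 / (b - e)) ^ 4 * poly G b"
      by (subst moebius_poly_eval[OF deg]) simp_all
    then show ?thesis using 3 by (simp add: moebius_def power_divide flip: power_mult)
  qed
qed

text \<open>Valuation at least n, for an integer n, expressed without a value group.\<close>

definition lv :: "'a::field set => int => 'a => bool" where "lv V n a \<longleftrightarrow> 2 powi (- n) * a \<in> V"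

context valuation_ring_2
begin

abbreviation "L \<equiv> lv V"

lemma L_mono: "L n a ==> m \<le> n ==> L m a"
proof -
  assume a: "L n a" "m \<le> n"
  have "(2 :: 'a) powi (- m) = 2 ^ nat (n - m) * 2 powi (- n)"
    using a(2) by (simp add: power_int_minus power_int_diff flip: power_int_of_nat) (simp add: power_int_diff divide_simps)
  with ops(4)[OF two_pow] a(1) show ?thesis by (simp add: lv_def mult.assoc)
qed

lemma L_V: "L 0 a \<longleftrightarrow> a \<in> V" by (simp add: lv_def)

lemma L_mult: "L n a ==> L m b ==> L (n + m) (a * b)"
  using ops(4)[of "2 powi (- n) * a" "2 powi (- m) * b"]
  by (simp add: lv_def power_int_add power_int_minus mult_ac power_int_diff divide_inverse)

lemma L_add: "L n a ==> L n b ==> L n (a + b)" using ops(3) by (simp add: lv_def distrib_left)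

lemma L_diff: "L n a ==> L n b ==> L n (a - b)" using ops(6) by (simp add: lv_def right_diff_distrib)

lemma L_1: "L 0 1" using ops(1) by (simp add: lv_def)

lemma L_2: "L 1 2" "L 2 4" using ops(1) by (simp_all add: lv_def power_int_minus)

lemma L_numeral: "L 0 (numeral k)" using ops(9)[of "numeral k"] by (simp add: lv_def)

lemma L_4_bound: "\<not> L 3 4" using half by (simp add: lv_def power_int_minus field_simps)

lemma L_1_bound: "L n 1 ==> n \<le> 0"
proof (rule ccontr)
  assume "L n 1" "\<not> n \<le> 0"
  then have "L 1 1" by (intro L_mono[of n 1 1]) auto
  then show False using half by (simp add: lv_def power_int_minus)
qed

lemma not_L_inverse: "\<not> L n a ==> L (- n) (inverse a)"
proof -
  assume "\<not> L n a"
  then have "2 powi (- n) * a \<notin> V" by (simp add: lv_def)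
  then have "inverse (2 powi (- n) * a) \<in> V" using val by blast
  then show ?thesis by (simp add: lv_def power_int_minus)
qed

lemma L_sq: "L (2 * n) (a ^ 2) ==> L n a"
proof (rule ccontr)
  assume a: "L (2 * n) (a ^ 2)" "\<not> L n a"
  define z where "z = 2 powi (- n) * a"
  have z: "z \<notin> V" using a(2) by (simp add: lv_def z_def)
  have "(2::'a) powi (- n + - n) = 2 powi (- n) * 2 powi (- n)" by (rule power_int_add) simp
  moreover have "- n + - n = - (2 * n)" by simp
  ultimately have p2: "(2::'a) powi (- (2 * n)) = 2 powi (- n) * 2 powi (- n)" by simp
  have "z ^ 2 = 2 powi (- (2 * n)) * a ^ 2" unfolding z_def p2 power2_eq_square by (simp only: mult_ac)
  then have z2: "z * z \<in> V" using a(1) by (simp add: lv_def power2_eq_square)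
  have "inverse z \<in> V" using z val by blast
  from ops(4)[OF z2 this] have "z \<in> V" using z ops(2) by (cases "z = 0") (auto simp: mult.assoc)
  with z show False by simp
qed

text \<open>After scaling by 2^-n: a product of two elements outside V is outside V, as the inverse
  of one factor would cancel it.\<close>

lemma L_product: "L (2 * n) (a * b) ==> L n a \<or> L n b"
proof (rule ccontr)
  assume a: "L (2 * n) (a * b)" "\<not> (L n a \<or> L n b)"
  define z w where "z = 2 powi (- n) * a" and "w = 2 powi (- n) * b"
  have z: "z \<notin> V" "w \<notin> V" using a(2) by (auto simp: lv_def z_def w_def)
  then have nz: "w ~= 0" using ops(2) by auto
  have "(2::'a) powi (- n + - n) = 2 powi (- n) * 2 powi (- n)" by (rule power_int_add) simp
  moreover have "- n + - n = - (2 * n)" by simp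
  ultimately have p2: "(2::'a) powi (- (2 * n)) = 2 powi (- n) * 2 powi (- n)" by simp
  have "z * w = 2 powi (- (2 * n)) * (a * b)" unfolding z_def w_def p2 by (simp only: mult_ac)
  then have zw: "z * w \<in> V" using a(1) by (simp add: lv_def)
  have "inverse w \<in> V" using z val by blast
  from ops(4)[OF zw this] have "z \<in> V" using nz by (simp add: mult.assoc)
  with z show False by simp
qed

lemma L_unit: "L 1 (u - 1) ==> u ~= 0 \<and> L 0 (inverse u)"
proof -
  assume "L 1 (u - 1)"
  then have a: "(u - 1) / 2 \<in> V" by (simp add: lv_def power_int_minus field_simps)
  show ?thesis using unit[OF a] by (simp add: L_V field_simps)
qed

lemma L_sm: "sm n a \<longleftrightarrow> L (int n) a" by (simp add: sm_def lv_def power_int_minus field_simps)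

end

context number_field_valuation
begin

lemma L_bounded: "\<exists>m\<le>0. \<forall>c\<in>set cs. L m c"
proof -
  obtain N where N: "\<forall>c\<in>set cs. 2 ^ N * c \<in> V" using bounded_finite[of "set cs"] by auto
  then show ?thesis by (intro exI[of _ "- int N"]) (simp add: lv_def)
qed

lemma L_poly: "\<exists>m. \<forall>x. L M x --> L m (poly p x)"
proof (induction p)
  case 0
  then show ?case using ops(2) by (auto simp: lv_def)
next
  case (pCons c p)
  obtain m where m: "!!x. L M x ==> L m (poly p x)" using pCons by blast
  obtain n where n: "L n c" using L_bounded[of "[c]"] by auto
  have "L (min n (M + m)) (poly (pCons c p) x)" if "L M x" for x
    using L_add[OF L_mono[OF n] L_mono[OF L_mult[OF that m[OF that]]], of "min n (M + m)"] by simp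
  then show ?case by blast
qed

end

lemma pderiv_map_ac: "pderiv (map_poly to_ac u) = map_poly to_ac (pderiv u)"
  by (rule poly_eqI) (simp add: coeff_pderiv coeff_map_poly)

section \<open>Torsion points of a cubic under the 2-adic valuation\<close>

locale cubic_torsion = number_field_valuation V + H: genus_one h 1
  for V :: "'k::field_char_0 alg_closure set" and h :: "'k alg_closure poly" +
  assumes c4: "Polynomial.coeff h 4 = 0"
begin

lemma h0_eq: "H.hp 0 = h" by (simp add: H.hp_def)

definition l where "l = Polynomial.coeff h 3"
definition l2 where "l2 = Polynomial.coeff h 2"
definition l1 where "l1 = Polynomial.coeff h 1"
definition l0 where "l0 = Polynomial.coeff h 0"

lemma h_expand: "h = [:l0, l1, l2, l:]"
proof -
  have "[:Polynomial.coeff h 4:] = 0" by (simp add: c4)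
  then show ?thesis using quartic_expand[OF H.deg_le] unfolding l_def l2_def l1_def l0_def by (simp add: c4)
qed

lemma l_nonzero: "l ~= 0"
proof
  assume "l = 0"
  then have "Polynomial.degree h \<le> 2" by (subst h_expand) simp
  with H.deg_ge show False by simp
qed

lemma poly_h: "poly h x = l0 + l1 * x + l2 * x ^ 2 + l * x ^ 3"
  by (subst h_expand) (simp add: algebra_simps power2_eq_square power3_eq_cube)

lemma poly_h': "poly (pderiv h) x = l1 + 2 * l2 * x + 3 * l * x ^ 2"
  by (subst h_expand) (simp add: pderiv_pCons algebra_simps power2_eq_square)

text \<open>The only point at infinity of a cubic. It equals its own opposite, so with this origin
  the group inverse is \<open>neg\<close>.\<close>

definition ori :: "'k alg_closure \<times> 'k alg_closure \<times> 'k alg_closure" where "ori = (0, 1, 0)"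

lemma neg_ori [simp]: "neg ori = ori" by (simp add: ori_def neg_def)

lemma on_ori: "H.on ori" by (simp add: ori_def H.on_def H.kon_def h0_eq c4)

lemma on_affine: "H.on (1, x, y) \<longleftrightarrow> y ^ 2 = poly h x" by (simp add: H.on_def H.kon_def h0_eq)

text \<open>Passing through \<open>ori\<close> forces the leading coefficient of the conic to
  vanish, so it is a line y = r x + s. The remaining relations are Vieta's formulas for its
  intersection with the cubic.\<close>

lemma cop4_chord:
  assumes c: "cop4 h (1, x1, y1) (1, x2, y2) ori P4" and P4: "H.on P4"
  shows "\<exists>x3 y3 r s. P4 = (1, x3, y3) \<and> y1 = r * x1 + s \<and> y2 = r * x2 + s \<and>
     r ^ 2 - l2 = l * (x1 + x2 + x3) \<and> 2 * s * r - l1 = - l * (x1 * x2 + x1 * x3 + x2 * x3)"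
proof -
  obtain a4 b4 y4 where abc: "P4 = (a4, b4, y4)" by (cases P4) auto
  obtain q \<kappa> where q: "Polynomial.degree q \<le> 2" "\<kappa> ~= 0"
     "q ^ 2 - h = smult \<kappa> (linf (1, x1, y1) * linf (1, x2, y2) * linf ori * linf P4)"
     "qvp q (1, x1, y1) = y1" "qvp q (1, x2, y2) = y2" "qvp q ori = 0"
    using c unfolding cop4_def by (auto simp: ori_def)
  define r s where "r = Polynomial.coeff q 1" and "s = Polynomial.coeff q 0"
  have "Polynomial.coeff q 2 = 0" using q(6) by (simp add: qvp_def ori_def)
  then have qq: "q = [:s, r:]" using quadratic_expand[OF q(1)] by (simp add: r_def s_def)
  have "[:s ^ 2 - l0, 2 * s * r - l1, r ^ 2 - l2, - l:] = q ^ 2 - h"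
    by (subst h_expand) (simp add: qq power2_eq_square)
  also have "\<dots> = [:\<kappa> * (x1 * x2 * b4), - \<kappa> * ((x1 + x2) * b4 + x1 * x2 * a4), \<kappa> * (b4 + (x1 + x2) * a4), - \<kappa> * a4:]"
    unfolding q(3) abc by (simp add: linf_def ori_def algebra_simps)
  finally have eq: "2 * s * r - l1 = - \<kappa> * ((x1 + x2) * b4 + x1 * x2 * a4)" "r ^ 2 - l2 = \<kappa> * (b4 + (x1 + x2) * a4)" "- l = - \<kappa> * a4"
    by simp_all
  have a4: "a4 = 1" using eq(3) l_nonzero P4 by (auto simp: abc H.on_def H.kon_def)
  then have k: "\<kappa> = l" using eq(3) by simp
  have y1: "y1 = r * x1 + s" using q(4) unfolding qvp_def qq by (simp add: mult.commute add.commute)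
  have y2: "y2 = r * x2 + s" using q(5) unfolding qvp_def qq by (simp add: mult.commute add.commute)
  have e2: "r ^ 2 - l2 = l * (x1 + x2 + b4)" unfolding eq(2) a4 k by (simp add: algebra_simps)
  have e1: "2 * s * r - l1 = - l * (x1 * x2 + x1 * b4 + x2 * b4)" unfolding eq(1) a4 k by (simp add: algebra_simps)
  have "P4 = (1, b4, y4)" unfolding abc a4 ..
  with y1 y2 e1 e2 show ?thesis by blast
qed

abbreviation "GG \<equiv> H.MW ori"

definition tors where "tors P \<longleftrightarrow> H.on P \<and> (\<exists>n::nat. n > 0 \<and> H.KP P [^]\<^bsub>GG\<^esub> n = \<one>\<^bsub>GG\<^esub>)"

lemma GG_group: "comm_group GG" by (rule H.MW_comm_group[OF on_ori])

lemma KP_carrier: "H.on P ==> H.KP P \<in> carrier GG" by (simp add: H.MW_carrier)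

lemma GG_mult: "H.on P ==> H.on Q ==> H.on S ==> H.KP P \<otimes>\<^bsub>GG\<^esub> H.KP Q = H.KP S \<longleftrightarrow> srel h P Q ori S"
  using H.MW_mult(2)[of P Q ori S] on_ori by (simp add: h0_eq)

lemma GG_neg: "H.on P ==> H.KP P \<otimes>\<^bsub>GG\<^esub> H.KP (neg P) = \<one>\<^bsub>GG\<^esub>"
  unfolding H.MW_one by (subst GG_mult) (auto simp: H.on_neg on_ori srel_def)

lemma tors_add:
  assumes "tors P" "tors Q" "H.on S" "srel h P Q ori S"
  shows "tors S"
proof -
  interpret G: comm_group GG by (rule GG_group)
  obtain n m :: nat where n: "n > 0" "H.KP P [^]\<^bsub>GG\<^esub> n = \<one>\<^bsub>GG\<^esub>" and m: "m > 0" "H.KP Q [^]\<^bsub>GG\<^esub> m = \<one>\<^bsub>GG\<^esub>"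
    using assms(1,2) unfolding tors_def by blast
  have on: "H.on P" "H.on Q" using assms(1,2) by (auto simp: tors_def)
  note c = KP_carrier[OF on(1)] KP_carrier[OF on(2)]
  have "H.KP S = H.KP P \<otimes>\<^bsub>GG\<^esub> H.KP Q" using GG_mult[OF on assms(3)] assms(4) by simp
  then have "H.KP S [^]\<^bsub>GG\<^esub> (n * m) = (H.KP P [^]\<^bsub>GG\<^esub> n) [^]\<^bsub>GG\<^esub> m \<otimes>\<^bsub>GG\<^esub> (H.KP Q [^]\<^bsub>GG\<^esub> m) [^]\<^bsub>GG\<^esub> n"
    using c by (simp add: G.nat_pow_distrib G.nat_pow_pow mult.commute)
  also have "\<dots> = \<one>\<^bsub>GG\<^esub>" unfolding n(2) m(2) by simp
  finally show ?thesis unfolding tors_def using assms(3) n(1) m(1) by (intro conjI exI[of _ "n * m"]) auto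
qed

lemma tors_neg:
  assumes "tors P"
  shows "tors (neg P)"
proof -
  interpret G: comm_group GG by (rule GG_group)
  obtain n :: nat where n: "n > 0" "H.KP P [^]\<^bsub>GG\<^esub> n = \<one>\<^bsub>GG\<^esub>" using assms unfolding tors_def by blast
  have on: "H.on P" "H.on (neg P)" using assms H.on_neg by (auto simp: tors_def)
  note c = KP_carrier[OF on(1)] KP_carrier[OF on(2)]
  have "\<one>\<^bsub>GG\<^esub> = (H.KP P \<otimes>\<^bsub>GG\<^esub> H.KP (neg P)) [^]\<^bsub>GG\<^esub> n" unfolding GG_neg[OF on(1)] by simp
  also have "\<dots> = H.KP (neg P) [^]\<^bsub>GG\<^esub> n" using c n(2) by (simp add: G.nat_pow_distrib)
  finally show ?thesis unfolding tors_def using on(2) n(1) by metis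
qed

text \<open>Chosen so that, once 1/x has level M, each lower coefficient of h divided by l becomes
  divisible by 2 when multiplied by 1/x.\<close>

definition M where "M = (SOME M. M \<ge> 1 \<and> (\<forall>c\<in>set [l2 / l, l1 / l, l0 / l]. L (1 - M) c))"

lemma M: "M \<ge> 1" "L (1 - M) (l2 / l)" "L (1 - M) (l1 / l)" "L (1 - M) (l0 / l)"
proof -
  obtain m where m: "m \<le> 0" "\<forall>c\<in>set [l2 / l, l1 / l, l0 / l]. L m c" using L_bounded by blast
  have "\<exists>M. M \<ge> 1 \<and> (\<forall>c\<in>set [l2 / l, l1 / l, l0 / l]. L (1 - M) c)"
    by (rule exI[of _ "1 - m"]) (use m in simp)
  from someI_ex[OF this] show "M \<ge> 1" "L (1 - M) (l2 / l)" "L (1 - M) (l1 / l)" "L (1 - M) (l0 / l)"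
    unfolding M_def[symmetric] by auto
qed

text \<open>Close to infinity for \<open>V\<close>, doubling moves a point strictly closer to infinity.\<close>

lemma large_double:
  assumes on: "H.on (1, x, y)" and x: "x ~= 0" "L n (inverse x)" "n \<ge> M"
  shows "\<exists>x' y'. H.on (1, x', y') \<and> H.KP (1, x', y') = H.KP (1, x, y) \<otimes>\<^bsub>GG\<^esub> H.KP (1, x, y) \<and>
     x' ~= 0 \<and> L (n + 2) (inverse x')"
proof -
  define t where "t = inverse x"
  have t: "L M t" "L n t" "L 0 t" using x M(1) L_mono[of n t] by (auto simp: t_def)
  have xt: "x * t = 1" using x(1) by (simp add: t_def)
  \<comment> \<open>They satisfy h(x) = l x^3 A and h'(x) = l x^2 B; both are 1 modulo 2, since the
    coefficient 3 of the derivative is odd.\<close>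
  define B A where "B = 3 + 2 * (l2 / l) * t + (l1 / l) * t ^ 2" and "A = 1 + (l2 / l) * t + (l1 / l) * t ^ 2 + (l0 / l) * t ^ 3"
  have m1: "L 1 ((l2 / l) * t)" "L 1 ((l1 / l) * t)" "L 1 ((l0 / l) * t)"
    using L_mult[OF M(2) t(1)] L_mult[OF M(3) t(1)] L_mult[OF M(4) t(1)] by simp_all
  have m2: "L 1 ((l1 / l) * t ^ 2)" "L 1 ((l0 / l) * t ^ 2)"
    using L_mult[OF m1(2) t(3)] L_mult[OF m1(3) t(3)] by (simp_all add: power2_eq_square mult.assoc)
  have m3: "L 1 ((l0 / l) * t ^ 3)" using L_mult[OF m2(2) t(3)] by (simp add: power2_eq_square power3_eq_cube mult.assoc)
  have A1: "L 1 (A - 1)" unfolding A_def using L_add[OF L_add[OF m1(1) m2(1)] m3] by (simp add: algebra_simps)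
  have twice: "L 1 (2 * u)" if "L 0 u" for u using L_mult[OF L_2(1) that] by simp
  have V1: "L 0 u" if "L 1 u" for u using L_mono[OF that] by simp
  have B1: "L 1 (B - 1)"
  proof -
    have "B - 1 = 2 * (1 + (l2 / l) * t) + (l1 / l) * t ^ 2" by (simp add: B_def algebra_simps)
    moreover have "L 1 (2 * (1 + (l2 / l) * t))" by (rule twice[OF L_add[OF L_1 V1[OF m1(1)]]])
    ultimately show ?thesis using L_add m2(1) by metis
  qed
  have VA: "L 0 A" using L_add[OF V1[OF A1] L_1] by simp
  have VB: "L 0 B" using L_add[OF V1[OF B1] L_1] by simp
  \<comment> \<open>The duplication formula becomes 4 A x' = x D. Since D is a unit, the factor 4
    yields the gain of 2 in the level of 1/x'.\<close>
  define D where "D = B ^ 2 - 8 * A - 4 * A * ((l2 / l) * t)"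
  have "D - 1 = (B - 1) * (B + 1) - 2 * (4 * A + 2 * A * ((l2 / l) * t))" by (simp add: D_def algebra_simps power2_eq_square)
  moreover have "L 1 ((B - 1) * (B + 1))" using L_mult[OF B1 L_add[OF VB L_1]] by simp
  moreover have "L 1 (2 * (4 * A + 2 * A * ((l2 / l) * t)))"
  proof (rule twice, rule L_add)
    show "L 0 (4 * A)" using L_mult[OF L_numeral VA] by simp
    show "L 0 (2 * A * ((l2 / l) * t))" using L_mult[OF L_mult[OF L_numeral VA] V1[OF m1(1)]] by simp
  qed
  ultimately have D1: "L 1 (D - 1)" using L_diff by metis
  note uA = L_unit[OF A1] and uD = L_unit[OF D1]
  have hx: "poly h x = l * x ^ 3 * A"
  proof -
    have "l * x ^ 3 * (1 + u * t + w * t ^ 2 + z * t ^ 3) =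
        l * x ^ 3 + (l * u) * x ^ 2 * (x * t) + (l * w) * x * (x * t) ^ 2 + (l * z) * (x * t) ^ 3" for u w z
      by (simp add: algebra_simps power2_eq_square power3_eq_cube)
    from this[of "l2 / l" "l1 / l" "l0 / l"] show ?thesis
      unfolding A_def[symmetric] xt poly_h using l_nonzero by (simp add: algebra_simps)
  qed
  have h'x: "poly (pderiv h) x = l * x ^ 2 * B"
  proof -
    have "l * x ^ 2 * (3 + 2 * u * t + w * t ^ 2) = 3 * l * x ^ 2 + 2 * (l * u) * x * (x * t) + (l * w) * (x * t) ^ 2" for u w
      by (simp add: algebra_simps power2_eq_square)
    from this[of "l2 / l" "l1 / l"] show ?thesis unfolding B_def[symmetric] xt poly_h' using l_nonzero by (simp add: algebra_simps)
  qed
  have y2: "y ^ 2 = l * x ^ 3 * A" using on hx by (simp add: on_affine)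
  have y0: "y ~= 0" using y2 l_nonzero x(1) uA by auto
  obtain S where S: "H.on S" "srel h (1, x, y) (1, x, y) ori S"
    using H.srel_exists[OF on on on_ori] unfolding h0_eq by blast
  have "cop4 h (1, x, y) (1, x, y) ori (neg S)"
    using S(2) y0 unfolding srel_def neg_ori by (auto simp: ori_def neg_def)
  from cop4_chord[OF this H.on_neg[OF S(1)]] obtain x' y' r s where c: "neg S = (1, x', y')" "y = r * x + s"
    "r ^ 2 - l2 = l * (x + x + x')" "2 * s * r - l1 = - l * (x * x + x * x' + x * x')" by blast
  have S_eq: "S = (1, x', - y')" using c(1) by (metis neg_def neg_neg fst_conv snd_conv)
  have d: "2 * y * r = poly (pderiv h) x"
  proof -
    have "2 * y * r - poly (pderiv h) x = 2 * x * (r ^ 2 - l2) + (2 * s * r - l1) - 3 * l * x ^ 2"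
      unfolding c(2) poly_h' by (simp add: algebra_simps power2_eq_square)
    also have "\<dots> = 0" unfolding c(3,4) by (simp add: algebra_simps power2_eq_square)
    finally show ?thesis by simp
  qed
  have "4 * (l * x ^ 3 * A) * (l2 + l * (2 * x + x')) = (l * x ^ 2 * B) ^ 2"
  proof -
    have "r ^ 2 = l2 + l * (2 * x + x')" using c(3) by (simp add: algebra_simps)
    then have "4 * (l * x ^ 3 * A) * (l2 + l * (2 * x + x')) = (2 * y * r) ^ 2"
      unfolding y2[symmetric] by (simp add: power_mult_distrib algebra_simps)
    then show ?thesis unfolding d h'x .
  qed
  moreover have "4 * (l * x ^ 3 * A) * (l * u + l * (2 * x + x')) = (l ^ 2 * x ^ 3) * (4 * A * (u + 2 * x + x'))" for u
    by (simp add: algebra_simps power2_eq_square)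
  from this[of "l2 / l"] have "4 * (l * x ^ 3 * A) * (l2 + l * (2 * x + x')) = (l ^ 2 * x ^ 3) * (4 * A * ((l2 / l) + 2 * x + x'))"
    using l_nonzero by simp
  moreover have "(l * x ^ 2 * B) ^ 2 = (l ^ 2 * x ^ 3) * (x * B ^ 2)"
    by (simp add: power2_eq_square power3_eq_cube mult_ac)
  ultimately have "(l ^ 2 * x ^ 3) * (4 * A * ((l2 / l) + 2 * x + x')) = (l ^ 2 * x ^ 3) * (x * B ^ 2)" by metis
  then have "4 * A * ((l2 / l) + 2 * x + x') = x * B ^ 2" using l_nonzero x(1) by simp
  then have "4 * A * x' = x * B ^ 2 - 8 * A * x - 4 * A * ((l2 / l) * (x * t))" unfolding xt by (simp add: algebra_simps)
  also have "\<dots> = x * D" by (simp add: D_def algebra_simps)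
  finally have x': "4 * A * x' = x * D" .
  then have x'0: "x' ~= 0" using x(1) uD by auto
  have "inverse x' = 4 * A * t * inverse D"
  proof -
    have "x' * (4 * A * t * inverse D) = (4 * A * x') * t * inverse D" by (simp only: mult_ac)
    also have "\<dots> = (x * t) * (D * inverse D)" unfolding x' by (simp only: mult_ac)
    also have "\<dots> = 1" unfolding xt using uD by simp
    finally show ?thesis using inverse_unique by metis
  qed
  moreover have "L (2 + 0 + n + 0) (4 * A * t * inverse D)"
    using L_mult[OF L_mult[OF L_mult[OF L_2(2) VA] t(2)] conjunct2[OF uD]] by simp
  ultimately have "L (n + 2) (inverse x')" by (simp add: add.commute)
  then show ?thesis using GG_mult[OF on on S(1)] S x'0 unfolding S_eq by metis
qed

text \<open>Repeated doubling would give multiples arbitrarily close to infinity. A torsion point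
  has only finitely many multiples, and their abscissae are bounded by
  \<open>bounded_finite\<close>.\<close>

lemma torsion_not_large:
  assumes P: "tors (1, x, y)" "x ~= 0"
  shows "\<not> L M (inverse x)"
proof
  assume lg: "L M (inverse x)"
  interpret G: comm_group GG by (rule GG_group)
  have on: "H.on (1, x, y)" using P by (simp add: tors_def)
  obtain n :: nat where n: "n > 0" "H.KP (1, x, y) [^]\<^bsub>GG\<^esub> n = \<one>\<^bsub>GG\<^esub>" using P unfolding tors_def by blast
  define p where "p = H.KP (1, x, y)"
  have p: "p \<in> carrier GG" unfolding p_def by (rule KP_carrier[OF on])
  define T where "T = {x'. \<exists>y' j::nat. H.on (1, x', y') \<and> H.KP (1, x', y') = p [^]\<^bsub>GG\<^esub> j}"
  have iter: "\<exists>x' y'. H.on (1, x', y') \<and> H.KP (1, x', y') = p [^]\<^bsub>GG\<^esub> (2 ^ k :: nat) \<and> x' ~= 0 \<and> L (M + 2 * int k) (inverse x')" for k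
  proof (induction k)
    case 0
    then show ?case using on P(2) lg p unfolding p_def by (intro exI[of _ x] exI[of _ y]) simp
  next
    case (Suc k)
    then obtain x' y' where k: "H.on (1, x', y')" "H.KP (1, x', y') = p [^]\<^bsub>GG\<^esub> (2 ^ k :: nat)" "x' ~= 0" "L (M + 2 * int k) (inverse x')" by blast
    from large_double[OF k(1,3,4)] obtain x'' y'' where "H.on (1, x'', y'')"
      "H.KP (1, x'', y'') = H.KP (1, x', y') \<otimes>\<^bsub>GG\<^esub> H.KP (1, x', y')" "x'' ~= 0" "L (M + 2 * int k + 2) (inverse x'')" by auto
    then show ?case using p unfolding k(2) by (intro exI[of _ x''] exI[of _ y'']) (simp add: G.nat_pow_mult mult_2 algebra_simps)
  qed
  have "T \<subseteq> (\<lambda>u. fst (snd (SOME P. H.on P \<and> H.KP P = u))) ` ((\<lambda>j. p [^]\<^bsub>GG\<^esub> j) ` {..<n})"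
  proof
    fix x' assume "x' \<in> T"
    then obtain y' and j :: nat where j: "H.on (1, x', y')" "H.KP (1, x', y') = p [^]\<^bsub>GG\<^esub> j" unfolding T_def by blast
    have "p [^]\<^bsub>GG\<^esub> j = p [^]\<^bsub>GG\<^esub> (n * (j div n) + j mod n)" by simp
    also have "\<dots> = (p [^]\<^bsub>GG\<^esub> n) [^]\<^bsub>GG\<^esub> (j div n) \<otimes>\<^bsub>GG\<^esub> p [^]\<^bsub>GG\<^esub> (j mod n)"
      using p by (simp only: G.nat_pow_pow G.nat_pow_mult)
    also have "\<dots> = p [^]\<^bsub>GG\<^esub> (j mod n)" using n(2) p unfolding p_def[symmetric] by simp
    finally have jm: "p [^]\<^bsub>GG\<^esub> j = p [^]\<^bsub>GG\<^esub> (j mod n)" .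
    define R where "R = (SOME P. H.on P \<and> H.KP P = p [^]\<^bsub>GG\<^esub> j)"
    have R: "H.on R \<and> H.KP R = p [^]\<^bsub>GG\<^esub> j"
      unfolding R_def by (rule someI[of _ "(1, x', y')"]) (use j in simp)
    have "R = (1, x', y')" by (rule H.KP_eq_iff[THEN iffD1]) (use R j in auto)
    then have "x' = fst (snd R)" by simp
    then have "x' = fst (snd (SOME P. H.on P \<and> H.KP P = p [^]\<^bsub>GG\<^esub> (j mod n)))" unfolding R_def jm .
    then show "x' \<in> (\<lambda>u. fst (snd (SOME P. H.on P \<and> H.KP P = u))) ` ((\<lambda>j. p [^]\<^bsub>GG\<^esub> j) ` {..<n})"
      using n(1) by (intro image_eqI[OF _ imageI[of "j mod n"]]) auto
  qed
  then have "finite T" by (rule finite_subset) simp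
  then obtain N where N: "\<forall>c\<in>T. 2 ^ N * c \<in> V" using bounded_finite by blast
  obtain x' y' where k: "H.on (1, x', y')" "H.KP (1, x', y') = p [^]\<^bsub>GG\<^esub> (2 ^ Suc N :: nat)" "x' ~= 0" "L (M + 2 * int (Suc N)) (inverse x')"
    using iter[of "Suc N"] by blast
  have "x' \<in> T" unfolding T_def using k(1,2) by blast
  then have "L (- int N) x'" using N by (simp add: lv_def)
  from L_mult[OF this k(4)] have "L (- int N + (M + 2 * int (Suc N))) 1" using k(3) by simp
  from L_1_bound[OF this] M(1) show False by simp
qed

lemma L_0: "L n 0" using ops(2) by (simp add: lv_def)

lemma torsion_bounded: "tors (1, x, y) ==> L (- M) x"
  using torsion_not_large[of x y] not_L_inverse[of M "inverse x"] L_0 by (cases "x = 0") auto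

text \<open>Torsion points with nearly equal abscissae are nearly equal after a choice of sign. The
  chord through P1 and -P2 meets the cubic in a third torsion point, which is bounded, so the slope
  r is bounded. Then y1 + y2 = r (x1 - x2) is small, hence so is 2 y1, and so is h'(x1). Thus 4 h
  and h' are both small at x1, against a h + b h' = 1.\<close>

lemma torsion_separated:
  "\<exists>N. \<forall>x1 y1 x2 y2. tors (1, x1, y1) --> tors (1, x2, y2) --> x1 ~= x2 --> \<not> L N (x1 - x2)"
proof -
  obtain c where c: "c \<le> 0" "L c l" "L c l2" "L c l1" using L_bounded[of "[l, l2, l1]"] by auto
  have "\<exists>a b. a * h + b * pderiv h = 1"
  proof (rule bezout_no_common_root)
    fix x assume hx: "poly h x = 0"
    show "poly (pderiv h) x ~= 0"
    proof
      assume "poly (pderiv h) x = 0"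
      then have "poly (map_poly to_ac h) (to_ac x) = 0" "poly (pderiv (map_poly to_ac h)) (to_ac x) = 0"
        unfolding pderiv_map_ac poly_map_ac using hx by simp_all
      with H.sqfree show False unfolding rsquarefree_roots by blast
    qed
  qed
  then obtain a b where ab: "a * h + b * pderiv h = 1" by blast
  obtain D1' where D1': "!!x. L (- M) x ==> L D1' (poly a x)" using L_poly by blast
  obtain D2' where D2': "!!x. L (- M) x ==> L D2' (poly b x)" using L_poly by blast
  define D1 D2 where "D1 = min D1' 0" and "D2 = min D2' 0"
  have D1: "L D1 (poly a x)" "D1 \<le> 0" and D2: "L D2 (poly b x)" "D2 \<le> 0" if "L (- M) x" for x
    using L_mono[OF D1'[OF that], of D1] L_mono[OF D2'[OF that], of D2] by (auto simp: D1_def D2_def)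
  have Ds: "D1 \<le> 0" "D2 \<le> 0" by (simp_all add: D1_def D2_def)
  \<comment> \<open>At level j the identity a h + b h' = 1, multiplied by 4, would give 4 level 3. N
    is such that x1 - x2 of level N gives (y1 + y2)(y1 - y2) level 2 j.\<close>
  define j where "j = 3 - D1 - D2 - c + M"
  have j: "j \<ge> 0" using Ds c(1) M(1) by (simp add: j_def)
  define N where "N = 2 * j - c + 2 * M"
  define Sx where "Sx x1 x2 = l * (x1 ^ 2 + x1 * x2 + x2 ^ 2) + l2 * (x1 + x2) + l1" for x1 x2
  have core: False if T: "tors (1, x1, y1)" "tors (1, x2, y2)" "x1 ~= x2" "L N (x1 - x2)" "L j (y1 - y2)" for x1 y1 x2 y2
  proof -
    have on: "H.on (1, x1, y1)" "H.on (1, x2, y2)" using T by (auto simp: tors_def)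
    have nn: "neg (1, x2, y2) = (1, x2, - y2)" by (simp add: neg_def)
    have on': "H.on (1, x2, - y2)" using H.on_neg[OF on(2)] by (simp only: nn)
    obtain S where S: "H.on S" "srel h (1, x1, y1) (1, x2, - y2) ori S"
      using H.srel_exists[OF on(1) on' on_ori] unfolding h0_eq by blast
    have S': "tors (neg S)" by (rule tors_neg[OF tors_add[OF T(1) tors_neg[OF T(2), unfolded nn] S]])
    have "cop4 h (1, x1, y1) (1, x2, - y2) ori (neg S)"
      using S(2) T(3) unfolding srel_def neg_ori by (auto simp: ori_def neg_def)
    from cop4_chord[OF this H.on_neg[OF S(1)]] obtain x3 y3 r s where ch: "neg S = (1, x3, y3)" "y1 = r * x1 + s" "- y2 = r * x2 + s"
      "r ^ 2 - l2 = l * (x1 + x2 + x3)" by blast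
    note b1 = torsion_bounded[OF T(1)] and b2 = torsion_bounded[OF T(2)] and b3 = torsion_bounded[OF S'[unfolded ch(1)]]
    have "L (c - M) (l * (x1 + x2 + x3))" using L_mult[OF c(2) L_add[OF L_add[OF b1 b2] b3]] by simp
    then have "L (c - M) (r ^ 2)" using L_add[OF _ L_mono[OF c(3)], of "c - M" "l * (x1 + x2 + x3)"] M(1) ch(4)
      by (simp add: algebra_simps)
    then have "L (2 * (c - M)) (r ^ 2)" by (rule L_mono) (use c(1) M(1) in simp)
    then have r: "L (c - M) r" by (rule L_sq)
    have "y1 - (- y2) = r * (x1 - x2)" unfolding ch(2,3) by (simp add: algebra_simps)
    then have sum: "y1 + y2 = r * (x1 - x2)" by simp
    have "(x1 - x2) * Sx x1 x2 = poly h x1 - poly h x2"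
      unfolding poly_h Sx_def by (simp add: algebra_simps power2_eq_square power3_eq_cube)
    also have "\<dots> = (y1 + y2) * (y1 - y2)" using on by (simp add: on_affine algebra_simps power2_eq_square)
    also have "\<dots> = (x1 - x2) * (r * (y1 - y2))" unfolding sum by simp
    finally have "Sx x1 x2 = r * (y1 - y2)" using T(3) by simp
    then have lS: "L (c - M + j) (Sx x1 x2)" using L_mult[OF r T(5)] by simp
    have "L (c - M + N) (y1 + y2)" unfolding sum by (rule L_mult[OF r T(4)])
    then have "L j (y1 + y2)" by (rule L_mono) (use j M(1) in \<open>simp add: N_def\<close>)
    from L_add[OF this T(5)] have "L j (2 * y1)" by (simp add: algebra_simps)
    from L_mult[OF this this] have "L (j + j) (2 * y1 * (2 * y1))" .
    moreover have "2 * y1 * (2 * y1) = 4 * y1 ^ 2" by (simp add: power2_eq_square)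
    ultimately have h4: "L (j + j) (4 * poly h x1)" using on(1)[unfolded on_affine] by metis
    have "L (N + (c - M)) ((x1 - x2) * (l * (2 * x1 + x2) + l2))"
    proof (rule L_mult[OF T(4) L_add])
      have "L (- M) (x1 + x1 + x2)" by (intro L_add b1 b2)
      moreover have "x1 + x1 + x2 = 2 * x1 + x2" by simp
      ultimately have "L (- M) (2 * x1 + x2)" by (simp only:)
      from L_mult[OF c(2) this] show "L (c - M) (l * (2 * x1 + x2))" by (simp only: diff_conv_add_uminus)
      show "L (c - M) l2" using M(1) by (intro L_mono[OF c(3)]) simp
    qed
    then have "L (c - M + j) ((x1 - x2) * (l * (2 * x1 + x2) + l2))"
      by (rule L_mono) (use j M(1) c(1) in \<open>simp add: N_def\<close>)
    moreover have "(x1 - x2) * (l * (2 * x1 + x2) + l2) + Sx x1 x2 = poly (pderiv h) x1"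
      unfolding Sx_def poly_h' by (simp add: algebra_simps power2_eq_square)
    ultimately have h': "L (c - M + j) (poly (pderiv h) x1)" using L_add[OF _ lS] by metis
    have "L (D1 + (j + j)) (poly a x1 * (4 * poly h x1))" by (rule L_mult[OF D1(1)[OF b1] h4])
    then have s1: "L 3 (poly a x1 * (4 * poly h x1))"
      by (rule L_mono) (use Ds c(1) M(1) in \<open>simp add: j_def\<close>)
    have "L (0 + (D2 + (c - M + j))) (4 * (poly b x1 * poly (pderiv h) x1))"
      by (intro L_mult L_numeral D2(1)[OF b1] h')
    then have s2: "L 3 (4 * (poly b x1 * poly (pderiv h) x1))"
      by (rule L_mono) (use Ds c(1) M(1) in \<open>simp add: j_def\<close>)
    have "poly a x1 * (4 * poly h x1) + 4 * (poly b x1 * poly (pderiv h) x1) = 4 * poly (a * h + b * pderiv h) x1"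
      by (simp add: algebra_simps)
    also have "\<dots> = 4" unfolding ab by simp
    finally show False using L_add[OF s1 s2] L_4_bound by simp
  qed
  have "\<not> L N (x1 - x2)" if T: "tors (1, x1, y1)" "tors (1, x2, y2)" "x1 ~= x2" for x1 y1 x2 y2
  proof
    assume lN: "L N (x1 - x2)"
    have on: "H.on (1, x1, y1)" "H.on (1, x2, y2)" using T by (auto simp: tors_def)
    note b1 = torsion_bounded[OF T(1)] and b2 = torsion_bounded[OF T(2)]
    have "L (c - 2 * M) (Sx x1 x2)" unfolding Sx_def
    proof (intro L_add)
      have "L (- M + - M) (x1 * x1 + x1 * x2 + x2 * x2)" by (intro L_add L_mult b1 b2)
      from L_mult[OF c(2) this] show "L (c - 2 * M) (l * (x1 ^ 2 + x1 * x2 + x2 ^ 2))" by (simp add: power2_eq_square)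
      have "L (c - M) (l2 * (x1 + x2))" using L_mult[OF c(3) L_add[OF b1 b2]] by simp
      then show "L (c - 2 * M) (l2 * (x1 + x2))" by (rule L_mono) (use M(1) in simp)
      show "L (c - 2 * M) l1" using M(1) by (intro L_mono[OF c(4)]) simp
    qed
    from L_mult[OF lN this] have "L (2 * j) ((x1 - x2) * Sx x1 x2)" by (simp add: N_def)
    moreover have "(x1 - x2) * Sx x1 x2 = poly h x1 - poly h x2"
      unfolding poly_h Sx_def by (simp add: algebra_simps power2_eq_square power3_eq_cube)
    moreover have "poly h x1 - poly h x2 = (y1 + y2) * (y1 - y2)"
      using on by (simp add: on_affine algebra_simps power2_eq_square)
    ultimately have "L (2 * j) ((y1 + y2) * (y1 - y2))" by simp
    then consider "L j (y1 + y2)" | "L j (y1 - y2)" using L_product by blast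
    then show False
    proof cases
      case 1
      have "tors (1, x2, - y2)" using tors_neg[OF T(2)] by (simp add: neg_def)
      from core[OF T(1) this T(3) lN] 1 show False by simp
    next
      case 2
      from core[OF T lN this] show False .
    qed
  qed
  then show ?thesis by blast
qed

end

section \<open>Finiteness uniform in the twist\<close>

context cubic_torsion
begin

text \<open>Z need not go to a torsion point, so if n kills Q on the twist, one only gets n F(Q) = n
  F(Z) on the cubic. Using this for P and for -P eliminates Z: n F(P) = n F(-P) = -n F(P).\<close>

lemma transfer_torsion:
  fixes g :: "'k poly"
  assumes gen: "genus_one g C" and e: "poly (map_poly to_ac g) e = 0" and h: "h = moebius_poly (map_poly to_ac g) e"
    and PZ: "genus_one.on g C P" "genus_one.on g C Z"
    and r: "\<not> group_rank (mordell_weil_group (twisted_curve g C) (genus_one.KP Z)) > 0"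
    and cc: "cc ^ 2 = to_ac C"
  shows "tors (moebius e (bc cc P))"
proof -
  interpret E: genus_one g C by (rule gen)
  define G where "G = map_poly to_ac g"
  have dG: "Polynomial.degree G \<le> 4" using E.deg_le by (simp add: G_def degree_map_ac)
  have C0: "to_ac C ~= 0" using E.C_nonzero by simp
  then have cc0: "cc ~= 0" using cc by auto
  have eG: "poly G e = 0" using e by (simp add: G_def)
  have hG: "h = moebius_poly G e" using h by (simp add: G_def)
  have G_h0: "smult (cc ^ 2) (map_poly to_ac (E.hp 0)) = G"
    unfolding cc E.hp_def G_def by (simp add: map_ac_smult E.C_nonzero)
  define F where "F P = moebius e (bc cc P)" for P
  have G_poly: "poly G (to_ac b) = cc ^ 2 * to_ac (poly (E.hp 0) b)" for b
    unfolding G_h0[symmetric] by (simp add: poly_map_ac)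
  have G_4: "Polynomial.coeff G 4 = cc ^ 2 * to_ac (Polynomial.coeff (E.hp 0) 4)"
    unfolding G_h0[symmetric] by (simp add: coeff_map_poly)
  have onb: "(fst (bc cc P) = 1 \<and> snd (snd (bc cc P)) ^ 2 = poly G (fst (snd (bc cc P)))) \<or>
      (fst (bc cc P) = 0 \<and> fst (snd (bc cc P)) = 1 \<and> snd (snd (bc cc P)) ^ 2 = Polynomial.coeff G 4)" if "E.on P" for P
  proof -
    obtain a b y where P: "P = (a, b, y)" by (cases P) auto
    from that consider "a = 1" "y ^ 2 = poly (E.hp 0) b" | "a = 0" "b = 1" "y ^ 2 = Polynomial.coeff (E.hp 0) 4"
      unfolding P E.on_def E.kon_def by auto
    then show ?thesis by cases (simp_all add: P bc_def G_poly G_4 power_mult_distrib flip: to_ac_power)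
  qed
  have onF: "H.on (F P)" if "E.on P" for P
  proof -
    obtain a b y where P: "bc cc P = (a, b, y)" by (cases "bc cc P") auto
    show ?thesis using on_moebius[OF dG eG, of a y b] onb[OF that]
      unfolding F_def P H.on_def H.kon_def h0_eq hG[symmetric] by (auto split: prod.splits)
  qed
  have F_neg: "F (neg P) = neg (F P)" for P by (simp add: F_def bc_neg moebius_neg)
  have cop: "cop4 h (F P1) (F P2) (F P3) (F P4)"
    if "cop4 (E.hp 0) P1 P2 P3 P4" "E.on P1" "E.on P2" "E.on P3" "E.on P4" for P1 P2 P3 P4
  proof -
    have "cop4 G (bc cc P1) (bc cc P2) (bc cc P3) (bc cc P4)" using cop4_bc[OF that(1) cc0] unfolding G_h0 .
    then show ?thesis unfolding F_def hG
      by (rule cop4_moebius[OF dG eG, rotated]) (use that(2-5) onb in blast)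
  qed
  have srelF: "srel h (F P) (F Q) (F R) (F S)" if "srel (E.hp 0) P Q R S" "E.on P" "E.on Q" "E.on R" "E.on S" for P Q R S
  proof -
    from that(1) consider "P = R" "S = Q" | "Q = R" "S = P" | "P = neg Q" "S = neg R" | "cop4 (E.hp 0) P Q (neg R) (neg S)"
      unfolding srel_def by blast
    then show ?thesis
    proof cases
      case 4
      from cop[OF this that(2,3) E.on_neg[OF that(4)] E.on_neg[OF that(5)]] show ?thesis by (simp add: srel_def F_neg)
    qed (auto simp: srel_def F_neg)
  qed
  interpret G: comm_group GG by (rule GG_group)
  interpret K: comm_group "E.MW Z" by (rule E.MW_comm_group[OF PZ(2)])
  define \<theta> where "\<theta> P = H.KP (F P)" for P
  have \<theta>C: "\<theta> P \<in> carrier GG" if "E.on P" for P unfolding \<theta>_def by (rule KP_carrier[OF onF[OF that]])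
  have mult: "\<theta> Q [^]\<^bsub>GG\<^esub> n = \<theta> Z [^]\<^bsub>GG\<^esub> n" if Q: "E.on Q" "E.KP Q [^]\<^bsub>E.MW Z\<^esub> n = \<one>\<^bsub>E.MW Z\<^esub>" for Q and n :: nat
  proof -
    have QK: "E.KP Q \<in> carrier (E.MW Z)" using Q by (simp add: E.MW_carrier)
    \<comment> \<open>In additive notation m F(Q) + F(Z) = F(m Q) + m F(Z), by induction, because F
      respects \<open>srel\<close>.\<close>
    have "\<exists>S. E.on S \<and> E.KP S = E.KP Q [^]\<^bsub>E.MW Z\<^esub> m \<and> \<theta> Q [^]\<^bsub>GG\<^esub> m \<otimes>\<^bsub>GG\<^esub> \<theta> Z = \<theta> S \<otimes>\<^bsub>GG\<^esub> \<theta> Z [^]\<^bsub>GG\<^esub> m" for m :: nat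
    proof (induction m)
      case 0
      show ?case by (rule exI[of _ Z]) (use PZ(2) \<theta>C[OF PZ(2)] in \<open>simp add: E.MW_one\<close>)
    next
      case (Suc m)
      then obtain S where S: "E.on S" "E.KP S = E.KP Q [^]\<^bsub>E.MW Z\<^esub> m"
        "\<theta> Q [^]\<^bsub>GG\<^esub> m \<otimes>\<^bsub>GG\<^esub> \<theta> Z = \<theta> S \<otimes>\<^bsub>GG\<^esub> \<theta> Z [^]\<^bsub>GG\<^esub> m" by blast
      obtain T where T: "E.on T" "srel (E.hp 0) S Q Z T" using E.srel_exists[OF S(1) Q(1) PZ(2)] by blast
      have "E.KP T = E.KP Q [^]\<^bsub>E.MW Z\<^esub> Suc m"
        using E.MW_mult(2)[OF S(1) Q(1) PZ(2) T(1)] T(2) S(2) by simp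
      moreover have bal: "\<theta> S \<otimes>\<^bsub>GG\<^esub> \<theta> Q = \<theta> T \<otimes>\<^bsub>GG\<^esub> \<theta> Z"
        unfolding \<theta>_def
        by (rule H.MW_balance[OF onF[OF S(1)] onF[OF Q(1)] onF[OF T(1)] onF[OF PZ(2)] on_ori])
          (use srelF[OF T(2) S(1) Q(1) PZ(2) T(1)] in \<open>simp add: h0_eq\<close>)
      moreover have "\<theta> Q [^]\<^bsub>GG\<^esub> Suc m \<otimes>\<^bsub>GG\<^esub> \<theta> Z = \<theta> T \<otimes>\<^bsub>GG\<^esub> \<theta> Z [^]\<^bsub>GG\<^esub> Suc m"
      proof -
        note c = \<theta>C[OF S(1)] \<theta>C[OF Q(1)] \<theta>C[OF T(1)] \<theta>C[OF PZ(2)]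
        have "\<theta> Q [^]\<^bsub>GG\<^esub> Suc m \<otimes>\<^bsub>GG\<^esub> \<theta> Z = (\<theta> Q [^]\<^bsub>GG\<^esub> m \<otimes>\<^bsub>GG\<^esub> \<theta> Z) \<otimes>\<^bsub>GG\<^esub> \<theta> Q" using c by (simp add: G.m_ac)
        also have "\<dots> = (\<theta> S \<otimes>\<^bsub>GG\<^esub> \<theta> Q) \<otimes>\<^bsub>GG\<^esub> \<theta> Z [^]\<^bsub>GG\<^esub> m" unfolding S(3) using c by (simp add: G.m_ac)
        also have "\<dots> = \<theta> T \<otimes>\<^bsub>GG\<^esub> \<theta> Z [^]\<^bsub>GG\<^esub> Suc m" unfolding bal using c by (simp add: G.m_ac)
        finally show ?thesis .
      qed
      ultimately show ?case using T(1) by blast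
    qed
    then obtain S where S: "E.on S" "E.KP S = \<one>\<^bsub>E.MW Z\<^esub>" "\<theta> Q [^]\<^bsub>GG\<^esub> n \<otimes>\<^bsub>GG\<^esub> \<theta> Z = \<theta> S \<otimes>\<^bsub>GG\<^esub> \<theta> Z [^]\<^bsub>GG\<^esub> n"
      using Q(2) by metis
    have "S = Z" using E.KP_eq_iff[OF S(1) PZ(2)] S(2) by (simp add: E.MW_one)
    note c = \<theta>C[OF Q(1)] \<theta>C[OF PZ(2)]
    have "\<theta> Q [^]\<^bsub>GG\<^esub> n \<otimes>\<^bsub>GG\<^esub> \<theta> Z = \<theta> Z [^]\<^bsub>GG\<^esub> n \<otimes>\<^bsub>GG\<^esub> \<theta> Z" using S(3) c unfolding \<open>S = Z\<close> by (simp add: G.m_comm)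
    then show ?thesis using c by simp
  qed
  obtain n1 :: nat where n1: "n1 > 0" "E.KP P [^]\<^bsub>E.MW Z\<^esub> n1 = \<one>\<^bsub>E.MW Z\<^esub>"
    by (rule E.rank_zero_torsion[OF PZ(2) r PZ(1)])
  obtain n2 :: nat where n2: "n2 > 0" "E.KP (neg P) [^]\<^bsub>E.MW Z\<^esub> n2 = \<one>\<^bsub>E.MW Z\<^esub>"
    by (rule E.rank_zero_torsion[OF PZ(2) r E.on_neg[OF PZ(1)]])
  define n where "n = n1 * n2"
  have on': "E.on (neg P)" by (rule E.on_neg[OF PZ(1)])
  have KC: "E.KP P \<in> carrier (E.MW Z)" "E.KP (neg P) \<in> carrier (E.MW Z)" using PZ(1) on' by (auto simp: E.MW_carrier)
  have "E.KP P [^]\<^bsub>E.MW Z\<^esub> n = (E.KP P [^]\<^bsub>E.MW Z\<^esub> n1) [^]\<^bsub>E.MW Z\<^esub> n2" using KC by (simp add: n_def K.nat_pow_pow)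
  then have p1: "E.KP P [^]\<^bsub>E.MW Z\<^esub> n = \<one>\<^bsub>E.MW Z\<^esub>" by (simp add: n1)
  have "E.KP (neg P) [^]\<^bsub>E.MW Z\<^esub> n = (E.KP (neg P) [^]\<^bsub>E.MW Z\<^esub> n2) [^]\<^bsub>E.MW Z\<^esub> n1" using KC by (simp add: n_def K.nat_pow_pow mult.commute)
  then have p2: "E.KP (neg P) [^]\<^bsub>E.MW Z\<^esub> n = \<one>\<^bsub>E.MW Z\<^esub>" by (simp add: n2)
  have eqn: "\<theta> P [^]\<^bsub>GG\<^esub> n = \<theta> (neg P) [^]\<^bsub>GG\<^esub> n" using mult[OF PZ(1) p1] mult[OF on' p2] by simp
  note c = \<theta>C[OF PZ(1)] \<theta>C[OF on']
  have "\<theta> P \<otimes>\<^bsub>GG\<^esub> \<theta> (neg P) = \<one>\<^bsub>GG\<^esub>" unfolding \<theta>_def F_neg by (rule GG_neg[OF onF[OF PZ(1)]])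
  then have "\<one>\<^bsub>GG\<^esub> = (\<theta> P \<otimes>\<^bsub>GG\<^esub> \<theta> (neg P)) [^]\<^bsub>GG\<^esub> n" by simp
  also have "\<dots> = \<theta> P [^]\<^bsub>GG\<^esub> n \<otimes>\<^bsub>GG\<^esub> \<theta> P [^]\<^bsub>GG\<^esub> n" unfolding G.nat_pow_distrib[OF c] eqn ..
  also have "\<dots> = \<theta> P [^]\<^bsub>GG\<^esub> (n + n)" using c by (simp add: G.nat_pow_mult)
  finally have "H.KP (F P) [^]\<^bsub>GG\<^esub> (n + n) = \<one>\<^bsub>GG\<^esub>" by (simp add: \<theta>_def)
  moreover have "n + n > 0" using n1 n2 by (simp add: n_def)
  ultimately show ?thesis using onF[OF PZ(1)] unfolding tors_def F_def by blast
qed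

text \<open>The difference of 1/(x - e) and 1/(x' - e) is x' - x times two bounded factors, so two
  elements congruent modulo a high power of 2 would have torsion abscissae that are too close.
  Elements outside V are compared through their inverses.\<close>

lemma finite_torsion_abscissae:
  assumes B: "!!x. x \<in> B ==> to_ac x ~= e \<and> (\<exists>Y. tors (1, 1 / (to_ac x - e), Y))"
  shows "finite (B :: 'k set)"
proof -
  obtain N where N: "!!x1 y1 x2 y2. tors (1, x1, y1) ==> tors (1, x2, y2) ==> x1 ~= x2 ==> \<not> L N (x1 - x2)"
    using torsion_separated by blast
  have sep: "\<not> L N (1 / (to_ac x - e) - 1 / (to_ac x' - e))" if x: "x \<in> B" "x' \<in> B" "x ~= x'" for x x'
  proof -
    obtain Y Y' where "tors (1, 1 / (to_ac x - e), Y)" "tors (1, 1 / (to_ac x' - e), Y')" using B x by blast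
    from N[OF this] show ?thesis using x(3) B[OF x(1)] B[OF x(2)] by (auto simp: field_simps)
  qed
  have bd: "L (- M) (1 / (to_ac x - e))" if "x \<in> B" for x using B[OF that] torsion_bounded by blast
  have two: "\<exists>x x'. x \<in> S \<and> x' \<in> S \<and> x ~= x'" if inf: "infinite S" for S :: "'k set"
  proof -
    have "S ~= {}" using inf by auto
    then obtain x where x: "x \<in> S" by blast
    have "infinite (S - {x})" using inf by simp
    then have "S - {x} ~= {}" by (metis finite.emptyI)
    then obtain x' where "x' \<in> S - {x}" by blast
    with x show ?thesis by blast
  qed
  define B1 where "B1 = {x \<in> B. to_ac x \<in> V}"
  define B2 where "B2 = {x \<in> B. to_ac x \<notin> V}"
  have "finite B1"
  proof (rule ccontr)
    assume inf: "infinite B1"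
    define k where "k = nat (N + 2 * M)"
    obtain S where S: "infinite S" "S \<subseteq> B1" "\<forall>x\<in>S. \<forall>y\<in>S. sm k (to_ac (x - y))"
      using pigeonhole[OF inf, of k] unfolding B1_def by blast
    obtain x x' where x: "x \<in> S" "x' \<in> S" "x ~= x'" using two[OF S(1)] by blast
    have xB: "x \<in> B" "x' \<in> B" using x S(2) by (auto simp: B1_def)
    have ne: "to_ac x - e ~= 0" "to_ac x' - e ~= 0" using B xB by auto
    have "L (int k) (to_ac (x' - x))" using S(3) x L_sm by blast
    from L_mult[OF L_mult[OF this bd[OF xB(1)]] bd[OF xB(2)]]
    have "L (int k + - M + - M) (to_ac (x' - x) * (1 / (to_ac x - e)) * (1 / (to_ac x' - e)))" .
    moreover have "to_ac (x' - x) * (1 / (to_ac x - e)) * (1 / (to_ac x' - e)) = 1 / (to_ac x - e) - 1 / (to_ac x' - e)"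
      using ne by (simp add: field_simps)
    ultimately have "L N (1 / (to_ac x - e) - 1 / (to_ac x' - e))"
      using L_mono[of "int k + - M + - M" _ N] by (simp add: k_def)
    with sep[OF xB x(3)] show False by simp
  qed
  moreover have "finite B2"
  proof (rule ccontr)
    assume inf: "infinite B2"
    obtain c where c: "c \<le> 0" "L c e" using L_bounded[of "[e]"] by auto
    define b where "b = c - M"
    define k where "k = nat (N - 2 * b)"
    have nz: "x ~= 0" if "x \<in> B2" for x using that ops(2) by (auto simp: B2_def)
    have inj: "inj_on inverse B2" by (rule inj_onI) simp
    have i1: "infinite (inverse ` B2)" using inf inj finite_imageD by blast
    have i2: "inverse ` B2 \<subseteq> {x. to_ac x \<in> V}"
    proof (rule image_subsetI)
      fix x assume "x \<in> B2"
      then show "inverse x \<in> {x. to_ac x \<in> V}" using val[of "to_ac x"] by (auto simp: B2_def)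
    qed
    obtain S where S: "infinite S" "S \<subseteq> inverse ` B2" "\<forall>x\<in>S. \<forall>y\<in>S. sm k (to_ac (x - y))"
      using pigeonhole[OF i1 i2, of k] by blast
    obtain u u' where u: "u \<in> S" "u' \<in> S" "u ~= u'" using two[OF S(1)] by blast
    then obtain x x' where x: "x \<in> B2" "x' \<in> B2" "u = inverse x" "u' = inverse x'" using S(2) by blast
    have xB: "x \<in> B" "x' \<in> B" using x by (auto simp: B2_def)
    have ne: "to_ac x - e ~= 0" "to_ac x' - e ~= 0" using B xB by auto
    \<comment> \<open>This factor equals y/(y - e); it appears when differences of inverses are
      compared.\<close>
    have xx: "L b (1 + e * (1 / (to_ac y - e)))" if "y \<in> B" for y
    proof (rule L_add)
      show "L b 1" using M(1) c(1) by (intro L_mono[OF L_1]) (simp add: b_def)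
      show "L b (e * (1 / (to_ac y - e)))" using L_mult[OF c(2) bd[OF that]] by (simp add: b_def)
    qed
    have "L (int k) (to_ac (u - u'))" using S(3) u L_sm by blast
    from L_mult[OF L_mult[OF this xx[OF xB(1)]] xx[OF xB(2)]]
    have "L (int k + b + b) (to_ac (u - u') * (1 + e * (1 / (to_ac x - e))) * (1 + e * (1 / (to_ac x' - e))))" .
    moreover have "to_ac (u - u') * (1 + e * (1 / (to_ac x - e))) * (1 + e * (1 / (to_ac x' - e))) = 1 / (to_ac x - e) - 1 / (to_ac x' - e)"
    proof -
      have z: "1 + e * (1 / (a - e)) = a / (a - e)" if "a - e ~= 0" for a using that by (simp add: field_simps)
      have nx: "to_ac x ~= 0" "to_ac x' ~= 0" using nz x by auto
      have "to_ac (u - u') = inverse (to_ac x) - inverse (to_ac x')" unfolding x(3,4) by simp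
      also have "\<dots> = (to_ac x' - to_ac x) / (to_ac x * to_ac x')" using nx by (simp add: field_simps)
      finally have "to_ac (u - u') = (to_ac x' - to_ac x) / (to_ac x * to_ac x')" .
      then have "to_ac (u - u') * (1 + e * (1 / (to_ac x - e))) * (1 + e * (1 / (to_ac x' - e))) =
          (to_ac x' - to_ac x) / ((to_ac x - e) * (to_ac x' - e))"
        unfolding z[OF ne(1)] z[OF ne(2)] using nx by simp
      also have "\<dots> = 1 / (to_ac x - e) - 1 / (to_ac x' - e)" using ne by (simp add: field_simps)
      finally show ?thesis .
    qed
    ultimately have "L N (1 / (to_ac x - e) - 1 / (to_ac x' - e))"
      using L_mono[of "int k + b + b" _ N] by (simp add: k_def)
    moreover have "x ~= x'" using u(3) x by auto
    ultimately show False using sep[OF xB] by simp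
  qed
  moreover have "B = B1 \<union> B2" by (auto simp: B1_def B2_def)
  ultimately show ?thesis by simp
qed

end

lemma rank_zero_abscissae_finite:
  fixes g :: "'k::field_char_0 poly"
  assumes nf: "number_field TYPE('k)" and sq: "rsquarefree (map_poly to_ac g)"
    and deg: "3 \<le> Polynomial.degree g" "Polynomial.degree g \<le> 4"
  shows "finite {x. \<exists>C y z. C ~= 0 \<and> C * y ^ 2 = poly g x \<and> z \<in> rational_points (twisted_curve g C) \<and>
     \<not> group_rank (mordell_weil_group (twisted_curve g C) z) > 0}" (is "finite ?B")
proof -
  obtain V :: "'k alg_closure set" where V: "valuation_ring_2 V" using valuation_ring_exists by blast
  define G where "G = map_poly to_ac g"
  have dG: "Polynomial.degree G = Polynomial.degree g" by (simp add: G_def degree_map_ac)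
  obtain e where e: "poly G e = 0" using alg_closed_imp_poly_has_root[of G] deg dG by auto
  define h where "h = moebius_poly G e"
  have d4: "Polynomial.degree G \<le> 4" using deg dG by simp
  have c4: "Polynomial.coeff h 4 = 0" unfolding h_def moebius_poly_coeff[OF d4] by (rule e)
  have c3: "Polynomial.coeff h 3 ~= 0"
    unfolding h_def moebius_poly_coeff[OF d4] using sq e unfolding G_def rsquarefree_roots by blast
  have sqh: "rsquarefree h"
    unfolding h_def moebius_poly_def
  proof (rule rsquarefree_grev)
    show "rsquarefree (pcompose G [:e, 1:])"
      using sq unfolding rsquarefree_roots G_def[symmetric] by (simp add: pderiv_pcompose poly_pcompose pderiv_pCons)
  qed (use deg dG in \<open>simp_all add: degree_shift\<close>)
  have "genus_one h 1"
  proof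
    show "3 \<le> Polynomial.degree h" using c3 by (rule le_degree)
    show "Polynomial.degree h \<le> 4" unfolding h_def moebius_poly_def grev_pCons by simp
    show "rsquarefree (map_poly to_ac h)" by (rule rsquarefree_map_to_ac[OF sqh])
  qed simp
  then interpret T: cubic_torsion V h
    using V nf c4 by (simp add: cubic_torsion_def cubic_torsion_axioms_def number_field_valuation_def number_field_valuation_axioms_def)
  define B' where "B' = {x \<in> ?B. to_ac x ~= e}"
  have "finite B'"
  proof (rule T.finite_torsion_abscissae)
    fix x assume "x \<in> B'"
    then obtain C y z where xe: "to_ac x ~= e" and C: "C ~= 0" "C * y ^ 2 = poly g x" "z \<in> rational_points (twisted_curve g C)"
      "\<not> group_rank (mordell_weil_group (twisted_curve g C) z) > 0" unfolding B'_def by blast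
    have gen: "genus_one g C" by standard (use C sq deg in auto)
    interpret E: genus_one g C by (rule gen)
    obtain Z where Z: "E.on Z" "z = E.KP Z" using C(3) unfolding E.rational_points_KP by blast
    obtain cc where cc: "cc ^ 2 = to_ac C" using ex_sqrt by blast
    have "E.on (1, x, y)" using C(1,2) by (simp add: E.on_def E.kon_def E.hp_def field_simps)
    from T.transfer_torsion[OF gen e[unfolded G_def] h_def[unfolded G_def] this Z(1) C(4)[unfolded Z(2)] cc]
    have "T.tors (1, 1 / (to_ac x - e), cc * to_ac y / (to_ac x - e) ^ 2)" using xe by (simp add: moebius_def bc_def)
    with xe show "to_ac x ~= e \<and> (\<exists>Y. T.tors (1, 1 / (to_ac x - e), Y))" by blast
  qed
  \<comment> \<open>The root e, if it lies in k, is sent to infinity and has to be counted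
    separately.\<close>
  moreover have "finite {x :: 'k. to_ac x = e}"
  proof (cases "\<exists>x :: 'k. to_ac x = e")
    case True
    then obtain x0 :: 'k where "to_ac x0 = e" by blast
    then have "{x :: 'k. to_ac x = e} = {x0}" by auto
    then show ?thesis by simp
  qed simp
  moreover have "?B \<subseteq> B' \<union> {x. to_ac x = e}" by (auto simp: B'_def)
  ultimately show ?thesis by (meson finite_UnI finite_subset)
qed

section \<open>The quotient of a product of curves by the involution\<close>

text \<open>Scales the coordinate with index 3 in both factors of a Segre product. For r = -1 this
  is the involution, and for r^2 = C it identifies the product of the twists by C with the original
  product.\<close>

definition sc :: "'a::field => (nat => 'a) => nat => 'a" where
  "sc r z l = (case prod_decode l of (i, j) => (if i = 3 then r else 1) * (if j = 3 then r else 1) * z l)"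

lemma sc_sc [simp]: "sc r (sc s z) = sc (r * s) z"
  by (rule ext) (simp add: sc_def split: prod.splits)

lemma sc_1 [simp]: "sc 1 z = z"
  by (rule ext) (simp add: sc_def split: prod.splits)

lemma sc_scale: "sc r (\<lambda>l. c * z l) = (\<lambda>l. c * sc r z l)"
  by (rule ext) (simp add: sc_def split: prod.splits)

lemma sc_tensor: "sc r (tensor v w) = tensor (v(3 := r * v 3)) (w(3 := r * w 3))"
  by (rule ext) (simp add: sc_def tensor_def split: prod.splits)

lemma sc_hline: "sc r ` hline z = hline (sc r z)"
proof -
  have "sc r ` {(\<lambda>i. c * z i) | c. c ~= 0} = {sc r (\<lambda>i. c * z i) | c. c ~= 0}" by auto
  then show ?thesis unfolding hline_def sc_scale .
qed

lemma upd_nonzero: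
  fixes v :: "nat => 'a::field"
  assumes "r ~= 0" "v ~= (\<lambda>_. 0)"
  shows "v(3 := r * v 3) ~= (\<lambda>_. 0)"
proof
  assume *: "v(3 := r * v 3) = (\<lambda>_. 0)"
  have "v i = 0" for i using fun_cong[OF *, of i] assms(1) by (cases "i = 3") auto
  with assms(2) show False by auto
qed

definition even_fun :: "((nat => 'a::field) => 'a) => bool" where
  "even_fun P \<longleftrightarrow> (\<forall>z. P (sc (- 1) z) = P z)"

lemma even_fun_prod: "even_fun (\<lambda>z. P z * P (sc (- 1) z))"
  by (simp add: even_fun_def mult.commute)

lemma form_sc_neg:
  assumes "form d P"
  shows "form d (\<lambda>v. P (sc (- 1) v))"
proof -
  have "form 1 (\<lambda>v :: nat => 'a alg_closure. sc (- 1) v l)" for l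
  proof -
    obtain i j where ij: "prod_decode l = (i, j)" by force
    have eq: "(\<lambda>v :: nat => 'a alg_closure. sc (- 1) v l) =
        (\<lambda>v. to_ac ((if i = 3 then - 1 else 1) * (if j = 3 then - 1 else 1)) * v l)"
      by (rule ext) (simp add: sc_def ij)
    show ?thesis unfolding eq by (rule form_cmult[OF form_coord])
  qed
  from form_comp[OF assms this] show ?thesis by simp
qed

text \<open>Pulling back along the isomorphism with the twist, which is only defined over the
  quadratic extension, splits into an even and an odd part over the base field.\<close>

lemma form_twist:
  assumes "form d P"
  shows "\<exists>P1 P2. form d P1 \<and> form d P2 \<and> (\<forall>\<gamma> z. \<gamma> ^ 2 = to_ac C --> P (sc \<gamma> z) = P1 z + \<gamma> * P2 z)"
  using assms
proof (induction rule: form_induct)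
  case (zero d)
  show ?case by (rule exI[of _ "\<lambda>_. 0"], rule exI[of _ "\<lambda>_. 0"]) (simp add: form_zero)
next
  case (const c)
  show ?case by (rule exI[of _ "\<lambda>_. to_ac c"], rule exI[of _ "\<lambda>_. 0"]) (simp add: form_zero form_const)
next
  case (coord d P l)
  then obtain P1 P2 where P: "form d P1" "form d P2" "!!\<gamma> z. \<gamma> ^ 2 = to_ac C ==> P (sc \<gamma> z) = P1 z + \<gamma> * P2 z" by blast
  obtain i j where ij: "prod_decode l = (i, j)" by force
  have F: "form (Suc d) (\<lambda>v. to_ac e * (v l * R v))" if "form d R" for R e
    using form_cmult[OF form_mult[OF form_coord that]] by simp
  show ?case
  proof (cases "(i = 3) = (j = 3)")
    case True
    define e where "e = (if i = 3 then C else 1)"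
    have s: "sc \<gamma> z l = to_ac e * z l" if "\<gamma> ^ 2 = to_ac C" for \<gamma> z
      using that True by (simp add: sc_def ij e_def power2_eq_square)
    have "to_ac e * z l * (P1 z + \<gamma> * P2 z) = to_ac e * (z l * P1 z) + \<gamma> * (to_ac e * (z l * P2 z))" for \<gamma> z
      by (simp add: algebra_simps)
    then show ?thesis
      by (intro exI[of _ "\<lambda>v. to_ac e * (v l * P1 v)"] exI[of _ "\<lambda>v. to_ac e * (v l * P2 v)"] conjI allI impI F P)
        (simp only: s P(3))
  next
    case False
    have s: "sc \<gamma> z l = \<gamma> * z l" for \<gamma> z using False by (auto simp: sc_def ij)
    have "\<gamma> * z l * (P1 z + \<gamma> * P2 z) = to_ac C * (z l * P2 z) + \<gamma> * (to_ac 1 * (z l * P1 z))" if "\<gamma> ^ 2 = to_ac C" for \<gamma> z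
      unfolding that[symmetric] by (simp add: algebra_simps power2_eq_square)
    then show ?thesis
      by (intro exI[of _ "\<lambda>v. to_ac C * (v l * P2 v)"] exI[of _ "\<lambda>v. to_ac 1 * (v l * P1 v)"] conjI allI impI F P)
        (simp only: s P(3))
  qed
next
  case (add d P R)
  then obtain P1 P2 R1 R2 where P: "form d P1" "form d P2" "!!\<gamma> z. \<gamma> ^ 2 = to_ac C ==> P (sc \<gamma> z) = P1 z + \<gamma> * P2 z"
    and R: "form d R1" "form d R2" "!!\<gamma> z. \<gamma> ^ 2 = to_ac C ==> R (sc \<gamma> z) = R1 z + \<gamma> * R2 z" by blast
  show ?case
    by (rule exI[of _ "\<lambda>v. P1 v + R1 v"], rule exI[of _ "\<lambda>v. P2 v + R2 v"])
      (simp add: form_add[OF P(1) R(1)] form_add[OF P(2) R(2)] P(3) R(3) algebra_simps)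
qed

text \<open>Replacing \<gamma> by -\<gamma> amounts to applying the involution, which does not
  change P; so the part linear in \<gamma> vanishes and a form over k remains.\<close>

lemma form_twist_even:
  fixes C :: "'k::field_char_0"
  assumes P: "form d P" "even_fun P" and C: "C ~= 0"
  shows "\<exists>P1. form d P1 \<and> even_fun P1 \<and> (\<forall>\<gamma> z. \<gamma> ^ 2 = to_ac C --> P (sc \<gamma> z) = P1 z)"
proof -
  obtain P1 P2 where t: "form d P1" "form d P2" "!!\<gamma> z. \<gamma> ^ 2 = to_ac C ==> P (sc \<gamma> z) = P1 z + \<gamma> * P2 z"
    using form_twist[OF P(1)] by blast
  have eq: "P (sc \<gamma> z) = P1 z" if g: "\<gamma> ^ 2 = to_ac C" for \<gamma> z
  proof -
    have "(- \<gamma>) ^ 2 = to_ac C" using g by simp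
    from t(3)[OF this] have "P (sc (- 1) (sc \<gamma> z)) = P1 z - \<gamma> * P2 z" by simp
    moreover have "P (sc (- 1) (sc \<gamma> z)) = P (sc \<gamma> z)" using P(2) unfolding even_fun_def by blast
    ultimately have "2 * (\<gamma> * P2 z) = 0" using t(3)[OF g, of z] by (simp add: algebra_simps)
    then show ?thesis using t(3)[OF g, of z] by simp
  qed
  obtain \<gamma> :: "'k alg_closure" where g: "\<gamma> ^ 2 = to_ac C" using ex_sqrt by blast
  have "P1 (sc (- 1) z) = P1 z" for z
  proof -
    have "P1 (sc (- 1) z) = P (sc (- 1) (sc \<gamma> z))" using eq[OF g, of "sc (- 1) z"] by (simp add: mult.commute)
    also have "\<dots> = P (sc \<gamma> z)" using P(2) unfolding even_fun_def by blast
    also have "\<dots> = P1 z" by (rule eq[OF g])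
    finally show ?thesis .
  qed
  then have "even_fun P1" unfolding even_fun_def by blast
  with t(1) eq show ?thesis by blast
qed

lemma twisted_curve_twist:
  assumes gC: "genus_one g C" and g1: "genus_one g C'" and v: "v ~= (\<lambda>_. 0)" and r: "to_ac C' * r ^ 2 = to_ac C"
  shows "hline v \<in> twisted_curve g C \<longleftrightarrow> hline (v(3 := r * v 3)) \<in> twisted_curve g C'"
proof -
  have "to_ac C ~= 0" using gC by (simp add: genus_one_def)
  then have r0: "r ~= 0" using r by auto
  have v': "v(3 := r * v 3) ~= (\<lambda>_. 0)" by (rule upd_nonzero[OF r0 v])
  have "to_ac C' * (r * v 3) ^ 2 = to_ac C * v 3 ^ 2" unfolding r[symmetric] by (simp add: power_mult_distrib)
  then show ?thesis unfolding genus_one.E_iff[OF gC v] genus_one.E_iff[OF g1 v'] by simp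
qed

context curve_pair
begin

lemma A_obtain:
  assumes "b \<in> A"
  shows "\<exists>v w. v ~= (\<lambda>_. 0) \<and> w ~= (\<lambda>_. 0) \<and> hline v \<in> E1.E \<and> hline w \<in> E2.E \<and> b = hline (tensor v w)"
proof -
  obtain x y where xy: "x \<in> E1.E" "y \<in> E2.E" "b = ppair x y" using assms unfolding A_eq by blast
  have p: "x \<in> pts" "y \<in> pts" using xy E1.E_sub E2.E_sub by auto
  show ?thesis using rep[OF p(1)] rep[OF p(2)] xy unfolding ppair_def by metis
qed

lemma tensor_in_A: "hline v \<in> E1.E ==> hline w \<in> E2.E ==> v ~= (\<lambda>_. 0) ==> w ~= (\<lambda>_. 0) ==> hline (tensor v w) \<in> A"
  unfolding A_eq using ppair_hline by blast

lemma kummer_involution_sc: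
  assumes "a \<in> A"
  shows "kummer_involution a = sc (- 1) ` a"
proof -
  obtain v w where vw: "a = hline (tensor v w)" using A_obtain[OF assms] by blast
  have t: "\<exists>v' w'. z = tensor v' w'" if "z \<in> a" for z
  proof -
    obtain c where "z = (\<lambda>i. c * tensor v w i)" using \<open>z \<in> a\<close> hline_memD vw by blast
    then have "z = tensor (\<lambda>i. c * v i) (\<lambda>i. 1 * w i)" unfolding tensor_scale by simp
    then show ?thesis by blast
  qed
  have f: "tensor (flip v') (flip w') = sc (- 1) (tensor v' w')" for v' w' :: "nat => 'k alg_closure"
    unfolding sc_tensor flip_def by simp
  show ?thesis unfolding kummer_involution_def f using t by blast
qed

end

lemma twist_A:
  assumes b: "b \<in> product_variety (twisted_curve g C) (twisted_curve f C)"
    and pair: "curve_pair g f C" "curve_pair g f C'" and r: "to_ac C' * r ^ 2 = to_ac C"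
  shows "sc r ` b \<in> product_variety (twisted_curve g C') (twisted_curve f C')"
proof -
  interpret P: curve_pair g f C by (rule pair(1))
  interpret P': curve_pair g f C' by (rule pair(2))
  have "to_ac C ~= 0" using P.E1.C_nonzero by simp
  then have r0: "r ~= 0" using r by auto
  obtain v w where vw: "v ~= (\<lambda>_. 0)" "w ~= (\<lambda>_. 0)" "hline v \<in> P.E1.E" "hline w \<in> P.E2.E" "b = hline (tensor v w)"
    using P.A_obtain[OF b] by blast
  have n: "v(3 := r * v 3) ~= (\<lambda>_. 0)" "w(3 := r * w 3) ~= (\<lambda>_. 0)"
    by (rule upd_nonzero[OF r0 vw(1)], rule upd_nonzero[OF r0 vw(2)])
  have e: "hline (v(3 := r * v 3)) \<in> P'.E1.E" "hline (w(3 := r * w 3)) \<in> P'.E2.E"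
    using twisted_curve_twist[OF P.E1.genus_one_axioms P'.E1.genus_one_axioms vw(1) r]
      twisted_curve_twist[OF P.E2.genus_one_axioms P'.E2.genus_one_axioms vw(2) r] vw(3,4) by auto
  show ?thesis unfolding vw(5) sc_hline sc_tensor by (rule P'.tensor_in_A[OF e n])
qed

lemma morphism_local:
  assumes "X \<subseteq> pts" "morphism X Y \<phi>" "x \<in> X"
  shows "\<exists>d F e R. (\<forall>i. form d (F i)) \<and> form e R \<and> x \<in> nz R \<and>
     (\<forall>y\<in>X \<inter> nz R. \<forall>v\<in>y. (\<lambda>i. F i v) \<in> \<phi> y)"
  by (rule assms(2)[unfolded morphism_iff[OF assms(1)], THEN conjunct2, rule_format, OF assms(3)])

text \<open>Composing P with a local formula F for the morphism gives a form that cuts out the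
  preimage of \<open>nz P\<close> where F is valid.\<close>

lemma morphism_pullback:
  assumes Y: "Y \<subseteq> pts" and X: "X \<subseteq> pts" and m: "morphism Y X \<phi>" and b: "b \<in> Y" and P: "form d P" "\<phi> b \<in> nz P"
  shows "\<exists>d' F e R. (\<forall>i. form d' (F i)) \<and> form e R \<and> b \<in> nz R \<and>
    (\<forall>y\<in>Y \<inter> nz R. \<phi> y \<in> nz P \<and> (\<forall>v\<in>y. (\<lambda>i. F i v) \<in> \<phi> y))"
proof -
  obtain d' F e R where F: "\<forall>i. form d' (F i)" "form e R" "b \<in> nz R" "\<forall>y\<in>Y \<inter> nz R. \<forall>v\<in>y. (\<lambda>i. F i v) \<in> \<phi> y"
    using morphism_local[OF Y m b] by (elim exE conjE) (rule that)
  define T where "T v = P (\<lambda>i. F i v)" for v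
  have T: "form (d * d') T" unfolding T_def by (rule form_comp[OF P(1) F(1)[rule_format]])
  have *: "y \<in> nz T \<longleftrightarrow> \<phi> y \<in> nz P" if y: "y \<in> Y" "y \<in> nz R" for y
  proof -
    have yp: "y \<in> pts" using y Y by blast
    obtain v where v: "v \<in> y" using yp pts_obtain by metis
    have "\<phi> y \<in> X" using m[unfolded morphism_def, THEN conjunct1] by (rule subsetD) (rule imageI[OF y(1)])
    then have xp: "\<phi> y \<in> pts" using X by blast
    have Fv: "(\<lambda>i. F i v) \<in> \<phi> y" using F(4) y v by blast
    show ?thesis unfolding nz_iff[OF T yp v] nz_iff[OF P(1) xp Fv] T_def ..
  qed
  show ?thesis
  proof (intro exI conjI)
    show "\<forall>i. form d' (F i)" by (rule F(1))
    show "form (e + d * d') (\<lambda>v. R v * T v)" by (rule form_mult[OF F(2) T])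
    show "b \<in> nz (\<lambda>v. R v * T v)" unfolding nz_mult[OF F(2) T] using *[OF b F(3)] F(3) P(2) by blast
    show "\<forall>y\<in>Y \<inter> nz (\<lambda>v. R v * T v). \<phi> y \<in> nz P \<and> (\<forall>v\<in>y. (\<lambda>i. F i v) \<in> \<phi> y)"
      unfolding nz_mult[OF F(2) T] using * F(4) by blast
  qed
qed

lemma sc_nz:
  assumes "form d P" "form d' P'" "!!z. P (sc r z) = P' z" "b \<in> pts" "sc r ` b \<in> pts"
  shows "b \<in> nz P' \<longleftrightarrow> sc r ` b \<in> nz P"
proof -
  obtain v where v: "v \<in> b" using assms(4) pts_obtain by metis
  show ?thesis unfolding nz_iff[OF assms(2,4) v] nz_iff[OF assms(1,5) imageI[OF v]] assms(3) ..
qed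

locale kummer = K1: curve_pair g f 1
  for g f :: "'k::field_char_0 poly" +
  fixes X Q U V :: "'k alg_closure ppoint set" and q \<rho> \<psi> :: "'k alg_closure ppoint => 'k alg_closure ppoint"
  assumes X_sub: "X \<subseteq> pts" and X_irr: "zariski_irreducible X" and Q_sub: "Q \<subseteq> pts"
    and quotient: "geometric_quotient K1.A kummer_involution Q q"
    and rho_morphism: "morphism X Q \<rho>"
    and U_open: "openin (zariski_on X) U" and V_open: "openin (zariski_on Q) V" and V_ne: "V ~= {}"
    and psi_morphism: "morphism V U \<psi>" and rho_U: "\<rho> ` U \<subseteq> V"
    and psi_rho: "!!x. x \<in> U ==> \<psi> (\<rho> x) = x" and rho_psi: "!!r. r \<in> V ==> \<rho> (\<psi> r) = r"
begin

sublocale XX: irreducible_set X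
  by standard (rule X_irr, rule X_sub)

abbreviation "A \<equiv> K1.A"

lemma A_sub: "A \<subseteq> pts" by (rule K1.A_sub)

lemmas q_props = quotient[unfolded geometric_quotient_def]

lemma q_morphism: "morphism A Q q" by (rule q_props[THEN conjunct1])
lemma q_surj: "q ` A = Q" by (rule q_props[THEN conjunct2, THEN conjunct1])
lemma q_fibre: "a \<in> A ==> b \<in> A ==> q a = q b \<longleftrightarrow> b = a \<or> b = sc (- 1) ` a"
  using q_props[THEN conjunct2, THEN conjunct2, THEN conjunct1, rule_format, of a b] K1.kummer_involution_sc[of a] by simp
lemma q_topology: "W \<subseteq> Q ==> openin (zariski_on Q) W \<longleftrightarrow> openin (zariski_on A) {a \<in> A. q a \<in> W}"
  by (rule q_props[THEN conjunct2, THEN conjunct2, THEN conjunct2, THEN conjunct1, rule_format])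
lemma q_regular: "openin (zariski_on Q) W ==> regular_on W h \<longleftrightarrow> regular_on {a \<in> A. q a \<in> W} (h \<circ> q)"
  by (rule q_props[THEN conjunct2, THEN conjunct2, THEN conjunct2, THEN conjunct2, rule_format])

lemma rho_Q: "x \<in> X ==> \<rho> x \<in> Q"
  using rho_morphism[unfolded morphism_def, THEN conjunct1] by (rule subsetD) (rule imageI)

lemma sigma_A: "a \<in> A ==> sc (- 1) ` a \<in> A"
  by (rule twist_A[OF _ K1.curve_pair_axioms K1.curve_pair_axioms]) auto

lemma sigma_mem: "v \<in> a ==> sc (- 1) v \<in> sc (- 1) ` a" by blast

lemma q_sigma: "a \<in> A ==> q (sc (- 1) ` a) = q a"
  using q_fibre[of a "sc (- 1) ` a"] sigma_A by auto

lemma sigma_nz: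
  assumes "form e N" "even_fun N" "a \<in> A"
  shows "sc (- 1) ` a \<in> nz N \<longleftrightarrow> a \<in> nz N"
  using sc_nz[OF assms(1) assms(1) assms(2)[unfolded even_fun_def, rule_format]] assms(3) sigma_A A_sub by blast

lemma saturated:
  assumes "form e N" "even_fun N"
  shows "{a \<in> A. q a \<in> q ` (A \<inter> nz N)} = A \<inter> nz N"
proof (intro equalityI subsetI)
  fix a assume "a \<in> {a \<in> A. q a \<in> q ` (A \<inter> nz N)}"
  then obtain b where b: "a \<in> A" "b \<in> A" "b \<in> nz N" "q a = q b" by blast
  then have "b = a \<or> b = sc (- 1) ` a" using q_fibre by blast
  then show "a \<in> A \<inter> nz N" using b sigma_nz[OF assms b(1)] by auto
qed auto

lemma q_open:
  assumes "form e N" "even_fun N"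
  shows "openin (zariski_on Q) (q ` (A \<inter> nz N))"
proof -
  have "q ` (A \<inter> nz N) \<subseteq> Q" using q_surj by blast
  then show ?thesis unfolding q_topology[OF \<open>q ` (A \<inter> nz N) \<subseteq> Q\<close>] saturated[OF assms] by (simp add: openin_nz[OF assms(1)])
qed

definition AV where "AV = {a \<in> A. q a \<in> V}"
text \<open>The rational map of degree 2 from the product of the curves to the surface through the
  quotient; it is meaningful on \<open>AV\<close>.\<close>

definition \<Phi> where "\<Phi> a = \<psi> (q a)"

lemma V_sub: "V \<subseteq> Q" using V_open unfolding openin_zariski_on by blast
lemma U_sub: "U \<subseteq> X" using U_open unfolding openin_zariski_on by blast

lemma AV_open: "openin (zariski_on A) AV"
  unfolding AV_def using q_topology[OF V_sub] V_open by blast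

lemma AV_ne: "AV ~= {}" using V_ne V_sub q_surj unfolding AV_def by blast

lemma psi_U: "r \<in> V ==> \<psi> r \<in> U"
  using psi_morphism[unfolded morphism_def, THEN conjunct1] by (rule subsetD) (rule imageI)

lemma Phi_U: "a \<in> AV ==> \<Phi> a \<in> U" unfolding \<Phi>_def AV_def using psi_U by blast
lemma Phi_X: "a \<in> AV ==> \<Phi> a \<in> X" using Phi_U U_sub by blast
lemma rho_Phi: "a \<in> AV ==> \<rho> (\<Phi> a) = q a" unfolding \<Phi>_def AV_def using rho_psi by blast
lemma Phi_sigma: "a \<in> A ==> \<Phi> (sc (- 1) ` a) = \<Phi> a" by (simp add: \<Phi>_def q_sigma)

lemma Phi_local:
  assumes a: "a \<in> AV"
  shows "\<exists>D F e R. (\<forall>i. form D (F i)) \<and> form e R \<and> a \<in> nz R \<and>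
     (\<forall>y\<in>A \<inter> nz R. y \<in> AV \<and> (\<forall>v\<in>y. (\<lambda>i. F i v) \<in> \<Phi> y))"
proof -
  have aA: "a \<in> A" "q a \<in> V" using a by (auto simp: AV_def)
  obtain e1 R1 where R1: "form e1 R1" "a \<in> nz R1" "A \<inter> nz R1 \<subseteq> AV"
    using AV_open a unfolding openin_zariski_on by blast
  have Vp: "V \<subseteq> pts" using V_sub Q_sub by blast
  obtain d' H e3 R3 where H: "\<forall>i. form d' (H i)" "form e3 R3" "q a \<in> nz R3" "\<forall>y\<in>V \<inter> nz R3. \<forall>v\<in>y. (\<lambda>i. H i v) \<in> \<psi> y"
    using morphism_local[OF Vp psi_morphism aA(2)] by (elim exE conjE) (rule that)
  obtain d F e2 R2 where F: "\<forall>i. form d (F i)" "form e2 R2" "a \<in> nz R2"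
    "\<forall>y\<in>A \<inter> nz R2. q y \<in> nz R3 \<and> (\<forall>v\<in>y. (\<lambda>i. F i v) \<in> q y)"
    using morphism_pullback[OF A_sub Q_sub q_morphism aA(1) H(2,3)] by (elim exE conjE) (rule that)
  note nzR = nz_mult[OF R1(1) F(2)]
  show ?thesis
  proof (intro exI conjI)
    show "\<forall>i. form (d' * d) (\<lambda>v. H i (\<lambda>j. F j v))" by (intro allI form_comp H(1)[rule_format] F(1)[rule_format])
    show "form (e1 + e2) (\<lambda>v. R1 v * R2 v)" by (rule form_mult[OF R1(1) F(2)])
    show "a \<in> nz (\<lambda>v. R1 v * R2 v)" unfolding nzR using R1(2) F(3) by blast
    show "\<forall>y\<in>A \<inter> nz (\<lambda>v. R1 v * R2 v). y \<in> AV \<and> (\<forall>v\<in>y. (\<lambda>i. H i (\<lambda>j. F j v)) \<in> \<Phi> y)"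
      unfolding nzR
    proof (intro ballI conjI)
      fix y assume y: "y \<in> A \<inter> (nz R1 \<inter> nz R2)"
      then show yV: "y \<in> AV" using R1(3) by blast
      have y2: "y \<in> A \<inter> nz R2" using y by blast
      fix v assume v: "v \<in> y"
      have "q y \<in> V \<inter> nz R3" using yV F(4)[rule_format, OF y2] unfolding AV_def by blast
      moreover have "(\<lambda>i. F i v) \<in> q y" using F(4)[rule_format, OF y2] v by blast
      ultimately show "(\<lambda>i. H i (\<lambda>j. F j v)) \<in> \<Phi> y" unfolding \<Phi>_def using H(4) by blast
    qed
  qed
qed

text \<open>An even basic open set is saturated, so q maps it to an open set; its image under \<Phi>
  is then, inside U, a preimage under \<rho>.\<close>

lemma Phi_open:
  assumes N: "form e N" "even_fun N" "A \<inter> nz N \<subseteq> AV"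
  shows "openin (zariski_on X) (\<Phi> ` (A \<inter> nz N))"
  unfolding openin_zariski_on
proof (intro conjI ballI)
  show "\<Phi> ` (A \<inter> nz N) \<subseteq> X" using Phi_X N(3) by blast
  fix x assume "x \<in> \<Phi> ` (A \<inter> nz N)"
  then obtain a where a: "a \<in> A" "a \<in> nz N" "a \<in> AV" "x = \<Phi> a" using N(3) by blast
  have xX: "x \<in> X" "x \<in> U" using Phi_X Phi_U a by auto
  obtain e1 R1 where R1: "form e1 R1" "x \<in> nz R1" "X \<inter> nz R1 \<subseteq> U"
    using U_open xX(2) unfolding openin_zariski_on by blast
  have "\<rho> x \<in> q ` (A \<inter> nz N)" using rho_Phi[OF a(3)] a by auto
  then obtain e3 R3 where R3: "form e3 R3" "\<rho> x \<in> nz R3" "Q \<inter> nz R3 \<subseteq> q ` (A \<inter> nz N)"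
    using q_open[OF N(1,2)] unfolding openin_zariski_on by blast
  obtain d F e2 R2 where F: "\<forall>i. form d (F i)" "form e2 R2" "x \<in> nz R2"
    "\<forall>y\<in>X \<inter> nz R2. \<rho> y \<in> nz R3 \<and> (\<forall>v\<in>y. (\<lambda>i. F i v) \<in> \<rho> y)"
    using morphism_pullback[OF X_sub Q_sub rho_morphism xX(1) R3(1,2)] by (elim exE conjE) (rule that)
  note nzR = nz_mult[OF R1(1) F(2)]
  have R: "form (e1 + e2) (\<lambda>v. R1 v * R2 v)" by (rule form_mult[OF R1(1) F(2)])
  have "x \<in> nz (\<lambda>v. R1 v * R2 v)" unfolding nzR using R1(2) F(3) by blast
  moreover have "X \<inter> nz (\<lambda>v. R1 v * R2 v) \<subseteq> \<Phi> ` (A \<inter> nz N)"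
    unfolding nzR
  proof
    fix y assume y: "y \<in> X \<inter> (nz R1 \<inter> nz R2)"
    then have yU: "y \<in> U" and y2: "y \<in> X \<inter> nz R2" using R1(3) by blast+
    have "\<rho> y \<in> Q \<inter> nz R3" using F(4)[rule_format, OF y2] rho_Q y by blast
    then obtain b where b: "b \<in> A \<inter> nz N" "\<rho> y = q b" using R3(3) by blast
    then have "y = \<Phi> b" unfolding \<Phi>_def using psi_rho[OF yU] by simp
    with b show "y \<in> \<Phi> ` (A \<inter> nz N)" by blast
  qed
  ultimately show "\<exists>d P. form d P \<and> x \<in> nz P \<and> X \<inter> nz P \<subseteq> \<Phi> ` (A \<inter> nz N)" using R by blast
qed

text \<open>The quotient p1/p2 is invariant, so it factors through q as some h. That h is regular is
  part of the definition of \<open>geometric_quotient\<close>, and h composed with \<rho> is the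
  required function.\<close>

lemma descent:
  assumes N: "form e N" "even_fun N" "A \<inter> nz N \<subseteq> AV"
    and p: "form d p1" "form d p2" "even_fun p1" "even_fun p2" "A \<inter> nz N \<subseteq> nz p2"
  shows "\<exists>c. (\<forall>x\<in>\<Phi> ` (A \<inter> nz N). regular_at X x c) \<and> (\<forall>a\<in>A \<inter> nz N. \<forall>v\<in>a. c (\<Phi> a) = p1 v / p2 v)"
proof -
  define W where "W = q ` (A \<inter> nz N)"
  have W_open: "openin (zariski_on Q) W" unfolding W_def by (rule q_open[OF N(1,2)])
  have W_sub: "W \<subseteq> Q" using W_open unfolding openin_zariski_on by blast
  have Wp: "W \<subseteq> pts" using W_sub Q_sub by blast
  define val where "val a = p1 (rep a) / p2 (rep a)" for a
  have val: "p2 v ~= 0 \<and> p1 v / p2 v = val a" if a: "a \<in> A \<inter> nz N" "v \<in> a" for a v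
  proof -
    have ap: "a \<in> pts" using a A_sub by blast
    have z: "p2 v ~= 0" using p(5) a nz_iff[OF p(2) ap a(2)] by blast
    have "v \<in> hline (rep a)" using rep(2)[OF ap] a(2) by simp
    then obtain c where c: "c ~= 0" "v = (\<lambda>i. c * rep a i)" using hline_memD by blast
    show ?thesis using z c(1) unfolding val_def c(2) form_scale[OF p(1)] form_scale[OF p(2)] by simp
  qed
  have val_sigma: "val (sc (- 1) ` a) = val a" if a: "a \<in> A \<inter> nz N" for a
  proof -
    have ap: "a \<in> pts" using a A_sub by blast
    obtain v where v: "v \<in> a" using ap pts_obtain by metis
    have "sc (- 1) ` a \<in> A \<inter> nz N" using a sigma_A sigma_nz[OF N(1,2)] by blast
    from val[OF this sigma_mem[OF v]] val[OF a v] show ?thesis using p(3,4) by (simp add: even_fun_def)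
  qed
  \<comment> \<open>Any preimage serves: by \<open>val_sigma\<close> the other one has the same
    value.\<close>
  define h where "h r = val (SOME a. a \<in> A \<inter> nz N \<and> q a = r)" for r
  have h: "h (q a) = val a" if a: "a \<in> A \<inter> nz N" for a
  proof -
    define b where "b = (SOME b. b \<in> A \<inter> nz N \<and> q b = q a)"
    have "b \<in> A \<inter> nz N \<and> q b = q a" unfolding b_def by (rule someI[of _ a]) (use a in blast)
    then have b: "b \<in> A" "q a = q b" by auto
    have "b = a \<or> b = sc (- 1) ` a" using q_fibre b a by blast
    then have "val b = val a" using val_sigma[OF a] by auto
    then show ?thesis unfolding h_def b_def .
  qed
  have AN: "A \<inter> nz N \<subseteq> pts" using A_sub by blast
  have "regular_on (A \<inter> nz N) (h \<circ> q)"
    unfolding regular_on_def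
  proof
    fix a assume a: "a \<in> A \<inter> nz N"
    have "\<forall>y\<in>(A \<inter> nz N) \<inter> nz N. quot p1 p2 (h \<circ> q) y" unfolding quot_def using val h by auto
    then show "regular_at (A \<inter> nz N) a (h \<circ> q)"
      unfolding regular_at_iff eventually_zariski[OF AN a] using p(1,2) N(1) a by blast
  qed
  then have reg: "regular_on W h" unfolding q_regular[OF W_open] unfolding W_def saturated[OF N(1,2)] .
  have "regular_at X x (h \<circ> \<rho>)" if x: "x \<in> \<Phi> ` (A \<inter> nz N)" for x
  proof -
    have xX: "x \<in> X" using x Phi_X N(3) by blast
    have rW: "\<rho> y \<in> W" if y: "y \<in> \<Phi> ` (A \<inter> nz N)" for y
    proof -
      obtain a where a: "a \<in> A \<inter> nz N" "y = \<Phi> a" using y by blast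
      then have "\<rho> y = q a" using rho_Phi N(3) by blast
      then show ?thesis using a unfolding W_def by blast
    qed
    obtain d1 F1 G1 where FG: "form d1 F1" "form d1 G1" "eventually (quot F1 G1 h) (nhdsin (zariski_on W) (\<rho> x))"
      using reg rW[OF x] unfolding regular_on_def regular_at_iff by blast
    then obtain e3 R3 where R3: "form e3 R3" "\<rho> x \<in> nz R3" "\<forall>y\<in>W \<inter> nz R3. quot F1 G1 h y"
      unfolding eventually_zariski[OF Wp rW[OF x]] by blast
    obtain d2 F e2 R2 where F: "\<forall>i. form d2 (F i)" "form e2 R2" "x \<in> nz R2"
      "\<forall>y\<in>X \<inter> nz R2. \<rho> y \<in> nz R3 \<and> (\<forall>v\<in>y. (\<lambda>i. F i v) \<in> \<rho> y)"
      using morphism_pullback[OF X_sub Q_sub rho_morphism xX R3(1,2)] by (elim exE conjE) (rule that)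
    obtain e1 R1 where R1: "form e1 R1" "x \<in> nz R1" "X \<inter> nz R1 \<subseteq> \<Phi> ` (A \<inter> nz N)"
      using Phi_open[OF N] x unfolding openin_zariski_on by blast
    define R where "R v = R1 v * R2 v" for v
    have R: "form (e1 + e2) R" unfolding R_def by (rule form_mult[OF R1(1) F(2)])
    have nzR: "nz R = nz R1 \<inter> nz R2" unfolding R_def by (rule nz_mult[OF R1(1) F(2)])
    have xR: "x \<in> nz R" unfolding nzR using R1(2) F(3) by blast
    have qq: "quot (\<lambda>v. F1 (\<lambda>i. F i v)) (\<lambda>v. G1 (\<lambda>i. F i v)) (h \<circ> \<rho>) y" if y: "y \<in> X \<inter> nz R" for y
    proof -
      have y2: "y \<in> X \<inter> nz R2" using y nzR by blast
      have "\<rho> y \<in> W \<inter> nz R3" using y R1(3) nzR F(4)[rule_format, OF y2] rW by blast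
      then have Q: "quot F1 G1 h (\<rho> y)" using R3(3) by blast
      show ?thesis unfolding quot_def
      proof
        fix v assume v: "v \<in> y"
        have "(\<lambda>i. F i v) \<in> \<rho> y" using F(4)[rule_format, OF y2] v by blast
        then show "G1 (\<lambda>i. F i v) ~= 0 \<and> (h \<circ> \<rho>) y = F1 (\<lambda>i. F i v) / G1 (\<lambda>i. F i v)" using Q unfolding quot_def by simp
      qed
    qed
    have ff: "form (d1 * d2) (\<lambda>v. F1 (\<lambda>i. F i v))" "form (d1 * d2) (\<lambda>v. G1 (\<lambda>i. F i v))"
      by (intro form_comp FG F(1)[rule_format])+
    show ?thesis unfolding regular_at_iff eventually_zariski[OF X_sub xX]
      by (rule exI[of _ "d1 * d2"], rule exI[of _ "\<lambda>v. F1 (\<lambda>i. F i v)"], rule exI[of _ "\<lambda>v. G1 (\<lambda>i. F i v)"],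
        intro conjI ff, rule exI[of _ "e1 + e2"], rule exI[of _ R], intro conjI ballI R xR qq)
  qed
  moreover have "(h \<circ> \<rho>) (\<Phi> a) = p1 v / p2 v" if a: "a \<in> A \<inter> nz N" "v \<in> a" for a v
  proof -
    have "\<rho> (\<Phi> a) = q a" using rho_Phi N(3) a(1) by blast
    then show ?thesis using h[OF a(1)] val[OF a] by simp
  qed
  ultimately show ?thesis by (intro exI[of _ "h \<circ> \<rho>"] conjI ballI)
qed

text \<open>Locally \<open>\<Phi>\<close> is given by even forms: multiply by the conjugate of a nonvanishing coordinate.\<close>

lemma even_chart:
  assumes P0: "form d0 P0" "A \<inter> nz P0 ~= {}"
  shows "\<exists>e N D G. form e N \<and> even_fun N \<and> A \<inter> nz N ~= {} \<and> A \<inter> nz N \<subseteq> AV \<and> A \<inter> nz N \<subseteq> nz P0 \<and>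
     (\<forall>i. form D (G i)) \<and> (\<forall>y\<in>A \<inter> nz N. \<forall>v\<in>y. (\<lambda>i. G i v) \<in> \<Phi> y \<and> (\<forall>i. G i (sc (- 1) v) = G i v))"
proof -
  obtain a1 where "a1 \<in> AV" using AV_ne by blast
  then obtain e1 R1 where R1: "form e1 R1" "a1 \<in> nz R1" "A \<inter> nz R1 \<subseteq> AV" "a1 \<in> A"
    using AV_open unfolding openin_zariski_on by blast
  have irr: "A \<inter> nz P \<inter> nz R ~= {}" if "form d P" "form e R" "A \<inter> nz P ~= {}" "A \<inter> nz R ~= {}" for d P e R
    using K1.A_irreducible that unfolding zariski_irreducible_iff[OF A_sub] by blast
  have "A \<inter> nz R1 \<inter> nz P0 ~= {}" using irr[OF R1(1) P0(1)] R1 P0(2) by blast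
  then obtain a where a: "a \<in> AV" "a \<in> nz P0" "a \<in> A" using R1(3) by blast
  obtain D F e2 R where F: "\<forall>i. form D (F i)" "form e2 R" "a \<in> nz R"
    "\<forall>y\<in>A \<inter> nz R. y \<in> AV \<and> (\<forall>v\<in>y. (\<lambda>i. F i v) \<in> \<Phi> y)" using Phi_local[OF a(1)] by (elim exE conjE) (rule that)
  have ap: "a \<in> pts" using a A_sub by blast
  obtain v0 where v0: "v0 \<in> a" using ap pts_obtain by metis
  have "(\<lambda>i. F i v0) \<in> \<Phi> a" using F(3,4) a(3) v0 by blast
  moreover have "\<Phi> a \<in> pts" using Phi_X a(1) X_sub by blast
  ultimately have "(\<lambda>i. F i v0) ~= (\<lambda>_. 0)" using pts_cases by blast
  then obtain j where j: "F j v0 ~= 0" by auto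
  have Fj: "form D (F j)" using F(1) by blast
  define N0 where "N0 v = P0 v * (R v * F j v)" for v
  have N0: "form (d0 + (e2 + D)) N0" unfolding N0_def by (intro form_mult P0(1) F(2) Fj)
  have nzN0: "nz N0 = nz P0 \<inter> (nz R \<inter> nz (F j))"
    unfolding N0_def by (simp add: nz_mult[OF P0(1) form_mult[OF F(2) Fj]] nz_mult[OF F(2) Fj])
  have aN0: "a \<in> nz N0" unfolding nzN0 using a(2) F(3) nz_iff[OF Fj ap v0] j by blast
  define N1 where "N1 v = N0 (sc (- 1) v)" for v
  have N1: "form (d0 + (e2 + D)) N1" unfolding N1_def by (rule form_sc_neg[OF N0])
  have N1_iff: "y \<in> nz N1 \<longleftrightarrow> sc (- 1) ` y \<in> nz N0" if y: "y \<in> A" for y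
    by (rule sc_nz[OF N0 N1 N1_def[symmetric]]) (use y sigma_A A_sub in blast)+
  have inv: "sc (- 1) ` (sc (- 1) ` y) = y" for y :: "'k alg_closure ppoint" unfolding image_image by simp
  have "sc (- 1) ` a \<in> A \<inter> nz N1" using N1_iff[OF sigma_A[OF a(3)]] sigma_A[OF a(3)] aN0 unfolding inv by blast
  then have ne: "A \<inter> nz N0 \<inter> nz N1 ~= {}" using irr[OF N0 N1] a(3) aN0 by blast
  define N where "N v = N0 v * N0 (sc (- 1) v)" for v
  have N_eq: "N = (\<lambda>v. N0 v * N1 v)" by (simp add: N_def N1_def fun_eq_iff)
  have N: "form (d0 + (e2 + D) + (d0 + (e2 + D))) N" unfolding N_eq by (rule form_mult[OF N0 N1])
  have nzN: "nz N = nz N0 \<inter> nz N1" unfolding N_eq by (rule nz_mult[OF N0 N1])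
  \<comment> \<open>By invariance of \<Phi>, conjugation multiplies the vector of all F i by one
    scalar c; hence G i takes the value c F i F j both at v and at its conjugate.\<close>
  define G where "G i v = F i v * F j (sc (- 1) v)" for i v
  have G: "form (D + D) (G i)" for i
    unfolding G_def using form_mult[of D "F i" D "\<lambda>v. F j (sc (- 1) v)"] F(1) form_sc_neg[OF Fj] by simp
  have main: "(\<lambda>i. G i v) \<in> \<Phi> y \<and> (\<forall>i. G i (sc (- 1) v) = G i v)" if y: "y \<in> A \<inter> nz N" "v \<in> y" for y v
  proof -
    have yA: "y \<in> A" using y by blast
    have y0: "y \<in> nz N0" "sc (- 1) ` y \<in> nz N0" using y nzN N1_iff by auto
    have m1: "(\<lambda>i. F i v) \<in> \<Phi> y" "y \<in> AV" using F(4) y0(1) y nzN0 yA by auto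
    have m2: "(\<lambda>i. F i (sc (- 1) v)) \<in> \<Phi> y"
      using F(4) y0(2) nzN0 sigma_A[OF yA] sigma_mem[OF y(2)] Phi_sigma[OF yA] by (metis IntD1 IntD2 IntI)
    have "\<Phi> y \<in> pts" using Phi_X[OF m1(2)] X_sub by blast
    then have hl: "\<Phi> y = hline (\<lambda>i. F i v)" using pts_cases m1(1) by blast
    obtain c where c: "c ~= 0" "(\<lambda>i. F i (sc (- 1) v)) = (\<lambda>i. c * F i v)" using hline_memD m2 unfolding hl by blast
    have ci: "F i (sc (- 1) v) = c * F i v" for i using fun_cong[OF c(2)] .
    have sp: "sc (- 1) ` y \<in> pts" using sigma_A[OF yA] A_sub by blast
    have nz: "F j (sc (- 1) v) ~= 0" using y0(2) nzN0 nz_iff[OF Fj sp sigma_mem[OF y(2)]] by blast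
    have "(\<lambda>i. F j (sc (- 1) v) * F i v) \<in> hline (\<lambda>i. F i v)" unfolding hline_def using nz by blast
    then have "(\<lambda>i. G i v) \<in> \<Phi> y" unfolding hl G_def by (simp add: mult.commute)
    moreover have "G i (sc (- 1) v) = G i v" for i unfolding G_def using ci by (simp add: mult_ac)
    ultimately show ?thesis by blast
  qed
  have s1: "A \<inter> nz N \<subseteq> AV" using F(4) unfolding nzN nzN0 by auto
  have s2: "A \<inter> nz N \<subseteq> nz P0" unfolding nzN nzN0 by blast
  have s3: "A \<inter> nz N ~= {}" unfolding nzN using ne by blast
  have s4: "even_fun N" unfolding N_def by (rule even_fun_prod)
  show ?thesis
  proof (intro exI conjI)
    show "form (d0 + (e2 + D) + (d0 + (e2 + D))) N" by (rule N)
    show "\<forall>i. form (D + D) (G i)" by (intro allI G)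
    show "\<forall>y\<in>A \<inter> nz N. \<forall>v\<in>y. (\<lambda>i. G i v) \<in> \<Phi> y \<and> (\<forall>i. G i (sc (- 1) v) = G i v)"
      by (intro ballI main)
  qed (rule s4 s3 s1 s2)+
qed

end

lemma morphism_rational:
  assumes Y: "Y \<subseteq> pts" and m: "morphism Y X \<phi>" and b: "b \<in> rational_points Y"
  shows "\<phi> b \<in> rational_points X"
proof -
  obtain v where v: "b \<in> Y" "v \<in> b" "\<forall>i. v i \<in> range to_ac" using b unfolding rational_points_def by blast
  obtain d F e R where F: "\<forall>i. form d (F i)" "form e R" "b \<in> nz R" "\<forall>y\<in>Y \<inter> nz R. \<forall>v\<in>y. (\<lambda>i. F i v) \<in> \<phi> y"
    using morphism_local[OF Y m v(1)] by (elim exE conjE) (rule that)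
  have Fv: "(\<lambda>i. F i v) \<in> \<phi> b" using F(3,4) v(1,2) by blast
  have "F i v \<in> range to_ac" for i by (rule form_rational[OF F(1)[rule_format]]) (use v(3) in blast)
  moreover have "\<phi> b \<in> X" using m[unfolded morphism_def, THEN conjunct1] by (rule subsetD) (rule imageI[OF v(1)])
  ultimately show ?thesis unfolding rational_points_def using Fv by (intro CollectI conjI bexI[of _ "\<lambda>i. F i v"]) auto
qed

lemma rep_ratio: "y \<in> pts ==> v \<in> y ==> rep y i / rep y j = v i / v j"
proof -
  assume y: "y \<in> pts" "v \<in> y"
  have "v \<in> hline (rep y)" using rep(2)[OF y(1)] y(2) by simp
  then obtain c where c: "c ~= 0" "v = (\<lambda>i. c * rep y i)" using hline_memD by blast
  then show ?thesis by simp
qed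

lemma sc_encode: "sc r z (prod_encode (i, j)) = (if i = 3 then r else 1) * (if j = 3 then r else 1) * z (prod_encode (i, j))"
  by (simp add: sc_def)

text \<open>On affine points normalized as in \<open>coords\<close>, the Segre coordinates
  \<open>i00\<close>, \<open>i30\<close>, \<open>i33\<close> are 1, y and y s.\<close>

abbreviation "i00 \<equiv> prod_encode (0, 0)"
abbreviation "i30 \<equiv> prod_encode (3, 0)"
abbreviation "i33 \<equiv> prod_encode (3, 3)"

section \<open>The double covers of the surface by products of twists\<close>

locale kummer_chart = kummer +
  fixes e D :: nat and N :: "(nat => 'a alg_closure) => 'a alg_closure" and G
  assumes N_form: "form e N" and N_even: "even_fun N" and N_ne: "A \<inter> nz N ~= {}" and N_AV: "A \<inter> nz N \<subseteq> AV"
    and N_00: "A \<inter> nz N \<subseteq> nz (\<lambda>z. z i00)" and N_30: "A \<inter> nz N \<subseteq> nz (\<lambda>z. z i30)" and N_33: "A \<inter> nz N \<subseteq> nz (\<lambda>z. z i33)"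
    and G_form: "!!i. form D (G i)"
    and G_chart: "!!y v. y \<in> A \<inter> nz N ==> v \<in> y ==> (\<lambda>i. G i v) \<in> \<Phi> y \<and> (\<forall>i. G i (sc (- 1) v) = G i v)"
begin

lemma pair: "C ~= 0 ==> curve_pair g f C"
  using K1.E1.genus_one_axioms K1.E2.genus_one_axioms unfolding genus_one_def curve_pair_def by simp

definition XN where "XN = \<Phi> ` (A \<inter> nz N)"

lemma XN_open: "openin (zariski_on X) XN" unfolding XN_def by (rule Phi_open[OF N_form N_even N_AV])
lemma XN_ne: "XN ~= {}" unfolding XN_def using N_ne by blast
lemma XN_sub: "XN \<subseteq> X" using XN_open unfolding openin_zariski_on by blast

lemma XN_meets: "form d P ==> X \<inter> nz P ~= {} ==> XN \<inter> nz P ~= {}"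
proof -
  assume P: "form d P" "X \<inter> nz P ~= {}"
  obtain x where "x \<in> XN" using XN_ne by blast
  then obtain e1 R where R: "form e1 R" "x \<in> nz R" "X \<inter> nz R \<subseteq> XN" using XN_open unfolding openin_zariski_on by blast
  have "x \<in> X" using \<open>x \<in> XN\<close> XN_sub by blast
  then have "X \<inter> nz R \<inter> nz P ~= {}"
    using X_irr P R unfolding zariski_irreducible_iff[OF X_sub] by blast
  then show ?thesis using R(3) by blast
qed

definition AC where "AC C = product_variety (twisted_curve g C) (twisted_curve f C)"
text \<open>Either square root gives the same \<open>cov\<close>, since they differ by the
  involution.\<close>

definition rt :: "'a => 'a alg_closure" where "rt C = (SOME \<gamma>. \<gamma> ^ 2 = to_ac C)"
definition tw where "tw C b = sc (rt C) ` b"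
definition UC where "UC C = {b \<in> AC C. tw C b \<in> nz N}"
definition cov where "cov C b = \<Phi> (tw C b)"

context
  fixes C :: 'a
  assumes C: "C ~= 0"
begin

interpretation P: curve_pair g f C by (rule pair[OF C])

lemma rt: "rt C ^ 2 = to_ac C" "rt C ~= 0" "inverse (rt C) ^ 2 = to_ac (inverse C)"
proof -
  show r: "rt C ^ 2 = to_ac C" unfolding rt_def using someI_ex[OF ex_sqrt] .
  then show "rt C ~= 0" using C by auto
  show "inverse (rt C) ^ 2 = to_ac (inverse C)" by (simp add: power_inverse r)
qed

lemma AC_sub: "AC C \<subseteq> pts" unfolding AC_def by (rule P.A_sub)

lemma tw_A: "b \<in> AC C ==> tw C b \<in> A"
  unfolding AC_def tw_def by (rule twist_A[OF _ pair[OF C] K1.curve_pair_axioms]) (simp_all add: rt)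

lemma untw_AC: "a \<in> A ==> sc (inverse (rt C)) ` a \<in> AC C"
  unfolding AC_def by (rule twist_A[OF _ K1.curve_pair_axioms pair[OF C]]) (simp_all add: rt C flip: to_ac_mult)

lemma tw_untw: "tw C (sc (inverse (rt C)) ` a) = a" unfolding tw_def image_image using rt(2) by simp
lemma untw_tw: "sc (inverse (rt C)) ` tw C a = a" unfolding tw_def image_image using rt(2) by simp

lemma tw_mem: "v \<in> b ==> sc (rt C) v \<in> tw C b" unfolding tw_def by blast

lemma tw_nz:
  assumes "form d P" "form d' P'" "!!z. P (sc (rt C) z) = P' z" "b \<in> AC C"
  shows "b \<in> nz P' \<longleftrightarrow> tw C b \<in> nz P"
  unfolding tw_def by (rule sc_nz[OF assms(1-3)]) (use assms(4) AC_sub tw_A A_sub in \<open>auto simp flip: tw_def\<close>)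

text \<open>The map \<open>tw\<close> is not defined over k, but the even form N pulls back along it
  to a form over k.\<close>

lemma UC_form: "\<exists>N'. form e N' \<and> even_fun N' \<and> UC C = AC C \<inter> nz N'"
proof -
  obtain N' where N': "form e N'" "even_fun N'" "\<forall>\<gamma> z. \<gamma> ^ 2 = to_ac C --> N (sc \<gamma> z) = N' z"
    using form_twist_even[OF N_form N_even C] by blast
  have "UC C = AC C \<inter> nz N'"
    unfolding UC_def using tw_nz[OF N_form N'(1)] N'(3) rt(1) by blast
  with N' show ?thesis by blast
qed

lemma UC_open: "openin (zariski_on (AC C)) (UC C)"
  using UC_form openin_nz by metis

lemma UC_sub: "UC C \<subseteq> AC C" unfolding UC_def by blast

lemma tw_UC: "b \<in> UC C ==> tw C b \<in> A \<inter> nz N" unfolding UC_def using tw_A by blast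

text \<open>Over the algebraic closure every twisted product is the original one, so the image does
  not depend on C.\<close>

lemma cov_image: "cov C ` UC C = XN"
proof (intro equalityI subsetI)
  fix x assume "x \<in> cov C ` UC C"
  then show "x \<in> XN" unfolding XN_def cov_def using tw_UC by blast
next
  fix x assume "x \<in> XN"
  then obtain a where a: "a \<in> A" "a \<in> nz N" "x = \<Phi> a" unfolding XN_def by blast
  have "sc (inverse (rt C)) ` a \<in> UC C" unfolding UC_def using untw_AC[of a] a tw_untw[of a] by simp
  moreover have "x = cov C (sc (inverse (rt C)) ` a)" unfolding cov_def tw_untw by (rule a(3))
  ultimately show "x \<in> cov C ` UC C" by blast
qed

lemma UC_ne: "UC C ~= {}" using cov_image XN_ne by blast

text \<open>At the points of the chart G is even, so the sign of \<open>rt C\<close> does not matter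
  and the term of \<open>form_twist\<close> linear in it vanishes. What remains is a formula over
  k.\<close>

lemma cov_morphism: "morphism (UC C) X (cov C)"
proof -
  have sub: "UC C \<subseteq> pts" using UC_sub AC_sub by blast
  have "\<forall>i. \<exists>G1. form D G1 \<and> (\<exists>G2. \<forall>\<gamma> z. \<gamma> ^ 2 = to_ac C --> G i (sc \<gamma> z) = G1 z + \<gamma> * G2 z)"
    using form_twist[OF G_form] by blast
  from choice[OF this] obtain G1 where G1: "\<forall>i. form D (G1 i) \<and> (\<exists>G2. \<forall>\<gamma> z. \<gamma> ^ 2 = to_ac C --> G i (sc \<gamma> z) = G1 i z + \<gamma> * G2 z)" ..
  obtain N' where N': "form e N'" "UC C = AC C \<inter> nz N'" using UC_form by blast
  have key: "(\<lambda>i. G1 i v) \<in> cov C y" if y: "y \<in> UC C" "v \<in> y" for y v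
  proof -
    have m: "(\<lambda>i. G i (sc (rt C) v)) \<in> \<Phi> (tw C y)" and ev: "!!i. G i (sc (- 1) (sc (rt C) v)) = G i (sc (rt C) v)"
      using G_chart[OF tw_UC[OF y(1)] tw_mem[OF y(2)]] by blast+
    have "G1 i v = G i (sc (rt C) v)" for i
    proof -
      obtain G2 where G2: "\<forall>\<gamma> z. \<gamma> ^ 2 = to_ac C --> G i (sc \<gamma> z) = G1 i z + \<gamma> * G2 z" using G1 by blast
      have "(- rt C) ^ 2 = to_ac C" using rt(1) by simp
      then have "G i (sc (- rt C) v) = G1 i v + - rt C * G2 v" using G2 by blast
      moreover have "G i (sc (rt C) v) = G1 i v + rt C * G2 v" using G2 rt(1) by blast
      moreover have "G i (sc (- rt C) v) = G i (sc (rt C) v)" using ev[of i] by simp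
      ultimately have "2 * (rt C * G2 v) = 0" "G i (sc (rt C) v) = G1 i v + rt C * G2 v" by (simp_all add: algebra_simps)
      then show ?thesis by simp
    qed
    then have "(\<lambda>i. G1 i v) = (\<lambda>i. G i (sc (rt C) v))" by blast
    with m show ?thesis unfolding cov_def by simp
  qed
  show ?thesis
    unfolding morphism_iff[OF sub]
  proof (intro conjI ballI)
    show "cov C ` UC C \<subseteq> X" unfolding cov_image by (rule XN_sub)
    fix b assume b: "b \<in> UC C"
    show "\<exists>d F e R. (\<forall>i. form d (F i)) \<and> form e R \<and> b \<in> nz R \<and> (\<forall>y\<in>UC C \<inter> nz R. \<forall>v\<in>y. (\<lambda>i. F i v) \<in> cov C y)"
    proof (rule exI, rule exI, rule exI, rule exI, intro conjI ballI)
      show "\<forall>i. form D (G1 i)" using G1 by blast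
      show "form e N'" by (rule N')
      show "b \<in> nz N'" using b N'(2) by blast
      fix y v assume "y \<in> UC C \<inter> nz N'" "v \<in> y"
      then show "(\<lambda>i. G1 i v) \<in> cov C y" using key by blast
    qed
  qed
qed

lemma cov_dominant: "dominant_rational_map (AC C) X (UC C) (cov C)"
  unfolding dominant_rational_map_def cov_image
proof (intro conjI UC_open UC_ne cov_morphism)
  show "zariski_dense_in X XN"
    unfolding zariski_dense_iff[OF X_sub XN_sub] using XN_meets by blast
qed

lemma AC_integral: "integral_variety (AC C)" unfolding AC_def by (rule P.A_integral)

lemma AC_irr: "form d P ==> form d' R ==> AC C \<inter> nz P ~= {} ==> AC C \<inter> nz R ~= {} ==> AC C \<inter> nz P \<inter> nz R ~= {}"
  using P.A_irreducible unfolding AC_def[symmetric] zariski_irreducible_iff[OF AC_sub] by blast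

lemma sigma_AC: "b \<in> AC C ==> sc (- 1) ` b \<in> AC C"
  unfolding AC_def by (rule twist_A[OF _ pair[OF C] pair[OF C]]) simp_all

lemma sigma_nz_AC:
  assumes "form d P" "form d' P'" "!!z. P (sc (- 1) z) = P' z" "b \<in> AC C"
  shows "b \<in> nz P' \<longleftrightarrow> sc (- 1) ` b \<in> nz P"
  by (rule sc_nz[OF assms(1-3)]) (use assms(4) AC_sub sigma_AC in blast)+

lemma tw_sigma: "tw C (sc (- 1) ` b) = sc (- 1) ` tw C b"
  unfolding tw_def image_image by simp

lemma cov_sigma: "b \<in> AC C ==> cov C (sc (- 1) ` b) = cov C b"
  unfolding cov_def tw_sigma by (rule Phi_sigma[OF tw_A])

text \<open>A form times its conjugate is even, and irreducibility keeps the product from vanishing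
  everywhere.\<close>

lemma even_shrink:
  assumes P: "form d P" "AC C \<inter> nz P ~= {}"
  shows "\<exists>e0 N0. form e0 N0 \<and> even_fun N0 \<and> AC C \<inter> nz N0 ~= {} \<and> AC C \<inter> nz N0 \<subseteq> nz P \<and> AC C \<inter> nz N0 \<subseteq> UC C"
proof -
  obtain N' where N': "form e N'" "UC C = AC C \<inter> nz N'" using UC_form by blast
  define N1 where "N1 v = P v * N' v" for v
  have N1: "form (d + e) N1" unfolding N1_def by (rule form_mult[OF P(1) N'(1)])
  have nzN1: "nz N1 = nz P \<inter> nz N'" unfolding N1_def by (rule nz_mult[OF P(1) N'(1)])
  have "AC C \<inter> nz P \<inter> nz N' ~= {}" by (rule AC_irr[OF P(1) N'(1) P(2)]) (use UC_ne N'(2) in simp)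
  then obtain b where b: "b \<in> AC C" "b \<in> nz N1" unfolding nzN1 by blast
  define N2 where "N2 v = N1 (sc (- 1) v)" for v
  have N2: "form (d + e) N2" unfolding N2_def by (rule form_sc_neg[OF N1])
  have "sc (- 1) ` (sc (- 1) ` b) = b" unfolding image_image by simp
  then have "sc (- 1) ` b \<in> nz N2" using sigma_nz_AC[OF N1 N2 N2_def[symmetric] sigma_AC[OF b(1)]] b(2) by simp
  then have "AC C \<inter> nz N1 \<inter> nz N2 ~= {}" by (intro AC_irr[OF N1 N2]) (use b sigma_AC in blast)+
  then have ne: "AC C \<inter> nz (\<lambda>v. N1 v * N2 v) ~= {}" unfolding nz_mult[OF N1 N2] by blast
  show ?thesis
  proof (intro exI conjI)
    show "form (d + e + (d + e)) (\<lambda>v. N1 v * N2 v)" by (rule form_mult[OF N1 N2])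
    show "even_fun (\<lambda>v. N1 v * N2 v)" unfolding N2_def by (rule even_fun_prod)
    show "AC C \<inter> nz (\<lambda>v. N1 v * N2 v) ~= {}" by (rule ne)
  qed (unfold nz_mult[OF N1 N2] nzN1 N'(2), blast+)
qed

text \<open>The inverse of \<open>tw C\<close> is the twist by 1/C, so
  \<open>form_twist_even\<close> applies in this direction.\<close>

lemma even_push:
  assumes N0: "form e0 N0" "even_fun N0"
  shows "\<exists>n0. form e0 n0 \<and> even_fun n0 \<and> (\<forall>z. n0 (sc (rt C) z) = N0 z)"
proof -
  have "inverse C ~= 0" using C by simp
  from form_twist_even[OF N0 this] obtain n0 where n0: "form e0 n0" "even_fun n0" "\<forall>\<gamma> z. \<gamma> ^ 2 = to_ac (inverse C) --> N0 (sc \<gamma> z) = n0 z"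
    by blast
  have "n0 (sc (rt C) z) = N0 z" for z
  proof -
    have "n0 (sc (rt C) z) = N0 (sc (inverse (rt C)) (sc (rt C) z))" using n0(3) rt(3) by metis
    then show ?thesis using rt(2) by simp
  qed
  with n0 show ?thesis by blast
qed

lemma push_image:
  assumes n0: "form e0 n0" "form e0 N0" "!!z. n0 (sc (rt C) z) = N0 z" and U: "AC C \<inter> nz N0 \<subseteq> UC C"
  shows "cov C ` (AC C \<inter> nz N0) = \<Phi> ` (A \<inter> nz n0)" "A \<inter> nz n0 \<subseteq> AV" "tw C ` (AC C \<inter> nz N0) = A \<inter> nz n0"
proof -
  show t: "tw C ` (AC C \<inter> nz N0) = A \<inter> nz n0"
  proof (intro equalityI subsetI)
    fix a assume "a \<in> tw C ` (AC C \<inter> nz N0)"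
    then show "a \<in> A \<inter> nz n0" using tw_A tw_nz[OF n0] by blast
  next
    fix a assume a: "a \<in> A \<inter> nz n0"
    have b: "sc (inverse (rt C)) ` a \<in> AC C" using a untw_AC by blast
    have "sc (inverse (rt C)) ` a \<in> nz N0" unfolding tw_nz[OF n0 b] tw_untw using a by blast
    then show "a \<in> tw C ` (AC C \<inter> nz N0)" using b tw_untw by (metis IntI image_eqI)
  qed
  show "cov C ` (AC C \<inter> nz N0) = \<Phi> ` (A \<inter> nz n0)" unfolding t[symmetric] image_image cov_def ..
  show "A \<inter> nz n0 \<subseteq> AV" unfolding t[symmetric] using U tw_UC N_AV by blast
qed

text \<open>Even forms are moved from the twist to the original product by \<open>even_push\<close>,
  where \<open>descent\<close> is available.\<close>

lemma descent_AC:
  assumes N0: "form e0 N0" "even_fun N0" "AC C \<inter> nz N0 ~= {}" "AC C \<inter> nz N0 \<subseteq> UC C"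
    and P: "form d P1" "form d P2" "even_fun P1" "even_fun P2" "AC C \<inter> nz N0 \<subseteq> nz P2"
  shows "\<exists>c. rational_function X c \<and> (\<forall>b\<in>AC C \<inter> nz N0. \<forall>v\<in>b. c (cov C b) = P1 v / P2 v)"
proof -
  obtain n0 where n0: "form e0 n0" "even_fun n0" "\<forall>z. n0 (sc (rt C) z) = N0 z" using even_push[OF N0(1,2)] by blast
  obtain p1 where p1: "form d p1" "even_fun p1" "\<forall>z. p1 (sc (rt C) z) = P1 z" using even_push[OF P(1,3)] by blast
  obtain p2 where p2: "form d p2" "even_fun p2" "\<forall>z. p2 (sc (rt C) z) = P2 z" using even_push[OF P(2,4)] by blast
  note im = push_image[OF n0(1) N0(1) n0(3)[rule_format] N0(4)]
  have sub: "A \<inter> nz n0 \<subseteq> nz p2"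
    unfolding im(3)[symmetric] using P(5) tw_nz[OF p2(1) P(2) p2(3)[rule_format]] by blast
  obtain c where c: "\<forall>x\<in>\<Phi> ` (A \<inter> nz n0). regular_at X x c" "\<forall>a\<in>A \<inter> nz n0. \<forall>v\<in>a. c (\<Phi> a) = p1 v / p2 v"
    using descent[OF n0(1,2) im(2) p1(1) p2(1) p1(2) p2(2) sub] by blast
  obtain b where "b \<in> AC C \<inter> nz N0" using N0(3) by blast
  then have x: "cov C b \<in> \<Phi> ` (A \<inter> nz n0)" unfolding im(1)[symmetric] by (rule imageI)
  then obtain a where a: "cov C b = \<Phi> a" "a \<in> A \<inter> nz n0" by (rule imageE)
  have "cov C b \<in> X" unfolding a(1) by (rule Phi_X[OF subsetD[OF im(2) a(2)]])
  then have "rational_function X c" by (rule XX.regular_imp_rational_function[OF _ c(1)[rule_format, OF x]])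
  moreover have "c (cov C b) = P1 v / P2 v" if b: "b \<in> AC C \<inter> nz N0" "v \<in> b" for b v
  proof -
    have tA: "tw C b \<in> A \<inter> nz n0" unfolding im(3)[symmetric] by (rule imageI[OF b(1)])
    have "c (cov C b) = p1 (sc (rt C) v) / p2 (sc (rt C) v)"
      unfolding cov_def by (rule c(2)[rule_format, OF tA tw_mem[OF b(2)]])
    then show ?thesis using p1(3) p2(3) by simp
  qed
  ultimately show ?thesis by blast
qed

lemma UC_coords:
  assumes b: "b \<in> UC C" "v \<in> b"
  shows "v i00 ~= 0" "v i30 ~= 0"
proof -
  have a: "tw C b \<in> A \<inter> nz N" by (rule tw_UC[OF b(1)])
  then have p: "tw C b \<in> pts" by (rule subsetD[OF A_sub IntD1])
  have "tw C b \<in> nz (\<lambda>z. z i00)" by (rule subsetD[OF N_00 a])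
  then show "v i00 ~= 0" unfolding nz_iff[OF form_coord p tw_mem[OF b(2)]] by (simp add: sc_encode)
  have "tw C b \<in> nz (\<lambda>z. z i30)" by (rule subsetD[OF N_30 a])
  then show "v i30 ~= 0" unfolding nz_iff[OF form_coord p tw_mem[OF b(2)]] by (simp add: sc_encode)
qed

text \<open>The basis 1, y of the function field of the cover over that of the surface; y is odd
  under the involution.\<close>

definition bas :: "nat => 'a alg_closure ppoint => 'a alg_closure" where
  "bas j y = (if j = 0 then 1 else rep y i30 / rep y i00)"

lemma bas_eq: "b \<in> AC C ==> v \<in> b ==> bas j b = (if j = 0 then 1 else v i30 / v i00)"
  unfolding bas_def using rep_ratio[of b v i30 i00] AC_sub by auto

lemma bas_rational: "rational_function (AC C) (bas j)"
proof -
  obtain N' where N': "form e N'" "UC C = AC C \<inter> nz N'" using UC_form by blast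
  have "\<forall>y\<in>AC C \<inter> nz N'. quot (\<lambda>v. v (if j = 0 then i00 else i30)) (\<lambda>v. v i00) (bas j) y"
    unfolding quot_def using UC_coords(1) bas_eq N'(2) by auto
  then have "generically (AC C) (quot (\<lambda>v. v (if j = 0 then i00 else i30)) (\<lambda>v. v i00) (bas j))"
    unfolding generically_iff using N' UC_ne by blast
  then show ?thesis unfolding rational_function_iff using form_coord by blast
qed

text \<open>A function is split into its even and odd parts under the involution. The even part
  descends, and the odd part is y times an even function.\<close>

lemma bas_span:
  assumes h: "rational_function (AC C) h"
  shows "\<exists>c. (\<forall>j<2. rational_function X (c j)) \<and> generically (AC C) (\<lambda>y. h y = (\<Sum>j<2::nat. c j (cov C y) * bas j y))"
proof -
  obtain d F H where FH: "form d F" "form d H" "generically (AC C) (quot F H h)"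
    using h unfolding rational_function_iff by blast
  obtain d1 P1 where P1: "form d1 P1" "AC C \<inter> nz P1 ~= {}" "\<forall>y\<in>AC C \<inter> nz P1. quot F H h y"
    using FH(3) unfolding generically_iff by blast
  obtain e0 N0 where N0: "form e0 N0" "even_fun N0" "AC C \<inter> nz N0 ~= {}" "AC C \<inter> nz N0 \<subseteq> nz P1" "AC C \<inter> nz N0 \<subseteq> UC C"
    using even_shrink[OF P1(1,2)] by blast
  define Hs where "Hs v = H (sc (- 1) v)" for v
  define Fs where "Fs v = F (sc (- 1) v)" for v
  have s: "form d Hs" "form d Fs" unfolding Hs_def Fs_def by (rule form_sc_neg[OF FH(2)], rule form_sc_neg[OF FH(1)])
  \<comment> \<open>h = F/H equals (E + B)/(2 H Hs), with E even and B odd.\<close>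
  define den where "den v = to_ac 2 * (H v * Hs v)" for v
  define E where "E v = F v * Hs v + Fs v * H v" for v
  define B where "B v = F v * Hs v - Fs v * H v" for v
  have f: "form (d + d) den" "form (d + d) E" "form (d + d) B" unfolding den_def E_def B_def
    by (rule form_cmult[OF form_mult[OF FH(2) s(1)]], rule form_add[OF form_mult[OF FH(1) s(1)] form_mult[OF s(2) FH(2)]],
      rule form_diff[OF form_mult[OF FH(1) s(1)] form_mult[OF s(2) FH(2)]])
  have m1: "sc (- 1) (sc (- 1) z) = z" for z :: "nat => 'a alg_closure" by simp
  have sw: "Hs (sc (- 1) v) = H v" "Fs (sc (- 1) v) = F v" "H (sc (- 1) v) = Hs v" "F (sc (- 1) v) = Fs v" for v
    unfolding Hs_def Fs_def m1 by (rule refl)+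
  have ev: "even_fun den" "even_fun E" unfolding even_fun_def den_def E_def sw by (simp_all add: mult_ac add_ac)
  have B_odd: "B (sc (- 1) v) = - B v" for v unfolding B_def sw by simp
  \<comment> \<open>\<open>B1\<close>/\<open>den1\<close> is the odd part divided by y, arranged as
    a quotient of two even forms of equal degree.\<close>
  define B1 where "B1 v = B v * (v i00 * v i30)" for v
  define den1 where "den1 v = den v * (v i30 * v i30)" for v
  have f1: "form (d + d + (1 + 1)) B1" "form (d + d + (1 + 1)) den1" unfolding B1_def den1_def
    by (rule form_mult[OF f(3) form_mult[OF form_coord form_coord]], rule form_mult[OF f(1) form_mult[OF form_coord form_coord]])
  have ev1: "even_fun B1" "even_fun den1"
    using ev(1) unfolding even_fun_def B1_def den1_def B_odd by (simp_all add: sc_encode)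
  have Hnz: "H v ~= 0 \<and> h b = F v / H v" if "b \<in> AC C \<inter> nz N0" "v \<in> b" for b v
    using P1(3) N0(4) that unfolding quot_def by blast
  have sN0: "sc (- 1) ` b \<in> AC C \<inter> nz N0" if b: "b \<in> AC C \<inter> nz N0" for b
  proof -
    have "N0 (sc (- 1) z) = N0 z" for z by (rule N0(2)[unfolded even_fun_def, rule_format])
    from sigma_nz_AC[OF N0(1) N0(1) this] show ?thesis using b sigma_AC by blast
  qed
  have Hs_nz: "Hs v ~= 0" if "b \<in> AC C \<inter> nz N0" "v \<in> b" for b v
    unfolding Hs_def using Hnz[OF sN0[OF that(1)] imageI[OF that(2)]] by blast
  have den_nz: "den v ~= 0" if "b \<in> AC C \<inter> nz N0" "v \<in> b" for b v
    unfolding den_def using Hnz[OF that] Hs_nz[OF that] by simp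
  have ptv: "\<exists>v. v \<in> b \<and> b \<in> pts" if b: "b \<in> AC C" for b
  proof -
    have "b \<in> pts" using b AC_sub by blast
    then show ?thesis using pts_obtain by metis
  qed
  have nz1: "AC C \<inter> nz N0 \<subseteq> nz den"
  proof
    fix b assume b: "b \<in> AC C \<inter> nz N0"
    then obtain v where v: "v \<in> b" "b \<in> pts" using ptv by blast
    show "b \<in> nz den" unfolding nz_iff[OF f(1) v(2,1)] by (rule den_nz[OF b v(1)])
  qed
  have nz2: "AC C \<inter> nz N0 \<subseteq> nz den1"
  proof
    fix b assume b: "b \<in> AC C \<inter> nz N0"
    then obtain v where v: "v \<in> b" "b \<in> pts" using ptv by blast
    have "v i30 ~= 0" by (rule UC_coords(2)[OF subsetD[OF N0(5) b] v(1)])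
    then show "b \<in> nz den1" unfolding nz_iff[OF f1(2) v(2,1)] den1_def using den_nz[OF b v(1)] by simp
  qed
  obtain c0 where c0: "rational_function X c0" "\<forall>b\<in>AC C \<inter> nz N0. \<forall>v\<in>b. c0 (cov C b) = E v / den v"
    using descent_AC[OF N0(1,2,3,5) f(2,1) ev(2,1) nz1] by (elim exE conjE) (rule that)
  obtain c1 where c1: "rational_function X c1" "\<forall>b\<in>AC C \<inter> nz N0. \<forall>v\<in>b. c1 (cov C b) = B1 v / den1 v"
    using descent_AC[OF N0(1,2,3,5) f1 ev1 nz2] by (elim exE conjE) (rule that)
  define c where "c j = (if j = 0 then c0 else c1)" for j :: nat
  have "h y = (\<Sum>j<2::nat. c j (cov C y) * bas j y)" if y: "y \<in> AC C \<inter> nz N0" for y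
  proof -
    obtain v where v: "v \<in> y" using y ptv by blast
    have nz: "v i00 ~= 0" "v i30 ~= 0" "H v ~= 0" "Hs v ~= 0"
      using UC_coords[of y v] y N0(5) v Hnz[OF y v] Hs_nz[OF y v] by auto
    have hy: "h y = F v / H v" using Hnz[OF y v] by blast
    have cc: "c0 (cov C y) = E v / den v" "c1 (cov C y) = B1 v / den1 v" by (rule c0(2)[rule_format, OF y v], rule c1(2)[rule_format, OF y v])
    have by1: "bas 1 y = v i30 / v i00" using bas_eq[of y v 1] y v by simp
    have "(\<Sum>j<2::nat. c j (cov C y) * bas j y) = c0 (cov C y) + c1 (cov C y) * bas 1 y"
      by (simp add: numeral_2_eq_2 c_def bas_def)
    also have "\<dots> = E v / den v + B v / den v"
      unfolding cc by1 B1_def den1_def using nz by simp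
    also have "\<dots> = (E v + B v) / den v" by (simp add: add_divide_distrib)
    also have "E v + B v = 2 * (F v * Hs v)" unfolding E_def B_def by simp
    also have "2 * (F v * Hs v) / den v = F v / H v" unfolding den_def using nz by simp
    finally show ?thesis unfolding hy ..
  qed
  then have "generically (AC C) (\<lambda>y. h y = (\<Sum>j<2::nat. c j (cov C y) * bas j y))"
    unfolding generically_iff using N0(1,3) by blast
  moreover have "\<forall>j<2. rational_function X (c j)" unfolding c_def using c0(1) c1(1) by simp
  ultimately show ?thesis by blast
qed

text \<open>Passing to the conjugate point changes only the sign of y, so both coefficients vanish
  at the images of these points, which fill an open set.\<close>

lemma bas_independent:
  assumes c: "generically (AC C) (\<lambda>y. (\<Sum>j<2::nat. c j (cov C y) * bas j y) = 0)" and j: "j < (2::nat)"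
  shows "generically X (\<lambda>x. c j x = 0)"
proof -
  obtain d P where P: "form d P" "AC C \<inter> nz P ~= {}" "\<forall>y\<in>AC C \<inter> nz P. (\<Sum>j<2::nat. c j (cov C y) * bas j y) = 0"
    using c unfolding generically_iff by blast
  obtain e0 N0 where N0: "form e0 N0" "even_fun N0" "AC C \<inter> nz N0 ~= {}" "AC C \<inter> nz N0 \<subseteq> nz P" "AC C \<inter> nz N0 \<subseteq> UC C"
    using even_shrink[OF P(1,2)] by blast
  have ev: "N0 (sc (- 1) z) = N0 z" for z by (rule N0(2)[unfolded even_fun_def, rule_format])
  have zero: "c 0 (cov C b) = 0 \<and> c 1 (cov C b) = 0" if b: "b \<in> AC C \<inter> nz N0" for b
  proof -
    have bA: "b \<in> AC C" using b by blast
    have b': "sc (- 1) ` b \<in> AC C \<inter> nz N0" using sigma_nz_AC[OF N0(1) N0(1) ev bA] b sigma_AC[OF bA] by simp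
    have "b \<in> pts" using bA AC_sub by blast
    then obtain v where v: "v \<in> b" using pts_obtain by metis
    have nz: "v i00 ~= 0" "v i30 ~= 0" using UC_coords[of b v] b N0(5) v by auto
    have eq1: "c 0 (cov C y) + c 1 (cov C y) * bas 1 y = 0" if y: "y \<in> AC C \<inter> nz N0" for y
    proof -
      have yP: "y \<in> AC C \<inter> nz P" using N0(4) y by blast
      have "(\<Sum>j<2::nat. c j (cov C y) * bas j y) = 0" by (rule P(3)[rule_format, OF yP])
      then show ?thesis by (simp add: numeral_2_eq_2 bas_def)
    qed
    have "bas 1 b = v i30 / v i00" using bas_eq[OF bA v, of 1] by simp
    moreover have "bas 1 (sc (- 1) ` b) = - (v i30 / v i00)"
      using bas_eq[OF sigma_AC[OF bA] imageI[OF v], of 1] by (simp add: sc_encode)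
    ultimately have "c 0 (cov C b) + c 1 (cov C b) * (v i30 / v i00) = 0" "c 0 (cov C b) - c 1 (cov C b) * (v i30 / v i00) = 0"
      using eq1[OF b] eq1[OF b'] cov_sigma[OF bA] by simp_all
    then have e: "c 0 (cov C b) + c 1 (cov C b) * (v i30 / v i00) = 0" "c 0 (cov C b) = c 1 (cov C b) * (v i30 / v i00)" by simp_all
    from e(1) have "2 * c 0 (cov C b) = 0" unfolding e(2)[symmetric] by (simp only: mult_2)
    then have z: "c 0 (cov C b) = 0" by simp
    then have "c 1 (cov C b) * (v i30 / v i00) = 0" using e(2) by simp
    then show ?thesis using nz z by simp
  qed
  obtain n0 where n0: "form e0 n0" "even_fun n0" "\<forall>z. n0 (sc (rt C) z) = N0 z" using even_push[OF N0(1,2)] by blast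
  note im = push_image[OF n0(1) N0(1) n0(3)[rule_format] N0(5)]
  have "openin (zariski_on X) (cov C ` (AC C \<inter> nz N0))" unfolding im(1) by (rule Phi_open[OF n0(1,2) im(2)])
  moreover have "cov C ` (AC C \<inter> nz N0) ~= {}" using N0(3) unfolding image_is_empty .
  moreover have "\<forall>x\<in>cov C ` (AC C \<inter> nz N0). c j x = 0"
  proof -
    have "j = 0 \<or> j = 1" using j by auto
    then show ?thesis using zero by auto
  qed
  ultimately show ?thesis unfolding generically_def by blast
qed

lemma cov_degree: "has_degree (AC C) X (cov C) 2"
  unfolding has_degree_def
proof (rule exI[of _ bas], intro conjI)
  show "\<forall>j<2. rational_function (AC C) (bas j)" by (intro allI impI bas_rational)
qed (intro allI impI bas_span, assumption, intro allI impI, elim conjE, rule bas_independent)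

end

end

section \<open>Rational points of the surface and of the twists\<close>

lemma (in genus_one) affine_coords:
  assumes v: "hline v \<in> E" "v 0 ~= 0"
  shows "\<exists>x y. hline v = hline (coords 0 x y) \<and> y ^ 2 = poly (HP 0) x"
  using v(1)
proof (cases rule: E_cases)
  case (affine u w)
  then show ?thesis unfolding pt_def by blast
next
  case (infinite w)
  have "v \<in> hline (coords 2 0 w)" using hline_self[of v] unfolding infinite(1) pt_def .
  then obtain c where "v = (\<lambda>i. c * coords 2 0 w i)" using hline_memD by blast
  then have "v 0 = c * coords 2 0 w 0" by (rule fun_cong)
  then have "v 0 = 0" unfolding coords_simps by simp
  with v(2) show ?thesis by simp
qed

lemma coords_upd: "(coords 0 x y)(3 := r) = coords 0 x r"
  by (rule ext) (simp add: coords_def)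

lemma tensor_coords:
  fixes x y t s :: "'a::field"
  shows "tensor (coords 0 x y) (coords 0 t s) i00 = 1" "tensor (coords 0 x y) (coords 0 t s) i33 = y * s"
  "tensor (coords 0 x y) (coords 0 t s) i30 = y" "tensor (coords 0 x y) (coords 0 t s) (prod_encode (1, 0)) = x"
  "tensor (coords 0 x y) (coords 0 t s) (prod_encode (0, 1)) = t"
  unfolding tensor_encode by (simp_all add: coords_simps)

lemma coords_0_nonzero: "coords 0 x y ~= (\<lambda>_. 0)"
proof
  assume "coords 0 x y = (\<lambda>_. 0)"
  from fun_cong[OF this, of 0] show False by (simp add: coords_def)
qed

lemma prod_form:
  assumes "finite B"
  shows "\<exists>d P. form d P \<and> (\<forall>z. P z = (\<Prod>x\<in>B. z i - to_ac x * z j))"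
  using assms
proof (induction B rule: finite_induct)
  case empty
  show ?case by (rule exI[of _ 0], rule exI[of _ "\<lambda>_. to_ac 1"]) (simp only: form_const, simp)
next
  case (insert b B)
  then obtain d P where P: "form d P" "\<forall>z. P z = (\<Prod>x\<in>B. z i - to_ac x * z j)" by blast
  have "form (1 + d) (\<lambda>z. (z i - to_ac b * z j) * P z)"
    by (rule form_mult[OF form_diff[OF form_coord form_cmult[OF form_coord]] P(1)])
  then show ?case using P(2) insert(1,2) by (intro exI[of _ "1 + d"] exI[of _ "\<lambda>z. (z i - to_ac b * z j) * P z"]) simp
qed

context kummer_chart
begin

text \<open>An even coordinate descends to a function over k regular at p; so its value is rational
  although the point a over p need not be.\<close>

lemma rational_coordinate:
  assumes p: "p \<in> rational_points X" "p = \<Phi> a" and a: "a \<in> A \<inter> nz N" "z \<in> a" and l: "even_fun (\<lambda>z :: nat => 'a alg_closure. z l)"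
  shows "z l / z i00 \<in> range to_ac"
proof -
  have ev: "even_fun (\<lambda>z :: nat => 'a alg_closure. z i00)" unfolding even_fun_def by (simp add: sc_encode)
  obtain c where c: "\<forall>x\<in>\<Phi> ` (A \<inter> nz N). regular_at X x c" "\<forall>a\<in>A \<inter> nz N. \<forall>v\<in>a. c (\<Phi> a) = v l / v i00"
    using descent[OF N_form N_even N_AV form_coord[of l] form_coord[of i00] l ev N_00] by (elim exE conjE) (rule that)
  have "regular_at X p c" unfolding p(2) by (rule c(1)[rule_format, OF imageI[OF a(1)]])
  from XX.regular_rational_value[OF p(1) this] have "c p \<in> range to_ac" .
  then show ?thesis unfolding p(2) c(2)[rule_format, OF a] .
qed

text \<open>x, t and m = y s are rational by \<open>rational_coordinate\<close>. If C u^2 = g(x),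
  the points (x, u) and (t, u m / g(x)) lie on the twists by C, and sqrt C times their ordinates
  gives y and s up to a common sign.\<close>

lemma rational_lift:
  assumes p: "p \<in> rational_points X" "p \<in> XN"
  shows "\<exists>x t m y s. hline (tensor (coords 0 (to_ac x) y) (coords 0 (to_ac t) s)) \<in> A \<inter> nz N \<and> poly g x ~= 0 \<and>
    (\<forall>C u. C ~= 0 --> C * u ^ 2 = poly g x -->
       C * (u * m / poly g x) ^ 2 = poly f t \<and> p \<in> cov C ` rational_points (UC C))"
proof -
  from p(2) obtain a where a: "p = \<Phi> a" "a \<in> A \<inter> nz N" unfolding XN_def by (rule imageE)
  have aA: "a \<in> A" "a \<in> pts" using a(2) A_sub by auto
  obtain v w where vw: "v ~= (\<lambda>_. 0)" "w ~= (\<lambda>_. 0)" "hline v \<in> K1.E1.E" "hline w \<in> K1.E2.E" "a = hline (tensor v w)"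
    using K1.A_obtain[OF aA(1)] by (elim exE conjE) (rule that)
  have mem: "tensor v w \<in> a" unfolding vw(5) by simp
  have "a \<in> nz (\<lambda>z. z i00)" by (rule subsetD[OF N_00 a(2)])
  then have "tensor v w i00 ~= 0" unfolding nz_iff[OF form_coord aA(2) mem] .
  then have v0: "v 0 ~= 0" "w 0 ~= 0" by (auto simp: tensor_encode)
  obtain x' y where xy: "hline v = hline (coords 0 x' y)" "y ^ 2 = poly (K1.E1.HP 0) x'" using K1.E1.affine_coords[OF vw(3) v0(1)] by blast
  obtain t' s where ts: "hline w = hline (coords 0 t' s)" "s ^ 2 = poly (K1.E2.HP 0) t'" using K1.E2.affine_coords[OF vw(4) v0(2)] by blast
  define z where "z = tensor (coords 0 x' y) (coords 0 t' s)"
  have az: "a = hline z"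
    unfolding vw(5) z_def ppair_hline[OF vw(1,2), symmetric] ppair_hline[OF coords_0_nonzero coords_0_nonzero, symmetric] xy(1) ts(1) ..
  have zc: "z i00 = 1" "z i33 = y * s" "z (prod_encode (1, 0)) = x'" "z (prod_encode (0, 1)) = t'" unfolding z_def tensor_coords by (rule refl)+
  have zm: "z \<in> a" unfolding az by simp
  note rc = rational_coordinate[OF p(1) a zm]
  have "z (prod_encode (1, 0)) / z i00 \<in> range to_ac" by (rule rc) (simp add: even_fun_def sc_encode)
  then obtain x where x: "x' = to_ac x" unfolding zc by auto
  have "z (prod_encode (0, 1)) / z i00 \<in> range to_ac" by (rule rc) (simp add: even_fun_def sc_encode)
  then obtain t where t: "t' = to_ac t" unfolding zc by auto
  have "z i33 / z i00 \<in> range to_ac" by (rule rc) (simp add: even_fun_def sc_encode)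
  then obtain m where m: "y * s = to_ac m" unfolding zc by auto
  have "a \<in> nz (\<lambda>z. z i33)" by (rule subsetD[OF N_33 a(2)])
  then have "z i33 ~= 0" unfolding nz_iff[OF form_coord aA(2) zm] .
  then have ys: "y ~= 0" "s ~= 0" unfolding zc by auto
  have y2: "y ^ 2 = to_ac (poly g x)" using xy(2) unfolding x by (simp add: K1.E1.hp_def poly_map_ac)
  have s2: "s ^ 2 = to_ac (poly f t)" using ts(2) unfolding t by (simp add: K1.E2.hp_def poly_map_ac)
  have gx: "poly g x ~= 0" using y2 ys(1) by auto
  have main: "C * (u * m / poly g x) ^ 2 = poly f t \<and> p \<in> cov C ` rational_points (UC C)"
    if C: "C ~= 0" and Cu: "C * u ^ 2 = poly g x" for C u
  proof
    define k where "k = u * m / poly g x"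
    have "to_ac (m ^ 2) = to_ac (poly g x * poly f t)"
      unfolding to_ac_power m[symmetric] power_mult_distrib y2 s2 by simp
    then have m2: "m ^ 2 = poly g x * poly f t" unfolding to_ac_eq_iff .
    have "C * k ^ 2 = (C * u ^ 2) * m ^ 2 / poly g x ^ 2" by (simp add: k_def power_mult_distrib power_divide)
    also have "\<dots> = poly f t" unfolding Cu m2 using gx by (simp add: power2_eq_square)
    finally show "C * (u * m / poly g x) ^ 2 = poly f t" unfolding k_def .
    define r where "r = rt C"
    have r2: "r ^ 2 = to_ac C" unfolding r_def by (rule rt(1)[OF C])
    have "(r * to_ac u) ^ 2 = y ^ 2" unfolding power_mult_distrib r2 y2 Cu[symmetric] by simp
    then obtain \<epsilon> where e: "\<epsilon> = 1 \<or> \<epsilon> = - 1" "r * to_ac u = \<epsilon> * y"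
      unfolding power2_eq_iff by (metis mult_1 mult_minus1)
    \<comment> \<open>The sign in the second factor is the same as in the first, so the two points
      of the product differ at most by the involution.\<close>
    have "r * to_ac k = (r * to_ac u) * (y * s) / y ^ 2" unfolding k_def y2 m by simp
    also have "\<dots> = \<epsilon> * s" unfolding e(2) using ys by (simp add: power2_eq_square)
    finally have rk: "r * to_ac k = \<epsilon> * s" .
    define zb where "zb = tensor (coords 0 (to_ac x) (to_ac u)) (coords 0 (to_ac t) (to_ac k))"
    define b where "b = hline zb"
    have c3: "coords 0 \<xi> \<eta> 3 = \<eta>" for \<xi> \<eta> :: "'a alg_closure" by (simp add: coords_def)
    have "sc r zb = sc \<epsilon> z"
      unfolding zb_def z_def sc_tensor coords_upd c3 e(2) rk x t ..
    then have tb: "tw C b = sc \<epsilon> ` a" unfolding tw_def b_def az sc_hline r_def by simp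
    have "sc \<epsilon> ` a = a \<or> sc \<epsilon> ` a = sc (- 1) ` a" using e(1) by auto
    then have tbN: "tw C b \<in> A \<inter> nz N" and Ptb: "\<Phi> (tw C b) = p"
      unfolding tb using a aA sigma_A[OF aA(1)] sigma_nz[OF N_form N_even aA(1)] Phi_sigma[OF aA(1)] by auto
    have "b = sc (inverse (rt C)) ` tw C b" by (simp only: untw_tw[OF C])
    also have "\<dots> \<in> AC C" by (rule untw_AC[OF C]) (use tbN in blast)
    finally have bU: "b \<in> UC C" unfolding UC_def using tbN by simp
    have rat: "coords 0 (to_ac \<xi>) (to_ac \<eta>) i \<in> range to_ac" for \<xi> \<eta> :: 'a and i
      by (auto simp: coords_def simp flip: to_ac_power)
    have "zb i \<in> range to_ac" for i
      unfolding zb_def tensor_def by (auto split: prod.splits intro: range_to_ac_closed(2) rat)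
    then have "b \<in> rational_points (UC C)" unfolding rational_points_def b_def
      using bU[unfolded b_def] by (intro CollectI conjI bexI[of _ zb]) auto
    moreover have "p = cov C b" unfolding cov_def Ptb ..
    ultimately show "p \<in> cov C ` rational_points (UC C)" by blast
  qed
  have "hline (tensor (coords 0 (to_ac x) y) (coords 0 (to_ac t) s)) \<in> A \<inter> nz N" using a(2) unfolding az z_def x t .
  with gx main show ?thesis by blast
qed

text \<open>A basic open set of the surface is pulled back to the product of the twists, where
  \<open>product_dense\<close> finds a rational point; its image is rational because the cover is
  defined over k.\<close>

lemma rational_dense:
  assumes C: "C ~= 0" and inf: "infinite (rational_points (twisted_curve g C))" "infinite (rational_points (twisted_curve f C))"
  shows "zariski_dense_in X (rational_points X)"
proof -
  interpret P: curve_pair g f C by (rule pair[OF C])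
  have Xr: "rational_points X \<subseteq> X" unfolding rational_points_def by blast
  have Us: "UC C \<subseteq> pts" using UC_sub[OF C] AC_sub[OF C] by blast
  have "rational_points X \<inter> nz T ~= {}" if T: "form d T" "X \<inter> nz T ~= {}" for d T
  proof -
    obtain x where x: "x \<in> XN" "x \<in> nz T" using XN_meets[OF T] by blast
    then obtain b where b: "x = cov C b" "b \<in> UC C" unfolding cov_image[OF C, symmetric] by blast
    have bT: "cov C b \<in> nz T" using x(2) b(1) by simp
    obtain d' F e1 R where R: "\<forall>i. form d' (F i)" "form e1 R" "b \<in> nz R"
        "\<forall>y\<in>UC C \<inter> nz R. cov C y \<in> nz T \<and> (\<forall>v\<in>y. (\<lambda>i. F i v) \<in> cov C y)"
      using morphism_pullback[OF Us X_sub cov_morphism[OF C] b(2) T(1) bT] by (elim exE conjE) (rule that)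
    obtain N' where N': "form e N'" "UC C = AC C \<inter> nz N'" using UC_form[OF C] by blast
    have nzW: "nz (\<lambda>v. R v * N' v) = nz R \<inter> nz N'" by (rule nz_mult[OF R(2) N'(1)])
    have "P.A \<inter> nz (\<lambda>v. R v * N' v) ~= {}" using b(2) R(3) unfolding nzW N'(2) AC_def by blast
    moreover have "rational_points P.E1.E \<subseteq> P.E1.E" "rational_points P.E2.E \<subseteq> P.E2.E" unfolding rational_points_def by blast+
    ultimately obtain y1 y2 where y: "y1 \<in> rational_points P.E1.E" "y2 \<in> rational_points P.E2.E" "ppair y1 y2 \<in> nz (\<lambda>v. R v * N' v)"
      using P.product_dense[OF inf(1) _ inf(2) _ form_mult[OF R(2) N'(1)]] by metis
    from y(3) have y34: "ppair y1 y2 \<in> nz R" "ppair y1 y2 \<in> nz N'" unfolding nzW by auto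
    have E: "y1 \<in> P.E1.E" "y2 \<in> P.E2.E" using y unfolding rational_points_def by auto
    have "ppair y1 y2 \<in> P.A" unfolding P.A_eq using E by blast
    then have U: "ppair y1 y2 \<in> UC C" unfolding N'(2) AC_def using y34(2) by blast
    obtain v1 where v1: "v1 \<in> y1" "\<forall>i. v1 i \<in> range to_ac" using y(1) unfolding rational_points_def by blast
    obtain v2 where v2: "v2 \<in> y2" "\<forall>i. v2 i \<in> range to_ac" using y(2) unfolding rational_points_def by blast
    have h1: "y1 = hline v1 \<and> v1 ~= (\<lambda>_. 0)" by (rule pts_cases[OF subsetD[OF P.E1.E_sub E(1)] v1(1)])
    have h2: "y2 = hline v2 \<and> v2 ~= (\<lambda>_. 0)" by (rule pts_cases[OF subsetD[OF P.E2.E_sub E(2)] v2(1)])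
    have pp: "ppair y1 y2 = hline (tensor v1 v2)" using ppair_hline[of v1 v2] h1 h2 by simp
    have "tensor v1 v2 i \<in> range to_ac" for i
      unfolding tensor_def using v1(2) v2(2) by (auto split: prod.splits intro: range_to_ac_closed(2))
    then have "ppair y1 y2 \<in> rational_points (UC C)" unfolding rational_points_def
      using U by (intro CollectI conjI bexI[of _ "tensor v1 v2"]) (auto simp: pp)
    from morphism_rational[OF Us cov_morphism[OF C] this] have "cov C (ppair y1 y2) \<in> rational_points X" .
    moreover have "cov C (ppair y1 y2) \<in> nz T" using R(4) U y34(1) by blast
    ultimately show ?thesis by blast
  qed
  then show ?thesis unfolding zariski_dense_iff[OF X_sub Xr] by blast
qed

end

text \<open>Collects the abscissae on rank 0 twists for all C and all origins at once, which is the
  uniformity needed to remove them by a single form.\<close>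

definition bad :: "'k::field_char_0 poly => 'k set" where
  "bad g = {x. \<exists>C y z. C ~= 0 \<and> C * y ^ 2 = poly g x \<and> z \<in> rational_points (twisted_curve g C) \<and>
     \<not> group_rank (mordell_weil_group (twisted_curve g C) z) > 0}"

lemma (in genus_one) rational_point_exists:
  assumes "C * u ^ 2 = poly g x"
  shows "rational_points E ~= {}"
proof -
  have "on (1, x, u)" using assms C_nonzero by (simp add: on_def kon_def hp_def field_simps)
  then show ?thesis unfolding rational_points_KP by blast
qed

lemma (in genus_one) rational_points_infinite:
  assumes "rational_points E ~= {}" "\<forall>z\<in>rational_points E. group_rank (mordell_weil_group E z) > 0"
  shows "infinite (rational_points E)"
proof -
  obtain Z where Z: "on Z" "KP Z \<in> rational_points E" using assms(1) unfolding rational_points_KP by blast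
  show ?thesis by (rule rank_positive_infinite[OF Z(1)]) (use assms(2) Z(2) in blast)
qed

lemma SPR_not_bad:
  assumes "genus_one g C" "genus_one f C" "C ~= 0" "C * u ^ 2 = poly g x" "C * k ^ 2 = poly f t" "x \<notin> bad g" "t \<notin> bad f"
  shows "SPR f g C"
  unfolding SPR_def
proof (intro conjI ballI)
  show "rational_points (twisted_curve g C) ~= {}" by (rule genus_one.rational_point_exists[OF assms(1,4)])
  show "rational_points (twisted_curve f C) ~= {}" by (rule genus_one.rational_point_exists[OF assms(2,5)])
next
  fix z assume "z \<in> rational_points (twisted_curve g C)"
  then show "group_rank (mordell_weil_group (twisted_curve g C) z) > 0" using assms(3,4,6) unfolding bad_def by blast
next
  fix z assume "z \<in> rational_points (twisted_curve f C)"
  then show "group_rank (mordell_weil_group (twisted_curve f C) z) > 0" using assms(3,5,7) unfolding bad_def by blast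
qed

text \<open>The excluded abscissae are removed by factors x - b and t - b written in Segre
  coordinates. The result is not identically zero because the curves have infinitely many geometric
  abscissae.\<close>

lemma (in curve_pair) generic_form:
  assumes C1: "C = 1" and B: "finite B1" "finite B2"
  shows "\<exists>d P. form d P \<and> A \<inter> nz P ~= {} \<and> nz P \<subseteq> nz (\<lambda>z. z i00) \<and> nz P \<subseteq> nz (\<lambda>z. z i30) \<and> nz P \<subseteq> nz (\<lambda>z. z i33) \<and>
    (\<forall>x y t s. P (tensor (coords 0 (to_ac x) y) (coords 0 (to_ac t) s)) ~= 0 --> x \<notin> B1 \<and> t \<notin> B2)"
proof -
  obtain d1 P1 where P1: "form d1 P1" "\<forall>z. P1 z = (\<Prod>x\<in>B1. z (prod_encode (1, 0)) - to_ac x * z i00)" using prod_form[OF B(1)] by blast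
  obtain d2 P2 where P2: "form d2 P2" "\<forall>z. P2 z = (\<Prod>x\<in>B2. z (prod_encode (0, 1)) - to_ac x * z i00)" using prod_form[OF B(2)] by blast
  define P where "P z = z i00 * (z i33 * (z i30 * (P1 z * P2 z)))" for z
  have F: "form (1 + (1 + (1 + (d1 + d2)))) P" unfolding P_def by (intro form_mult form_coord P1(1) P2(1))
  have sub: "nz P \<subseteq> nz (\<lambda>z. z i00) \<and> nz P \<subseteq> nz (\<lambda>z. z i30) \<and> nz P \<subseteq> nz (\<lambda>z. z i33)"
    unfolding nz_def P_def by auto
  have Pz: "P (tensor (coords 0 x y) (coords 0 t s)) = y * s * (y * ((\<Prod>b\<in>B1. x - to_ac b) * (\<Prod>b\<in>B2. t - to_ac b)))" for x y t s
    unfolding P_def P1(2)[rule_format] P2(2)[rule_format] tensor_coords by simp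
  have good: "\<exists>x y. y ^ 2 = poly (map_poly to_ac h) x \<and> y ~= 0 \<and> x \<notin> to_ac ` B" if h: "h ~= 0" "finite B" for h :: "'k poly" and B
  proof -
    have "map_poly to_ac h ~= 0" using h(1) by (simp add: poly_eq_iff coeff_map_poly)
    then have "finite ({x. poly (map_poly to_ac h) x = 0} \<union> to_ac ` B)" using h(2) by (simp add: poly_roots_finite)
    from ex_new_if_finite[OF infinite_UNIV_char_0 this] obtain x where x: "poly (map_poly to_ac h) x ~= 0" "x \<notin> to_ac ` B" by blast
    obtain y where "y ^ 2 = poly (map_poly to_ac h) x" using ex_sqrt by blast
    with x show ?thesis by (intro exI[of _ x] exI[of _ y]) auto
  qed
  have ne: "g ~= 0" "f ~= 0" using E1.deg_ge E2.deg_ge by auto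
  obtain x y where xy: "y ^ 2 = poly (map_poly to_ac g) x" "y ~= 0" "x \<notin> to_ac ` B1" using good[OF ne(1) B(1)] by blast
  obtain t s where ts: "s ^ 2 = poly (map_poly to_ac f) t" "s ~= 0" "t \<notin> to_ac ` B2" using good[OF ne(2) B(2)] by blast
  have h0: "E1.hp 0 = g" "E2.hp 0 = f" unfolding E1.hp_def E2.hp_def using C1 by simp_all
  have E: "hline (coords 0 x y) \<in> E1.E" "hline (coords 0 t s) \<in> E2.E"
    using E1.pt_in_E[of 0 x y, unfolded h0 pt_def] E2.pt_in_E[of 0 t s, unfolded h0 pt_def] xy(1) ts(1) by simp_all
  define z where "z = tensor (coords 0 x y) (coords 0 t s)"
  have zA: "hline z \<in> A" unfolding z_def by (rule tensor_in_A[OF E coords_0_nonzero coords_0_nonzero])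
  have "P z ~= 0" unfolding z_def Pz using xy ts B by auto
  moreover have "z ~= (\<lambda>_. 0)" unfolding z_def by (rule tensor_nonzero[OF coords_0_nonzero coords_0_nonzero])
  ultimately have "hline z \<in> nz P" unfolding nz_def by blast
  then have "A \<inter> nz P ~= {}" using zA by blast
  moreover have "x \<notin> B1 \<and> t \<notin> B2" if "P (tensor (coords 0 (to_ac x) y) (coords 0 (to_ac t) s)) ~= 0" for x y t s
    using that B unfolding Pz by auto
  ultimately show ?thesis using F sub by blast
qed

lemma finite_bad:
  fixes g :: "'k::field_char_0 poly"
  assumes "number_field TYPE('k)" "rsquarefree (map_poly to_ac g)" "3 \<le> Polynomial.degree g" "Polynomial.degree g \<le> 4"
  shows "finite (bad g)"
  unfolding bad_def by (rule rank_zero_abscissae_finite[OF assms])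

lemma kummer_surface_chart:
  fixes f g :: "'k::field_char_0 poly"
  assumes k: "is_kummer_surface f g X" and gen: "genus_one g 1" "genus_one f 1" and B: "finite B1" "finite B2"
  shows "\<exists>Q U V q \<rho> \<psi> e D N G. kummer_chart g f X Q U V q \<rho> \<psi> e D N G \<and>
    (\<forall>x y t s. hline (tensor (coords 0 (to_ac x) y) (coords 0 (to_ac t) s)) \<in>
       product_variety (twisted_curve g 1) (twisted_curve f 1) \<inter> nz N --> x \<notin> B1 \<and> t \<notin> B2)"
proof -
  interpret P: curve_pair g f 1 using gen by (simp add: curve_pair_def)
  obtain Q q \<rho> where Q: "projective_variety Q" "geometric_quotient P.A kummer_involution Q q" "minimal_desingularization X Q \<rho>"
    using k unfolding is_kummer_surface_def by (elim exE conjE) (rule that)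
  have d: "projective_variety X" "birational_morphism X Q \<rho>"
    using Q(3) unfolding minimal_desingularization_def desingularization_def by simp_all
  have ps: "proj_space n \<subseteq> pts" for n unfolding proj_space_def pts_def by blast
  have X: "X \<subseteq> pts" "zariski_irreducible X" and Qp: "Q \<subseteq> pts"
    using d(1) Q(1) ps unfolding projective_variety_def by blast+
  have rho: "morphism X Q \<rho>" using d(2) unfolding birational_morphism_def by (rule conjunct1)
  obtain U V where UV: "openin (zariski_on X) U" "openin (zariski_on Q) V" "V ~= {}" "isomorphism U V \<rho>"
    using d(2) unfolding birational_morphism_def by (elim exE conjE) (rule that)
  have rhoUV: "\<rho> ` U \<subseteq> V" using UV(4)[unfolded isomorphism_def morphism_def, THEN conjunct1, THEN conjunct1] .
  obtain \<psi> where psi: "morphism V U \<psi>" "\<forall>x\<in>U. \<psi> (\<rho> x) = x" "\<forall>y\<in>V. \<rho> (\<psi> y) = y"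
    using UV(4)[unfolded isomorphism_def, THEN conjunct2] by (elim exE conjE) (rule that)
  interpret K: kummer g f X Q U V q \<rho> \<psi>
    by unfold_locales (use X Qp Q(2) rho UV(1-3) psi rhoUV in simp_all)
  obtain d P0 where P0: "form d P0" "P.A \<inter> nz P0 ~= {}" "nz P0 \<subseteq> nz (\<lambda>z. z i00)" "nz P0 \<subseteq> nz (\<lambda>z. z i30)" "nz P0 \<subseteq> nz (\<lambda>z. z i33)"
    "\<forall>x y t s. P0 (tensor (coords 0 (to_ac x) y) (coords 0 (to_ac t) s)) ~= 0 --> x \<notin> B1 \<and> t \<notin> B2"
    using P.generic_form[OF refl B] by (elim exE conjE) (rule that)
  obtain e N D G where N: "form e N" "even_fun N" "P.A \<inter> nz N ~= {}" "P.A \<inter> nz N \<subseteq> K.AV" "P.A \<inter> nz N \<subseteq> nz P0"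
     "\<forall>i. form D (G i)" "\<forall>y\<in>P.A \<inter> nz N. \<forall>v\<in>y. (\<lambda>i. G i v) \<in> K.\<Phi> y \<and> (\<forall>i. G i (sc (- 1) v) = G i v)"
    using K.even_chart[OF P0(1,2)] by (elim exE conjE) (rule that)
  have chart: "kummer_chart g f X Q U V q \<rho> \<psi> e D N G"
    by (intro kummer_chart.intro K.kummer_axioms kummer_chart_axioms.intro)
      (rule N(1) N(2) N(3) N(4) subset_trans[OF N(5) P0(3)] subset_trans[OF N(5) P0(4)] subset_trans[OF N(5) P0(5)]
        N(6)[rule_format] N(7)[rule_format], (assumption+)?)+
  have nb: "x \<notin> B1 \<and> t \<notin> B2" if h: "hline (tensor (coords 0 (to_ac x) y) (coords 0 (to_ac t) s)) \<in> P.A \<inter> nz N" for x y t s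
  proof -
    have "hline (tensor (coords 0 (to_ac x) y) (coords 0 (to_ac t) s)) \<in> pts" using h P.A_sub by blast
    moreover have "hline (tensor (coords 0 (to_ac x) y) (coords 0 (to_ac t) s)) \<in> nz P0" by (rule subsetD[OF N(5) h])
    ultimately have "P0 (tensor (coords 0 (to_ac x) y) (coords 0 (to_ac t) s)) ~= 0"
      using nz_iff[OF P0(1) _ hline_self] by blast
    then show ?thesis using P0(6) by blast
  qed
  have all: "\<forall>x y t s. hline (tensor (coords 0 (to_ac x) y) (coords 0 (to_ac t) s)) \<in> P.A \<inter> nz N --> x \<notin> B1 \<and> t \<notin> B2"
    by (intro allI impI nb)
  show ?thesis by (rule exI)+ (rule conjI[OF chart all])
qed

lemma (in kummer_chart) classes_nonempty_dense:
  assumes ne: "{square_class C | C. C ~= 0 \<and> SPR f g C} ~= {}"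
  shows "zariski_dense_in X (rational_points X)"
proof -
  obtain C where C: "C ~= 0" "SPR f g C" using ne by blast
  interpret P: curve_pair g f C by (rule pair[OF C(1)])
  have "infinite (rational_points (twisted_curve g C))" "infinite (rational_points (twisted_curve f C))"
    by (rule P.E1.rational_points_infinite P.E2.rational_points_infinite; use C(2) in \<open>simp add: SPR_def\<close>)+
  then show ?thesis by (rule rational_dense[OF C(1)])
qed

text \<open>One representative of each class gives finitely many covers of degree 2. By the covering
  hypothesis their rational points hit every rational point of the nonempty open set
  \<open>XN\<close>.\<close>

lemma (in kummer_chart) not_hilbert:
  assumes cover: "!!p. p \<in> rational_points X ==> p \<in> XN ==> \<exists>C. C ~= 0 \<and> SPR f g C \<and>
      (\<forall>C'. C' ~= 0 --> square_class C' = square_class C --> p \<in> cov C' ` rational_points (UC C'))"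
    and fin: "finite {square_class C | C. C ~= 0 \<and> SPR f g C}"
  shows "thin_rational_points X"
proof -
  define \<C> where "\<C> = {square_class C | C. C ~= 0 \<and> SPR f g C}"
  obtain \<beta> where \<beta>: "bij_betw \<beta> {0..<card \<C>} \<C>" using ex_bij_betw_nat_finite[OF fin] unfolding \<C>_def by blast
  have "\<forall>i\<in>{..<card \<C>}. \<exists>C. C ~= 0 \<and> square_class C = \<beta> i"
  proof
    fix i assume "i \<in> {..<card \<C>}"
    then have "\<beta> i \<in> \<C>" using \<beta> unfolding bij_betw_def by auto
    then obtain C where "\<beta> i = square_class C" "C ~= 0" unfolding \<C>_def by blast
    then show "\<exists>C. C ~= 0 \<and> square_class C = \<beta> i" by (intro exI[of _ C]) simp
  qed
  from bchoice[OF this] obtain R where R: "\<forall>i\<in>{..<card \<C>}. R i ~= 0 \<and> square_class (R i) = \<beta> i" ..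
  have sub: "rational_points X - (\<Union>i<card \<C>. cov (R i) ` rational_points (UC (R i))) \<subseteq> X - XN"
  proof
    fix p assume p: "p \<in> rational_points X - (\<Union>i<card \<C>. cov (R i) ` rational_points (UC (R i)))"
    have "p \<in> X" using p unfolding rational_points_def by blast
    moreover have "p \<notin> XN"
    proof
      assume "p \<in> XN"
      have pr: "p \<in> rational_points X" using p by blast
      obtain C where C: "C ~= 0" "SPR f g C"
        "\<forall>C'. C' ~= 0 --> square_class C' = square_class C --> p \<in> cov C' ` rational_points (UC C')"
        using cover[OF pr \<open>p \<in> XN\<close>] by (elim exE conjE) (rule that)
      have "square_class C \<in> \<C>" unfolding \<C>_def using C(1,2) by blast
      then have "square_class C \<in> \<beta> ` {0..<card \<C>}" using \<beta> unfolding bij_betw_def by simp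
      then obtain i where i: "i < card \<C>" "square_class C = \<beta> i" by auto
      then have "p \<in> cov (R i) ` rational_points (UC (R i))" using C(3) R by simp
      with p i(1) show False by blast
    qed
    ultimately show "p \<in> X - XN" by blast
  qed
  have closed: "closedin (zariski_on X) (X - XN)"
    using closedin_diff[OF closedin_topspace XN_open] unfolding topspace_zariski_on[OF X_sub] .
  have proper: "X - XN ~= X" using XN_ne XN_sub by blast
  show ?thesis unfolding thin_rational_points_def
  proof (intro exI conjI allI impI)
    fix i assume "i < card \<C>"
    then have R0: "R i ~= 0" using R by simp
    show "integral_variety (AC (R i))" by (rule AC_integral[OF R0])
    show "dominant_rational_map (AC (R i)) X (UC (R i)) (cov (R i))" by (rule cov_dominant[OF R0])
    show "2 \<le> (2::nat)" by simp
    show "has_degree (AC (R i)) X (cov (R i)) 2" by (rule cov_degree[OF R0])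
  qed (rule closed proper sub)+
qed

lemma square_class_eqD:
  assumes "C ~= 0" "square_class C' = square_class C"
  shows "\<exists>u. C' * u ^ 2 = C"
proof -
  have "C' \<in> square_class C'" unfolding square_class_def by (rule CollectI, rule exI[of _ 1]) simp
  then have "C' \<in> square_class C" unfolding assms(2) .
  then obtain u where "C' = C * u ^ 2" "u ~= 0" unfolding square_class_def by blast
  then have "C' * (1 / u) ^ 2 = C" by (simp add: power_divide)
  then show ?thesis by blast
qed

theorem theorem3p1:
  fixes f g :: "'k::field_char_0 poly"
    and X :: "'k alg_closure ppoint set"
  assumes "number_field TYPE('k)"
    and "rsquarefree (map_poly to_ac f)" and "rsquarefree (map_poly to_ac g)"
    and "3 \<le> Polynomial.degree f" and "Polynomial.degree f \<le> 4"
    and "3 \<le> Polynomial.degree g" and "Polynomial.degree g \<le> 4"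
    and "is_kummer_surface f g X"
  shows "(zariski_dense_in X (rational_points X) \<longleftrightarrow>
           {square_class C | C. C \<noteq> 0 \<and> SPR f g C} \<noteq> {}) \<and>
         (hilbert_property X \<longrightarrow>
           infinite {square_class C | C. C \<noteq> 0 \<and> SPR f g C})"
proof -
  have gen: "genus_one g C" "genus_one f C" if "C ~= 0" for C
    using assms(2-7) that by (simp_all add: genus_one_def)
  note B = finite_bad[OF assms(1,3,6,7)] finite_bad[OF assms(1,2,4,5)]
  obtain Q U V q \<rho> \<psi> e D N G where chart: "kummer_chart g f X Q U V q \<rho> \<psi> e D N G"
    and nbad: "\<forall>x y t s. hline (tensor (coords 0 (to_ac x) y) (coords 0 (to_ac t) s)) \<in>
       product_variety (twisted_curve g 1) (twisted_curve f 1) \<inter> nz N --> x \<notin> bad g \<and> t \<notin> bad f"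
    using kummer_surface_chart[OF assms(8) gen[OF one_neq_zero] B] by (elim exE conjE) (rule that)
  interpret K: kummer_chart g f X Q U V q \<rho> \<psi> e D N G by (rule chart)
  have cover: "\<exists>C. C ~= 0 \<and> SPR f g C \<and>
      (\<forall>C'. C' ~= 0 --> square_class C' = square_class C --> p \<in> K.cov C' ` rational_points (K.UC C'))"
    if p: "p \<in> rational_points X" "p \<in> K.XN" for p
  proof -
    obtain x t m y s where x: "hline (tensor (coords 0 (to_ac x) y) (coords 0 (to_ac t) s)) \<in> K.A \<inter> nz N" "poly g x ~= 0"
      "\<forall>C u. C ~= 0 --> C * u ^ 2 = poly g x -->
         C * (u * m / poly g x) ^ 2 = poly f t \<and> p \<in> K.cov C ` rational_points (K.UC C)"
      using K.rational_lift[OF p] by (elim exE conjE) (rule that)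
    have nb: "x \<notin> bad g" "t \<notin> bad f" using nbad x(1) by blast+
    \<comment> \<open>C = g(x) puts (x, 1) on the twist; any other representative C' of its class
      satisfies C' u^2 = g(x) for some u, so it covers p as well.\<close>
    have one: "poly g x * 1 ^ 2 = poly g x" by simp
    have "SPR f g (poly g x)"
      by (rule SPR_not_bad[OF gen[OF x(2)] x(2) one _ nb]) (use x(3) x(2) one in blast)
    moreover have "p \<in> K.cov C' ` rational_points (K.UC C')" if C': "C' ~= 0" "square_class C' = square_class (poly g x)" for C'
      using square_class_eqD[OF x(2) C'(2)] x(3) C'(1) by blast
    ultimately show ?thesis using x(2) by blast
  qed
  have "{square_class C | C. C ~= 0 \<and> SPR f g C} ~= {}" if dense: "zariski_dense_in X (rational_points X)"
  proof -
    have Xr: "rational_points X \<subseteq> X" unfolding rational_points_def by blast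
    obtain x where "x \<in> K.XN" using K.XN_ne by blast
    then obtain d P where P: "form d P" "x \<in> nz P" "X \<inter> nz P \<subseteq> K.XN" using K.XN_open unfolding openin_zariski_on by blast
    have "X \<inter> nz P ~= {}" using P(2) \<open>x \<in> K.XN\<close> K.XN_sub by blast
    then obtain p where "p \<in> rational_points X" "p \<in> nz P"
      using dense P(1) unfolding zariski_dense_iff[OF K.X_sub Xr] by blast
    then have "p \<in> rational_points X" "p \<in> K.XN" using P(3) Xr by auto
    from cover[OF this] obtain C where "C ~= 0" "SPR f g C" by (elim exE conjE) (rule that)
    then show ?thesis by blast
  qed
  moreover have "infinite {square_class C | C. C ~= 0 \<and> SPR f g C}" if hilbert: "hilbert_property X"
  proof
    assume fin: "finite {square_class C | C. C ~= 0 \<and> SPR f g C}"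
    have "thin_rational_points X" by (rule K.not_hilbert[OF _ fin]) (rule cover)
    with hilbert show False unfolding hilbert_property_def by simp
  qed
  ultimately show ?thesis using K.classes_nonempty_dense by (intro conjI iffI impI)
qed

end
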